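(* Let $\mathcal C$ be a join restriction category with local glueings. The equivalence $\Phi\colon\mathrm{peCat}_c(\mathcal C)\simeq\mathrm{jrCat}/\!/_h\,\mathcal C\colon\Psi$ restricts to an equivalence $$\Phi\colon\mathrm{peGpd}_c(\mathcal C)\;\simeq\;\mathrm{ejCat}/\!/_h\,\mathcal C\;\colon\Psi$$ between the category of étale partite internal groupoids in $\mathcal C$ (with partite cofunctors) and the category of étale join restriction categories hyperconnected over $\mathcal C$.
   Context: RESTRICTION CATEGORIES. A restriction category is a category with an operation assigning to each $f\colon A\to B$ a map $\bar f\colon A\to A$ such that $f\bar f=f$; $\bar f\bar g=\bar g\bar f$ and $\overline{g\bar f}=\bar g\bar f$ for $f\colon A\to B$, $g\colon A\to C$; and $\bar g f=f\,\overline{gf}$ for $f\colon A\to B$, $g\colon B\to C$. $\mathcal O(A)$ is the set of restriction idempotents on $A$ (maps $e\colon A\to A$ with $\bar e=e$). A map $f$ is total if $\bar f=1$. For parallel maps, $f\leqslant g$ iff $f=g\bar f$, and $f\smile g$ (compatible) iff $f\bar g=g\bar f$. A restriction functor satisfies $F\bar f=\overline{Ff}$; it is hyperconnected if each induced $\mathcal O(A)\to\mathcal O(FA)$ is an isomorphism. A join restriction category is a restriction category in which every pairwise-compatible family of parallel maps has a join for $\leqslant$, and these joins are preserved by precomposition. A partial isomorphism is a map $s\colon A\to B$ with a (necessarily unique) partial inverse $s^*\colon B\to A$: $s^*s=\bar s$, $ss^*=\overline{s^*}$. An étale map is a join of partial isomorphisms; a local homeomorphism is a total étale map; a join restriction category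 is étale if all its maps are étale. A local atlas on $X$ is a set $I$ and a family $\varphi_{ij}\in\mathcal O(X)$ ($i,j\in I$) with $\varphi_{ij}=\varphi_{ji}$ and $\varphi_{jk}\varphi_{ij}\leqslant\varphi_{ik}$. A glueing of $\varphi$ is a local homeomorphism $p=\bigvee_i p_i\colon A\to X$, with each $p_i$ a partial isomorphism with partial inverse $s_i$, such that $\varphi_{ij}=p_js_i$. $\mathcal C$ has local glueings if every local atlas on every object has a glueing. A partial section of a total map $p\colon A\to X$ is a map $s\colon X\to A$ with $ps=\bar s$. PARTITE INTERNAL CATEGORIES. For a set $I$, an $I$-partite internal category $\mathbb A$ in $\mathcal C$ comprises objects $A_i$; objects $A_{ij}$ with total maps $\sigma_{ij}\colon A_{ij}\to A_i$, $\tau_{ij}\colon A_{ij}\to A_j$, where $\sigma_{ij}$ admits pullbacks along all total maps; maps $\eta_i\colon A_i\to A_{ii}$ with $\sigma_{ii}\eta_i=1=\tau_{ii}\eta_i$; and maps $\mu_{ijk}\colon A_{jk}\times_{A_j}A_{ij}\to A_{ik}$ (domain the pullback of $\sigma_{jk}$ along $\tau_{ij}$) with $\sigma_{ik}\mu_{ijk}=\sigma_{ij}\pi_2$, $\tau_{ik}\mu_{ijk}=\tau_{jk}\pi_1$, satisfying $\mu_{iij}(1,\eta_i\sigma_{ij})=1=\mu_{ijj}(\eta_j\tau_{ij},1)$ and $\mu_{ik\ell}(1\times\mu_{ijk})=\mu_{ij\ell}(\mu_{jk\ell}\times 1)$. It is source-étale if every $\sigma_{ij}$ is a local homeomorphism.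 It is an internal partite groupoid if there are (necessarily unique) total maps $\iota_{ij}\colon A_{ij}\to A_{ji}$ with $\iota_{ij}\iota_{ji}=1$, $\sigma_{ji}\iota_{ij}=\tau_{ij}$ and $\mu_{iji}(\iota_{ij},1)=\eta_i\sigma_{ij}$; a source-étale one is called étale. A partite cofunctor $F\colon\mathbb A\rightsquigarrow\mathbb B$ from an $I$-partite to a $J$-partite internal category comprises a function $I\to J$, $i\mapsto Fi$; total maps $F_i\colon B_{Fi}\to A_i$; and total maps $F_{ij}\colon A_{ij}\times_{A_i}B_{Fi}\to B_{Fi,Fj}$ (domain the pullback of $\sigma_{ij}$ along $F_i$) with $\sigma_{Fi,Fj}F_{ij}=\pi_2$, $F_j\tau_{Fi,Fj}F_{ij}=\tau_{ij}\pi_1$, $F_{ii}(\eta_iF_i,1)=\eta_{Fi}$, and $F_{ik}(\mu_{ijk}\times1)=\mu_{Fi,Fj,Fk}(F_{jk}\times1)(1\times F_{ij})$ on $A_{jk}\times_{A_j}A_{ij}\times_{A_i}B_{Fi}$ (using $A_{jk}\times_{A_j}B_{Fi,Fj}\cong(A_{jk}\times_{A_j}B_{Fj})\times_{B_{Fj}}B_{Fi,Fj}$). Composition: $(GF)i=G(Fi)$, $(GF)_i=F_iG_{Fi}$, $(GF)_{ij}=G_{Fi,Fj}(F_{ij}\times1)$ up to the canonical isomorphism of pullbacks. $\mathrm{pCat}_c(\mathcal C)$ is the resulting category; $\mathrm{peCat}_c(\mathcal C)$ and $\mathrm{peGpd}_c(\mathcal C)$ are its full subcategories on the source-étale partite internal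 categories and the étale partite internal groupoids. CATEGORIES OVER $\mathcal C$. $\mathrm{rCat}/\!/\mathcal C$ has as objects pairs $(\mathcal A,P)$ of a restriction category and a restriction functor $P\colon\mathcal A\to\mathcal C$; a map $(F,\alpha)\colon(\mathcal A,P)\to(\mathcal B,Q)$ is a restriction functor $F\colon\mathcal A\to\mathcal B$ and a natural transformation $\alpha\colon QF\Rightarrow P$ with total components; $(G,\beta)(F,\alpha)=(GF,\alpha\circ\beta F)$. $\mathrm{jrCat}/\!/_h\,\mathcal C$ (resp. $\mathrm{ejCat}/\!/_h\,\mathcal C$) is the full subcategory of those $(\mathcal A,P)$ with $\mathcal A$ a join restriction category (resp. an étale join restriction category) and $P$ hyperconnected. THE FUNCTOR $\Phi$. $\Phi(\mathbb A)=(\Phi\mathbb A,\pi_{\mathbb A})$: $\Phi\mathbb A$ has object-set $I$; $\Phi\mathbb A(i,j)$ is the set of partial sections of $\sigma_{ij}$; identities are $\eta_i$; the composite of $s\in\Phi\mathbb A(i,j)$, $t\in\Phi\mathbb A(j,k)$ is $\mu_{ijk}\circ\tau_{ij}^*(t)\circ s$ where $\tau_{ij}^*(t)=(t\tau_{ij},\overline{t\tau_{ij}})\colon A_{ij}\to A_{jk}\times_{A_j}A_{ij}$; the restriction of $s$ is $\eta_i\bar s$; $\pi_{\mathbb A}(i)=A_i$, $\pi_{\mathbb A}(s)=\tau_{ij}s$. For a cofunctor $F$, $\Phi(F)=(\Phi F,\varpi^F)$ with $\Phi F(i)=Fi$, $\Phi F(s)=F_{ij}\circ(sF_i,\overline{sF_i})$,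 $\varpi^F_i=F_i$. THE FUNCTOR $\Psi$. Given $(\mathcal A,P)$ and $f,g\in\mathcal A(i,j)$ put $[\![f=_Pg]\!]=\bigvee\{Pe: e\in\mathcal O(i),\ e\leqslant\bar f\bar g,\ fe=ge\}\in\mathcal O(Pi)$. $\Psi P$ is the $\mathrm{ob}(\mathcal A)$-partite internal category with objects $Pi$; $\sigma_{ij}\colon\Psi P_{ij}\to Pi$ a glueing of the local atlas $([\![f=_Pg]\!])_{f,g\in\mathcal A(i,j)}$, with associated partial sections $s_f$; $\tau_{ij}$ the unique map with $\tau_{ij}s_f=Pf$ for all $f$; $\eta_i=s_{1_i}$; $\mu_{ijk}$ the unique map with $\mu_{ijk}\tau_{ij}^*(s_g)s_f=s_{gf}$ for all $f,g$. $\Psi\colon\mathrm{rCat}/\!/\mathcal C\to\mathrm{pCat}_c(\mathcal C)$ is left adjoint to $\Phi$ with unit $(\eta_P,1)$, $\eta_P\colon\mathcal A\to\Phi\Psi P$ the identity on objects and $f\mapsto s_f$ on maps; this adjunction restricts to an equivalence $\mathrm{peCat}_c(\mathcal C)\simeq\mathrm{jrCat}/\!/_h\,\mathcal C$. *)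

theory Defs
  imports "HOL-Library.Equipollence"
begin

section \<open>Categories and functors\<close>

text \<open>
  An arrow is a label tagged with its source and its target, so that every hom-set is a copy of a
  set of labels. For a locally small category the type \<open>'u\<close> of labels also measures
  size: a set is small if its cardinality is strictly below that of \<open>'u\<close>. The type of objects
  is not bounded by \<open>'u\<close>, so a category may have a proper class of objects.
\<close>

datatype ('o, 'u) arr = Arr (src: 'o) (trg: 'o) (lab: 'u)

record ('o, 'u) cat =
  obj :: "'o set"
  arrs :: "('o, 'u) arr set"
  idn :: "'o \<Rightarrow> ('o, 'u) arr"
  cmp :: "('o, 'u) arr \<Rightarrow> ('o, 'u) arr \<Rightarrow> ('o, 'u) arr"  (infixl "\<cdot>\<index>" 70)

definition hom :: "('o, 'u, 'z) cat_scheme \<Rightarrow> 'o \<Rightarrow> 'o \<Rightarrow> ('o, 'u) arr set" where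
  "hom C X Y = {f \<in> arrs C. src f = X \<and> trg f = Y}"

locale category =
  fixes C :: "('o, 'u, 'z) cat_scheme" (structure)
  assumes src_obj: "f \<in> arrs C \<Longrightarrow> src f \<in> obj C"
    and trg_obj: "f \<in> arrs C \<Longrightarrow> trg f \<in> obj C"
    and idn_hom: "X \<in> obj C \<Longrightarrow> idn C X \<in> hom C X X"
    and cmp_hom: "\<lbrakk>f \<in> hom C X Y; g \<in> hom C Y Z\<rbrakk> \<Longrightarrow> g \<cdot> f \<in> hom C X Z"
    and idn_left: "f \<in> hom C X Y \<Longrightarrow> idn C Y \<cdot> f = f"
    and idn_right: "f \<in> hom C X Y \<Longrightarrow> f \<cdot> idn C X = f"
    and cmp_assoc: "\<lbrakk>f \<in> hom C W X; g \<in> hom C X Y; h \<in> hom C Y Z\<rbrakk> \<Longrightarrow> h \<cdot> g \<cdot> f = h \<cdot> (g \<cdot> f)"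

definition locally_small :: "('o, 'u, 'z) cat_scheme \<Rightarrow> bool" where
  "locally_small C \<longleftrightarrow> (\<forall>X \<in> obj C. \<forall>Y \<in> obj C. hom C X Y \<prec> (UNIV :: 'u set))"

definition full_subcat :: "('o, 'u) cat \<Rightarrow> ('o \<Rightarrow> bool) \<Rightarrow> ('o, 'u) cat" where
  "full_subcat D S =
    \<lparr>obj = {x \<in> obj D. S x}, arrs = {f \<in> arrs D. S (src f) \<and> S (trg f)}, idn = idn D, cmp = cmp D\<rparr>"

record ('o, 'u, 'p, 'v) func =
  fob :: "'o \<Rightarrow> 'p"
  far :: "('o, 'u) arr \<Rightarrow> ('p, 'v) arr"

definition id_func :: "('o, 'u, 'o, 'u) func" where
  "id_func = \<lparr>fob = (\<lambda>X. X), far = (\<lambda>f. f)\<rparr>"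

definition comp_func ::
  "('p, 'v, 'q, 'w) func \<Rightarrow> ('o, 'u, 'p, 'v) func \<Rightarrow> ('o, 'u, 'q, 'w) func" where
  "comp_func G F = \<lparr>fob = fob G \<circ> fob F, far = far G \<circ> far F\<rparr>"

locale is_functor = D: category D + E: category E
  for D :: "('o, 'u, 'y) cat_scheme" and E :: "('p, 'v, 'z) cat_scheme" +
  fixes F :: "('o, 'u, 'p, 'v) func"
  assumes fob_obj: "X \<in> obj D \<Longrightarrow> fob F X \<in> obj E"
    and far_hom: "f \<in> hom D X Y \<Longrightarrow> far F f \<in> hom E (fob F X) (fob F Y)"
    and far_idn: "X \<in> obj D \<Longrightarrow> far F (idn D X) = idn E (fob F X)"
    and far_cmp: "\<lbrakk>f \<in> hom D X Y; g \<in> hom D Y Z\<rbrakk> \<Longrightarrow> far F (g \<cdot>\<^bsub>D\<^esub> f) = far F g \<cdot>\<^bsub>E\<^esub> far F f"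

definition is_iso :: "('o, 'u, 'z) cat_scheme \<Rightarrow> ('o, 'u) arr \<Rightarrow> bool" where
  "is_iso D f \<longleftrightarrow> f \<in> arrs D \<and>
    (\<exists>g \<in> hom D (trg f) (src f). g \<cdot>\<^bsub>D\<^esub> f = idn D (src f) \<and> f \<cdot>\<^bsub>D\<^esub> g = idn D (trg f))"

definition nat_iso ::
  "('o, 'u) cat \<Rightarrow> ('p, 'v) cat \<Rightarrow> ('o, 'u, 'p, 'v) func \<Rightarrow> ('o, 'u, 'p, 'v) func
    \<Rightarrow> ('o \<Rightarrow> ('p, 'v) arr) \<Rightarrow> bool" where
  "nat_iso D E F G \<eta> \<longleftrightarrow>
    (\<forall>X \<in> obj D. \<eta> X \<in> hom E (fob F X) (fob G X) \<and> is_iso E (\<eta> X)) \<and>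
    (\<forall>f \<in> arrs D. \<eta> (trg f) \<cdot>\<^bsub>E\<^esub> far F f = far G f \<cdot>\<^bsub>E\<^esub> \<eta> (src f))"

text \<open>An adjoint equivalence with right adjoint \<open>R\<close>, left adjoint \<open>L\<close> and unit \<open>\<eta>\<close>.\<close>

definition adjoint_equivalence ::
  "('o, 'u) cat \<Rightarrow> ('p, 'v) cat \<Rightarrow> ('o, 'u, 'p, 'v) func \<Rightarrow> ('p, 'v, 'o, 'u) func
    \<Rightarrow> ('p \<Rightarrow> ('p, 'v) arr) \<Rightarrow> bool" where
  "adjoint_equivalence D E R L \<eta> \<longleftrightarrow>
    is_functor D E R \<and> is_functor E D L \<and>
    nat_iso E E id_func (comp_func R L) \<eta> \<and>
    (\<exists>\<epsilon>. nat_iso D D (comp_func L R) id_func \<epsilon> \<and>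
      (\<forall>Y \<in> obj E. \<epsilon> (fob L Y) \<cdot>\<^bsub>D\<^esub> far L (\<eta> Y) = idn D (fob L Y)) \<and>
      (\<forall>X \<in> obj D. far R (\<epsilon> X) \<cdot>\<^bsub>E\<^esub> \<eta> (fob R X) = idn E (fob R X)))"


section \<open>Restriction categories\<close>

record ('o, 'u) rcat = "('o, 'u) cat" +
  rst :: "('o, 'u) arr \<Rightarrow> ('o, 'u) arr"

locale restriction_category = category C for C :: "('o, 'u, 'z) rcat_scheme" (structure) +
  assumes rst_hom: "f \<in> hom C X Y \<Longrightarrow> rst C f \<in> hom C X X"
    and cmp_rst: "f \<in> arrs C \<Longrightarrow> f \<cdot> rst C f = f"
    and rst_commute: "\<lbrakk>f \<in> arrs C; g \<in> arrs C; src f = src g\<rbrakk>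
          \<Longrightarrow> rst C f \<cdot> rst C g = rst C g \<cdot> rst C f"
    and rst_cmp_rst: "\<lbrakk>f \<in> arrs C; g \<in> arrs C; src f = src g\<rbrakk>
          \<Longrightarrow> rst C (g \<cdot> rst C f) = rst C g \<cdot> rst C f"
    and rst_cmp: "\<lbrakk>f \<in> hom C X Y; g \<in> hom C Y Z\<rbrakk> \<Longrightarrow> rst C g \<cdot> f = f \<cdot> rst C (g \<cdot> f)"

definition rids :: "('o, 'u, 'z) rcat_scheme \<Rightarrow> 'o \<Rightarrow> ('o, 'u) arr set" where
  "rids C X = {e \<in> hom C X X. rst C e = e}"

definition total :: "('o, 'u, 'z) rcat_scheme \<Rightarrow> ('o, 'u) arr \<Rightarrow> bool" where
  "total C f \<longleftrightarrow> f \<in> arrs C \<and> rst C f = idn C (src f)"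

definition parallel :: "('o, 'u, 'z) cat_scheme \<Rightarrow> ('o, 'u) arr \<Rightarrow> ('o, 'u) arr \<Rightarrow> bool" where
  "parallel C f g \<longleftrightarrow> f \<in> arrs C \<and> g \<in> arrs C \<and> src f = src g \<and> trg f = trg g"

definition rle :: "('o, 'u, 'z) rcat_scheme \<Rightarrow> ('o, 'u) arr \<Rightarrow> ('o, 'u) arr \<Rightarrow> bool" where
  "rle C f g \<longleftrightarrow> parallel C f g \<and> f = g \<cdot>\<^bsub>C\<^esub> rst C f"

definition compatible :: "('o, 'u, 'z) rcat_scheme \<Rightarrow> ('o, 'u) arr \<Rightarrow> ('o, 'u) arr \<Rightarrow> bool" where
  "compatible C f g \<longleftrightarrow> parallel C f g \<and> f \<cdot>\<^bsub>C\<^esub> rst C g = g \<cdot>\<^bsub>C\<^esub> rst C f"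

definition is_join :: "('o, 'u, 'z) rcat_scheme \<Rightarrow> 'o \<Rightarrow> 'o \<Rightarrow> ('o, 'u) arr set
    \<Rightarrow> ('o, 'u) arr \<Rightarrow> bool" where
  "is_join C X Y S j \<longleftrightarrow> S \<subseteq> hom C X Y \<and> j \<in> hom C X Y \<and> (\<forall>f \<in> S. rle C f j) \<and>
    (\<forall>h \<in> hom C X Y. (\<forall>f \<in> S. rle C f h) \<longrightarrow> rle C j h)"

definition join :: "('o, 'u, 'z) rcat_scheme \<Rightarrow> 'o \<Rightarrow> 'o \<Rightarrow> ('o, 'u) arr set \<Rightarrow> ('o, 'u) arr" where
  "join C X Y S = (THE j. is_join C X Y S j)"

locale join_restriction_category = restriction_category C
  for C :: "('o, 'u, 'z) rcat_scheme" (structure) +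
  assumes join_exists: "\<lbrakk>X \<in> obj C; Y \<in> obj C; S \<subseteq> hom C X Y;
            \<And>f g. f \<in> S \<Longrightarrow> g \<in> S \<Longrightarrow> compatible C f g\<rbrakk> \<Longrightarrow> \<exists>j. is_join C X Y S j"
    and join_precomp: "\<lbrakk>S \<subseteq> hom C X Y; \<And>f g. f \<in> S \<Longrightarrow> g \<in> S \<Longrightarrow> compatible C f g;
            is_join C X Y S j; k \<in> hom C W X\<rbrakk> \<Longrightarrow> is_join C W Y ((\<lambda>f. f \<cdot> k) ` S) (j \<cdot> k)"

definition partial_inverse :: "('o, 'u, 'z) rcat_scheme \<Rightarrow> ('o, 'u) arr \<Rightarrow> ('o, 'u) arr \<Rightarrow> bool" where
  "partial_inverse C s t \<longleftrightarrow> s \<in> arrs C \<and> t \<in> hom C (trg s) (src s) \<and>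
    t \<cdot>\<^bsub>C\<^esub> s = rst C s \<and> s \<cdot>\<^bsub>C\<^esub> t = rst C t"

definition partial_iso :: "('o, 'u, 'z) rcat_scheme \<Rightarrow> ('o, 'u) arr \<Rightarrow> bool" where
  "partial_iso C s \<longleftrightarrow> (\<exists>t. partial_inverse C s t)"

definition etale_map :: "('o, 'u, 'z) rcat_scheme \<Rightarrow> ('o, 'u) arr \<Rightarrow> bool" where
  "etale_map C f \<longleftrightarrow> (\<exists>S. (\<forall>s \<in> S. partial_iso C s) \<and> is_join C (src f) (trg f) S f)"

definition local_homeo :: "('o, 'u, 'z) rcat_scheme \<Rightarrow> ('o, 'u) arr \<Rightarrow> bool" where
  "local_homeo C f \<longleftrightarrow> total C f \<and> etale_map C f"

definition etale_category :: "('o, 'u, 'z) rcat_scheme \<Rightarrow> bool" where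
  "etale_category C \<longleftrightarrow> join_restriction_category C \<and> (\<forall>f \<in> arrs C. etale_map C f)"

definition local_atlas :: "('o, 'u, 'z) rcat_scheme \<Rightarrow> 'o \<Rightarrow> 'k set \<Rightarrow> ('k \<Rightarrow> 'k \<Rightarrow> ('o, 'u) arr) \<Rightarrow> bool" where
  "local_atlas C X I \<phi> \<longleftrightarrow> X \<in> obj C \<and>
    (\<forall>i \<in> I. \<forall>j \<in> I. \<phi> i j \<in> rids C X \<and> \<phi> i j = \<phi> j i) \<and>
    (\<forall>i \<in> I. \<forall>j \<in> I. \<forall>k \<in> I. rle C (\<phi> j k \<cdot>\<^bsub>C\<^esub> \<phi> i j) (\<phi> i k))"

definition is_glueing :: "('o, 'u, 'z) rcat_scheme \<Rightarrow> 'o \<Rightarrow> 'k set \<Rightarrow> ('k \<Rightarrow> 'k \<Rightarrow> ('o, 'u) arr)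
    \<Rightarrow> ('o, 'u) arr \<Rightarrow> ('k \<Rightarrow> ('o, 'u) arr) \<Rightarrow> ('k \<Rightarrow> ('o, 'u) arr) \<Rightarrow> bool" where
  "is_glueing C X I \<phi> p ps ss \<longleftrightarrow>
    local_homeo C p \<and> trg p = X \<and> is_join C (src p) X (ps ` I) p \<and>
    (\<forall>i \<in> I. partial_inverse C (ps i) (ss i)) \<and>
    (\<forall>i \<in> I. \<forall>j \<in> I. \<phi> i j = ps j \<cdot>\<^bsub>C\<^esub> ss i)"

text \<open>Every small index set is in bijection with a small set of labels.\<close>

definition has_local_glueings :: "('o, 'u, 'z) rcat_scheme \<Rightarrow> bool" where
  "has_local_glueings C \<longleftrightarrow>
    (\<forall>X (I :: 'u set) \<phi>. I \<prec> (UNIV :: 'u set) \<longrightarrow> local_atlas C X I \<phi> \<longrightarrow>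
      (\<exists>p ps ss. is_glueing C X I \<phi> p ps ss))"

definition psections :: "('o, 'u, 'z) rcat_scheme \<Rightarrow> ('o, 'u) arr \<Rightarrow> ('o, 'u) arr set" where
  "psections C p = {s \<in> hom C (trg p) (src p). p \<cdot>\<^bsub>C\<^esub> s = rst C s}"

locale restriction_functor =
  is_functor A B F + A: restriction_category A + B: restriction_category B
  for A :: "('o, 'u, 'y) rcat_scheme" and B :: "('p, 'v, 'z) rcat_scheme"
    and F :: "('o, 'u, 'p, 'v) func" +
  assumes far_rst: "f \<in> arrs A \<Longrightarrow> far F (rst A f) = rst B (far F f)"

text \<open>A restriction functor preserves composites of restriction idempotents, so it is enough
  that the induced maps of semilattices are bijective.\<close>

definition hyperconnected ::
  "('o, 'u, 'y) rcat_scheme \<Rightarrow> ('p, 'v, 'z) rcat_scheme \<Rightarrow> ('o, 'u, 'p, 'v) func \<Rightarrow> bool" where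
  "hyperconnected A B F \<longleftrightarrow> restriction_functor A B F \<and>
    (\<forall>X \<in> obj A. bij_betw (far F) (rids A X) (rids B (fob F X)))"


section \<open>Chosen pullbacks\<close>

text \<open>Pullbacks are ordinary pullbacks in \<open>C\<close>: the universal property is tested against all
  maps, partial ones included. Projections of pullbacks of total maps are then automatically total.\<close>

definition is_pullback :: "('o, 'u, 'z) cat_scheme \<Rightarrow> ('o, 'u) arr \<Rightarrow> ('o, 'u) arr
    \<Rightarrow> ('o, 'u) arr \<Rightarrow> ('o, 'u) arr \<Rightarrow> bool" where
  "is_pullback C f g p q \<longleftrightarrow>
    f \<in> arrs C \<and> g \<in> arrs C \<and> trg f = trg g \<and>
    p \<in> hom C (src p) (src f) \<and> q \<in> hom C (src p) (src g) \<and> f \<cdot>\<^bsub>C\<^esub> p = g \<cdot>\<^bsub>C\<^esub> q \<and>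
    (\<forall>W \<in> obj C. \<forall>u \<in> hom C W (src f). \<forall>v \<in> hom C W (src g). f \<cdot>\<^bsub>C\<^esub> u = g \<cdot>\<^bsub>C\<^esub> v \<longrightarrow>
      (\<exists>!w. w \<in> hom C W (src p) \<and> p \<cdot>\<^bsub>C\<^esub> w = u \<and> q \<cdot>\<^bsub>C\<^esub> w = v))"

definition pr1 :: "('o, 'u, 'z) cat_scheme \<Rightarrow> ('o, 'u) arr \<Rightarrow> ('o, 'u) arr \<Rightarrow> ('o, 'u) arr" where
  "pr1 C f g = fst (SOME (p, q). is_pullback C f g p q)"

definition pr2 :: "('o, 'u, 'z) cat_scheme \<Rightarrow> ('o, 'u) arr \<Rightarrow> ('o, 'u) arr \<Rightarrow> ('o, 'u) arr" where
  "pr2 C f g = snd (SOME (p, q). is_pullback C f g p q)"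

definition pbob :: "('o, 'u, 'z) cat_scheme \<Rightarrow> ('o, 'u) arr \<Rightarrow> ('o, 'u) arr \<Rightarrow> 'o" where
  "pbob C f g = src (pr1 C f g)"

text \<open>\<open>pair C f g u v\<close> is the map \<open>(u, v)\<close> into the chosen pullback of \<open>f\<close> along \<open>g\<close>.\<close>

definition pair :: "('o, 'u, 'z) cat_scheme \<Rightarrow> ('o, 'u) arr \<Rightarrow> ('o, 'u) arr
    \<Rightarrow> ('o, 'u) arr \<Rightarrow> ('o, 'u) arr \<Rightarrow> ('o, 'u) arr" where
  "pair C f g u v = (THE w. w \<in> hom C (src u) (pbob C f g) \<and>
    pr1 C f g \<cdot>\<^bsub>C\<^esub> w = u \<and> pr2 C f g \<cdot>\<^bsub>C\<^esub> w = v)"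

definition has_pullbacks_along_total :: "('o, 'u, 'z) rcat_scheme \<Rightarrow> ('o, 'u) arr \<Rightarrow> bool" where
  "has_pullbacks_along_total C f \<longleftrightarrow>
    (\<forall>g. total C g \<and> trg g = trg f \<longrightarrow> (\<exists>p q. is_pullback C f g p q))"


section \<open>Partite internal categories\<close>

text \<open>\<open>mu A i j k\<close> is the composition map from the pullback of \<open>sig A j k\<close> along \<open>tau A i j\<close>
  to \<open>ob1 A i k\<close>. The values of the fields at indices outside \<open>idx A\<close> are irrelevant.\<close>

record ('i, 'o, 'u) pcat =
  idx :: "'i set"
  ob0 :: "'i \<Rightarrow> 'o"
  ob1 :: "'i \<Rightarrow> 'i \<Rightarrow> 'o"
  sig :: "'i \<Rightarrow> 'i \<Rightarrow> ('o, 'u) arr"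
  tau :: "'i \<Rightarrow> 'i \<Rightarrow> ('o, 'u) arr"
  eta :: "'i \<Rightarrow> ('o, 'u) arr"
  mu  :: "'i \<Rightarrow> 'i \<Rightarrow> 'i \<Rightarrow> ('o, 'u) arr"

text \<open>In the associativity law, \<open>a\<close>, \<open>b\<close> and \<open>c\<close> are the three projections of the
  iterated pullback of \<open>sig A k l\<close>, \<open>tau A j k\<close>, \<open>sig A j k\<close> and \<open>tau A i j\<close>, bracketed to the
  right, and \<open>bc\<close> is its projection to the pullback of the last two factors.\<close>

locale partite_category =
  fixes C :: "('o, 'u) rcat" (structure) and A :: "('i, 'o, 'u) pcat"
  assumes ob0_obj: "i \<in> idx A \<Longrightarrow> ob0 A i \<in> obj C"
    and ob1_obj: "\<lbrakk>i \<in> idx A; j \<in> idx A\<rbrakk> \<Longrightarrow> ob1 A i j \<in> obj C"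
    and sig_hom: "\<lbrakk>i \<in> idx A; j \<in> idx A\<rbrakk> \<Longrightarrow> sig A i j \<in> hom C (ob1 A i j) (ob0 A i)"
    and sig_total: "\<lbrakk>i \<in> idx A; j \<in> idx A\<rbrakk> \<Longrightarrow> total C (sig A i j)"
    and sig_pullbacks: "\<lbrakk>i \<in> idx A; j \<in> idx A\<rbrakk> \<Longrightarrow> has_pullbacks_along_total C (sig A i j)"
    and tau_hom: "\<lbrakk>i \<in> idx A; j \<in> idx A\<rbrakk> \<Longrightarrow> tau A i j \<in> hom C (ob1 A i j) (ob0 A j)"
    and tau_total: "\<lbrakk>i \<in> idx A; j \<in> idx A\<rbrakk> \<Longrightarrow> total C (tau A i j)"
    and eta_hom: "i \<in> idx A \<Longrightarrow> eta A i \<in> hom C (ob0 A i) (ob1 A i i)"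
    and sig_eta: "i \<in> idx A \<Longrightarrow> sig A i i \<cdot> eta A i = idn C (ob0 A i)"
    and tau_eta: "i \<in> idx A \<Longrightarrow> tau A i i \<cdot> eta A i = idn C (ob0 A i)"
    and mu_hom: "\<lbrakk>i \<in> idx A; j \<in> idx A; k \<in> idx A\<rbrakk>
          \<Longrightarrow> mu A i j k \<in> hom C (pbob C (sig A j k) (tau A i j)) (ob1 A i k)"
    and sig_mu: "\<lbrakk>i \<in> idx A; j \<in> idx A; k \<in> idx A\<rbrakk>
          \<Longrightarrow> sig A i k \<cdot> mu A i j k = sig A i j \<cdot> pr2 C (sig A j k) (tau A i j)"
    and tau_mu: "\<lbrakk>i \<in> idx A; j \<in> idx A; k \<in> idx A\<rbrakk>
          \<Longrightarrow> tau A i k \<cdot> mu A i j k = tau A j k \<cdot> pr1 C (sig A j k) (tau A i j)"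
    and mu_unit_right: "\<lbrakk>i \<in> idx A; j \<in> idx A\<rbrakk>
          \<Longrightarrow> mu A i i j \<cdot> pair C (sig A i j) (tau A i i) (idn C (ob1 A i j)) (eta A i \<cdot> sig A i j)
            = idn C (ob1 A i j)"
    and mu_unit_left: "\<lbrakk>i \<in> idx A; j \<in> idx A\<rbrakk>
          \<Longrightarrow> mu A i j j \<cdot> pair C (sig A j j) (tau A i j) (eta A j \<cdot> tau A i j) (idn C (ob1 A i j))
            = idn C (ob1 A i j)"
    and mu_assoc: "\<lbrakk>i \<in> idx A; j \<in> idx A; k \<in> idx A; l \<in> idx A;
            a = pr1 C (sig A k l) (tau A j k \<cdot> pr1 C (sig A j k) (tau A i j));
            bc = pr2 C (sig A k l) (tau A j k \<cdot> pr1 C (sig A j k) (tau A i j));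
            b = pr1 C (sig A j k) (tau A i j) \<cdot> bc;
            c = pr2 C (sig A j k) (tau A i j) \<cdot> bc\<rbrakk>
          \<Longrightarrow> mu A i k l \<cdot> pair C (sig A k l) (tau A i k) a (mu A i j k \<cdot> bc)
            = mu A i j l \<cdot> pair C (sig A j l) (tau A i j)
                (mu A j k l \<cdot> pair C (sig A k l) (tau A j k) a b) c"

definition source_etale :: "('o, 'u) rcat \<Rightarrow> ('i, 'o, 'u) pcat \<Rightarrow> bool" where
  "source_etale C A \<longleftrightarrow> (\<forall>i \<in> idx A. \<forall>j \<in> idx A. local_homeo C (sig A i j))"

definition partite_groupoid :: "('o, 'u) rcat \<Rightarrow> ('i, 'o, 'u) pcat \<Rightarrow> bool" where
  "partite_groupoid C A \<longleftrightarrow> partite_category C A \<and>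
    (\<exists>\<iota>. \<forall>i \<in> idx A. \<forall>j \<in> idx A.
      \<iota> i j \<in> hom C (ob1 A i j) (ob1 A j i) \<and> total C (\<iota> i j) \<and>
      \<iota> i j \<cdot>\<^bsub>C\<^esub> \<iota> j i = idn C (ob1 A j i) \<and>
      sig A j i \<cdot>\<^bsub>C\<^esub> \<iota> i j = tau A i j \<and>
      mu A i j i \<cdot>\<^bsub>C\<^esub> pair C (sig A j i) (tau A i j) (\<iota> i j) (idn C (ob1 A i j))
        = eta A i \<cdot>\<^bsub>C\<^esub> sig A i j)"


section \<open>Partite cofunctors\<close>

record ('i, 'o, 'u) cofun =
  cfo :: "'i \<Rightarrow> 'i"
  cf0 :: "'i \<Rightarrow> ('o, 'u) arr"
  cf1 :: "'i \<times> 'i \<Rightarrow> ('o, 'u) arr"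

text \<open>In the last law, \<open>a\<close>, \<open>b\<close> and \<open>c\<close> are the projections of the iterated pullback of
  \<open>sig A j k\<close>, \<open>tau A i j\<close>, \<open>sig A i j\<close> and \<open>cf0 F i\<close>, bracketed to the right; \<open>bc\<close> is its projection
  to the pullback of the last two factors and \<open>d\<close> is the image of \<open>bc\<close> under \<open>cf1 F (i, j)\<close>. The
  components are extensional so that equality of cofunctors is equality of their data.\<close>

locale partite_cofunctor = A: partite_category C A + B: partite_category C B
  for C :: "('o, 'u) rcat" (structure) and A :: "('i, 'o, 'u) pcat" and B :: "('i, 'o, 'u) pcat" +
  fixes F :: "('i, 'o, 'u) cofun"
  assumes cfo_ext: "cfo F \<in> idx A \<rightarrow>\<^sub>E idx B"
    and cf0_ext: "cf0 F \<in> extensional (idx A)"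
    and cf1_ext: "cf1 F \<in> extensional (idx A \<times> idx A)"
    and cf0_hom: "i \<in> idx A \<Longrightarrow> cf0 F i \<in> hom C (ob0 B (cfo F i)) (ob0 A i)"
    and cf0_total: "i \<in> idx A \<Longrightarrow> total C (cf0 F i)"
    and cf1_hom: "\<lbrakk>i \<in> idx A; j \<in> idx A\<rbrakk>
          \<Longrightarrow> cf1 F (i, j) \<in> hom C (pbob C (sig A i j) (cf0 F i)) (ob1 B (cfo F i) (cfo F j))"
    and cf1_total: "\<lbrakk>i \<in> idx A; j \<in> idx A\<rbrakk> \<Longrightarrow> total C (cf1 F (i, j))"
    and sig_cf1: "\<lbrakk>i \<in> idx A; j \<in> idx A\<rbrakk>
          \<Longrightarrow> sig B (cfo F i) (cfo F j) \<cdot> cf1 F (i, j) = pr2 C (sig A i j) (cf0 F i)"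
    and tau_cf1: "\<lbrakk>i \<in> idx A; j \<in> idx A\<rbrakk>
          \<Longrightarrow> cf0 F j \<cdot> tau B (cfo F i) (cfo F j) \<cdot> cf1 F (i, j)
            = tau A i j \<cdot> pr1 C (sig A i j) (cf0 F i)"
    and cf1_eta: "i \<in> idx A
          \<Longrightarrow> cf1 F (i, i) \<cdot> pair C (sig A i i) (cf0 F i) (eta A i \<cdot> cf0 F i) (idn C (ob0 B (cfo F i)))
            = eta B (cfo F i)"
    and cf1_mu: "\<lbrakk>i \<in> idx A; j \<in> idx A; k \<in> idx A;
            a = pr1 C (sig A j k) (tau A i j \<cdot> pr1 C (sig A i j) (cf0 F i));
            bc = pr2 C (sig A j k) (tau A i j \<cdot> pr1 C (sig A i j) (cf0 F i));
            b = pr1 C (sig A i j) (cf0 F i) \<cdot> bc;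
            c = pr2 C (sig A i j) (cf0 F i) \<cdot> bc;
            d = cf1 F (i, j) \<cdot> bc\<rbrakk>
          \<Longrightarrow> cf1 F (i, k) \<cdot> pair C (sig A i k) (cf0 F i)
                (mu A i j k \<cdot> pair C (sig A j k) (tau A i j) a b) c
            = mu B (cfo F i) (cfo F j) (cfo F k)
                \<cdot> pair C (sig B (cfo F j) (cfo F k)) (tau B (cfo F i) (cfo F j))
                    (cf1 F (j, k) \<cdot> pair C (sig A j k) (cf0 F j) a (tau B (cfo F i) (cfo F j) \<cdot> d)) d"

definition id_cofun :: "('o, 'u) rcat \<Rightarrow> ('i, 'o, 'u) pcat \<Rightarrow> ('i, 'o, 'u) cofun" where
  "id_cofun C A =
    \<lparr>cfo = restrict (\<lambda>i. i) (idx A),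
     cf0 = restrict (\<lambda>i. idn C (ob0 A i)) (idx A),
     cf1 = restrict (\<lambda>(i, j). pr1 C (sig A i j) (idn C (ob0 A i))) (idx A \<times> idx A)\<rparr>"

text \<open>The composite \<open>GF\<close> of \<open>F\<close> from \<open>A\<close> to \<open>B\<close> with \<open>G\<close> from \<open>B\<close>.\<close>

definition comp_cofun :: "('o, 'u) rcat \<Rightarrow> ('i, 'o, 'u) pcat \<Rightarrow> ('i, 'o, 'u) pcat
    \<Rightarrow> ('i, 'o, 'u) cofun \<Rightarrow> ('i, 'o, 'u) cofun \<Rightarrow> ('i, 'o, 'u) cofun" where
  "comp_cofun C A B G F =
    \<lparr>cfo = restrict (\<lambda>i. cfo G (cfo F i)) (idx A),
     cf0 = restrict (\<lambda>i. cf0 F i \<cdot>\<^bsub>C\<^esub> cf0 G (cfo F i)) (idx A),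
     cf1 = restrict (\<lambda>(i, j).
       let h = cf0 F i \<cdot>\<^bsub>C\<^esub> cf0 G (cfo F i); x = pr1 C (sig A i j) h; y = pr2 C (sig A i j) h
       in cf1 G (cfo F i, cfo F j) \<cdot>\<^bsub>C\<^esub>
            pair C (sig B (cfo F i) (cfo F j)) (cf0 G (cfo F i))
              (cf1 F (i, j) \<cdot>\<^bsub>C\<^esub> pair C (sig A i j) (cf0 F i) x (cf0 G (cfo F i) \<cdot>\<^bsub>C\<^esub> y)) y)
       (idx A \<times> idx A)\<rparr>"

definition pCat :: "('o, 'u) rcat \<Rightarrow> (('i, 'o, 'u) pcat, ('i, 'o, 'u) cofun) cat" where
  "pCat C =
    \<lparr>obj = {A. partite_category C A},
     arrs = {Arr A B F | A B F. partite_cofunctor C A B F},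
     idn = (\<lambda>A. Arr A A (id_cofun C A)),
     cmp = (\<lambda>g f. Arr (src f) (trg g) (comp_cofun C (src f) (trg f) (lab g) (lab f)))\<rparr>"

definition peCat :: "('o, 'u) rcat \<Rightarrow> (('i, 'o, 'u) pcat, ('i, 'o, 'u) cofun) cat" where
  "peCat C = full_subcat (pCat C) (source_etale C)"

definition peGpd :: "('o, 'u) rcat \<Rightarrow> (('i, 'o, 'u) pcat, ('i, 'o, 'u) cofun) cat" where
  "peGpd C = full_subcat (pCat C) (\<lambda>A. source_etale C A \<and> partite_groupoid C A)"


section \<open>Restriction categories over \<open>C\<close>\<close>

type_synonym ('i, 'o, 'u) over = "('i, 'u) rcat \<times> ('i, 'u, 'o, 'u) func"
type_synonym ('i, 'o, 'u) over_map = "('i, 'u, 'i, 'u) func \<times> ('i \<Rightarrow> ('o, 'u) arr)"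

definition is_over :: "('o, 'u) rcat \<Rightarrow> ('i, 'o, 'u) over \<Rightarrow> bool" where
  "is_over C X \<longleftrightarrow> locally_small (fst X) \<and> restriction_functor (fst X) C (snd X)"

fun is_over_map :: "('o, 'u) rcat \<Rightarrow> ('i, 'o, 'u) over \<Rightarrow> ('i, 'o, 'u) over
    \<Rightarrow> ('i, 'o, 'u) over_map \<Rightarrow> bool" where
  "is_over_map C (A, P) (B, Q) (F, \<alpha>) \<longleftrightarrow>
    restriction_functor A B F \<and> fob F \<in> extensional (obj A) \<and> far F \<in> extensional (arrs A) \<and>
    \<alpha> \<in> extensional (obj A) \<and>
    (\<forall>i \<in> obj A. \<alpha> i \<in> hom C (fob Q (fob F i)) (fob P i) \<and> total C (\<alpha> i)) \<and>
    (\<forall>f \<in> arrs A. \<alpha> (trg f) \<cdot>\<^bsub>C\<^esub> far Q (far F f) = far P f \<cdot>\<^bsub>C\<^esub> \<alpha> (src f))"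

definition restrict_func :: "('o, 'u, 'z) cat_scheme \<Rightarrow> ('o, 'u, 'p, 'v) func \<Rightarrow> ('o, 'u, 'p, 'v) func" where
  "restrict_func A F = \<lparr>fob = restrict (fob F) (obj A), far = restrict (far F) (arrs A)\<rparr>"

fun id_over :: "('o, 'u) rcat \<Rightarrow> ('i, 'o, 'u) over \<Rightarrow> ('i, 'o, 'u) over_map" where
  "id_over C (A, P) = (restrict_func A id_func, restrict (\<lambda>i. idn C (fob P i)) (obj A))"

fun comp_over :: "('o, 'u) rcat \<Rightarrow> ('i, 'o, 'u) over
    \<Rightarrow> ('i, 'o, 'u) over_map \<Rightarrow> ('i, 'o, 'u) over_map \<Rightarrow> ('i, 'o, 'u) over_map" where
  "comp_over C (A, P) (G, \<beta>) (F, \<alpha>) =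
    (restrict_func A (comp_func G F), restrict (\<lambda>i. \<alpha> i \<cdot>\<^bsub>C\<^esub> \<beta> (fob F i)) (obj A))"

definition rCat_over :: "('o, 'u) rcat \<Rightarrow> (('i, 'o, 'u) over, ('i, 'o, 'u) over_map) cat" where
  "rCat_over C =
    \<lparr>obj = {X. is_over C X},
     arrs = {Arr X Y h | X Y h. is_over C X \<and> is_over C Y \<and> is_over_map C X Y h},
     idn = (\<lambda>X. Arr X X (id_over C X)),
     cmp = (\<lambda>g f. Arr (src f) (trg g) (comp_over C (src f) (lab g) (lab f)))\<rparr>"

definition jrCat_h :: "('o, 'u) rcat \<Rightarrow> (('i, 'o, 'u) over, ('i, 'o, 'u) over_map) cat" where
  "jrCat_h C = full_subcat (rCat_over C)
    (\<lambda>(A, P). join_restriction_category A \<and> hyperconnected A C P)"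

definition ejCat_h :: "('o, 'u) rcat \<Rightarrow> (('i, 'o, 'u) over, ('i, 'o, 'u) over_map) cat" where
  "ejCat_h C = full_subcat (rCat_over C)
    (\<lambda>(A, P). etale_category A \<and> hyperconnected A C P)"


section \<open>The functor \<open>\<Phi>\<close>\<close>

text \<open>\<open>tstar C s t x\<close> is the pullback of a partial section \<open>x\<close> of \<open>s\<close> along \<open>t\<close>.\<close>

definition tstar :: "('o, 'u) rcat \<Rightarrow> ('o, 'u) arr \<Rightarrow> ('o, 'u) arr \<Rightarrow> ('o, 'u) arr \<Rightarrow> ('o, 'u) arr" where
  "tstar C s t x = pair C s t (x \<cdot>\<^bsub>C\<^esub> t) (rst C (x \<cdot>\<^bsub>C\<^esub> t))"

text \<open>A partial section \<open>s\<close> of \<open>sig A i j\<close>, viewed as an arrow from \<open>i\<close> to \<open>j\<close>, keeps its label only: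
  its source \<open>ob0 A i\<close> and its target \<open>ob1 A i j\<close> are recovered from \<open>i\<close> and \<open>j\<close> by \<open>the_sec\<close>.\<close>

definition sec_arr :: "'i \<Rightarrow> 'i \<Rightarrow> ('o, 'u) arr \<Rightarrow> ('i, 'u) arr" where
  "sec_arr i j s = Arr i j (lab s)"

definition the_sec :: "('i, 'o, 'u) pcat \<Rightarrow> ('i, 'u) arr \<Rightarrow> ('o, 'u) arr" where
  "the_sec A f = Arr (ob0 A (src f)) (ob1 A (src f) (trg f)) (lab f)"

definition Phi_cat :: "('o, 'u) rcat \<Rightarrow> ('i, 'o, 'u) pcat \<Rightarrow> ('i, 'u) rcat" where
  "Phi_cat C A =
    \<lparr>obj = idx A,
     arrs = {sec_arr i j s | i j s. i \<in> idx A \<and> j \<in> idx A \<and> s \<in> psections C (sig A i j)},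
     idn = (\<lambda>i. sec_arr i i (eta A i)),
     cmp = (\<lambda>g f. let i = src f; j = trg f; k = trg g in
       sec_arr i k (mu A i j k \<cdot>\<^bsub>C\<^esub> tstar C (sig A j k) (tau A i j) (the_sec A g) \<cdot>\<^bsub>C\<^esub> the_sec A f)),
     rst = (\<lambda>f. sec_arr (src f) (src f) (eta A (src f) \<cdot>\<^bsub>C\<^esub> rst C (the_sec A f)))\<rparr>"

definition Phi_proj :: "('o, 'u) rcat \<Rightarrow> ('i, 'o, 'u) pcat \<Rightarrow> ('i, 'u, 'o, 'u) func" where
  "Phi_proj C A = \<lparr>fob = ob0 A, far = (\<lambda>f. tau A (src f) (trg f) \<cdot>\<^bsub>C\<^esub> the_sec A f)\<rparr>"

definition Phi_map :: "('o, 'u) rcat \<Rightarrow> ('i, 'o, 'u) pcat \<Rightarrow> ('i, 'o, 'u) cofun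
    \<Rightarrow> ('i, 'o, 'u) over_map" where
  "Phi_map C A F =
    (restrict_func (Phi_cat C A)
       \<lparr>fob = cfo F,
        far = (\<lambda>f. let i = src f; j = trg f; s = the_sec A f \<cdot>\<^bsub>C\<^esub> cf0 F i in
          sec_arr (cfo F i) (cfo F j)
            (cf1 F (i, j) \<cdot>\<^bsub>C\<^esub> pair C (sig A i j) (cf0 F i) s (rst C s)))\<rparr>,
     restrict (cf0 F) (idx A))"

definition Phi :: "('o, 'u) rcat \<Rightarrow>
    (('i, 'o, 'u) pcat, ('i, 'o, 'u) cofun, ('i, 'o, 'u) over, ('i, 'o, 'u) over_map) func" where
  "Phi C =
    \<lparr>fob = (\<lambda>A. (Phi_cat C A, Phi_proj C A)),
     far = (\<lambda>F. Arr (Phi_cat C (src F), Phi_proj C (src F)) (Phi_cat C (trg F), Phi_proj C (trg F))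
              (Phi_map C (src F) (lab F)))\<rparr>"


section \<open>The functor \<open>\<Psi>\<close>\<close>

definition agreement :: "('o, 'u) rcat \<Rightarrow> ('i, 'o, 'u) over \<Rightarrow> ('i, 'u) arr \<Rightarrow> ('i, 'u) arr
    \<Rightarrow> ('o, 'u) arr" where
  "agreement C X f g = (let A = fst X; P = snd X; i = src f in
    join C (fob P i) (fob P i)
      {far P e | e. e \<in> rids A i \<and> rle A e (rst A f \<cdot>\<^bsub>A\<^esub> rst A g) \<and> f \<cdot>\<^bsub>A\<^esub> e = g \<cdot>\<^bsub>A\<^esub> e})"

definition Psi_glueing :: "('o, 'u) rcat \<Rightarrow> ('i, 'o, 'u) over \<Rightarrow> 'i \<Rightarrow> 'i
    \<Rightarrow> ('o, 'u) arr \<times> (('i, 'u) arr \<Rightarrow> ('o, 'u) arr) \<times> (('i, 'u) arr \<Rightarrow> ('o, 'u) arr)" where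
  "Psi_glueing C X i j = (SOME (p, ps, ss).
    is_glueing C (fob (snd X) i) (hom (fst X) i j) (agreement C X) p ps ss)"

definition Psi_sig :: "('o, 'u) rcat \<Rightarrow> ('i, 'o, 'u) over \<Rightarrow> 'i \<Rightarrow> 'i \<Rightarrow> ('o, 'u) arr" where
  "Psi_sig C X i j = fst (Psi_glueing C X i j)"

definition Psi_sec :: "('o, 'u) rcat \<Rightarrow> ('i, 'o, 'u) over \<Rightarrow> ('i, 'u) arr \<Rightarrow> ('o, 'u) arr" where
  "Psi_sec C X f = snd (snd (Psi_glueing C X (src f) (trg f))) f"

definition Psi_tau :: "('o, 'u) rcat \<Rightarrow> ('i, 'o, 'u) over \<Rightarrow> 'i \<Rightarrow> 'i \<Rightarrow> ('o, 'u) arr" where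
  "Psi_tau C X i j = (THE t. t \<in> hom C (src (Psi_sig C X i j)) (fob (snd X) j) \<and>
    (\<forall>f \<in> hom (fst X) i j. t \<cdot>\<^bsub>C\<^esub> Psi_sec C X f = far (snd X) f))"

definition Psi_mu :: "('o, 'u) rcat \<Rightarrow> ('i, 'o, 'u) over \<Rightarrow> 'i \<Rightarrow> 'i \<Rightarrow> 'i \<Rightarrow> ('o, 'u) arr" where
  "Psi_mu C X i j k =
    (THE m. m \<in> hom C (pbob C (Psi_sig C X j k) (Psi_tau C X i j)) (src (Psi_sig C X i k)) \<and>
      (\<forall>f \<in> hom (fst X) i j. \<forall>g \<in> hom (fst X) j k.
        m \<cdot>\<^bsub>C\<^esub> tstar C (Psi_sig C X j k) (Psi_tau C X i j) (Psi_sec C X g) \<cdot>\<^bsub>C\<^esub> Psi_sec C X f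
          = Psi_sec C X (g \<cdot>\<^bsub>fst X\<^esub> f)))"

definition Psi_ob :: "('o, 'u) rcat \<Rightarrow> ('i, 'o, 'u) over \<Rightarrow> ('i, 'o, 'u) pcat" where
  "Psi_ob C X =
    \<lparr>idx = obj (fst X),
     ob0 = fob (snd X),
     ob1 = (\<lambda>i j. src (Psi_sig C X i j)),
     sig = Psi_sig C X,
     tau = Psi_tau C X,
     eta = (\<lambda>i. Psi_sec C X (idn (fst X) i)),
     mu = Psi_mu C X\<rparr>"

definition unit_arr :: "('o, 'u) rcat \<Rightarrow> ('i, 'o, 'u) over
    \<Rightarrow> (('i, 'o, 'u) over, ('i, 'o, 'u) over_map) arr" where
  "unit_arr C X = Arr X (fob (Phi C) (Psi_ob C X))
    (restrict_func (fst X)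
       \<lparr>fob = (\<lambda>i. i), far = (\<lambda>f. sec_arr (src f) (trg f) (Psi_sec C X f))\<rparr>,
     restrict (\<lambda>i. idn C (fob (snd X) i)) (obj (fst X)))"

text \<open>On arrows, \<open>Psi\<close> is the left adjoint determined by the unit: \<open>\<Psi> h\<close> is the unique map
  with \<open>\<Phi> (\<Psi> h) \<circ> \<eta> = \<eta> \<circ> h\<close>.\<close>

definition Psi :: "('o, 'u) rcat \<Rightarrow>
    (('i, 'o, 'u) over, ('i, 'o, 'u) over_map, ('i, 'o, 'u) pcat, ('i, 'o, 'u) cofun) func" where
  "Psi C =
    \<lparr>fob = Psi_ob C,
     far = (\<lambda>h. THE G. G \<in> hom (pCat C) (Psi_ob C (src h)) (Psi_ob C (trg h)) \<and>
       far (Phi C) G \<cdot>\<^bsub>rCat_over C\<^esub> unit_arr C (src h) = unit_arr C (trg h) \<cdot>\<^bsub>rCat_over C\<^esub> h)\<rparr>"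

end

theory Submission
  imports Defs
begin

text \<open>
  A local homeomorphism is covered by slices on each of which some partial section is inverse to it.
  So maps out of it, and out of its pullbacks along total maps, can be compared and constructed
  section by section. Tested on sections, the laws of a source-etale partite internal category and
  of a partite cofunctor become the laws of the category of sections and of functors over \<open>C\<close>;
  hence \<open>\<Phi>\<close> is full and faithful on source-etale objects. This also gives the category axioms for
  cofunctors: they are reflected by \<open>\<Phi>\<close>, so no iterated pullback has to be rebracketed.

  If \<open>P\<close> is hyperconnected, the sections of \<open>\<Psi> P\<close> satisfy \<open>s\<^sub>f Pe = s\<^sub>g Pe\<close> if and only if
  \<open>fe = ge\<close>, and, by joins, every section is some \<open>s\<^sub>f\<close>. So the unit is invertible, which for a full
  and faithful \<open>\<Phi>\<close> yields the adjoint equivalence.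

  For a groupoid with inversion \<open>\<iota>\<close>, a section \<open>s\<close> restricts on a cover to sections for which \<open>\<tau>s\<close>
  has a partial inverse \<open>w\<close> in \<open>C\<close>, and then \<open>\<iota>sw\<close> is a partial inverse of \<open>s\<close> in \<open>\<Phi>\<close>. Conversely, if all
  maps of the category are etale, then \<open>\<iota>\<close> is glued from the maps \<open>s\<^bsub>f*\<^esub> Pf\<close>, where \<open>f\<close> runs
  through the partial isomorphisms.
\<close>

section \<open>Restriction categories and joins\<close>

text \<open>\<open>C\<close> comes without pullbacks, yet the laws of an internal category live on
  pullbacks, and these are tested against partial maps as well. They are therefore glued too: over
  the source of a total map \<open>f\<close>, the pullback of a local homeomorphism is the glueing
  of the atlas recording where the composites of \<open>f\<close> with two partial sections agree.
  Local smallness of \<open>C\<close> keeps this atlas small. The recurring obstacle is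
  well-definedness of maps prescribed on sections. Pulled back sections may agree on an idempotent
  that is not the preimage of one on the base. Slices settle this: agreement along \<open>f\<close>
  is witnessed locally by idempotents of the base on which the original sections agree.
  Hyperconnectedness is what allows a return from \<open>C\<close> to the category over it.
  Idempotents of \<open>P i\<close> are exactly the images of those of \<open>i\<close>, so
  equations between restricted sections can be read as equations between restricted maps, and a
  section can be cut into pieces each of which comes from a map.\<close>

lemma in_hom [simp]: "f \<in> hom C X Y \<longleftrightarrow> f \<in> arrs C \<and> src f = X \<and> trg f = Y"
  by (auto simp: hom_def)

lemma in_rids: "e \<in> rids C X \<longleftrightarrow> e \<in> arrs C \<and> src e = X \<and> trg e = X \<and> rst C e = e"
  by (auto simp: rids_def)

context category
begin

lemma cmp_types [simp]:
  assumes "f \<in> arrs C" "g \<in> arrs C" "trg f = src g"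
  shows "g \<cdot> f \<in> arrs C" "src (g \<cdot> f) = src f" "trg (g \<cdot> f) = trg g"
  using cmp_hom[of f "src f" "trg f" g "trg g"] assms by auto

lemma cmp_assoc' [simp]:
  assumes "f \<in> arrs C" "g \<in> arrs C" "h \<in> arrs C" "trg f = src g" "trg g = src h"
  shows "h \<cdot> g \<cdot> f = h \<cdot> (g \<cdot> f)"
  using cmp_assoc[of f "src f" "trg f" g "trg g" h "trg h"] assms by auto

lemma idn_types [simp]:
  assumes "X \<in> obj C"
  shows "idn C X \<in> arrs C" "src (idn C X) = X" "trg (idn C X) = X"
  using idn_hom[OF assms] by auto

lemma idn_left' [simp]: "\<lbrakk>f \<in> arrs C; trg f = Y\<rbrakk> \<Longrightarrow> idn C Y \<cdot> f = f"
  and idn_right' [simp]: "\<lbrakk>f \<in> arrs C; src f = X\<rbrakk> \<Longrightarrow> f \<cdot> idn C X = f"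
  using idn_left[of f "src f"] idn_right[of f _ "trg f"] by auto

lemma arr_obj [simp]: "f \<in> arrs C \<Longrightarrow> src f \<in> obj C" "f \<in> arrs C \<Longrightarrow> trg f \<in> obj C"
  using src_obj trg_obj by auto

text \<open>Simplification nests composites to the right, so an equation for
  \<open>g \<cdot> f\<close> no longer matches inside \<open>g \<cdot> (f \<cdot> x)\<close>. This
  prefixed form makes such equations usable in the middle of a composite.\<close>

lemma reassoc:
  assumes "g \<cdot> f = k" "f \<in> arrs C" "g \<in> arrs C" "trg f = src g" "x \<in> arrs C" "trg x = src f"
  shows "g \<cdot> (f \<cdot> x) = k \<cdot> x"
  using assms by (metis cmp_assoc')

end

section \<open>Calculus of restriction idempotents and of the order on maps\<close>

context restriction_category
begin

lemma rst_types [simp]: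
  assumes "f \<in> arrs C"
  shows "rst C f \<in> arrs C" "src (rst C f) = src f" "trg (rst C f) = src f"
  using rst_hom[of f "src f" "trg f"] assms by auto

lemma cmp_rst_self [simp]: "f \<in> arrs C \<Longrightarrow> f \<cdot> rst C f = f"
  by (rule cmp_rst)

lemma idn_rst [simp]: "X \<in> obj C \<Longrightarrow> rst C (idn C X) = idn C X"
  using cmp_rst[of "idn C X"] idn_left'[of "rst C (idn C X)" X] by simp

lemma rst_rst [simp]: "f \<in> arrs C \<Longrightarrow> rst C (rst C f) = rst C f"
  using rst_cmp_rst[of f "idn C (src f)"] by simp

lemma rst_idem [simp]: "f \<in> arrs C \<Longrightarrow> rst C f \<cdot> rst C f = rst C f"
  using cmp_rst[of "rst C f"] by simp

lemma cmp_rst_self' [simp]: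
  "\<lbrakk>f \<in> arrs C; x \<in> arrs C; trg x = src f\<rbrakk> \<Longrightarrow> f \<cdot> (rst C f \<cdot> x) = f \<cdot> x"
  "\<lbrakk>f \<in> arrs C; x \<in> arrs C; trg x = src f\<rbrakk> \<Longrightarrow> rst C f \<cdot> (rst C f \<cdot> x) = rst C f \<cdot> x"
  using reassoc[OF cmp_rst_self, of f x] reassoc[OF rst_idem, of f x] by auto

lemma rst_in_rids [simp]: "\<lbrakk>f \<in> arrs C; src f = X\<rbrakk> \<Longrightarrow> rst C f \<in> rids C X"
  by (auto simp: in_rids)

lemma idn_in_rids [simp]: "X \<in> obj C \<Longrightarrow> idn C X \<in> rids C X"
  by (auto simp: in_rids)

lemma ridsD:
  assumes "e \<in> rids C X"
  shows "e \<in> arrs C" "src e = X" "trg e = X" "rst C e = e" "e \<cdot> e = e" "X \<in> obj C"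
proof -
  show 1: "e \<in> arrs C" "src e = X" "trg e = X" "rst C e = e"
    using assms by (auto simp: in_rids)
  show "e \<cdot> e = e" using rst_idem[OF 1(1)] 1 by simp
  show "X \<in> obj C" using arr_obj[OF 1(1)] 1 by simp
qed

lemma rids_comm: "\<lbrakk>e \<in> rids C X; d \<in> rids C X\<rbrakk> \<Longrightarrow> e \<cdot> d = d \<cdot> e"
  using rst_commute[of e d] by (auto simp: in_rids)

lemma rst_cmp_rid: "\<lbrakk>f \<in> arrs C; e \<in> rids C (src f)\<rbrakk> \<Longrightarrow> rst C (f \<cdot> e) = rst C f \<cdot> e"
  using rst_cmp_rst[of e f] by (auto simp: in_rids)

lemma rids_cmp [simp]: "\<lbrakk>e \<in> rids C X; d \<in> rids C X\<rbrakk> \<Longrightarrow> e \<cdot> d \<in> rids C X"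
  using rst_cmp_rid[of e d] by (auto simp: in_rids)

lemma rst_slide: "\<lbrakk>f \<in> arrs C; g \<in> arrs C; trg f = src g\<rbrakk> \<Longrightarrow> rst C g \<cdot> f = f \<cdot> rst C (g \<cdot> f)"
  using rst_cmp[of f "src f" "trg f" g "trg g"] by auto

lemma rid_slide: "\<lbrakk>e \<in> rids C Y; f \<in> arrs C; trg f = Y\<rbrakk> \<Longrightarrow> e \<cdot> f = f \<cdot> rst C (e \<cdot> f)"
  using rst_slide[of f e] by (auto simp: in_rids)

lemma rst_cmp_le:
  assumes "f \<in> arrs C" "g \<in> arrs C" "trg f = src g"
  shows "rst C (g \<cdot> f) \<cdot> rst C f = rst C (g \<cdot> f)" "rst C f \<cdot> rst C (g \<cdot> f) = rst C (g \<cdot> f)"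
proof -
  show 1: "rst C (g \<cdot> f) \<cdot> rst C f = rst C (g \<cdot> f)"
    using rst_cmp_rst[of f "g \<cdot> f"] assms by simp
  show "rst C f \<cdot> rst C (g \<cdot> f) = rst C (g \<cdot> f)"
    using rst_commute[of "g \<cdot> f" f] 1 assms by simp
qed

text \<open>Sliding turns the inner composite into \<open>f\<close> cut down to the domain of
  \<open>g \<cdot> f\<close>, and that domain already lies inside the domain of \<open>f\<close>. So
  \<open>g\<close> enters the domain of a composite only through its own domain.\<close>

lemma rst_rst_cmp [simp]:
  assumes "f \<in> arrs C" "g \<in> arrs C" "trg f = src g"
  shows "rst C (rst C g \<cdot> f) = rst C (g \<cdot> f)"
  using rst_cmp_rid[of f "rst C (g \<cdot> f)"] rst_cmp_le(2)[OF assms] assms by (simp add: rst_slide[OF assms])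

lemma total_cmp_rst:
  assumes "f \<in> arrs C" "total C g" "trg f = src g"
  shows "rst C (g \<cdot> f) = rst C f"
  using rst_rst_cmp[of f g] assms by (auto simp: total_def simp del: rst_rst_cmp)

lemma total_arr: "total C g \<Longrightarrow> g \<in> arrs C" "total C g \<Longrightarrow> rst C g = idn C (src g)"
  by (auto simp: total_def)

lemma total_cmp: "\<lbrakk>total C f; total C g; trg f = src g\<rbrakk> \<Longrightarrow> total C (g \<cdot> f)"
  using total_cmp_rst[of f g] by (auto simp: total_def)

lemma total_idn [simp]: "X \<in> obj C \<Longrightarrow> total C (idn C X)"
  by (auto simp: total_def)

text \<open>Taking preimages of idempotents along \<open>f\<close> preserves meets:
  \<open>d \<cdot> f\<close> is \<open>f\<close> precomposed with the preimage of \<open>d\<close>,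
  so restricting further to \<open>e\<close> just multiplies the two preimages.\<close>

lemma rst_mult_cmp:
  assumes "e \<in> rids C Y" "d \<in> rids C Y" "f \<in> arrs C" "trg f = Y"
  shows "rst C (e \<cdot> d \<cdot> f) = rst C (e \<cdot> f) \<cdot> rst C (d \<cdot> f)"
proof -
  note e = ridsD[OF assms(1)] and d = ridsD[OF assms(2)]
  have "e \<cdot> d \<cdot> f = e \<cdot> f \<cdot> rst C (d \<cdot> f)"
    using rid_slide[OF assms(2-4)] e d assms by simp
  then show ?thesis
    using rst_cmp_rst[of "d \<cdot> f" "e \<cdot> f"] e d assms by simp
qed

lemma cmp_rid_rst: "\<lbrakk>f \<in> arrs C; e \<in> rids C (src f)\<rbrakk> \<Longrightarrow> f \<cdot> e = f \<cdot> rst C (f \<cdot> e)"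
  using rst_cmp_rid[of f e] reassoc[OF cmp_rst_self[of f], of e] ridsD[of e "src f"] by auto

lemma rle_iff: "rle C f g \<longleftrightarrow> f \<in> arrs C \<and> g \<in> arrs C \<and> src f = src g \<and> trg f = trg g \<and> g \<cdot> rst C f = f"
  by (auto simp: rle_def parallel_def)

lemma rle_rst: "rle C f g \<Longrightarrow> rst C g \<cdot> rst C f = rst C f"
  using rst_cmp_rid[of g "rst C f"] by (auto simp: rle_iff)

lemma rle_rst_mono: "rle C f g \<Longrightarrow> rle C (rst C f) (rst C g)"
  using rle_rst by (auto simp: rle_iff)

lemma rle_antisym:
  assumes "rle C f g" "rle C g f"
  shows "f = g"
proof -
  have 1: "f \<in> arrs C" "g \<in> arrs C" "src f = src g" "g \<cdot> rst C f = f" "f \<cdot> rst C g = g"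
    using assms by (auto simp: rle_iff)
  have "rst C f = rst C g"
    using rle_rst[OF assms(1)] rle_rst[OF assms(2)] rst_commute[OF 1(1-3)] by metis
  then show ?thesis using 1(4) cmp_rst_self[OF 1(2)] by metis
qed

lemma rle_trans:
  assumes "rle C f g" "rle C g h"
  shows "rle C f h"
proof -
  have 1: "f \<in> arrs C" "g \<in> arrs C" "h \<in> arrs C" "src f = src h" "src g = src h" "trg f = trg h"
    "trg g = trg h" "g \<cdot> rst C f = f" "h \<cdot> rst C g = g"
    using assms by (auto simp: rle_iff)
  then have "h \<cdot> (rst C g \<cdot> rst C f) = f" using reassoc[OF 1(9), of "rst C f"] by simp
  then show ?thesis using rle_rst[OF assms(1)] 1 by (auto simp: rle_iff)
qed

lemma rle_restrict: "\<lbrakk>f \<in> arrs C; e \<in> rids C (src f)\<rbrakk> \<Longrightarrow> rle C (f \<cdot> e) f"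
  using cmp_rid_rst[of f e] ridsD[of e "src f"] by (auto simp: rle_iff)

lemma rle_rids:
  assumes "e \<in> rids C X" "d \<in> rids C X"
  shows "rle C e d \<longleftrightarrow> d \<cdot> e = e" "rle C e d \<longleftrightarrow> e \<cdot> d = e"
  using ridsD[OF assms(1)] ridsD[OF assms(2)] rids_comm[OF assms] by (auto simp: rle_iff)

lemma rle_idn: "\<lbrakk>rle C f (idn C X); X \<in> obj C\<rbrakk> \<Longrightarrow> f \<in> rids C X"
  using idn_left'[of "rst C f" X] by (auto simp: rle_iff in_rids)

lemma rle_cmp_left:
  assumes "rle C f f'" "g \<in> arrs C" "trg f = src g"
  shows "rle C (g \<cdot> f) (g \<cdot> f')"
proof -
  have 1: "f \<in> arrs C" "f' \<in> arrs C" "src f = src f'" "trg f = trg f'" "f' \<cdot> rst C f = f"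
    using assms by (auto simp: rle_iff)
  have "g \<cdot> f' \<cdot> rst C f = g \<cdot> f" using 1 assms by simp
  then show ?thesis using rle_restrict[of "g \<cdot> f'" "rst C f"] 1 assms by auto
qed

lemma compatible_iff: "compatible C f g \<longleftrightarrow>
    f \<in> arrs C \<and> g \<in> arrs C \<and> src f = src g \<and> trg f = trg g \<and> f \<cdot> rst C g = g \<cdot> rst C f"
  by (auto simp: compatible_def parallel_def)

text \<open>Below a common bound \<open>h\<close>, both sides are \<open>h\<close> cut down to the
  intersection of the two domains. This supplies compatibility whenever a family is known to have an
  upper bound.\<close>

lemma bounded_compatible:
  assumes "rle C f h" "rle C g h"
  shows "compatible C f g"
proof -
  have 1: "f \<in> arrs C" "g \<in> arrs C" "h \<in> arrs C" "src f = src h" "src g = src h" "trg f = trg h"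
    "trg g = trg h" "h \<cdot> rst C f = f" "h \<cdot> rst C g = g"
    using assms by (auto simp: rle_iff)
  have "f \<cdot> rst C g = h \<cdot> (rst C f \<cdot> rst C g)" using 1 reassoc[OF 1(8), of "rst C g"] by simp
  also have "\<dots> = h \<cdot> (rst C g \<cdot> rst C f)" using rst_commute[of f g] 1 by simp
  also have "\<dots> = g \<cdot> rst C f" using 1 reassoc[OF 1(9), of "rst C f"] by simp
  finally show ?thesis using 1 by (auto simp: compatible_iff)
qed

lemma is_join_unique: "\<lbrakk>is_join C X Y S j; is_join C X Y S k\<rbrakk> \<Longrightarrow> j = k"
  unfolding is_join_def by (meson rle_antisym)

lemma join_eq: "is_join C X Y S j \<Longrightarrow> join C X Y S = j"
  unfolding join_def using is_join_unique by blast

lemma is_joinD: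
  assumes "is_join C X Y S j"
  shows "j \<in> arrs C" "src j = X" "trg j = Y" "f \<in> S \<Longrightarrow> f \<in> arrs C" "f \<in> S \<Longrightarrow> src f = X"
    "f \<in> S \<Longrightarrow> trg f = Y" "f \<in> S \<Longrightarrow> rle C f j" "f \<in> S \<Longrightarrow> j \<cdot> rst C f = f"
  using assms unfolding is_join_def subset_iff by (auto simp: rle_iff)

lemma is_join_sub: "is_join C X Y S j \<Longrightarrow> S \<subseteq> hom C X Y"
  unfolding is_join_def by blast

lemma is_join_least: "\<lbrakk>is_join C X Y S j; h \<in> hom C X Y; \<And>f. f \<in> S \<Longrightarrow> rle C f h\<rbrakk> \<Longrightarrow> rle C j h"
  unfolding is_join_def by blast

end

section \<open>Joins, covers by idempotents, and locality\<close>

context join_restriction_category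
begin

text \<open>Let \<open>e\<close> be the join of the domains. Then \<open>j \<cdot> e\<close> still
  bounds \<open>S\<close>, so it equals \<open>j\<close> by leastness, and hence the domain of
  \<open>j\<close> lies below \<open>e\<close>. This transfers questions about joins of maps to
  covers by idempotents.\<close>

lemma is_join_rst:
  assumes "is_join C X Y S j"
  shows "is_join C X X (rst C ` S) (rst C j)"
proof -
  note j = is_joinD[OF assms]
  have X: "X \<in> obj C" using arr_obj(1)[OF j(1)] j(2) by simp
  have ub: "rle C f (rst C j)" if "f \<in> rst C ` S" for f
    using that j(7) rle_rst_mono by auto
  obtain e where e: "is_join C X X (rst C ` S) e"
  proof -
    have "rst C ` S \<subseteq> hom C X X" using j by auto
    then show ?thesis using join_exists[OF X X] ub bounded_compatible that by meson
  qed
  note e' = is_joinD[OF e]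
  have le: "rle C e (rst C j)" using is_join_least[OF e] ub j by simp
  have "rle C (rst C j) (idn C X)" using j X by (simp add: rle_iff)
  then have eX: "e \<in> rids C X" by (rule rle_idn[OF rle_trans[OF le] X])
  have "rle C f (j \<cdot> e)" if "f \<in> S" for f
  proof -
    have "e \<cdot> rst C f = rst C f" using e'(8)[of "rst C f"] that j by simp
    then show ?thesis using that j e' by (simp add: rle_iff)
  qed
  then have "rle C j (j \<cdot> e)" using is_join_least[OF assms] j e' by simp
  then have "j \<cdot> e = j" using rle_antisym[OF rle_restrict[of j e]] eX j(1,2) by simp
  then have "rst C j = rst C j \<cdot> e" using rst_cmp_rid[of j e] eX j by simp
  also have "\<dots> = e" using le rle_rids(1)[OF eX, of "rst C j"] j by simp
  finally show ?thesis using e by simp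
qed

text \<open>The actual join lies below the bound \<open>j\<close> and has the same domain by
  \<open>is_join_rst\<close>; comparable maps with equal domains coincide. Being a join is thus a
  matter of covering the domain.\<close>

lemma is_joinI:
  assumes S: "S \<subseteq> hom C X Y" and j: "j \<in> hom C X Y" and ub: "\<And>f. f \<in> S \<Longrightarrow> rle C f j"
    and r: "is_join C X X (rst C ` S) (rst C j)"
  shows "is_join C X Y S j"
proof -
  obtain k where k: "is_join C X Y S k"
  proof -
    have "X \<in> obj C" "Y \<in> obj C" using j by auto
    then show ?thesis using join_exists[OF _ _ S] ub bounded_compatible that by meson
  qed
  have "rst C k = rst C j"
    using is_join_unique[OF is_join_rst[OF k] r] .
  moreover have "rle C k j" using is_join_least[OF k] j ub by simp
  ultimately have "k = j" using j unfolding rle_iff by (metis cmp_rst_self in_hom)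
  then show ?thesis using k by simp
qed

lemma is_join_precomp:
  assumes "is_join C X Y S j" "k \<in> arrs C" "trg k = X"
  shows "is_join C (src k) Y ((\<lambda>f. f \<cdot> k) ` S) (j \<cdot> k)"
proof -
  note j = is_joinD[OF assms(1)]
  have "compatible C f g" if "f \<in> S" "g \<in> S" for f g
    using bounded_compatible j(7) that by blast
  then show ?thesis
    using join_precomp[OF is_join_sub[OF assms(1)] _ assms(1), of k "src k"] assms(2,3) by simp
qed

text \<open>The axioms speak of precomposition only. The domain of \<open>k \<cdot> f\<close> is
  that of \<open>f\<close> met with that of \<open>k \<cdot> j\<close>, so precomposing the cover by
  domains with the latter gives the cover that \<open>is_joinI\<close> asks for.\<close>

lemma is_join_postcomp:
  assumes "is_join C X Y S j" "k \<in> arrs C" "src k = Y"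
  shows "is_join C X (trg k) ((\<lambda>f. k \<cdot> f) ` S) (k \<cdot> j)"
proof (rule is_joinI)
  note j = is_joinD[OF assms(1)]
  show "(\<lambda>f. k \<cdot> f) ` S \<subseteq> hom C X (trg k)" "k \<cdot> j \<in> hom C X (trg k)"
    using j(1-3) is_join_sub[OF assms(1)] assms(2,3) by auto
  show "rle C f (k \<cdot> j)" if "f \<in> (\<lambda>f. k \<cdot> f) ` S" for f
    using that j(6,7) rle_cmp_left assms(2,3) by blast
  have "rst C f \<cdot> rst C (k \<cdot> j) = rst C (k \<cdot> f)" if f: "f \<in> S" for f
  proof -
    have "k \<cdot> f = k \<cdot> j \<cdot> rst C f" using j(8)[OF f] j f assms by simp
    then have "rst C (k \<cdot> f) = rst C (k \<cdot> j) \<cdot> rst C f"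
      using rst_cmp_rst[of f "k \<cdot> j"] j f assms by simp
    then show ?thesis using rst_commute[of f "k \<cdot> j"] j f assms by simp
  qed
  then have "(\<lambda>f. f \<cdot> rst C (k \<cdot> j)) ` rst C ` S = rst C ` (\<lambda>f. k \<cdot> f) ` S"
    by (auto simp: image_image)
  moreover have "rst C j \<cdot> rst C (k \<cdot> j) = rst C (k \<cdot> j)"
    using rst_cmp_le(2)[of j k] j assms by simp
  ultimately show "is_join C X X (rst C ` (\<lambda>f. k \<cdot> f) ` S) (rst C (k \<cdot> j))"
    using is_join_precomp[OF is_join_rst[OF assms(1)], of "rst C (k \<cdot> j)"] j assms by simp
qed

text \<open>Locality: by \<open>is_join_postcomp\<close> both sides are the join of one and the same
  set. All later tests on the pieces of a cover rest on this.\<close>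

lemma join_ext:
  assumes "is_join C X X E r" "E \<subseteq> rids C X" "g \<in> hom C X Y" "h \<in> hom C X Y"
    "\<And>e. e \<in> E \<Longrightarrow> g \<cdot> e = h \<cdot> e"
  shows "g \<cdot> r = h \<cdot> r"
proof -
  have "(\<lambda>f. g \<cdot> f) ` E = (\<lambda>f. h \<cdot> f) ` E" by (rule image_cong[OF refl assms(5)])
  then show ?thesis
    using is_join_postcomp[OF assms(1), of g] is_join_postcomp[OF assms(1), of h] assms(3,4)
      is_join_unique by auto
qed

lemma join_ext_idn:
  assumes "is_join C X X E (idn C X)" "E \<subseteq> rids C X" "g \<in> hom C X Y" "h \<in> hom C X Y"
    "\<And>e. e \<in> E \<Longrightarrow> g \<cdot> e = h \<cdot> e"
  shows "g = h"
  using join_ext[OF assms] assms(3,4) by simp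

lemma cover_pull:
  assumes "is_join C X X E r" "f \<in> arrs C" "trg f = X"
  shows "is_join C (src f) (src f) ((\<lambda>e. rst C (e \<cdot> f)) ` E) (rst C (r \<cdot> f))"
  using is_join_rst[OF is_join_precomp[OF assms]] by (simp add: image_image)

lemma cover_pull_idn:
  assumes "is_join C X X E (idn C X)" "f \<in> arrs C" "trg f = X"
  shows "is_join C (src f) (src f) ((\<lambda>e. rst C (e \<cdot> f)) ` E) (rst C f)"
  using cover_pull[OF assms] assms by simp

text \<open>A cover is usually exhibited by a convenient subfamily, whereas
  \<open>section_cover\<close> takes all slices at once; this closes the gap.\<close>

lemma is_join_mono:
  assumes "is_join C X Y E r" "E \<subseteq> E'" "\<And>e. e \<in> E' \<Longrightarrow> rle C e r"
  shows "is_join C X Y E' r"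
proof -
  note r = is_joinD[OF assms(1)]
  have "E' \<subseteq> hom C X Y" using assms(3) r(1-3) unfolding rle_iff by auto
  moreover have "rle C r h" if "h \<in> hom C X Y" "\<forall>f \<in> E'. rle C f h" for h
    using is_join_least[OF assms(1) that(1)] that(2) assms(2) by auto
  ultimately show ?thesis
    using r(1-3) assms(3) unfolding is_join_def by simp
qed

lemma rids_le_idn: "e \<in> rids C X \<Longrightarrow> rle C e (idn C X)"
  using ridsD[of e X] by (auto simp: rle_iff)

end

section \<open>Sections of local homeomorphisms\<close>

text \<open>The idempotents \<open>e\<close> in the cover are the slices: on \<open>e\<close>, the section \<open>\<theta> i\<close> is inverse to \<open>q\<close>.\<close>

definition section_cover :: "('o, 'u, 'z) rcat_scheme \<Rightarrow> ('o, 'u) arr \<Rightarrow> 'k set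
    \<Rightarrow> ('k \<Rightarrow> ('o, 'u) arr) \<Rightarrow> bool" where
  "section_cover C q I \<theta> \<longleftrightarrow> total C q \<and> (\<forall>i \<in> I. \<theta> i \<in> psections C q) \<and>
    is_join C (src q) (src q) {e \<in> rids C (src q). \<exists>i \<in> I. \<theta> i \<cdot>\<^bsub>C\<^esub> (q \<cdot>\<^bsub>C\<^esub> e) = e} (idn C (src q))"

section \<open>Slices of sections and partial inverses\<close>

context restriction_category
begin

lemma psectionsD:
  assumes "s \<in> psections C p"
  shows "s \<in> arrs C" "src s = trg p" "trg s = src p" "p \<cdot> s = rst C s"
  using assms by (auto simp: psections_def)

lemma psections_restrict:
  assumes "s \<in> psections C p" "p \<in> arrs C" "e \<in> rids C (trg p)"
  shows "s \<cdot> e \<in> psections C p"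
proof -
  note s = psectionsD[OF assms(1)] and e = ridsD[OF assms(3)]
  have "p \<cdot> (s \<cdot> e) = rst C s \<cdot> e" using reassoc[OF s(4)] s e assms(2) by simp
  also have "\<dots> = rst C (s \<cdot> e)" using rst_cmp_rid[of s e] s assms(3) by simp
  finally show ?thesis using s e by (simp add: psections_def)
qed

lemma section_coverD:
  assumes "section_cover C q I \<theta>"
  shows "q \<in> arrs C" "total C q" "rst C q = idn C (src q)" "i \<in> I \<Longrightarrow> \<theta> i \<in> psections C q"
    "is_join C (src q) (src q) {e \<in> rids C (src q). \<exists>i \<in> I. \<theta> i \<cdot> (q \<cdot> e) = e} (idn C (src q))"
  using assms by (auto simp: section_cover_def total_def)

text \<open>On the slice \<open>e\<close> the section \<open>s\<close> undoes \<open>q\<close>, so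
  \<open>e \<cdot> t\<close> is \<open>s\<close> after \<open>q \<cdot> (e \<cdot> t)\<close>; and
  \<open>q\<close> applied to a restriction of the section \<open>t\<close> is merely its domain.
  Hence two sections agree on the part of the base that \<open>t\<close> sends into a slice of
  \<open>s\<close>.\<close>

lemma slice_section:
  assumes s: "s \<in> psections C q" and t: "t \<in> psections C q" and q: "q \<in> arrs C"
    and e: "e \<in> rids C (src q)" and se: "s \<cdot> (q \<cdot> e) = e"
  shows "e \<cdot> t = s \<cdot> rst C (e \<cdot> t)" "e \<cdot> t = t \<cdot> rst C (e \<cdot> t)"
proof -
  note s' = psectionsD[OF s] and t' = psectionsD[OF t] and e' = ridsD[OF e]
  show 1: "e \<cdot> t = t \<cdot> rst C (e \<cdot> t)" using rid_slide[OF e] t' by simp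
  have "e \<cdot> t = s \<cdot> (q \<cdot> (e \<cdot> t))" using reassoc[OF se, of t] s' t' e' q by simp
  also have "q \<cdot> (e \<cdot> t) = q \<cdot> (t \<cdot> rst C (e \<cdot> t))" using arg_cong[OF 1] .
  also have "\<dots> = rst C t \<cdot> rst C (e \<cdot> t)"
    using reassoc[OF t'(4), of "rst C (e \<cdot> t)"] t' e' q by simp
  also have "\<dots> = rst C (e \<cdot> t)" using rst_cmp_le(2)[of t e] t' e' by simp
  finally show "e \<cdot> t = s \<cdot> rst C (e \<cdot> t)" .
qed

text \<open>For a partial isomorphism \<open>p\<close> below \<open>q\<close>, the partial inverse
  is a section of \<open>q\<close> and the domain of \<open>p\<close> is one of its slices. This is
  how etale maps give rise to section covers.\<close>

lemma partial_inverse_section: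
  assumes "partial_inverse C p t" "rle C p q"
  shows "t \<in> psections C q" "t \<cdot> (q \<cdot> rst C p) = rst C p"
proof -
  have 1: "p \<in> arrs C" "t \<in> arrs C" "src t = trg p" "trg t = src p" "t \<cdot> p = rst C p"
    "p \<cdot> t = rst C t" "q \<in> arrs C" "src q = src p" "trg q = trg p" "q \<cdot> rst C p = p"
    using assms by (auto simp: rle_iff partial_inverse_def)
  show "t \<cdot> (q \<cdot> rst C p) = rst C p" using 1 by simp
  have "rst C p \<cdot> t = t" using 1 reassoc[OF 1(5), of t] by simp
  then have "q \<cdot> t = rst C t" using 1 reassoc[OF 1(10), of t] by simp
  then show "t \<in> psections C q" using 1 by (simp add: psections_def)
qed

text \<open>Each of the two inverses is the other one restricted to its own domain, so each lies
  below the other.\<close>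

lemma partial_inverse_unique:
  assumes "partial_inverse C p s" "partial_inverse C p t"
  shows "s = t"
proof -
  have 1: "p \<in> arrs C" "t \<in> arrs C" "src t = trg p" "trg t = src p" "t \<cdot> p = rst C p"
    "p \<cdot> t = rst C t"
    "s \<in> arrs C" "src s = trg p" "trg s = src p" "s \<cdot> p = rst C p" "p \<cdot> s = rst C s"
    using assms by (auto simp: partial_inverse_def)
  have s: "rst C p \<cdot> s = s" and t: "rst C p \<cdot> t = t"
    using 1 reassoc[OF 1(10), of s] reassoc[OF 1(5), of t] by auto
  have "s = t \<cdot> (p \<cdot> s)" using s reassoc[OF 1(5), of s] 1 by simp
  then have st: "s = t \<cdot> rst C s" using 1 by simp
  have "t = s \<cdot> (p \<cdot> t)" using t reassoc[OF 1(10), of t] 1 by simp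
  then have ts: "t = s \<cdot> rst C t" using 1 by simp
  show ?thesis
    by (rule rle_antisym) (use st ts 1 in \<open>auto simp: rle_iff\<close>)
qed

text \<open>As for ordinary inverses, with reversed order. The idempotent left in the middle slides
  outwards and becomes the domain of the composite.\<close>

lemma partial_inverse_cmp:
  assumes "partial_inverse C f f'" "partial_inverse C g g'" "trg f = src g"
  shows "partial_inverse C (g \<cdot> f) (f' \<cdot> g')"
proof -
  have f: "f \<in> arrs C" "f' \<in> arrs C" "src f' = trg f" "trg f' = src f" "f' \<cdot> f = rst C f"
    "f \<cdot> f' = rst C f'" using assms(1) by (auto simp: partial_inverse_def)
  have g: "g \<in> arrs C" "g' \<in> arrs C" "src g' = trg g" "trg g' = src g" "g' \<cdot> g = rst C g"
    "g \<cdot> g' = rst C g'" using assms(2) by (auto simp: partial_inverse_def)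
  have "f' \<cdot> g' \<cdot> (g \<cdot> f) = f' \<cdot> (rst C g \<cdot> f)"
    using f g assms(3) reassoc[OF g(5), of f] by simp
  also have "rst C g \<cdot> f = f \<cdot> rst C (g \<cdot> f)" using rst_slide f g assms(3) by simp
  also have "f' \<cdot> (f \<cdot> rst C (g \<cdot> f)) = rst C f \<cdot> rst C (g \<cdot> f)"
    using reassoc[OF f(5), of "rst C (g \<cdot> f)"] f g assms(3) by simp
  also have "\<dots> = rst C (g \<cdot> f)" using rst_cmp_le(2) f g assms(3) by simp
  finally have 1: "f' \<cdot> g' \<cdot> (g \<cdot> f) = rst C (g \<cdot> f)" .
  have "g \<cdot> f \<cdot> (f' \<cdot> g') = g \<cdot> (rst C f' \<cdot> g')"
    using f g assms(3) reassoc[OF f(6), of g'] by simp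
  also have "rst C f' \<cdot> g' = g' \<cdot> rst C (f' \<cdot> g')" using rst_slide f g assms(3) by simp
  also have "g \<cdot> (g' \<cdot> rst C (f' \<cdot> g')) = rst C g' \<cdot> rst C (f' \<cdot> g')"
    using reassoc[OF g(6), of "rst C (f' \<cdot> g')"] f g assms(3) by simp
  also have "\<dots> = rst C (f' \<cdot> g')" using rst_cmp_le(2) f g assms(3) by simp
  finally have 2: "g \<cdot> f \<cdot> (f' \<cdot> g') = rst C (f' \<cdot> g')" .
  show ?thesis using 1 2 f g assms(3) by (simp add: partial_inverse_def)
qed

lemma partial_inverse_rid: "e \<in> rids C X \<Longrightarrow> partial_inverse C e e"
  using ridsD[of e X] by (simp add: partial_inverse_def)

lemma partial_inverse_sym: "partial_inverse C f g \<Longrightarrow> partial_inverse C g f"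
  by (auto simp: partial_inverse_def)

end

section \<open>Comparing and constructing maps section by section\<close>

context join_restriction_category
begin

text \<open>The domains of the partial isomorphisms with join \<open>q\<close> are slices, and by
  \<open>is_join_rst\<close> they cover the domain of \<open>q\<close>, which is everything since
  \<open>q\<close> is total. The index set may contain further sections.\<close>

lemma partial_isos_section_cover:
  assumes q: "total C q" and J: "is_join C (src q) (trg q) S q"
    and S: "\<And>p. p \<in> S \<Longrightarrow> \<exists>i \<in> I. partial_inverse C p (\<theta> i)"
    and \<theta>: "\<And>i. i \<in> I \<Longrightarrow> \<theta> i \<in> psections C q"
  shows "section_cover C q I \<theta>"
proof -
  have q': "q \<in> arrs C" "rst C q = idn C (src q)" using q by (auto simp: total_def)
  have "is_join C (src q) (src q) {e \<in> rids C (src q). \<exists>i \<in> I. \<theta> i \<cdot> (q \<cdot> e) = e} (rst C q)"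
  proof (rule is_join_mono[OF is_join_rst[OF J]])
    show "rst C ` S \<subseteq> {e \<in> rids C (src q). \<exists>i \<in> I. \<theta> i \<cdot> (q \<cdot> e) = e}"
    proof (rule image_subsetI)
      fix p assume p: "p \<in> S"
      note p' = is_joinD(4-8)[OF J p]
      obtain i where i: "i \<in> I" "partial_inverse C p (\<theta> i)" using S[OF p] by blast
      show "rst C p \<in> {e \<in> rids C (src q). \<exists>i \<in> I. \<theta> i \<cdot> (q \<cdot> e) = e}"
        using p' i partial_inverse_section(2)[OF i(2) p'(4)] by auto
    qed
    show "rle C e (rst C q)" if "e \<in> {e \<in> rids C (src q). \<exists>i \<in> I. \<theta> i \<cdot> (q \<cdot> e) = e}" for e
      using that rids_le_idn[of e "src q"] q' by simp
  qed
  then show ?thesis using q q' \<theta> by (simp add: section_cover_def)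
qed

lemma local_homeo_section_cover:
  assumes "local_homeo C q"
  shows "section_cover C q (psections C q) (\<lambda>s. s)"
proof -
  have q: "total C q" using assms by (simp add: local_homeo_def)
  obtain S where S: "\<And>s. s \<in> S \<Longrightarrow> partial_iso C s" and J: "is_join C (src q) (trg q) S q"
    using assms by (auto simp: local_homeo_def etale_map_def)
  show ?thesis
  proof (rule partial_isos_section_cover[OF q J])
    show "\<exists>i \<in> psections C q. partial_inverse C p i" if p: "p \<in> S" for p
      using S[OF p] partial_inverse_section(1)[OF _ is_joinD(7)[OF J p]]
      unfolding partial_iso_def by blast
  qed
qed

text \<open>On a slice \<open>e\<close> of \<open>\<theta> i\<close> the map \<open>g\<close> equals
  \<open>g \<cdot> \<theta> i\<close> after \<open>q \<cdot> e\<close>, so the values on sections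
  determine it on a cover.\<close>

lemma section_cover_ext:
  assumes "section_cover C q I \<theta>" "g \<in> hom C (src q) B" "h \<in> hom C (src q) B"
    "\<And>i. i \<in> I \<Longrightarrow> g \<cdot> \<theta> i = h \<cdot> \<theta> i"
  shows "g = h"
proof (rule join_ext_idn[OF section_coverD(5)[OF assms(1)] _ assms(2,3)])
  note q = section_coverD[OF assms(1)]
  fix e assume "e \<in> {e \<in> rids C (src q). \<exists>i \<in> I. \<theta> i \<cdot> (q \<cdot> e) = e}"
  then obtain i where e: "e \<in> rids C (src q)" "\<theta> i \<cdot> (q \<cdot> e) = e" and i: "i \<in> I" by blast
  note e' = ridsD[OF e(1)] and s = psectionsD[OF q(4)[OF i]]
  have "g \<cdot> e = (g \<cdot> \<theta> i) \<cdot> (q \<cdot> e)" using e s e' q(1) assms(2) by simp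
  also have "\<dots> = (h \<cdot> \<theta> i) \<cdot> (q \<cdot> e)" using assms(4)[OF i] by simp
  also have "\<dots> = h \<cdot> e" using e s e' q(1) assms(3) by simp
  finally show "g \<cdot> e = h \<cdot> e" .
qed auto

text \<open>The equation stating totality is itself tested on sections; sliding reduces it there to
  the domains of the composites.\<close>

lemma section_cover_total:
  assumes "section_cover C q I \<theta>" "k \<in> arrs C" "src k = src q"
    "\<And>i. i \<in> I \<Longrightarrow> rst C (k \<cdot> \<theta> i) = rst C (\<theta> i)"
  shows "total C k"
proof -
  note q = section_coverD[OF assms(1)]
  have "rst C k = idn C (src q)"
  proof (rule section_cover_ext[OF assms(1)])
    fix i assume i: "i \<in> I"
    note s = psectionsD[OF q(4)[OF i]]
    have "rst C k \<cdot> \<theta> i = \<theta> i \<cdot> rst C (k \<cdot> \<theta> i)" using rst_slide s assms(2,3) by simp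
    then show "rst C k \<cdot> \<theta> i = idn C (src q) \<cdot> \<theta> i" using assms(4)[OF i] s by simp
  qed (use assms(2,3) q(1) in auto)
  then show ?thesis using assms(2,3) by (simp add: total_def)
qed

lemma section_cover_slices:
  assumes "section_cover C q I \<theta>" "u \<in> arrs C" "trg u = src q"
  shows "is_join C (src u) (src u)
    ((\<lambda>e. rst C (e \<cdot> u)) ` {e \<in> rids C (src q). \<exists>i \<in> I. \<theta> i \<cdot> (q \<cdot> e) = e}) (rst C u)"
  using cover_pull_idn[OF section_coverD(5)[OF assms(1)]] assms(2,3) by simp

text \<open>The preimages of the slices along \<open>u\<close> cover the domain of \<open>u\<close>.
  An equation is thus tested on parts where \<open>u\<close> lands in a single slice and so factors
  through one section.\<close>

lemma section_cover_pieces: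
  assumes "section_cover C q I \<theta>" "u \<in> arrs C" "trg u = src q" "g \<in> hom C (src u) B"
    "h \<in> hom C (src u) B"
    and *: "\<And>e i. \<lbrakk>e \<in> rids C (src q); i \<in> I; \<theta> i \<cdot> (q \<cdot> e) = e\<rbrakk>
      \<Longrightarrow> g \<cdot> rst C (e \<cdot> u) = h \<cdot> rst C (e \<cdot> u)"
  shows "g \<cdot> rst C u = h \<cdot> rst C u"
proof (rule join_ext[OF section_cover_slices[OF assms(1-3)] _ assms(4,5)])
  note q = section_coverD[OF assms(1)]
  show "(\<lambda>e. rst C (e \<cdot> u)) ` {e \<in> rids C (src q). \<exists>i \<in> I. \<theta> i \<cdot> (q \<cdot> e) = e} \<subseteq> rids C (src u)"
    using assms(2,3) ridsD[of _ "src q"] by (intro image_subsetI) simp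
qed (use * in auto)

text \<open>On a slice \<open>e\<close> of \<open>\<theta> i\<close> the map has to be
  \<open>K i \<cdot> (q \<cdot> e)\<close>, and \<open>k\<close> is the join of these pieces. The
  conditions on \<open>K\<close> say that a value lives on the domain of its section and that
  agreeing sections have agreeing values; any \<open>k\<close> as wanted would force both.\<close>

lemma section_cover_lift:
  assumes sc: "section_cover C q I \<theta>"
    and K: "\<And>i. i \<in> I \<Longrightarrow> K i \<in> hom C (trg q) B" "\<And>i. i \<in> I \<Longrightarrow> K i \<cdot> rst C (\<theta> i) = K i"
    and KK: "\<And>i j d. \<lbrakk>i \<in> I; j \<in> I; d \<in> rids C (trg q); \<theta> i \<cdot> d = \<theta> j \<cdot> d\<rbrakk> \<Longrightarrow> K i \<cdot> d = K j \<cdot> d"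
    and B: "B \<in> obj C"
  shows "\<exists>k \<in> hom C (src q) B. \<forall>i \<in> I. k \<cdot> \<theta> i = K i"
proof -
  note q = section_coverD[OF sc]
  define T where "T = {(e, i). e \<in> rids C (src q) \<and> i \<in> I \<and> \<theta> i \<cdot> (q \<cdot> e) = e}"
  define S where "S = (\<lambda>(e, i). K i \<cdot> (q \<cdot> e)) ` T"
  have SubS: "S \<subseteq> hom C (src q) B"
    using K(1) q(1) by (auto simp: S_def T_def in_rids)
  \<comment> \<open>On the overlap \<open>c\<close> of two slices both sections undo
    \<open>q\<close>. They agree on the idempotent \<open>d\<close> of the base, and
    \<open>q \<cdot> c\<close> lands in \<open>d\<close>, so the two prescribed values coincide on
    \<open>c\<close>.\<close>
  have piece: "K i \<cdot> (q \<cdot> e \<cdot> e') = K j \<cdot> (q \<cdot> e \<cdot> e')" if ei: "(e, i) \<in> T" and ej: "(e', j) \<in> T" for e i e' j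
  proof -
    have i: "i \<in> I" "\<theta> i \<cdot> (q \<cdot> e) = e" "e \<in> rids C (src q)"
      and j: "j \<in> I" "\<theta> j \<cdot> (q \<cdot> e') = e'" "e' \<in> rids C (src q)"
      using ei ej by (auto simp: T_def)
    note s = psectionsD[OF q(4)[OF i(1)]] and t = psectionsD[OF q(4)[OF j(1)]]
    note e = ridsD[OF i(3)] and e' = ridsD[OF j(3)]
    define c where "c = e \<cdot> e'"
    have c: "c \<in> rids C (src q)" using i(3) j(3) by (simp add: c_def)
    note c' = ridsD[OF c]
    have ic: "\<theta> i \<cdot> (q \<cdot> c) = c"
      using reassoc[OF i(2), of e'] e e' s q(1) by (simp add: c_def)
    have "\<theta> j \<cdot> (q \<cdot> (e' \<cdot> e)) = e' \<cdot> e"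
      using reassoc[OF j(2), of e] e e' t q(1) by simp
    then have jc: "\<theta> j \<cdot> (q \<cdot> c) = c" using rids_comm[OF i(3) j(3)] by (simp add: c_def)
    define d where "d = rst C (c \<cdot> \<theta> i)"
    have d: "d \<in> rids C (trg q)" using s c' by (simp add: d_def)
    have 1: "c \<cdot> \<theta> i = \<theta> i \<cdot> d"
      using slice_section(1)[OF q(4)[OF i(1)] q(4)[OF i(1)] q(1) c ic] by (simp add: d_def)
    have 2: "c \<cdot> \<theta> i = \<theta> j \<cdot> d"
      using slice_section(1)[OF q(4)[OF j(1)] q(4)[OF i(1)] q(1) c jc] by (simp add: d_def)
    have eq: "K i \<cdot> d = K j \<cdot> d" using KK[OF i(1) j(1) d] 1 2 by simp
    have "d \<cdot> (q \<cdot> c) = (q \<cdot> c) \<cdot> rst C (c \<cdot> \<theta> i \<cdot> (q \<cdot> c))"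
      using rst_slide[of "q \<cdot> c" "c \<cdot> \<theta> i"] c' s q(1) by (simp add: d_def)
    also have "c \<cdot> \<theta> i \<cdot> (q \<cdot> c) = c" using ic c' s q(1) by simp
    also have "(q \<cdot> c) \<cdot> rst C c = q \<cdot> c" using c' q(1) by simp
    finally have dq: "d \<cdot> (q \<cdot> c) = q \<cdot> c" .
    have Ki: "K i \<in> arrs C" "src (K i) = trg q" "trg (K i) = B"
      and Kj: "K j \<in> arrs C" "src (K j) = trg q" "trg (K j) = B"
      using K(1) i(1) j(1) by auto
    note d' = ridsD[OF d]
    have "K i \<cdot> (q \<cdot> c) = K i \<cdot> d \<cdot> (q \<cdot> c)" using dq Ki d' c' q(1) by simp
    also have "\<dots> = K j \<cdot> (q \<cdot> c)" using dq Kj d' c' q(1) eq by simp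
    finally show ?thesis using q(1) e e' by (simp add: c_def)
  qed
  \<comment> \<open>Each piece has its domain inside its slice, so the overlap equation
    \<open>f \<cdot> e' = g \<cdot> e\<close> already amounts to compatibility.\<close>
  have compat: "compatible C f g" if "f \<in> S" "g \<in> S" for f g
  proof -
    obtain e i where f: "f = K i \<cdot> (q \<cdot> e)" and ei: "(e, i) \<in> T" using \<open>f \<in> S\<close> by (auto simp: S_def)
    obtain e' j where g: "g = K j \<cdot> (q \<cdot> e')" and ej: "(e', j) \<in> T" using \<open>g \<in> S\<close> by (auto simp: S_def)
    have ee: "e \<in> rids C (src q)" "e' \<in> rids C (src q)" and I: "i \<in> I" "j \<in> I"
      using ei ej by (auto simp: T_def)
    note e = ridsD[OF ee(1)] and e' = ridsD[OF ee(2)]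
    have Ki: "K i \<in> arrs C" "src (K i) = trg q" "trg (K i) = B"
      and Kj: "K j \<in> arrs C" "src (K j) = trg q" "trg (K j) = B"
      using K(1) I by auto
    have fe: "f \<cdot> e = f" using f e Ki q(1) by simp
    have ge: "g \<cdot> e' = g" using g e' Kj q(1) by simp
    have fg: "f \<in> arrs C" "g \<in> arrs C" "src f = src q" "src g = src q" "trg f = B" "trg g = B"
      using f g Ki Kj e e' q(1) by auto
    have rf: "rst C f = rst C f \<cdot> e" using rst_cmp_rid[of f e] fg ee fe by simp
    have rg: "rst C g = rst C g \<cdot> e'" using rst_cmp_rid[of g e'] fg ee ge by simp
    have eqq: "f \<cdot> e' = g \<cdot> e"
      using piece[OF ei ej] rids_comm[OF ee] e e' Ki Kj q(1) by (simp add: f g)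
    have "rst C f \<cdot> e' = rst C g \<cdot> e"
      using eqq rst_cmp_rid[of f e'] rst_cmp_rid[of g e] fg ee by simp
    have "f \<cdot> rst C g = f \<cdot> (e' \<cdot> rst C g)" using rg rids_comm[of "rst C g" "src q" e'] fg ee by simp
    also have "\<dots> = (f \<cdot> e') \<cdot> rst C g" using fg e' by simp
    also have "\<dots> = g \<cdot> e \<cdot> rst C g" using eqq by simp
    also have "\<dots> = g \<cdot> e" using rids_comm[of e "src q" "rst C g"] fg ee e by simp
    finally have 1: "f \<cdot> rst C g = g \<cdot> e" .
    have "g \<cdot> rst C f = g \<cdot> (e \<cdot> rst C f)" using rf rids_comm[of "rst C f" "src q" e] fg ee by simp
    also have "\<dots> = f \<cdot> e' \<cdot> rst C f" using eqq fg e e' by simp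
    also have "\<dots> = f \<cdot> e'" using rids_comm[of e' "src q" "rst C f"] fg ee e' by simp
    finally show ?thesis using 1 eqq fg by (simp add: compatible_iff)
  qed
  obtain k where k: "is_join C (src q) B S k"
    using join_exists[OF _ B SubS compat] q(1) by auto
  note k' = is_joinD(1-3)[OF k]
  \<comment> \<open>Precomposed with \<open>e\<close>, every member of \<open>S\<close> falls below
    the piece \<open>f\<close> of that slice by agreement on overlaps, and \<open>f\<close> itself
    is such a member; so the restricted join is \<open>f\<close>.\<close>
  have ke: "k \<cdot> e = K i \<cdot> (q \<cdot> e)" if ei: "(e, i) \<in> T" for e i
  proof -
    have ee: "e \<in> rids C (src q)" and i: "i \<in> I" using ei by (auto simp: T_def)
    note e = ridsD[OF ee]
    have Ki: "K i \<in> arrs C" "src (K i) = trg q" "trg (K i) = B" using K(1) i by auto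
    define f where "f = K i \<cdot> (q \<cdot> e)"
    have f: "f \<in> arrs C" "src f = src q" "trg f = B" "f \<cdot> e = f" using Ki e q(1) by (auto simp: f_def)
    have le: "rle C f (k \<cdot> e)"
    proof -
      have "f \<in> S" using ei by (auto simp: S_def f_def)
      then have "k \<cdot> rst C f = f" using is_joinD(8)[OF k] by simp
      moreover have "rst C f = e \<cdot> rst C f"
        using rst_cmp_rid[of f e] rids_comm[of "rst C f" "src q" e] f ee by simp
      ultimately show ?thesis using k' f e unfolding rle_iff by simp
    qed
    have "is_join C (src q) B ((\<lambda>f. f \<cdot> e) ` S) (k \<cdot> e)"
      using is_join_precomp[OF k, of e] e by simp
    moreover have "rle C g f" if "g \<in> (\<lambda>f. f \<cdot> e) ` S" for g
    proof -
      obtain e' j where ej: "(e', j) \<in> T" and g: "g = K j \<cdot> (q \<cdot> e') \<cdot> e"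
        using \<open>g \<in> _\<close> by (auto simp: S_def)
      have ee': "e' \<in> rids C (src q)" and j: "j \<in> I" using ej by (auto simp: T_def)
      note e' = ridsD[OF ee']
      have Kj: "K j \<in> arrs C" "src (K j) = trg q" "trg (K j) = B" using K(1) j by auto
      have "g = f \<cdot> e'" using piece[OF ei ej] rids_comm[OF ee ee'] Ki Kj e e' q(1) by (simp add: g f_def)
      then show ?thesis using rle_restrict[of f e'] f ee' by simp
    qed
    ultimately have "rle C (k \<cdot> e) f" using is_join_least f by simp
    then show ?thesis using le rle_antisym by (simp add: f_def)
  qed
  have "k \<cdot> \<theta> j = K j" if j: "j \<in> I" for j
  proof -
    note s = psectionsD[OF q(4)[OF j]]
    have Kj: "K j \<in> arrs C" "src (K j) = trg q" "trg (K j) = B" using K(1) j by auto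
    \<comment> \<open>The slices met by \<open>\<theta> j\<close> may belong to other sections
      \<open>\<theta> i\<close>. The two sections agree on \<open>d\<close>, and the agreement
      condition then replaces \<open>K i\<close> by \<open>K j\<close>.\<close>
    have "k \<cdot> \<theta> j \<cdot> rst C (\<theta> j) = K j \<cdot> rst C (\<theta> j)"
    proof (rule section_cover_pieces[OF sc])
      fix e i assume e: "e \<in> rids C (src q)" and i: "i \<in> I" and ei: "\<theta> i \<cdot> (q \<cdot> e) = e"
      note e' = ridsD[OF e] and t = psectionsD[OF q(4)[OF i]]
      have Ki: "K i \<in> arrs C" "src (K i) = trg q" "trg (K i) = B" using K(1) i by auto
      note sl = slice_section[OF q(4)[OF i] q(4)[OF j] q(1) e ei]
      define d where "d = rst C (e \<cdot> \<theta> j)"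
      have d: "d \<in> rids C (trg q)" using s e' by (simp add: d_def)
      note d' = ridsD[OF d]
      have "\<theta> i \<cdot> d = \<theta> j \<cdot> d" using sl by (simp add: d_def)
      then have Kd: "K i \<cdot> d = K j \<cdot> d" using KK[OF i j d] by simp
      have "k \<cdot> \<theta> j \<cdot> d = k \<cdot> (e \<cdot> \<theta> j)" using sl(2) s d' k' by (simp add: d_def)
      also have "\<dots> = K i \<cdot> (q \<cdot> e) \<cdot> \<theta> j"
        using reassoc[OF ke, of e i "\<theta> j"] e e' i ei k' s by (simp add: T_def)
      also have "\<dots> = K i \<cdot> (q \<cdot> (e \<cdot> \<theta> j))" using Ki e' q(1) s by simp
      also have "q \<cdot> (e \<cdot> \<theta> j) = rst C (\<theta> i) \<cdot> d"
        using sl(1) reassoc[OF t(4), of d] t d' q(1) by (simp add: d_def)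
      also have "K i \<cdot> (rst C (\<theta> i) \<cdot> d) = K i \<cdot> d"
        using reassoc[OF K(2)[OF i], of d] Ki t d' by simp
      finally show "k \<cdot> \<theta> j \<cdot> rst C (e \<cdot> \<theta> j) = K j \<cdot> rst C (e \<cdot> \<theta> j)"
        using Kd by (simp add: d_def)
    qed (use s k' Kj in auto)
    then show ?thesis using K(2)[OF j] s k' by simp
  qed
  then show ?thesis using k' by (intro bexI[of _ k]) auto
qed

text \<open>Sections of a local homeomorphism that agree after precomposition with \<open>f\<close> agree on
  idempotents of their common domain through which \<open>f\<close> locally factors.\<close>

lemma section_agreement:
  assumes sc: "section_cover C q I \<theta>" and s: "s \<in> psections C q" and t: "t \<in> psections C q"
    and f: "f \<in> arrs C" "trg f = trg q" and d: "d \<in> rids C (src f)"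
    and st: "s \<cdot> (f \<cdot> d) = t \<cdot> (f \<cdot> d)"
    and g: "g \<in> hom C (src f) B" "g \<cdot> rst C (s \<cdot> f) = g"
    and h: "h \<in> hom C (src f) B" "h \<cdot> rst C (t \<cdot> f) = h"
    and gh: "\<And>c. \<lbrakk>c \<in> rids C (trg q); s \<cdot> c = t \<cdot> c\<rbrakk> \<Longrightarrow> g \<cdot> rst C (c \<cdot> f) = h \<cdot> rst C (c \<cdot> f)"
  shows "g \<cdot> d = h \<cdot> d"
proof -
  note q = section_coverD[OF sc] and s' = psectionsD[OF s] and t' = psectionsD[OF t] and d' = ridsD[OF d]
  define u where "u = s \<cdot> (f \<cdot> d)"
  have u: "u \<in> arrs C" "src u = src f" "trg u = src q" using s' f d' by (auto simp: u_def)
  have ut: "u = t \<cdot> (f \<cdot> d)" using st by (simp add: u_def)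
  have "g \<cdot> rst C u = h \<cdot> rst C u"
  proof (rule section_cover_pieces[OF sc u(1,3)])
    fix e i assume e: "e \<in> rids C (src q)" and i: "i \<in> I" and ei: "\<theta> i \<cdot> (q \<cdot> e) = e"
    note e' = ridsD[OF e]
    \<comment> \<open>Inside the slice \<open>e\<close> both sections coincide with
      \<open>\<theta> i\<close>: \<open>s\<close> on the part \<open>a\<close> of the base and
      \<open>t\<close> on the part \<open>b\<close>. So they agree on \<open>a \<cdot> b\<close>,
      which is the idempotent fed to the hypothesis.\<close>
    define a where "a = rst C (e \<cdot> s)"
    define b where "b = rst C (e \<cdot> t)"
    have a: "a \<in> rids C (trg q)" and b: "b \<in> rids C (trg q)" using s' t' e' by (auto simp: a_def b_def)
    note a' = ridsD[OF a] and b' = ridsD[OF b] and r = psectionsD[OF q(4)[OF i]]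
    have sa: "s \<cdot> a = \<theta> i \<cdot> a"
      using slice_section[OF q(4)[OF i] s q(1) e ei] by (simp add: a_def)
    have tb: "t \<cdot> b = \<theta> i \<cdot> b"
      using slice_section[OF q(4)[OF i] t q(1) e ei] by (simp add: b_def)
    have "s \<cdot> (a \<cdot> b) = \<theta> i \<cdot> (a \<cdot> b)" using reassoc[OF sa, of b] a' b' s' r by simp
    moreover have "t \<cdot> (b \<cdot> a) = \<theta> i \<cdot> (b \<cdot> a)" using reassoc[OF tb, of a] a' b' t' r by simp
    ultimately have ab: "s \<cdot> (a \<cdot> b) = t \<cdot> (a \<cdot> b)" using rids_comm[OF a b] by simp
    define w where "w = rst C (e \<cdot> u)"
    have w: "w \<in> rids C (src f)" using u e' by (simp add: w_def)
    note w' = ridsD[OF w]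
    have raf: "rst C (a \<cdot> f) = rst C (e \<cdot> s \<cdot> f)" "rst C (b \<cdot> f) = rst C (e \<cdot> t \<cdot> f)"
      using rst_rst_cmp[of f "e \<cdot> s"] rst_rst_cmp[of f "e \<cdot> t"] e' s' t' f
      by (simp_all add: a_def b_def)
    have "w = rst C (e \<cdot> s \<cdot> f \<cdot> d)" using e' s' f d' by (simp add: w_def u_def)
    then have wa: "w = rst C (a \<cdot> f) \<cdot> d" using rst_cmp_rid[of "e \<cdot> s \<cdot> f" d] raf e' s' f d by simp
    have "w = rst C (e \<cdot> t \<cdot> f \<cdot> d)" using e' t' f d' by (simp add: w_def ut)
    then have wb: "w = rst C (b \<cdot> f) \<cdot> d" using rst_cmp_rid[of "e \<cdot> t \<cdot> f" d] raf e' t' f d by simp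
    have idm: "x \<cdot> w = w" if "w = x \<cdot> d" "x \<in> rids C (src f)" for x
      using that reassoc[of x x x d] ridsD[of x "src f"] d' by simp
    have "rst C (a \<cdot> b \<cdot> f) = rst C (a \<cdot> f) \<cdot> rst C (b \<cdot> f)"
      using rst_mult_cmp[OF a b] f by simp
    \<comment> \<open>\<open>w\<close> is the part that the common composite \<open>u\<close> sends
      into \<open>e\<close>, and \<open>u\<close> is computed both through \<open>s\<close> and
      through \<open>t\<close>; hence \<open>f\<close> maps \<open>w\<close> into \<open>a\<close>
      as well as into \<open>b\<close>.\<close>
    then have abw: "rst C (a \<cdot> b \<cdot> f) \<cdot> w = w"
      using idm[OF wa] idm[OF wb] a' b' f w' by simp
    have "g \<cdot> w = g \<cdot> rst C (a \<cdot> b \<cdot> f) \<cdot> w" using abw g(1) a' b' f w' by simp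
    also have "\<dots> = h \<cdot> rst C (a \<cdot> b \<cdot> f) \<cdot> w" using gh[of "a \<cdot> b"] a b ab by simp
    also have "\<dots> = h \<cdot> w" using abw h(1) a' b' f w' by simp
    finally show "g \<cdot> rst C (e \<cdot> u) = h \<cdot> rst C (e \<cdot> u)" by (simp add: w_def)
  qed (use g(1) h(1) u in auto)
  moreover have "rst C u = rst C (s \<cdot> f) \<cdot> d" "rst C u = rst C (t \<cdot> f) \<cdot> d"
    using rst_cmp_rid[of "s \<cdot> f" d] rst_cmp_rid[of "t \<cdot> f" d] s' t' f d d'
    by (simp_all add: u_def st)
  ultimately show ?thesis
    using reassoc[OF g(2), of d] reassoc[OF h(2), of d] g(1) h(1) s' t' f d' by simp
qed

end

section \<open>Pullbacks of local homeomorphisms\<close>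

definition has_pb :: "('o, 'u, 'z) cat_scheme \<Rightarrow> ('o, 'u) arr \<Rightarrow> ('o, 'u) arr \<Rightarrow> bool" where
  "has_pb C f g \<longleftrightarrow> is_pullback C f g (pr1 C f g) (pr2 C f g)"

text \<open>The projections are picked by Hilbert choice, so the existence of any pullback makes the
  chosen pair one.\<close>

lemma has_pbI: "is_pullback C f g p q \<Longrightarrow> has_pb C f g"
  using someI[of "\<lambda>(p, q). is_pullback C f g p q" "(p, q)"]
  by (auto simp: has_pb_def pr1_def pr2_def split: prod.splits)

section \<open>Pairings into chosen pullbacks\<close>

context category
begin

lemma pb_types:
  assumes "has_pb C f g"
  shows "f \<in> arrs C" "g \<in> arrs C" "trg f = trg g"
    "pr1 C f g \<in> arrs C" "src (pr1 C f g) = pbob C f g" "trg (pr1 C f g) = src f"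
    "pr2 C f g \<in> arrs C" "src (pr2 C f g) = pbob C f g" "trg (pr2 C f g) = src g"
    "f \<cdot> pr1 C f g = g \<cdot> pr2 C f g" "pbob C f g \<in> obj C"
proof -
  show 1: "f \<in> arrs C" "g \<in> arrs C" "trg f = trg g"
    "pr1 C f g \<in> arrs C" "src (pr1 C f g) = pbob C f g" "trg (pr1 C f g) = src f"
    "pr2 C f g \<in> arrs C" "src (pr2 C f g) = pbob C f g" "trg (pr2 C f g) = src g"
    "f \<cdot> pr1 C f g = g \<cdot> pr2 C f g"
    using assms unfolding has_pb_def is_pullback_def pbob_def in_hom by auto
  show "pbob C f g \<in> obj C" using arr_obj(1)[OF 1(4)] 1(5) by simp
qed

lemma pb_ex1:
  assumes "has_pb C f g" "u \<in> arrs C" "v \<in> arrs C" "src u = src v" "trg u = src f" "trg v = src g"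
    "f \<cdot> u = g \<cdot> v"
  shows "\<exists>!w. w \<in> hom C (src u) (pbob C f g) \<and> pr1 C f g \<cdot> w = u \<and> pr2 C f g \<cdot> w = v"
proof -
  have "u \<in> hom C (src u) (src f)" "v \<in> hom C (src u) (src g)" "src u \<in> obj C"
    using assms by auto
  then show ?thesis using assms(1,7) unfolding has_pb_def is_pullback_def pbob_def by blast
qed

lemma pair_props:
  assumes "has_pb C f g" "u \<in> arrs C" "v \<in> arrs C" "src u = src v" "trg u = src f" "trg v = src g"
    "f \<cdot> u = g \<cdot> v"
  shows "pair C f g u v \<in> arrs C" "src (pair C f g u v) = src u" "trg (pair C f g u v) = pbob C f g"
    "pr1 C f g \<cdot> pair C f g u v = u" "pr2 C f g \<cdot> pair C f g u v = v"
  using theI'[OF pb_ex1[OF assms]] unfolding pair_def by auto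

lemma pb_ext:
  assumes "has_pb C f g" "w \<in> arrs C" "w' \<in> arrs C" "src w = src w'" "trg w = pbob C f g"
    "trg w' = pbob C f g" "pr1 C f g \<cdot> w = pr1 C f g \<cdot> w'" "pr2 C f g \<cdot> w = pr2 C f g \<cdot> w'"
  shows "w = w'"
proof -
  note pb = pb_types[OF assms(1)]
  have "\<exists>!x. x \<in> hom C (src (pr1 C f g \<cdot> w)) (pbob C f g) \<and> pr1 C f g \<cdot> x = pr1 C f g \<cdot> w
      \<and> pr2 C f g \<cdot> x = pr2 C f g \<cdot> w"
    by (rule pb_ex1[OF assms(1)]) (use pb assms reassoc[OF pb(10), of w] in auto)
  moreover have "src (pr1 C f g \<cdot> w) = src w" using pb assms by simp
  ultimately show ?thesis using assms(2-8) by (metis in_hom)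
qed

lemma pair_eqI:
  assumes "has_pb C f g" "w \<in> arrs C" "trg w = pbob C f g"
    "pr1 C f g \<cdot> w = u" "pr2 C f g \<cdot> w = v"
  shows "pair C f g u v = w"
proof -
  note pb = pb_types[OF assms(1)]
  have uv: "u \<in> arrs C" "v \<in> arrs C" "src u = src w" "src u = src v" "trg u = src f" "trg v = src g"
    "f \<cdot> u = g \<cdot> v"
    using pb assms(2,3) reassoc[OF pb(10), of w] unfolding assms(4,5)[symmetric] by auto
  note pp = pair_props[OF assms(1) uv(1,2,4-7)]
  show ?thesis by (rule pb_ext[OF assms(1)]) (use pp assms uv in auto)
qed

lemma pair_cmp:
  assumes "has_pb C f g" "u \<in> arrs C" "v \<in> arrs C" "src u = src v" "trg u = src f" "trg v = src g"
    "f \<cdot> u = g \<cdot> v" "x \<in> arrs C" "trg x = src u"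
  shows "pair C f g u v \<cdot> x = pair C f g (u \<cdot> x) (v \<cdot> x)"
proof -
  note pb = pb_types[OF assms(1)] and pp = pair_props[OF assms(1-7)]
  show ?thesis
    by (rule pair_eqI[OF assms(1), symmetric])
      (use pb pp assms(2-9) reassoc[OF pp(4), of x] reassoc[OF pp(5), of x] in auto)
qed

end

definition total_pb :: "('o, 'u, 'z) rcat_scheme \<Rightarrow> ('o, 'u) arr \<Rightarrow> ('o, 'u) arr \<Rightarrow> bool" where
  "total_pb C f g \<longleftrightarrow> has_pb C f g \<and> total C f \<and> total C g"

context restriction_category
begin

text \<open>Totality of \<open>f\<close> and \<open>g\<close> gives both projections the domain of
  the common composite. This idempotent fixes both projections, so by uniqueness of mediating maps,
  tested at a partial map, it is the identity.\<close>

lemma total_pbD: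
  assumes "total_pb C f g"
  shows "has_pb C f g" "total C f" "total C g" "total C (pr1 C f g)" "total C (pr2 C f g)"
proof -
  show 1: "has_pb C f g" "total C f" "total C g" using assms by (auto simp: total_pb_def)
  note pb = pb_types[OF 1(1)]
  have "rst C (pr1 C f g) = rst C (f \<cdot> pr1 C f g)" using total_cmp_rst[OF pb(4) 1(2)] pb by simp
  also have "\<dots> = rst C (pr2 C f g)"
    using total_cmp_rst[OF pb(7) 1(3)] pb(1-9) by (simp add: pb(10))
  finally have eq: "rst C (pr1 C f g) = rst C (pr2 C f g)" .
  have "rst C (pr1 C f g) = idn C (pbob C f g)"
  proof (rule pb_ext[OF 1(1)])
    show "pr2 C f g \<cdot> rst C (pr1 C f g) = pr2 C f g \<cdot> idn C (pbob C f g)"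
      using pb(4-9,11) by (simp add: eq)
  qed (use pb(4-9,11) in auto)
  then show "total C (pr1 C f g)" "total C (pr2 C f g)"
    using eq pb by (auto simp: total_def)
qed

lemma pair_rst:
  assumes "total_pb C f g" "u \<in> arrs C" "v \<in> arrs C" "src u = src v" "trg u = src f" "trg v = src g"
    "f \<cdot> u = g \<cdot> v"
  shows "rst C (pair C f g u v) = rst C u" "rst C v = rst C u"
proof -
  note t = total_pbD[OF assms(1)]
  note pp = pair_props[OF t(1) assms(2-7)] and pb = pb_types[OF t(1)]
  show "rst C (pair C f g u v) = rst C u"
    using total_cmp_rst[OF pp(1) t(4)] pp pb by simp
  then show "rst C v = rst C u"
    using total_cmp_rst[OF pp(1) t(5)] pp pb by simp
qed

lemma rst_eq_of_square:
  assumes "total C f" "total C g" "u \<in> arrs C" "v \<in> arrs C" "trg u = src f" "trg v = src g" "f \<cdot> u = g \<cdot> v"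
  shows "rst C u = rst C v"
  using total_cmp_rst[of u f] total_cmp_rst[of v g] assms by simp

end

text \<open>\<open>tstar\<close> and everything built on it are typed over the plain record without
  extension fields, so from here on the base is fixed at that type.\<close>

locale plain_restriction_category = restriction_category C for C :: "('o, 'u) rcat" (structure)
begin

lemma tstar_pair_cond:
  assumes "total_pb C \<sigma> f" "s \<in> psections C \<sigma>"
  shows "\<sigma> \<cdot> (s \<cdot> f) = f \<cdot> rst C (s \<cdot> f)"
proof -
  note t = total_pbD[OF assms(1)] and s = psectionsD[OF assms(2)]
  note pb = pb_types[OF t(1)]
  show ?thesis using reassoc[OF s(4), of f] rst_slide[of f s] s pb by simp
qed

lemma tstar_props:
  assumes "total_pb C \<sigma> f" "s \<in> psections C \<sigma>"
  shows "tstar C \<sigma> f s \<in> arrs C" "src (tstar C \<sigma> f s) = src f" "trg (tstar C \<sigma> f s) = pbob C \<sigma> f"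
    "pr1 C \<sigma> f \<cdot> tstar C \<sigma> f s = s \<cdot> f" "pr2 C \<sigma> f \<cdot> tstar C \<sigma> f s = rst C (s \<cdot> f)"
    "rst C (tstar C \<sigma> f s) = rst C (s \<cdot> f)" "tstar C \<sigma> f s \<in> psections C (pr2 C \<sigma> f)"
proof -
  note t = total_pbD[OF assms(1)] and s = psectionsD[OF assms(2)]
  note pb = pb_types[OF t(1)]
  have *: "s \<cdot> f \<in> arrs C" "rst C (s \<cdot> f) \<in> arrs C" "src (s \<cdot> f) = src (rst C (s \<cdot> f))"
    "trg (s \<cdot> f) = src \<sigma>" "trg (rst C (s \<cdot> f)) = src f" using s pb by auto
  note pp = pair_props[OF t(1) * tstar_pair_cond[OF assms], folded tstar_def]
  show 1: "tstar C \<sigma> f s \<in> arrs C" "src (tstar C \<sigma> f s) = src f" "trg (tstar C \<sigma> f s) = pbob C \<sigma> f"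
    "pr1 C \<sigma> f \<cdot> tstar C \<sigma> f s = s \<cdot> f" "pr2 C \<sigma> f \<cdot> tstar C \<sigma> f s = rst C (s \<cdot> f)"
    using pp s pb by auto
  show 2: "rst C (tstar C \<sigma> f s) = rst C (s \<cdot> f)"
    using pair_rst(1)[OF assms(1) * tstar_pair_cond[OF assms]] by (simp add: tstar_def)
  show "tstar C \<sigma> f s \<in> psections C (pr2 C \<sigma> f)"
    using 1 2 pb by (simp add: psections_def)
qed

text \<open>The pulled back section on a generalised element \<open>x\<close>: the second component
  is \<open>x\<close> cut down to where \<open>s\<close> is defined along it. Composites of sections
  are computed in this form.\<close>

lemma tstar_cmp:
  assumes "total_pb C \<sigma> f" "s \<in> psections C \<sigma>" "x \<in> arrs C" "trg x = src f"
  shows "tstar C \<sigma> f s \<cdot> x = pair C \<sigma> f (s \<cdot> (f \<cdot> x)) (x \<cdot> rst C (s \<cdot> (f \<cdot> x)))"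
proof -
  note t = total_pbD[OF assms(1)] and s = psectionsD[OF assms(2)] and ts = tstar_props[OF assms(1,2)]
  note pb = pb_types[OF t(1)]
  show ?thesis
  proof (rule pair_eqI[OF t(1), symmetric])
    show "pr2 C \<sigma> f \<cdot> (tstar C \<sigma> f s \<cdot> x) = x \<cdot> rst C (s \<cdot> (f \<cdot> x))"
      using reassoc[OF ts(5), of x] rst_slide[of x "s \<cdot> f"] ts(1-3) s pb assms(3,4) by simp
  qed (use reassoc[OF ts(4), of x] ts(1-3) s pb assms(3,4) in auto)
qed

text \<open>The idempotent \<open>c\<close> on the base moves to its preimage along
  \<open>f\<close>; since \<open>c \<cdot> f\<close> is \<open>f\<close> restricted to that
  preimage, both projections of the two sides agree.\<close>

lemma tstar_restrict:
  assumes "total_pb C \<sigma> f" "s \<in> psections C \<sigma>" "c \<in> rids C (trg \<sigma>)"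
  shows "tstar C \<sigma> f (s \<cdot> c) = tstar C \<sigma> f s \<cdot> rst C (c \<cdot> f)"
proof -
  note t = total_pbD[OF assms(1)] and s = psectionsD[OF assms(2)] and c = ridsD[OF assms(3)]
  note pb = pb_types[OF t(1)]
  have sc: "s \<cdot> c \<in> psections C \<sigma>" using psections_restrict[OF assms(2) _ assms(3)] pb by simp
  note ts = tstar_props[OF assms(1,2)] and tsc = tstar_props[OF assms(1) sc]
  have 1: "c \<cdot> f = f \<cdot> rst C (c \<cdot> f)" using rid_slide[OF assms(3)] pb by simp
  have 2: "s \<cdot> (c \<cdot> f) = s \<cdot> f \<cdot> rst C (c \<cdot> f)"
    using arg_cong[OF 1, of "\<lambda>x. s \<cdot> x"] s c pb by simp
  show ?thesis
  proof (rule pb_ext[OF t(1)])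
    show "pr1 C \<sigma> f \<cdot> tstar C \<sigma> f (s \<cdot> c) = pr1 C \<sigma> f \<cdot> (tstar C \<sigma> f s \<cdot> rst C (c \<cdot> f))"
      using reassoc[OF ts(4), of "rst C (c \<cdot> f)"] ts(1-3) tsc(4) 2 s c pb by simp
    have "rst C (s \<cdot> (c \<cdot> f)) = rst C (s \<cdot> f) \<cdot> rst C (c \<cdot> f)"
      using rst_cmp_rst[of "c \<cdot> f" "s \<cdot> f"] 2 s c pb by simp
    then show "pr2 C \<sigma> f \<cdot> tstar C \<sigma> f (s \<cdot> c) = pr2 C \<sigma> f \<cdot> (tstar C \<sigma> f s \<cdot> rst C (c \<cdot> f))"
      using reassoc[OF ts(5), of "rst C (c \<cdot> f)"] ts(1-3) tsc(5) s c pb by simp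
  qed (use ts(1-3) tsc(1-3) c pb in auto)
qed

end

section \<open>Section covers of pullbacks\<close>

locale plain_join_restriction_category =
  plain_restriction_category C + join_restriction_category C for C :: "('o, 'u) rcat" (structure)
begin

text \<open>The preimage of a slice of \<open>\<theta> i\<close> along the first projection is a
  slice of the pulled back section: on it \<open>\<theta> i\<close> undoes \<open>\<sigma>\<close>,
  so the first component can be recovered from the second.\<close>

lemma section_cover_tstar:
  assumes sc: "section_cover C \<sigma> I \<theta>" and tp: "total_pb C \<sigma> f"
  shows "section_cover C (pr2 C \<sigma> f) I (\<lambda>i. tstar C \<sigma> f (\<theta> i))"
proof -
  note q = section_coverD[OF sc] and t = total_pbD[OF tp]
  note pb = pb_types[OF t(1)]
  let ?E = "{e \<in> rids C (pbob C \<sigma> f). \<exists>i \<in> I. tstar C \<sigma> f (\<theta> i) \<cdot> (pr2 C \<sigma> f \<cdot> e) = e}"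
  have "is_join C (pbob C \<sigma> f) (pbob C \<sigma> f) ?E (rst C (pr1 C \<sigma> f))"
  proof (rule is_join_mono)
    show "is_join C (pbob C \<sigma> f) (pbob C \<sigma> f)
        ((\<lambda>e. rst C (e \<cdot> pr1 C \<sigma> f)) ` {e \<in> rids C (src \<sigma>). \<exists>i \<in> I. \<theta> i \<cdot> (\<sigma> \<cdot> e) = e})
        (rst C (pr1 C \<sigma> f))"
      using section_cover_slices[OF sc, of "pr1 C \<sigma> f"] pb by simp
    show "(\<lambda>e. rst C (e \<cdot> pr1 C \<sigma> f)) ` {e \<in> rids C (src \<sigma>). \<exists>i \<in> I. \<theta> i \<cdot> (\<sigma> \<cdot> e) = e} \<subseteq> ?E"
    proof (rule image_subsetI, clarify)
      fix e i assume e: "e \<in> rids C (src \<sigma>)" and i: "i \<in> I" and ei: "\<theta> i \<cdot> (\<sigma> \<cdot> e) = e"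
      note e' = ridsD[OF e] and s = psectionsD[OF q(4)[OF i]]
      define d where "d = rst C (e \<cdot> pr1 C \<sigma> f)"
      have d: "d \<in> rids C (pbob C \<sigma> f)" using e' pb by (simp add: d_def)
      note d' = ridsD[OF d]
      have p1: "pr1 C \<sigma> f \<cdot> d = e \<cdot> pr1 C \<sigma> f"
        using rid_slide[OF e] pb by (simp add: d_def)
      have "\<theta> i \<cdot> (f \<cdot> (pr2 C \<sigma> f \<cdot> d)) = \<theta> i \<cdot> (\<sigma> \<cdot> (pr1 C \<sigma> f \<cdot> d))"
        using reassoc[OF pb(10), of d] pb(1-9) d' s by simp
      also have "\<dots> = \<theta> i \<cdot> (\<sigma> \<cdot> e) \<cdot> pr1 C \<sigma> f" using p1 pb(1-9) d' e' s by simp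
      also have "\<dots> = pr1 C \<sigma> f \<cdot> d" using ei p1 by simp
      finally have 1: "\<theta> i \<cdot> (f \<cdot> (pr2 C \<sigma> f \<cdot> d)) = pr1 C \<sigma> f \<cdot> d" .
      have r: "rst C (pr1 C \<sigma> f \<cdot> d) = d" using total_cmp_rst[of d "pr1 C \<sigma> f"] t pb d' by simp
      have "tstar C \<sigma> f (\<theta> i) \<cdot> (pr2 C \<sigma> f \<cdot> d) = pair C \<sigma> f (pr1 C \<sigma> f \<cdot> d) (pr2 C \<sigma> f \<cdot> d)"
        using tstar_cmp[OF tp q(4)[OF i], of "pr2 C \<sigma> f \<cdot> d"] 1 r pb(1-9) d' by simp
      also have "\<dots> = d" by (rule pair_eqI[OF t(1)]) (use d' pb in auto)
      finally have "tstar C \<sigma> f (\<theta> i) \<cdot> (pr2 C \<sigma> f \<cdot> d) = d" .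
      then show "rst C (e \<cdot> pr1 C \<sigma> f) \<in> rids C (pbob C \<sigma> f) \<and>
          (\<exists>i \<in> I. tstar C \<sigma> f (\<theta> i) \<cdot> (pr2 C \<sigma> f \<cdot> rst C (e \<cdot> pr1 C \<sigma> f)) = rst C (e \<cdot> pr1 C \<sigma> f))"
        using i d unfolding d_def by blast
    qed
    show "rle C e (rst C (pr1 C \<sigma> f))" if "e \<in> ?E" for e
      using that rids_le_idn[of e] total_arr(2)[OF t(4)] pb by simp
  qed
  then show ?thesis
    using tstar_props(7)[OF tp] q(4) t(5) total_arr(2)[OF t(4)] pb by (simp add: section_cover_def)
qed

lemma pullback_ext:
  assumes sc: "section_cover C \<sigma> I \<theta>" and tp: "total_pb C \<sigma> f"
    and g: "g \<in> hom C (pbob C \<sigma> f) B" and h: "h \<in> hom C (pbob C \<sigma> f) B"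
    and gh: "\<And>i. i \<in> I \<Longrightarrow> g \<cdot> tstar C \<sigma> f (\<theta> i) = h \<cdot> tstar C \<sigma> f (\<theta> i)"
  shows "g = h"
  using section_cover_ext[OF section_cover_tstar[OF sc tp], of g B h] g h gh
    pb_types[OF total_pbD(1)[OF tp]] by simp

text \<open>Pulled back sections may agree on an idempotent \<open>d\<close> that does not come from
  the base, whereas the hypothesis only mentions idempotents \<open>c\<close> of the base.
  \<open>section_agreement\<close> bridges this by placing \<open>d\<close> locally inside preimages
  of such \<open>c\<close>.\<close>

lemma pullback_lift:
  assumes sc: "section_cover C \<sigma> I \<theta>" and tp: "total_pb C \<sigma> f"
    and K: "\<And>i. i \<in> I \<Longrightarrow> K i \<in> hom C (src f) B" "\<And>i. i \<in> I \<Longrightarrow> K i \<cdot> rst C (\<theta> i \<cdot> f) = K i"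
    and KK: "\<And>i j c. \<lbrakk>i \<in> I; j \<in> I; c \<in> rids C (trg \<sigma>); \<theta> i \<cdot> c = \<theta> j \<cdot> c\<rbrakk>
      \<Longrightarrow> K i \<cdot> rst C (c \<cdot> f) = K j \<cdot> rst C (c \<cdot> f)"
    and B: "B \<in> obj C"
  shows "\<exists>k \<in> hom C (pbob C \<sigma> f) B. \<forall>i \<in> I. k \<cdot> tstar C \<sigma> f (\<theta> i) = K i"
proof -
  note q = section_coverD[OF sc] and t = total_pbD[OF tp]
  note pb = pb_types[OF t(1)]
  have "\<exists>k \<in> hom C (src (pr2 C \<sigma> f)) B. \<forall>i \<in> I. k \<cdot> tstar C \<sigma> f (\<theta> i) = K i"
  proof (rule section_cover_lift[OF section_cover_tstar[OF sc tp] _ _ _ B])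
    show "K i \<in> hom C (trg (pr2 C \<sigma> f)) B" if "i \<in> I" for i using K(1)[OF that] pb by simp
    show "K i \<cdot> rst C (tstar C \<sigma> f (\<theta> i)) = K i" if "i \<in> I" for i
      using K(2)[OF that] tstar_props(6)[OF tp q(4)[OF that]] by simp
    fix i j d assume i: "i \<in> I" and j: "j \<in> I" and d: "d \<in> rids C (trg (pr2 C \<sigma> f))"
      and eq: "tstar C \<sigma> f (\<theta> i) \<cdot> d = tstar C \<sigma> f (\<theta> j) \<cdot> d"
    note ti = tstar_props[OF tp q(4)[OF i]] and tj = tstar_props[OF tp q(4)[OF j]]
    have d': "d \<in> rids C (src f)" using d pb by simp
    note d'' = ridsD[OF d'] and si = psectionsD[OF q(4)[OF i]] and sj = psectionsD[OF q(4)[OF j]]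
    have "pr1 C \<sigma> f \<cdot> (tstar C \<sigma> f (\<theta> i) \<cdot> d) = pr1 C \<sigma> f \<cdot> (tstar C \<sigma> f (\<theta> j) \<cdot> d)"
      using eq by simp
    then have "\<theta> i \<cdot> (f \<cdot> d) = \<theta> j \<cdot> (f \<cdot> d)"
      using reassoc[OF ti(4), of d] reassoc[OF tj(4), of d] ti(1-3) tj(1-3) pb d'' si sj by simp
    then show "K i \<cdot> d = K j \<cdot> d"
      using section_agreement[OF sc q(4)[OF i] q(4)[OF j] _ _ d', of "K i" B "K j"]
        K(1)[OF i] K(1)[OF j] K(2)[OF i] K(2)[OF j] KK[OF i j] pb by simp
  qed
  then show ?thesis using pb by simp
qed

end

section \<open>Agreement of maps and glueing\<close>

definition agree_set :: "('o, 'u, 'z) rcat_scheme \<Rightarrow> ('o, 'u) arr \<Rightarrow> ('o, 'u) arr \<Rightarrow> ('o, 'u) arr set" where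
  "agree_set C f g = {e. e \<in> rids C (src f) \<and> rle C e (rst C f \<cdot>\<^bsub>C\<^esub> rst C g) \<and> f \<cdot>\<^bsub>C\<^esub> e = g \<cdot>\<^bsub>C\<^esub> e}"

text \<open>The agreement of a category over itself by the identity functor. Over a base,
  \<open>agreement\<close> turns out to be its image under the hyperconnected functor; for maps of
  \<open>C\<close> itself it provides the atlas from which pullbacks are glued.\<close>

definition agree :: "('o, 'u, 'z) rcat_scheme \<Rightarrow> ('o, 'u) arr \<Rightarrow> ('o, 'u) arr \<Rightarrow> ('o, 'u) arr" where
  "agree C f g = join C (src f) (src f) (agree_set C f g)"

section \<open>The largest idempotent on which two maps agree\<close>

context join_restriction_category
begin

lemma is_join_rids:
  assumes "is_join C X X E e" "E \<subseteq> rids C X" "X \<in> obj C"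
  shows "e \<in> rids C X"
  using is_join_least[OF assms(1), of "idn C X"] rids_le_idn assms(2,3) rle_idn[OF _ assms(3)]
  by auto

text \<open>Idempotents all lie below the identity, so any set of them is pairwise compatible, and
  its join stays below the identity.\<close>

lemma rids_join_exists:
  assumes "E \<subseteq> rids C X" "X \<in> obj C"
  shows "\<exists>e \<in> rids C X. is_join C X X E e"
proof -
  have "E \<subseteq> hom C X X" using assms(1) by (auto simp: in_rids)
  then obtain e where "is_join C X X E e"
    using join_exists[OF assms(2,2), of E] bounded_compatible[of _ "idn C X"] rids_le_idn assms(1)
    by (metis subsetD)
  then show ?thesis using is_join_rids[OF _ assms] by blast
qed

lemma agree_is_join:
  assumes "f \<in> arrs C"
  shows "is_join C (src f) (src f) (agree_set C f g) (agree C f g)" "agree C f g \<in> rids C (src f)"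
proof -
  have "agree_set C f g \<subseteq> rids C (src f)" by (auto simp: agree_set_def)
  then obtain e where e: "e \<in> rids C (src f)" "is_join C (src f) (src f) (agree_set C f g) e"
    using rids_join_exists[of "agree_set C f g" "src f"] assms by auto
  then show "is_join C (src f) (src f) (agree_set C f g) (agree C f g)" "agree C f g \<in> rids C (src f)"
    using join_eq[OF e(2)] by (simp_all add: agree_def)
qed

lemma agree_eq:
  assumes "f \<in> hom C X Y" "g \<in> hom C X Y"
  shows "f \<cdot> agree C f g = g \<cdot> agree C f g"
  by (rule join_ext[where X = X and Y = Y and E = "agree_set C f g"])
    (use agree_is_join(1)[of f g] assms in \<open>auto simp: agree_set_def\<close>)

lemma agree_le:
  assumes "f \<in> hom C X Y" "g \<in> hom C X Y"
  shows "rst C f \<cdot> agree C f g = agree C f g" "rst C g \<cdot> agree C f g = agree C f g"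
proof -
  have f: "f \<in> arrs C" "src f = X" and g: "g \<in> arrs C" "src g = X" using assms by auto
  note a = agree_is_join[OF f(1), of g]
  note a' = ridsD[OF a(2)]
  have "rle C (agree C f g) (rst C f \<cdot> rst C g)"
    by (rule is_join_least[OF a(1)]) (use f g in \<open>auto simp: agree_set_def\<close>)
  then have 1: "rst C f \<cdot> rst C g \<cdot> agree C f g = agree C f g" using a' by (simp add: rle_iff)
  have 2: "rst C g \<cdot> rst C f \<cdot> agree C f g = agree C f g"
    using 1 rst_commute[of f g] f g by simp
  have "rst C f \<cdot> (rst C f \<cdot> rst C g \<cdot> agree C f g) = rst C f \<cdot> rst C g \<cdot> agree C f g"
    using f g a' by simp
  then show "rst C f \<cdot> agree C f g = agree C f g" using 1 by simp
  have "rst C g \<cdot> (rst C g \<cdot> rst C f \<cdot> agree C f g) = rst C g \<cdot> rst C f \<cdot> agree C f g"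
    using f g a' by simp
  then show "rst C g \<cdot> agree C f g = agree C f g" using 2 by simp
qed

text \<open>The idempotent \<open>e\<close> may leave the domain of \<open>f\<close>, so it need not
  lie below the agreement. What belongs to the agreement set is the meet \<open>d\<close> of
  \<open>e\<close> with that domain.\<close>

lemma agree_greatest:
  assumes "f \<in> hom C X Y" "g \<in> hom C X Y" "e \<in> rids C X" "f \<cdot> e = g \<cdot> e"
  shows "agree C f g \<cdot> e = rst C f \<cdot> e"
proof -
  have f: "f \<in> arrs C" "src f = X" "trg f = Y" and g: "g \<in> arrs C" "src g = X" "trg g = Y"
    using assms by auto
  note a = agree_is_join[OF f(1), of g] and e = ridsD[OF assms(3)]
  note a' = ridsD[OF a(2)]
  have r: "rst C f \<cdot> e = rst C g \<cdot> e"
    using rst_cmp_rid[of f e] rst_cmp_rid[of g e] f g assms(3,4) by simp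
  define d where "d = rst C f \<cdot> e"
  have d: "d \<in> rids C X" using f assms(3) by (simp add: d_def)
  note d' = ridsD[OF d]
  have "rst C g \<cdot> d = d" "rst C f \<cdot> d = d" using f g e by (simp_all add: d_def) (simp add: r g)
  then have "rst C f \<cdot> (rst C g \<cdot> d) = d" by simp
  then have "rle C d (rst C f \<cdot> rst C g)" using rle_rids(1)[OF d, of "rst C f \<cdot> rst C g"] f g d' by simp
  moreover have "f \<cdot> d = g \<cdot> d"
    using assms(4) f g e r by (metis cmp_rst_self'(1) d_def)
  ultimately have "d \<in> agree_set C f g" using d f by (simp add: agree_set_def)
  then have "agree C f g \<cdot> d = d"
    using is_joinD(7)[OF a(1)] rle_rids(1)[OF d, of "agree C f g"] a(2) f by simp
  moreover have "agree C f g \<cdot> d = agree C f g \<cdot> e"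
  proof -
    have "agree C f g \<cdot> rst C f = agree C f g"
      using agree_le(1)[OF assms(1,2)] rids_comm[OF a(2), of "rst C f"] f by simp
    then show ?thesis using reassoc[of "agree C f g" "rst C f" _ e] a' f e by (simp add: d_def)
  qed
  ultimately show ?thesis by (simp add: d_def)
qed

text \<open>A characterisation that does not mention joins; symmetry and the diagonal value follow
  from it.\<close>

lemma agree_eqI:
  assumes "f \<in> hom C X Y" "g \<in> hom C X Y" "e \<in> rids C X" "f \<cdot> e = g \<cdot> e"
    "rst C f \<cdot> e = e" "\<And>d. \<lbrakk>d \<in> rids C X; f \<cdot> d = g \<cdot> d; rst C f \<cdot> d = d\<rbrakk> \<Longrightarrow> e \<cdot> d = d"
  shows "agree C f g = e"
proof -
  have a: "agree C f g \<in> rids C X" using agree_is_join(2)[of f g] assms(1) by auto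
  have 1: "agree C f g \<cdot> e = e" using agree_greatest[OF assms(1-4)] assms(5) by simp
  have "e \<cdot> agree C f g = agree C f g" using assms(6)[OF a agree_eq[OF assms(1,2)] agree_le(1)[OF assms(1,2)]] .
  then show ?thesis using 1 rids_comm[OF a assms(3)] by simp
qed

lemma agree_sym:
  assumes "f \<in> hom C X Y" "g \<in> hom C X Y"
  shows "agree C f g = agree C g f"
proof (rule agree_eqI[OF assms])
  show "agree C g f \<in> rids C X" using agree_is_join(2)[of g f] assms(2) by auto
  show "f \<cdot> agree C g f = g \<cdot> agree C g f" using agree_eq[OF assms(2,1)] by simp
  show "rst C f \<cdot> agree C g f = agree C g f" using agree_le(2)[OF assms(2,1)] .
  fix d assume d: "d \<in> rids C X" "f \<cdot> d = g \<cdot> d" "rst C f \<cdot> d = d"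
  then have "rst C g \<cdot> d = d"
    using rst_cmp_rid[of f d] rst_cmp_rid[of g d] assms by auto
  then show "agree C g f \<cdot> d = d" using agree_greatest[OF assms(2,1) d(1)] d(2) by simp
qed

lemma agree_self: "f \<in> arrs C \<Longrightarrow> agree C f f = rst C f"
  by (rule agree_eqI[of _ "src f" "trg f"]) auto

lemma agree_trans:
  assumes "f \<in> hom C X Y" "g \<in> hom C X Y" "h \<in> hom C X Y"
  shows "rle C (agree C g h \<cdot> agree C f g) (agree C f h)"
proof -
  have f: "f \<in> arrs C" "src f = X" and g: "g \<in> arrs C" "src g = X" and h: "h \<in> arrs C" "src h = X"
    "trg g = trg f" "trg h = trg f"
    using assms by auto
  have a: "agree C f g \<in> rids C X" and b: "agree C g h \<in> rids C X" and c: "agree C f h \<in> rids C X"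
    using agree_is_join(2)[OF f(1)] agree_is_join(2)[OF g(1)] f g by auto
  note a' = ridsD[OF a] and b' = ridsD[OF b]
  let ?d = "agree C g h \<cdot> agree C f g"
  have d: "?d \<in> rids C X" and d2: "?d = agree C f g \<cdot> agree C g h"
    using a b rids_comm[OF a b] by auto
  have "f \<cdot> ?d = g \<cdot> ?d"
    unfolding d2 using reassoc[OF agree_eq[OF assms(1,2)], of "agree C g h"] f g h a' b' by simp
  also have "\<dots> = h \<cdot> ?d"
    using reassoc[OF agree_eq[OF assms(2,3)], of "agree C f g"] f g h a' b' by simp
  finally have "agree C f h \<cdot> ?d = rst C f \<cdot> ?d"
    using agree_greatest[OF assms(1,3) d] by simp
  also have "\<dots> = ?d"
    unfolding d2 using reassoc[OF agree_le(1)[OF assms(1,2)], of "agree C g h"] f a' b' by simp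
  finally show ?thesis using rle_rids(1)[OF d c] by simp
qed

text \<open>Symmetry and transitivity of agreement are the two atlas laws. The family
  \<open>u\<close> is arbitrary so that it can consist of the composites of the sections of a local
  homeomorphism with one total map.\<close>

lemma agree_local_atlas:
  assumes "X \<in> obj C" "\<And>i. i \<in> I \<Longrightarrow> u i \<in> hom C X Y"
  shows "local_atlas C X I (\<lambda>i j. agree C (u i) (u j))"
  unfolding local_atlas_def
proof (intro conjI ballI)
  fix i j assume ij: "i \<in> I" "j \<in> I"
  show "agree C (u i) (u j) \<in> rids C X" using agree_is_join(2)[of "u i" "u j"] assms(2)[OF ij(1)] by auto
  show "agree C (u i) (u j) = agree C (u j) (u i)" using agree_sym assms(2) ij by blast
  fix k assume "k \<in> I"
  then show "rle C (agree C (u j) (u k) \<cdot> agree C (u i) (u j)) (agree C (u i) (u k))"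
    using agree_trans assms(2) ij by blast
qed (rule assms(1))

text \<open>The last two items say that glued sections agree exactly as far as the atlas prescribes.
  Both come from \<open>\<phi> i j = ps j \<cdot> ss i\<close>: applying \<open>ss j\<close> to it
  restricts \<open>ss i\<close> to the domain of \<open>ps j\<close>, and applying
  \<open>ps j\<close> to equal restrictions of sections gives equal atlas values.\<close>

lemma glueing_props:
  assumes G: "is_glueing C X I \<phi> p ps ss" and A: "local_atlas C X I \<phi>"
  shows "total C p" "trg p = X" "section_cover C p I ss"
    "i \<in> I \<Longrightarrow> rst C (ss i) = \<phi> i i"
    "\<lbrakk>i \<in> I; j \<in> I\<rbrakk> \<Longrightarrow> ss i \<cdot> \<phi> i j = ss j \<cdot> \<phi> i j"
    "\<lbrakk>i \<in> I; j \<in> I; d \<in> rids C X; ss i \<cdot> d = ss j \<cdot> d\<rbrakk> \<Longrightarrow> \<phi> i j \<cdot> d = \<phi> j j \<cdot> d"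
proof -
  show p: "total C p" "trg p = X" using G by (auto simp: is_glueing_def local_homeo_def)
  have J: "is_join C (src p) (trg p) (ps ` I) p" using G by (auto simp: is_glueing_def)
  have inv: "partial_inverse C (ps i) (ss i)" if "i \<in> I" for i using G that by (auto simp: is_glueing_def)
  have le: "rle C (ps i) p" if "i \<in> I" for i using is_joinD(7)[OF J] that by simp
  have sec: "ss i \<in> psections C p" if "i \<in> I" for i
    using partial_inverse_section(1)[OF inv le] that by simp
  show "section_cover C p I ss"
    by (rule partial_isos_section_cover[OF p(1) J]) (use inv sec in auto)
  have \<phi>: "\<phi> i j = ps j \<cdot> ss i" if "i \<in> I" "j \<in> I" for i j
    using G that by (auto simp: is_glueing_def)
  have psi: "ps i \<in> arrs C" "src (ps i) = src p" "trg (ps i) = X" if "i \<in> I" for i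
    using le[OF that] p(2) by (auto simp: rle_iff)
  have r: "ps i \<cdot> ss i = rst C (ss i)" "ss i \<cdot> ps i = rst C (ps i)" if "i \<in> I" for i
    using inv[OF that] by (auto simp: partial_inverse_def)
  show r\<phi>: "rst C (ss i) = \<phi> i i" if "i \<in> I" for i
    using \<phi>[OF that that] r[OF that] by simp
  have s: "ss i \<in> arrs C" "src (ss i) = X" "trg (ss i) = src p" if "i \<in> I" for i
    using psectionsD[OF sec[OF that]] p(2) by auto
  show "ss i \<cdot> \<phi> i j = ss j \<cdot> \<phi> i j" if ij: "i \<in> I" "j \<in> I"
  proof -
    have rid: "\<phi> i j \<in> rids C X" using A ij by (simp add: local_atlas_def)
    have "ss j \<cdot> \<phi> i j = rst C (ps j) \<cdot> ss i"
      using reassoc[OF r(2)[OF ij(2)], of "ss i"] s psi ij by (simp add: \<phi>)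
    also have "\<dots> = ss i \<cdot> rst C (\<phi> i j)" using rst_slide[of "ss i" "ps j"] s psi ij by (simp add: \<phi>)
    finally show ?thesis using ridsD[OF rid] by simp
  qed
  show "\<phi> i j \<cdot> d = \<phi> j j \<cdot> d" if ij: "i \<in> I" "j \<in> I" and d: "d \<in> rids C X" "ss i \<cdot> d = ss j \<cdot> d"
    using d(2) s psi ij ridsD[OF d(1)] by (simp add: \<phi>)
qed

end

lemma arr_eqI: "\<lbrakk>src f = src g; trg f = trg g; lab f = lab g\<rbrakk> \<Longrightarrow> f = g"
  by (rule arr.expand) simp

text \<open>Glueings are granted for atlases indexed by sets of labels. A set of parallel arrows is
  in bijection with its labels, so the atlas is reindexed along \<open>lab\<close> and the glueing
  carried back.\<close>

lemma glueing_exists: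
  fixes C :: "('o, 'u, 'z) rcat_scheme" and I :: "('a, 'u) arr set"
  assumes lg: "has_local_glueings C" and small: "I \<prec> (UNIV :: 'u set)"
    and I: "\<And>f. f \<in> I \<Longrightarrow> src f = a \<and> trg f = b" and A: "local_atlas C X I \<phi>"
  shows "\<exists>p ps ss. is_glueing C X I \<phi> p ps ss"
proof -
  have inv: "Arr a b (lab f) = f" if "f \<in> I" for f using I[OF that] by (intro arr_eqI) auto
  have "lab ` I \<prec> (UNIV :: 'u set)" using lesspoll_trans1[OF image_lepoll small] .
  moreover have "local_atlas C X (lab ` I) (\<lambda>x y. \<phi> (Arr a b x) (Arr a b y))"
    using A inv unfolding local_atlas_def by simp
  ultimately obtain p ps ss where
    G: "is_glueing C X (lab ` I) (\<lambda>x y. \<phi> (Arr a b x) (Arr a b y)) p ps ss"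
    using lg unfolding has_local_glueings_def by blast
  have "is_glueing C X I \<phi> p (\<lambda>f. ps (lab f)) (\<lambda>f. ss (lab f))"
    using G inv unfolding is_glueing_def by (simp add: image_image)
  then show ?thesis by blast
qed

section \<open>Pullbacks of local homeomorphisms by glueing\<close>

locale glueing_category = plain_join_restriction_category C for C :: "('o, 'u) rcat" (structure) +
  assumes loc_small: "locally_small C" and glueings: "has_local_glueings C"
begin

text \<open>The pullback is glued from the domains of the composites \<open>s \<cdot> f\<close>, one
  for each partial section \<open>s\<close> of \<open>\<sigma>\<close>, identified where these
  composites agree. The glued map \<open>q\<close> is the projection to the source of
  \<open>f\<close>; the other projection \<open>g\<close> is determined by its values
  \<open>s \<cdot> f\<close> on the glued sections \<open>ts s\<close>.\<close>

lemma pullback_exists: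
  assumes lh: "local_homeo C \<sigma>" and tf: "total C f" and tr: "trg f = trg \<sigma>"
  shows "\<exists>p q. is_pullback C \<sigma> f p q"
proof -
  have \<sigma>: "total C \<sigma>" using lh by (simp add: local_homeo_def)
  note \<sigma>' = total_arr[OF \<sigma>] and f = total_arr[OF tf]
  note sc = local_homeo_section_cover[OF lh]
  let ?I = "psections C \<sigma>"
  let ?\<phi> = "\<lambda>s t. agree C (s \<cdot> f) (t \<cdot> f)"
  have sf: "s \<cdot> f \<in> hom C (src f) (src \<sigma>)" if "s \<in> ?I" for s
    using psectionsD[OF that] f \<sigma>' tr by simp
  \<comment> \<open>All partial sections serve as indices. They lie in a single hom-set, which local
    smallness bounds.\<close>
  have sub: "?I \<subseteq> hom C (trg \<sigma>) (src \<sigma>)" by (auto simp: psections_def)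
  have "hom C (trg \<sigma>) (src \<sigma>) \<prec> (UNIV :: 'u set)"
    using loc_small \<sigma>' by (simp add: locally_small_def)
  then have small: "?I \<prec> (UNIV :: 'u set)"
    using lesspoll_trans1[OF subset_imp_lepoll[OF sub]] by blast
  have LA: "local_atlas C (src f) ?I ?\<phi>"
    by (rule agree_local_atlas) (use sf f in auto)
  obtain q qs ts where G: "is_glueing C (src f) ?I ?\<phi> q qs ts"
    using glueing_exists[OF glueings small _ LA, of "trg \<sigma>" "src \<sigma>"] psectionsD(2,3) by blast
  note gl = glueing_props[OF G LA]
  note q = section_coverD[OF gl(3)]
  have t: "ts s \<in> arrs C" "src (ts s) = src f" "trg (ts s) = src q" "q \<cdot> ts s = rst C (ts s)"
    "rst C (ts s) = rst C (s \<cdot> f)" if "s \<in> ?I" for s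
    using psectionsD[OF q(4)[OF that]] gl(2) gl(4)[OF that] agree_self[of "s \<cdot> f"] sf[OF that] by auto
  \<comment> \<open>Well defined because glued sections agree only where the atlas says so, that is,
    where the values \<open>s \<cdot> f\<close> agree.\<close>
  have "\<exists>g \<in> hom C (src q) (src \<sigma>). \<forall>s \<in> ?I. g \<cdot> ts s = s \<cdot> f"
  proof (rule section_cover_lift[OF gl(3)])
    show "s \<cdot> f \<in> hom C (trg q) (src \<sigma>)" if "s \<in> ?I" for s using sf[OF that] gl(2) by simp
    show "s \<cdot> f \<cdot> rst C (ts s) = s \<cdot> f" if "s \<in> ?I" for s
      using t(5)[OF that] sf[OF that] cmp_rst_self[of "s \<cdot> f"] by simp
    show "src \<sigma> \<in> obj C" using \<sigma>' by simp
    fix s s' d assume s: "s \<in> ?I" and s': "s' \<in> ?I" and d: "d \<in> rids C (trg q)"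
      and eq: "ts s \<cdot> d = ts s' \<cdot> d"
    have dX: "d \<in> rids C (src f)" using d gl(2) by simp
    note d' = ridsD[OF dX] and ss = psectionsD[OF s] and ss' = psectionsD[OF s']
    have u: "s \<cdot> f \<in> arrs C" "src (s \<cdot> f) = src f" "trg (s \<cdot> f) = src \<sigma>"
      and u': "s' \<cdot> f \<in> arrs C" "src (s' \<cdot> f) = src f" "trg (s' \<cdot> f) = src \<sigma>"
      using sf[OF s] sf[OF s'] by auto
    have c: "?\<phi> s s' \<cdot> d = rst C (s' \<cdot> f) \<cdot> d"
      using gl(6)[OF s s' dX eq] agree_self[of "s' \<cdot> f"] u' by simp
    have r: "rst C (s \<cdot> f) \<cdot> d = rst C (s' \<cdot> f) \<cdot> d"
      using arg_cong[OF eq, of "rst C"] rst_cmp_rid[of "ts s" d] rst_cmp_rid[of "ts s'" d] t s s' dX by simp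
    have a: "?\<phi> s s' \<in> rids C (src f)" using agree_is_join(2)[OF u(1), of "s' \<cdot> f"] u by simp
    note a' = ridsD[OF a]
    have "(s \<cdot> f) \<cdot> d = (s \<cdot> f) \<cdot> (rst C (s \<cdot> f) \<cdot> d)" using u d' by (simp del: cmp_assoc')
    also have "\<dots> = (s \<cdot> f) \<cdot> (?\<phi> s s' \<cdot> d)" by (simp only: r c)
    also have "\<dots> = (s' \<cdot> f) \<cdot> (?\<phi> s s' \<cdot> d)"
      using reassoc[OF agree_eq[OF sf[OF s] sf[OF s']], of d] reassoc[of "s' \<cdot> f" "?\<phi> s s'" _ d] u u' a' d'
      by (simp del: cmp_assoc')
    also have "\<dots> = (s' \<cdot> f) \<cdot> d" using u' d' by (simp del: cmp_assoc' add: c)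
    finally show "s \<cdot> f \<cdot> d = s' \<cdot> f \<cdot> d" .
  qed
  then obtain g where g: "g \<in> arrs C" "src g = src q" "trg g = src \<sigma>"
    and gt: "\<And>s. s \<in> ?I \<Longrightarrow> g \<cdot> ts s = s \<cdot> f" by auto
  have sq: "\<sigma> \<cdot> g = f \<cdot> q"
  proof (rule section_cover_ext[OF gl(3)])
    show "\<sigma> \<cdot> g \<in> hom C (src q) (trg \<sigma>)" "f \<cdot> q \<in> hom C (src q) (trg \<sigma>)"
      using g f \<sigma>' q(1) gl(2) tr by auto
    fix s assume s: "s \<in> ?I"
    note ss = psectionsD[OF s]
    have "\<sigma> \<cdot> g \<cdot> ts s = rst C s \<cdot> f"
      using gt[OF s] g t[OF s] \<sigma>' reassoc[OF ss(4), of f] ss f tr by simp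
    also have "\<dots> = f \<cdot> rst C (s \<cdot> f)" using rst_slide[of f s] ss f tr by simp
    also have "\<dots> = f \<cdot> q \<cdot> ts s" using t[OF s] f q(1) gl(2) by simp
    finally show "\<sigma> \<cdot> g \<cdot> ts s = f \<cdot> q \<cdot> ts s" .
  qed
  \<comment> \<open>The converse passage, along any element \<open>v\<close> of the source of
    \<open>f\<close>: equal values of two sections make the two glued sections equal. The idempotent
    \<open>d\<close> need not come from the base of \<open>\<sigma>\<close>, hence the appeal to
    \<open>section_agreement\<close>.\<close>
  have key: "ts s \<cdot> v \<cdot> d = ts s' \<cdot> v \<cdot> d"
    if s: "s \<in> ?I" and s': "s' \<in> ?I" and v: "v \<in> arrs C" "trg v = src f" and d: "d \<in> rids C (src v)"
      and eq: "s \<cdot> (f \<cdot> (v \<cdot> d)) = s' \<cdot> (f \<cdot> (v \<cdot> d))" for s s' v d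
  proof (rule section_agreement[OF sc s s', of "f \<cdot> v" d "ts s \<cdot> v" "src q" "ts s' \<cdot> v"])
    note ss = psectionsD[OF s] and ss' = psectionsD[OF s'] and d' = ridsD[OF d]
    show "f \<cdot> v \<in> arrs C" "trg (f \<cdot> v) = trg \<sigma>" "d \<in> rids C (src (f \<cdot> v))" using f v tr d by auto
    show "s \<cdot> (f \<cdot> v \<cdot> d) = s' \<cdot> (f \<cdot> v \<cdot> d)" using eq f v d' by simp
    have r: "ts s \<cdot> v \<cdot> rst C (s \<cdot> (f \<cdot> v)) = ts s \<cdot> v" if s: "s \<in> ?I" for s
    proof -
      note ss = psectionsD[OF s]
      have "v \<cdot> rst C (s \<cdot> (f \<cdot> v)) = rst C (s \<cdot> f) \<cdot> v"
        using rst_slide[of v "s \<cdot> f"] v f ss tr by simp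
      then have "ts s \<cdot> v \<cdot> rst C (s \<cdot> (f \<cdot> v)) = ts s \<cdot> (rst C (ts s) \<cdot> v)"
        using t[OF s] v f ss tr by simp
      then show ?thesis using t(1-3)[OF s] v by simp
    qed
    show "ts s \<cdot> v \<cdot> rst C (s \<cdot> (f \<cdot> v)) = ts s \<cdot> v" "ts s' \<cdot> v \<cdot> rst C (s' \<cdot> (f \<cdot> v)) = ts s' \<cdot> v"
      using r s s' by auto
    show "ts s \<cdot> v \<in> hom C (src (f \<cdot> v)) (src q)" "ts s' \<cdot> v \<in> hom C (src (f \<cdot> v)) (src q)"
      using t s s' v f by auto
    fix c assume c: "c \<in> rids C (trg \<sigma>)" and cc: "s \<cdot> c = s' \<cdot> c"
    note c' = ridsD[OF c]
    define e where "e = rst C (c \<cdot> f)"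
    have e: "e \<in> rids C (src f)" using c' f tr by (simp add: e_def)
    note e' = ridsD[OF e]
    have u: "s \<cdot> f \<in> arrs C" "src (s \<cdot> f) = src f" "trg (s \<cdot> f) = src \<sigma>"
      and u': "s' \<cdot> f \<in> arrs C" "src (s' \<cdot> f) = src f" "trg (s' \<cdot> f) = src \<sigma>"
      using sf[OF s] sf[OF s'] by auto
    have cf: "c \<cdot> f = f \<cdot> e" using rid_slide[OF c] f tr by (simp add: e_def)
    have eqe: "(s \<cdot> f) \<cdot> e = (s' \<cdot> f) \<cdot> e"
      using reassoc[OF cc, of f] cf c' ss ss' f tr e' by simp
    have a: "?\<phi> s s' \<in> rids C (src f)" using agree_is_join(2)[OF u(1), of "s' \<cdot> f"] u by simp
    note a' = ridsD[OF a]
    have 1: "?\<phi> s s' \<cdot> e = rst C (s \<cdot> f) \<cdot> e"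
      using agree_greatest[OF sf[OF s] sf[OF s'] e eqe] .
    have 2: "rst C (s \<cdot> f) \<cdot> e = rst C (s' \<cdot> f) \<cdot> e"
      using arg_cong[OF eqe, of "rst C"] rst_cmp_rid[of "s \<cdot> f" e] rst_cmp_rid[of "s' \<cdot> f" e] u u' e by simp
    have "ts s \<cdot> e = ts s \<cdot> (rst C (ts s) \<cdot> e)" using t(1-3)[OF s] e' by simp
    also have "\<dots> = ts s \<cdot> (?\<phi> s s' \<cdot> e)" using 1 t(5)[OF s] by simp
    also have "\<dots> = ts s' \<cdot> (?\<phi> s s' \<cdot> e)"
      using reassoc[OF gl(5)[OF s s'], of e] t(1-3)[OF s] t(1-3)[OF s'] a' e' by simp
    also have "\<dots> = ts s' \<cdot> (rst C (ts s') \<cdot> e)" using 1 2 t(5)[OF s'] by simp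
    also have "\<dots> = ts s' \<cdot> e" using t(1-3)[OF s'] e' by simp
    finally have te: "ts s \<cdot> e = ts s' \<cdot> e" .
    have ve: "v \<cdot> rst C (c \<cdot> (f \<cdot> v)) = e \<cdot> v"
      using rst_slide[of v "c \<cdot> f"] v f c' tr by (simp add: e_def)
    show "ts s \<cdot> v \<cdot> rst C (c \<cdot> (f \<cdot> v)) = ts s' \<cdot> v \<cdot> rst C (c \<cdot> (f \<cdot> v))"
      using reassoc[OF te, of v] ve t(1-3)[OF s] t(1-3)[OF s'] v e' c' f tr by simp
  qed
  \<comment> \<open>Existence of the mediating map. Where \<open>u\<close> lands in a slice
    \<open>e\<close> of \<open>s\<close>, the square forces \<open>u\<close> to be \<open>s\<close>
    after \<open>f \<cdot> v\<close>, so the map has to be \<open>ts s \<cdot> v\<close> there; the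
    pieces over all slices are joined.\<close>
  have ex: "\<exists>w \<in> hom C W (src q). g \<cdot> w = u \<and> q \<cdot> w = v"
    if u: "u \<in> hom C W (src \<sigma>)" and v: "v \<in> hom C W (src f)" and uv: "\<sigma> \<cdot> u = f \<cdot> v" for W u v
  proof -
    have u': "u \<in> arrs C" "src u = W" "trg u = src \<sigma>" and v': "v \<in> arrs C" "src v = W" "trg v = src f"
      using u v by auto
    have ruv: "rst C u = rst C v" using rst_eq_of_square[OF \<sigma> tf] u' v' uv by simp
    let ?E = "{e \<in> rids C (src \<sigma>). \<exists>s \<in> ?I. s \<cdot> (\<sigma> \<cdot> e) = e}"
    have piece: "s \<cdot> (f \<cdot> (v \<cdot> rst C (e \<cdot> u))) = u \<cdot> rst C (e \<cdot> u)"
      if s: "s \<in> ?I" and e: "e \<in> rids C (src \<sigma>)" and se: "s \<cdot> (\<sigma> \<cdot> e) = e" for s e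
    proof -
      note e' = ridsD[OF e] and ss = psectionsD[OF s]
      have 1: "e \<cdot> u = u \<cdot> rst C (e \<cdot> u)" using rid_slide[OF e] u' by simp
      have "s \<cdot> (f \<cdot> (v \<cdot> rst C (e \<cdot> u))) = s \<cdot> (\<sigma> \<cdot> (u \<cdot> rst C (e \<cdot> u)))"
        using reassoc[OF uv, of "rst C (e \<cdot> u)"] u' v' f \<sigma>' e' tr by simp
      also have "\<dots> = s \<cdot> (\<sigma> \<cdot> (e \<cdot> u))" using 1 by simp
      also have "\<dots> = e \<cdot> u" using reassoc[OF se, of u] ss \<sigma>' e' u' by simp
      finally show ?thesis using 1 by simp
    qed
    have pr: "rst C (ts s \<cdot> v \<cdot> rst C (e \<cdot> u)) = rst C (e \<cdot> u)"
      if s: "s \<in> ?I" and e: "e \<in> rids C (src \<sigma>)" and se: "s \<cdot> (\<sigma> \<cdot> e) = e" for s e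
    proof -
      note e' = ridsD[OF e] and ss = psectionsD[OF s]
      have "rst C (ts s \<cdot> v \<cdot> rst C (e \<cdot> u)) = rst C (rst C (ts s) \<cdot> (v \<cdot> rst C (e \<cdot> u)))"
        using rst_rst_cmp[of "v \<cdot> rst C (e \<cdot> u)" "ts s"] t(1-3)[OF s] v' u' e' by simp
      also have "\<dots> = rst C (u \<cdot> rst C (e \<cdot> u))"
        using t(5)[OF s] piece[OF s e se] rst_rst_cmp[of "v \<cdot> rst C (e \<cdot> u)" "s \<cdot> f"] v' u' e' f ss tr by simp
      also have "\<dots> = rst C (e \<cdot> u)"
        using rid_slide[OF e, of u] u' rst_rst e' by (metis cmp_types(1))
      finally show ?thesis .
    qed
    define S where "S = {ts s \<cdot> v \<cdot> rst C (e \<cdot> u) | s e. s \<in> ?I \<and> e \<in> rids C (src \<sigma>) \<and> s \<cdot> (\<sigma> \<cdot> e) = e}"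
    have S: "\<exists>s e. k = ts s \<cdot> v \<cdot> rst C (e \<cdot> u) \<and> s \<in> ?I \<and> e \<in> rids C (src \<sigma>) \<and> s \<cdot> (\<sigma> \<cdot> e) = e \<and>
        k \<in> hom C W (src q) \<and> rst C k = rst C (e \<cdot> u)" if kS: "k \<in> S" for k
    proof -
      obtain s e where k: "k = ts s \<cdot> v \<cdot> rst C (e \<cdot> u)" and s: "s \<in> ?I" and e: "e \<in> rids C (src \<sigma>)"
        and se: "s \<cdot> (\<sigma> \<cdot> e) = e" using kS unfolding S_def by blast
      have "k \<in> hom C W (src q)" unfolding k using t(1-3)[OF s] v' u' ridsD[OF e] by simp
      then show ?thesis using k s e se pr[OF s e se] by blast
    qed
    \<comment> \<open>On the overlap of two pieces both sections take the value \<open>u\<close>, so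
      \<open>key\<close> identifies the corresponding glued sections.\<close>
    have comp: "compatible C k k'" if kS: "k \<in> S" and k'S: "k' \<in> S" for k k'
    proof -
      obtain s e where k: "k = ts s \<cdot> v \<cdot> rst C (e \<cdot> u)" "s \<in> ?I" "e \<in> rids C (src \<sigma>)" "s \<cdot> (\<sigma> \<cdot> e) = e"
        "k \<in> hom C W (src q)" "rst C k = rst C (e \<cdot> u)" using S[OF kS] by blast
      obtain s' e' where k': "k' = ts s' \<cdot> v \<cdot> rst C (e' \<cdot> u)" "s' \<in> ?I" "e' \<in> rids C (src \<sigma>)"
        "s' \<cdot> (\<sigma> \<cdot> e') = e'" "k' \<in> hom C W (src q)" "rst C k' = rst C (e' \<cdot> u)" using S[OF k'S] by blast
      define a where "a = rst C (e \<cdot> u)"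
      define b where "b = rst C (e' \<cdot> u)"
      have a: "a \<in> rids C W" and b: "b \<in> rids C W"
        using u' ridsD[OF k(3)] ridsD[OF k'(3)] by (auto simp: a_def b_def)
      note a' = ridsD[OF a] and b' = ridsD[OF b] and ss = psectionsD[OF k(2)] and ss' = psectionsD[OF k'(2)]
      have ab: "a \<cdot> b = b \<cdot> a" using rids_comm[OF a b] .
      have 1: "s \<cdot> (f \<cdot> (v \<cdot> (a \<cdot> b))) = u \<cdot> (a \<cdot> b)"
        using arg_cong[OF piece[OF k(2-4)], of "\<lambda>x. x \<cdot> b"] a' b' u' v' f ss tr by (simp flip: a_def)
      have 2: "s' \<cdot> (f \<cdot> (v \<cdot> (b \<cdot> a))) = u \<cdot> (b \<cdot> a)"
        using arg_cong[OF piece[OF k'(2-4)], of "\<lambda>x. x \<cdot> a"] a' b' u' v' f ss' tr by (simp flip: b_def)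
      have "ts s \<cdot> v \<cdot> (a \<cdot> b) = ts s' \<cdot> v \<cdot> (a \<cdot> b)"
        by (rule key[OF k(2) k'(2)]) (use 1 2 ab v' a b in auto)
      then have "k \<cdot> b = k' \<cdot> a"
        using k(1) k'(1) t(1-3)[OF k(2)] t(1-3)[OF k'(2)] v' a' b' ab
        by (simp flip: a_def b_def)
      then show ?thesis using k(5,6) k'(5,6) by (simp add: compatible_iff a_def b_def)
    qed
    have "S \<subseteq> hom C W (src q)" using S by fast
    then obtain w where w: "is_join C W (src q) S w"
      using join_exists[of W "src q" S] comp u' q(1) by auto
    note w' = is_joinD(1-3)[OF w]
    have we: "w \<cdot> rst C (e \<cdot> u) = ts s \<cdot> (v \<cdot> rst C (e \<cdot> u))"
      if s: "s \<in> ?I" and e: "e \<in> rids C (src \<sigma>)" and se: "s \<cdot> (\<sigma> \<cdot> e) = e" for s e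
    proof -
      let ?k = "ts s \<cdot> v \<cdot> rst C (e \<cdot> u)"
      have kS: "?k \<in> S" using s e se unfolding S_def by auto
      note e' = ridsD[OF e] and ss = psectionsD[OF s]
      show ?thesis using is_joinD(8)[OF w kS] pr[OF s e se] t(1-3)[OF s] v' u' e' by simp
    qed
    have gw: "g \<cdot> w \<cdot> rst C u = u \<cdot> rst C u"
    proof (rule section_cover_pieces[OF sc u'(1,3)])
      show "g \<cdot> w \<in> hom C (src u) (src \<sigma>)" "u \<in> hom C (src u) (src \<sigma>)" using g w' u' by auto
      fix e s assume e: "e \<in> rids C (src \<sigma>)" and s: "s \<in> ?I" and se: "s \<cdot> (\<sigma> \<cdot> e) = e"
      note e' = ridsD[OF e]
      show "g \<cdot> w \<cdot> rst C (e \<cdot> u) = u \<cdot> rst C (e \<cdot> u)"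
        using we[OF s e se] piece[OF s e se] reassoc[OF gt[OF s], of "v \<cdot> rst C (e \<cdot> u)"]
          g w' u' v' e' t(1-3)[OF s] psectionsD[OF s] f tr by simp
    qed
    have qw: "q \<cdot> w \<cdot> rst C u = v \<cdot> rst C u"
    proof (rule section_cover_pieces[OF sc u'(1,3)])
      show "q \<cdot> w \<in> hom C (src u) (src f)" "v \<in> hom C (src u) (src f)" using q(1) gl(2) w' u' v' by auto
      fix e s assume e: "e \<in> rids C (src \<sigma>)" and s: "s \<in> ?I" and se: "s \<cdot> (\<sigma> \<cdot> e) = e"
      note e' = ridsD[OF e] and ss = psectionsD[OF s]
      have x: "v \<cdot> rst C (e \<cdot> u) \<in> arrs C" "src (v \<cdot> rst C (e \<cdot> u)) = W" "trg (v \<cdot> rst C (e \<cdot> u)) = src f"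
        using v' u' e' by auto
      have "rst C (s \<cdot> (f \<cdot> (v \<cdot> rst C (e \<cdot> u)))) = rst C (e \<cdot> u)"
        using piece[OF s e se] rid_slide[OF e, of u] u' e' by (metis cmp_types(1) rst_rst)
      then have r: "rst C (s \<cdot> f \<cdot> (v \<cdot> rst C (e \<cdot> u))) = rst C (e \<cdot> u)"
        using ss f tr x by simp
      have "q \<cdot> w \<cdot> rst C (e \<cdot> u) = rst C (s \<cdot> f) \<cdot> (v \<cdot> rst C (e \<cdot> u))"
        using we[OF s e se] reassoc[OF t(4)[OF s], of "v \<cdot> rst C (e \<cdot> u)"] t(5)[OF s]
          q(1) w' u' e' t(1-3)[OF s] x by simp
      also have "\<dots> = v \<cdot> rst C (e \<cdot> u) \<cdot> rst C (e \<cdot> u)"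
        using rst_slide[of "v \<cdot> rst C (e \<cdot> u)" "s \<cdot> f"] r x ss f tr by simp
      also have "\<dots> = v \<cdot> rst C (e \<cdot> u)" using v' u' e' by simp
      finally show "q \<cdot> w \<cdot> rst C (e \<cdot> u) = v \<cdot> rst C (e \<cdot> u)" .
    qed
    have "w \<cdot> rst C u \<in> hom C W (src q)" using w' u' by simp
    moreover have "g \<cdot> (w \<cdot> rst C u) = u" using gw g w' u' by simp
    moreover have "q \<cdot> (w \<cdot> rst C u) = v" using qw q(1) w' u' v' by (simp add: ruv)
    ultimately show ?thesis by blast
  qed
  \<comment> \<open>Uniqueness. The domain is cut by slices of \<open>q\<close> met by
    \<open>w\<close> and then by those met by \<open>w'\<close>. On a common part each map is a
    glued section after one and the same map to the source of \<open>f\<close>, and equality of the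
    \<open>g\<close>-components lets \<open>key\<close> identify them.\<close>
  have un: "w = w'"
    if w: "w \<in> hom C W (src q)" and w': "w' \<in> hom C W (src q)"
      and gw: "g \<cdot> w = g \<cdot> w'" and qw: "q \<cdot> w = q \<cdot> w'" for W w w'
  proof -
    have a: "w \<in> arrs C" "src w = W" "trg w = src q" and a': "w' \<in> arrs C" "src w' = W" "trg w' = src q"
      using w w' by auto
    have rr: "rst C w = rst C w'"
      using total_cmp_rst[of w q] total_cmp_rst[of w' q] a a' gl(1) qw by simp
    have piece: "x \<cdot> rst C (e \<cdot> x) = ts s \<cdot> (q \<cdot> x) \<cdot> rst C (e \<cdot> x)"
      if "e \<in> rids C (src q)" "s \<in> ?I" "ts s \<cdot> (q \<cdot> e) = e" "x \<in> arrs C" "trg x = src q" for x e s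
    proof -
      note e' = ridsD[OF that(1)]
      have 1: "e \<cdot> x = x \<cdot> rst C (e \<cdot> x)" using rid_slide[OF that(1)] that by simp
      have "e \<cdot> x = ts s \<cdot> (q \<cdot> (e \<cdot> x))"
        using reassoc[OF that(3), of x] e' q(1) gl(2) t(1-3)[OF that(2)] that(4,5) by simp
      also have "\<dots> = ts s \<cdot> (q \<cdot> (x \<cdot> rst C (e \<cdot> x)))" using arg_cong[OF 1, of "\<lambda>y. ts s \<cdot> (q \<cdot> y)"] .
      finally have 2: "e \<cdot> x = ts s \<cdot> (q \<cdot> (x \<cdot> rst C (e \<cdot> x)))" .
      have 3: "ts s \<cdot> (q \<cdot> x) \<cdot> rst C (e \<cdot> x) = ts s \<cdot> (q \<cdot> (x \<cdot> rst C (e \<cdot> x)))"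
        using e' q(1) gl(2) t(1-3)[OF that(2)] that(4,5) by simp
      show ?thesis unfolding 3 by (rule trans[OF 1[symmetric] 2])
    qed
    have "w \<cdot> rst C w = w' \<cdot> rst C w"
    proof (rule section_cover_pieces[OF gl(3) a(1,3)])
      show "w \<in> hom C (src w) (src q)" "w' \<in> hom C (src w) (src q)" using a a' by auto
      fix e s assume e: "e \<in> rids C (src q)" and s: "s \<in> ?I" and se: "ts s \<cdot> (q \<cdot> e) = e"
      note e' = ridsD[OF e]
      define r where "r = rst C (e \<cdot> w)"
      have r: "r \<in> rids C W" using a e' by (simp add: r_def)
      note r' = ridsD[OF r]
      have rw: "r \<cdot> rst C w = r" using rst_cmp_le(1)[of w e] a e' by (simp add: r_def)
      have 1: "w \<cdot> r = ts s \<cdot> (q \<cdot> w) \<cdot> r" using piece[OF e s se a(1,3)] by (simp add: r_def)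
      have "w \<cdot> r \<cdot> rst C w' = w' \<cdot> r \<cdot> rst C w'"
      proof (rule section_cover_pieces[OF gl(3) a'(1,3)])
        show "w \<cdot> r \<in> hom C (src w') (src q)" "w' \<cdot> r \<in> hom C (src w') (src q)" using a a' r' by auto
        fix e2 s2 assume e2: "e2 \<in> rids C (src q)" and s2: "s2 \<in> ?I" and se2: "ts s2 \<cdot> (q \<cdot> e2) = e2"
        note e2' = ridsD[OF e2]
        define d where "d = rst C (e2 \<cdot> w')"
        have d: "d \<in> rids C W" using a' e2' by (simp add: d_def)
        note d' = ridsD[OF d]
        have 2: "w' \<cdot> d = ts s2 \<cdot> (q \<cdot> w') \<cdot> d" using piece[OF e2 s2 se2 a'(1,3)] by (simp add: d_def)
        have dr: "d \<cdot> r = r \<cdot> d" using rids_comm[OF d r] .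
        note ss = psectionsD[OF s] and ss2 = psectionsD[OF s2]
        have 3: "w \<cdot> (r \<cdot> d) = ts s \<cdot> (q \<cdot> w) \<cdot> (r \<cdot> d)"
          using arg_cong[OF 1, of "\<lambda>x. x \<cdot> d"] a q(1) gl(2) t(1-3)[OF s] r' d' by simp
        have 4: "w' \<cdot> (r \<cdot> d) = ts s2 \<cdot> (q \<cdot> w) \<cdot> (r \<cdot> d)"
          using arg_cong[OF 2, of "\<lambda>x. x \<cdot> r"] a a' q(1) gl(2) t(1-3)[OF s2] r' d' dr qw by simp
        have g1: "g \<cdot> (w \<cdot> (r \<cdot> d)) = s \<cdot> (f \<cdot> (q \<cdot> w \<cdot> (r \<cdot> d)))"
          unfolding 3 using reassoc[OF gt[OF s], of "q \<cdot> w \<cdot> (r \<cdot> d)"] g t(1-3)[OF s] a q(1) gl(2) r' d' f ss tr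
          by simp
        have g2: "g \<cdot> (w' \<cdot> (r \<cdot> d)) = s2 \<cdot> (f \<cdot> (q \<cdot> w \<cdot> (r \<cdot> d)))"
          unfolding 4 using reassoc[OF gt[OF s2], of "q \<cdot> w \<cdot> (r \<cdot> d)"] g t(1-3)[OF s2] a q(1) gl(2) r' d' f ss2 tr
          by simp
        have "g \<cdot> (w \<cdot> (r \<cdot> d)) = g \<cdot> (w' \<cdot> (r \<cdot> d))"
          using reassoc[OF gw, of "r \<cdot> d"] a a' g r' d' by simp
        then have "ts s \<cdot> (q \<cdot> w) \<cdot> (r \<cdot> d) = ts s2 \<cdot> (q \<cdot> w) \<cdot> (r \<cdot> d)"
          by (intro key[OF s s2]) (use g1 g2 a q(1) gl(2) r d in auto)
        then have "w \<cdot> (r \<cdot> d) = w' \<cdot> (r \<cdot> d)" using 3 4 by simp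
        then show "w \<cdot> r \<cdot> rst C (e2 \<cdot> w') = w' \<cdot> r \<cdot> rst C (e2 \<cdot> w')"
          using a a' r' d' by (simp flip: d_def)
      qed
      then show "w \<cdot> rst C (e \<cdot> w) = w' \<cdot> rst C (e \<cdot> w)"
        using rw a a' r' by (simp flip: r_def rr)
    qed
    then show ?thesis using cmp_rst_self[OF a(1)] cmp_rst_self[OF a'(1)] rr by metis
  qed
  have "is_pullback C \<sigma> f g q"
    unfolding is_pullback_def
  proof (intro conjI ballI impI)
    fix W u v assume uv: "u \<in> hom C W (src \<sigma>)" "v \<in> hom C W (src f)" "\<sigma> \<cdot> u = f \<cdot> v"
    obtain w where w: "w \<in> hom C W (src q)" "g \<cdot> w = u" "q \<cdot> w = v" using ex[OF uv] by blast
    show "\<exists>!w. w \<in> hom C W (src g) \<and> g \<cdot> w = u \<and> q \<cdot> w = v"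
    proof (rule ex1I)
      show "w \<in> hom C W (src g) \<and> g \<cdot> w = u \<and> q \<cdot> w = v" using w g(2) by simp
      show "w' = w" if w': "w' \<in> hom C W (src g) \<and> g \<cdot> w' = u \<and> q \<cdot> w' = v" for w'
        by (rule un[of _ W]) (use w w' g(2) in auto)
    qed
  qed (use \<sigma>' f tr g q(1) gl(2) sq in auto)
  then show ?thesis by blast
qed

lemma local_homeo_pullbacks: "local_homeo C \<sigma> \<Longrightarrow> has_pullbacks_along_total C \<sigma>"
  unfolding has_pullbacks_along_total_def using pullback_exists by blast

end

section \<open>The category of sections\<close>

text \<open>Composition in an internal category on generalised elements, and its special case of the
  composite of a section with a generalised element.\<close>

definition elem_mult :: "('o, 'u) rcat \<Rightarrow> ('i, 'o, 'u) pcat \<Rightarrow> 'i \<Rightarrow> 'i \<Rightarrow> 'i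
    \<Rightarrow> ('o, 'u) arr \<Rightarrow> ('o, 'u) arr \<Rightarrow> ('o, 'u) arr" where
  "elem_mult C A i j k u v = mu A i j k \<cdot>\<^bsub>C\<^esub> pair C (sig A j k) (tau A i j) u v"

definition sec_cmp :: "('o, 'u) rcat \<Rightarrow> ('i, 'o, 'u) pcat \<Rightarrow> 'i \<Rightarrow> 'i \<Rightarrow> 'i
    \<Rightarrow> ('o, 'u) arr \<Rightarrow> ('o, 'u) arr \<Rightarrow> ('o, 'u) arr" where
  "sec_cmp C A i j k t v = mu A i j k \<cdot>\<^bsub>C\<^esub> (tstar C (sig A j k) (tau A i j) t \<cdot>\<^bsub>C\<^esub> v)"

section \<open>Internal composition on generalised elements\<close>

locale pcat_over =
  plain_join_restriction_category C + partite_category C A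
  for C :: "('o, 'u) rcat" (structure) and A :: "('i, 'o, 'u) pcat"
begin

abbreviation sec :: "'i \<Rightarrow> 'i \<Rightarrow> ('o, 'u) arr set" where
  "sec i j \<equiv> psections C (sig A i j)"

lemma sig_types [simp]:
  assumes "i \<in> idx A" "j \<in> idx A"
  shows "sig A i j \<in> arrs C" "src (sig A i j) = ob1 A i j" "trg (sig A i j) = ob0 A i"
    "tau A i j \<in> arrs C" "src (tau A i j) = ob1 A i j" "trg (tau A i j) = ob0 A j"
  using sig_hom[OF assms] tau_hom[OF assms] by auto

lemma eta_types [simp]:
  assumes "i \<in> idx A"
  shows "eta A i \<in> arrs C" "src (eta A i) = ob0 A i" "trg (eta A i) = ob1 A i i"
  using eta_hom[OF assms] by auto

lemma mu_types [simp]: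
  assumes "i \<in> idx A" "j \<in> idx A" "k \<in> idx A"
  shows "mu A i j k \<in> arrs C" "src (mu A i j k) = pbob C (sig A j k) (tau A i j)"
    "trg (mu A i j k) = ob1 A i k"
  using mu_hom[OF assms] by auto

declare ob0_obj [simp] ob1_obj [simp]

lemma sig_pb:
  assumes "j \<in> idx A" "k \<in> idx A" "total C f" "trg f = ob0 A j"
  shows "total_pb C (sig A j k) f"
proof -
  obtain p q where "is_pullback C (sig A j k) f p q"
    using sig_pullbacks[OF assms(1,2)] assms unfolding has_pullbacks_along_total_def by auto
  then show ?thesis
    using has_pbI sig_total[OF assms(1,2)] assms(3) unfolding total_pb_def by blast
qed

lemma tau_pb: "\<lbrakk>i \<in> idx A; j \<in> idx A; k \<in> idx A\<rbrakk> \<Longrightarrow> total_pb C (sig A j k) (tau A i j)"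
  by (rule sig_pb) (auto simp: tau_total)

lemma tau_pb_types [simp]:
  assumes "i \<in> idx A" "j \<in> idx A" "k \<in> idx A"
  shows "pr1 C (sig A j k) (tau A i j) \<in> arrs C"
    "src (pr1 C (sig A j k) (tau A i j)) = pbob C (sig A j k) (tau A i j)"
    "trg (pr1 C (sig A j k) (tau A i j)) = ob1 A j k"
    "pr2 C (sig A j k) (tau A i j) \<in> arrs C"
    "src (pr2 C (sig A j k) (tau A i j)) = pbob C (sig A j k) (tau A i j)"
    "trg (pr2 C (sig A j k) (tau A i j)) = ob1 A i j"
    "pbob C (sig A j k) (tau A i j) \<in> obj C"
  using pb_types[OF total_pbD(1)[OF tau_pb[OF assms]]] assms by auto

text \<open>The internal laws are stated on universal pullbacks; here are their consequences for
  arbitrary composable pairs. The last item, stability under precomposition, is what allows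
  universal instances to be specialised.\<close>

lemma elem_mult_props:
  assumes i: "i \<in> idx A" "j \<in> idx A" "k \<in> idx A"
    and u: "u \<in> arrs C" "trg u = ob1 A j k" and v: "v \<in> arrs C" "trg v = ob1 A i j" "src u = src v"
    and uv: "sig A j k \<cdot> u = tau A i j \<cdot> v"
  shows "elem_mult C A i j k u v \<in> arrs C" "src (elem_mult C A i j k u v) = src v"
    "trg (elem_mult C A i j k u v) = ob1 A i k"
    "sig A i k \<cdot> elem_mult C A i j k u v = sig A i j \<cdot> v"
    "tau A i k \<cdot> elem_mult C A i j k u v = tau A j k \<cdot> u"
    "rst C (elem_mult C A i j k u v) = rst C v"
    "\<lbrakk>x \<in> arrs C; trg x = src v\<rbrakk> \<Longrightarrow> elem_mult C A i j k u v \<cdot> x = elem_mult C A i j k (u \<cdot> x) (v \<cdot> x)"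
proof -
  note tp = tau_pb[OF i]
  note pb = total_pbD(1)[OF tp]
  have c: "u \<in> arrs C" "v \<in> arrs C" "src u = src v" "trg u = src (sig A j k)" "trg v = src (tau A i j)"
    using u v i by auto
  note pp = pair_props[OF pb c uv]
  show 1: "elem_mult C A i j k u v \<in> arrs C" "src (elem_mult C A i j k u v) = src v"
    "trg (elem_mult C A i j k u v) = ob1 A i k"
    using pp(1-3) i v by (auto simp: elem_mult_def)
  show 2: "sig A i k \<cdot> elem_mult C A i j k u v = sig A i j \<cdot> v"
    using reassoc[OF sig_mu[OF i], of "pair C (sig A j k) (tau A i j) u v"] pp i by (simp add: elem_mult_def)
  show "tau A i k \<cdot> elem_mult C A i j k u v = tau A j k \<cdot> u"
    using reassoc[OF tau_mu[OF i], of "pair C (sig A j k) (tau A i j) u v"] pp i by (simp add: elem_mult_def)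
  show "rst C (elem_mult C A i j k u v) = rst C v"
    using rst_eq_of_square[OF sig_total sig_total _ _ _ _ 2] 1 i v by simp
  show "elem_mult C A i j k u v \<cdot> x = elem_mult C A i j k (u \<cdot> x) (v \<cdot> x)" if "x \<in> arrs C" "trg x = src v"
    using pair_cmp[OF pb c uv that(1)] that v(3) pp(1-3) i by (simp add: elem_mult_def)
qed

text \<open>The axiom is the case of the identity element of the object of arrows; precomposing it
  with \<open>u\<close> gives the general one.\<close>

lemma elem_mult_unit_right:
  assumes i: "i \<in> idx A" "j \<in> idx A" and u: "u \<in> arrs C" "trg u = ob1 A i j"
  shows "elem_mult C A i i j u (eta A i \<cdot> (sig A i j \<cdot> u)) = u"
proof -
  have uv: "sig A i j \<cdot> idn C (ob1 A i j) = tau A i i \<cdot> (eta A i \<cdot> sig A i j)"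
    using reassoc[OF tau_eta[OF i(1)], of "sig A i j"] i by simp
  have "elem_mult C A i i j u (eta A i \<cdot> (sig A i j \<cdot> u))
      = elem_mult C A i i j (idn C (ob1 A i j)) (eta A i \<cdot> sig A i j) \<cdot> u"
    using elem_mult_props(7)[OF i(1) i _ _ _ _ _ uv, of u] i u by simp
  then show ?thesis using mu_unit_right[OF i] u by (simp add: elem_mult_def)
qed

lemma elem_mult_unit_left:
  assumes i: "i \<in> idx A" "j \<in> idx A" and v: "v \<in> arrs C" "trg v = ob1 A i j"
  shows "elem_mult C A i j j (eta A j \<cdot> (tau A i j \<cdot> v)) v = v"
proof -
  have uv: "sig A j j \<cdot> (eta A j \<cdot> tau A i j) = tau A i j \<cdot> idn C (ob1 A i j)"
    using reassoc[OF sig_eta[OF i(2)], of "tau A i j"] i by simp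
  have "elem_mult C A i j j (eta A j \<cdot> (tau A i j \<cdot> v)) v
      = elem_mult C A i j j (eta A j \<cdot> tau A i j) (idn C (ob1 A i j)) \<cdot> v"
    using elem_mult_props(7)[OF i i(2) _ _ _ _ _ uv, of v] i v by simp
  then show ?thesis using mu_unit_left[OF i] v by (simp add: elem_mult_def)
qed

text \<open>The axiom concerns the three projections of the iterated pullback. A composable triple
  amounts to a map \<open>x\<close> into it, and precomposing the axiom with \<open>x\<close> gives
  the claim.\<close>

lemma elem_mult_assoc:
  assumes i: "i \<in> idx A" "j \<in> idx A" "k \<in> idx A" "l \<in> idx A"
    and u: "u \<in> arrs C" "trg u = ob1 A k l" and v: "v \<in> arrs C" "trg v = ob1 A j k" "src u = src v"
    and w: "w \<in> arrs C" "trg w = ob1 A i j" "src v = src w"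
    and uv: "sig A k l \<cdot> u = tau A j k \<cdot> v" and vw: "sig A j k \<cdot> v = tau A i j \<cdot> w"
  shows "elem_mult C A i k l u (elem_mult C A i j k v w) = elem_mult C A i j l (elem_mult C A j k l u v) w"
proof -
  define P where "P = pr1 C (sig A j k) (tau A i j)"
  define Q where "Q = pr2 C (sig A j k) (tau A i j)"
  define D where "D = pbob C (sig A j k) (tau A i j)"
  have P: "P \<in> arrs C" "src P = D" "trg P = ob1 A j k" and Q: "Q \<in> arrs C" "src Q = D" "trg Q = ob1 A i j"
    and D: "D \<in> obj C"
    using i by (auto simp: P_def Q_def D_def)
  note tp1 = tau_pb[OF i(1-3)]
  note pb1 = total_pbD(1)[OF tp1]
  have "total C (tau A j k \<cdot> P)"
    using total_cmp[of P "tau A j k"] total_pbD(4)[OF tp1] tau_total[OF i(2,3)] i P by (simp add: P_def)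
  then have tp2: "total_pb C (sig A k l) (tau A j k \<cdot> P)"
    by (rule sig_pb[OF i(3,4)]) (use P i in auto)
  note pb2 = total_pbD(1)[OF tp2]
  define a where "a = pr1 C (sig A k l) (tau A j k \<cdot> P)"
  define b where "b = pr2 C (sig A k l) (tau A j k \<cdot> P)"
  define E where "E = pbob C (sig A k l) (tau A j k \<cdot> P)"
  have a: "a \<in> arrs C" "src a = E" "trg a = ob1 A k l" and b: "b \<in> arrs C" "src b = E" "trg b = D"
    and sq: "sig A k l \<cdot> a = tau A j k \<cdot> (P \<cdot> b)" and E: "E \<in> obj C"
    using pb_types[OF pb2] i P by (auto simp: a_def b_def E_def)
  have PQ: "sig A j k \<cdot> P = tau A i j \<cdot> Q" using pb_types(10)[OF pb1] by (simp add: P_def Q_def)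
  have vw': "v \<in> arrs C" "w \<in> arrs C" "src v = src w" "trg v = src (sig A j k)" "trg w = src (tau A i j)"
    using v w i by auto
  define y where "y = pair C (sig A j k) (tau A i j) v w"
  note y = pair_props[OF pb1 vw' vw, folded y_def P_def Q_def D_def]
  have uy: "u \<in> arrs C" "y \<in> arrs C" "src u = src y" "trg u = src (sig A k l)" "trg y = src (tau A j k \<cdot> P)"
    "sig A k l \<cdot> u = tau A j k \<cdot> P \<cdot> y"
    using u v y P i uv by auto
  define x where "x = pair C (sig A k l) (tau A j k \<cdot> P) u y"
  note x = pair_props[OF pb2 uy, folded x_def a_def b_def E_def]
  have law: "mu A i k l \<cdot> pair C (sig A k l) (tau A i k) a (mu A i j k \<cdot> b)
      = mu A i j l \<cdot> pair C (sig A j l) (tau A i j)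
          (mu A j k l \<cdot> pair C (sig A k l) (tau A j k) a (P \<cdot> b)) (Q \<cdot> b)"
    by (rule mu_assoc[OF i]) (simp_all add: a_def b_def P_def Q_def)
  have mb: "mu A i j k \<cdot> b \<in> arrs C" "src (mu A i j k \<cdot> b) = E" "trg (mu A i j k \<cdot> b) = ob1 A i k"
    using b i D_def by auto
  have "tau A i k \<cdot> mu A i j k = tau A j k \<cdot> P" using tau_mu[OF i(1-3)] by (simp add: P_def)
  then have m1: "sig A k l \<cdot> a = tau A i k \<cdot> (mu A i j k \<cdot> b)"
    using reassoc[of "tau A i k" "mu A i j k" "tau A j k \<cdot> P" b] sq b P i D_def by simp
  have m2: "sig A j k \<cdot> (P \<cdot> b) = tau A i j \<cdot> (Q \<cdot> b)" using reassoc[OF PQ, of b] P Q b i by simp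
  have muy: "mu A i j k \<cdot> b \<cdot> x = elem_mult C A i j k v w"
    using x b i D_def by (simp add: elem_mult_def flip: y_def)
  have "elem_mult C A i k l a (mu A i j k \<cdot> b) \<cdot> x = elem_mult C A i k l (a \<cdot> x) (mu A i j k \<cdot> b \<cdot> x)"
    by (rule elem_mult_props(7)) (use i a mb m1 x in auto)
  then have L: "elem_mult C A i k l a (mu A i j k \<cdot> b) \<cdot> x = elem_mult C A i k l u (elem_mult C A i j k v w)"
    using x muy by simp
  have Pb: "P \<cdot> b \<in> arrs C" "src (P \<cdot> b) = E" "trg (P \<cdot> b) = ob1 A j k" "P \<cdot> b \<cdot> x = v"
    and Qb: "Q \<cdot> b \<in> arrs C" "src (Q \<cdot> b) = E" "trg (Q \<cdot> b) = ob1 A i j" "Q \<cdot> b \<cdot> x = w"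
    using P Q b x y by auto
  note g = elem_mult_props[OF i(2-4) a(1,3) Pb(1,3) _ sq]
  have g2: "sig A j l \<cdot> elem_mult C A j k l a (P \<cdot> b) = tau A i j \<cdot> (Q \<cdot> b)"
    using g(4) m2 a Pb by simp
  have "elem_mult C A i j l (elem_mult C A j k l a (P \<cdot> b)) (Q \<cdot> b) \<cdot> x
      = elem_mult C A i j l (elem_mult C A j k l a (P \<cdot> b) \<cdot> x) (Q \<cdot> b \<cdot> x)"
    by (rule elem_mult_props(7)) (use i a g(1-3) g2 Pb Qb x in auto)
  also have "elem_mult C A j k l a (P \<cdot> b) \<cdot> x = elem_mult C A j k l (a \<cdot> x) (P \<cdot> b \<cdot> x)"
    by (rule g(7)) (use a Pb x in auto)
  finally have "elem_mult C A i j l (elem_mult C A j k l a (P \<cdot> b)) (Q \<cdot> b) \<cdot> x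
      = elem_mult C A i j l (elem_mult C A j k l u v) w"
    using x Pb Qb by simp
  then show ?thesis using L law by (simp add: elem_mult_def)
qed

section \<open>Composition of partial sections\<close>

lemma secD:
  assumes "s \<in> sec i j" "i \<in> idx A" "j \<in> idx A"
  shows "s \<in> arrs C" "src s = ob0 A i" "trg s = ob1 A i j" "sig A i j \<cdot> s = rst C s"
  using psectionsD[OF assms(1)] assms(2,3) by auto

text \<open>The composite exists only where \<open>t\<close> is defined after the target of
  \<open>v\<close>, so the second factor has to be cut down to that domain. The laws for elements
  thereby become available for sections.\<close>

lemma sec_cmp_elem_mult:
  assumes i: "i \<in> idx A" "j \<in> idx A" "k \<in> idx A" and t: "t \<in> sec j k"
    and v: "v \<in> arrs C" "trg v = ob1 A i j"
  shows "sec_cmp C A i j k t v = elem_mult C A i j k (t \<cdot> (tau A i j \<cdot> v)) (v \<cdot> rst C (t \<cdot> (tau A i j \<cdot> v)))"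
    "sig A j k \<cdot> (t \<cdot> (tau A i j \<cdot> v)) = tau A i j \<cdot> (v \<cdot> rst C (t \<cdot> (tau A i j \<cdot> v)))"
proof -
  note t' = secD[OF t i(2,3)]
  show "sec_cmp C A i j k t v = elem_mult C A i j k (t \<cdot> (tau A i j \<cdot> v)) (v \<cdot> rst C (t \<cdot> (tau A i j \<cdot> v)))"
    using tstar_cmp[OF tau_pb[OF i] t v(1)] v i by (simp add: sec_cmp_def elem_mult_def)
  show "sig A j k \<cdot> (t \<cdot> (tau A i j \<cdot> v)) = tau A i j \<cdot> (v \<cdot> rst C (t \<cdot> (tau A i j \<cdot> v)))"
    using reassoc[OF t'(4), of "tau A i j \<cdot> v"] rst_slide[of "tau A i j \<cdot> v" t] t' v i by simp
qed

lemma sec_cmp_props: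
  assumes i: "i \<in> idx A" "j \<in> idx A" "k \<in> idx A" and t: "t \<in> sec j k"
    and v: "v \<in> arrs C" "trg v = ob1 A i j"
  shows "sec_cmp C A i j k t v \<in> arrs C" "src (sec_cmp C A i j k t v) = src v"
    "trg (sec_cmp C A i j k t v) = ob1 A i k"
    "tau A i k \<cdot> sec_cmp C A i j k t v = tau A j k \<cdot> (t \<cdot> (tau A i j \<cdot> v))"
    "rst C (sec_cmp C A i j k t v) = rst C (t \<cdot> (tau A i j \<cdot> v))"
    "\<lbrakk>x \<in> arrs C; trg x = src v\<rbrakk> \<Longrightarrow> sec_cmp C A i j k t v \<cdot> x = sec_cmp C A i j k t (v \<cdot> x)"
proof -
  note t' = secD[OF t i(2,3)]
  note sg = sec_cmp_elem_mult[OF i t v]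
  let ?e = "rst C (t \<cdot> (tau A i j \<cdot> v))"
  have c: "t \<cdot> (tau A i j \<cdot> v) \<in> arrs C" "trg (t \<cdot> (tau A i j \<cdot> v)) = ob1 A j k"
    "v \<cdot> ?e \<in> arrs C" "trg (v \<cdot> ?e) = ob1 A i j" "src (t \<cdot> (tau A i j \<cdot> v)) = src (v \<cdot> ?e)"
    "src (v \<cdot> ?e) = src v"
    using t' v i by auto
  note g = elem_mult_props[OF i c(1-5) sg(2), folded sg(1)]
  show "sec_cmp C A i j k t v \<in> arrs C" "src (sec_cmp C A i j k t v) = src v"
    "trg (sec_cmp C A i j k t v) = ob1 A i k"
    "tau A i k \<cdot> sec_cmp C A i j k t v = tau A j k \<cdot> (t \<cdot> (tau A i j \<cdot> v))"
    using g c(6) by auto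
  have "rst C (v \<cdot> ?e) = rst C v \<cdot> ?e" using rst_cmp_rid[of v ?e] t' v i by simp
  also have "\<dots> = ?e" using rst_cmp_le(2)[of v "t \<cdot> tau A i j"] t' v i by simp
  finally show "rst C (sec_cmp C A i j k t v) = ?e" using g(6) by simp
  have ts: "tstar C (sig A j k) (tau A i j) t \<in> arrs C" "src (tstar C (sig A j k) (tau A i j) t) = ob1 A i j"
    "trg (tstar C (sig A j k) (tau A i j) t) = pbob C (sig A j k) (tau A i j)"
    using tstar_props(1-3)[OF tau_pb[OF i] t] i by auto
  show "sec_cmp C A i j k t v \<cdot> x = sec_cmp C A i j k t (v \<cdot> x)" if "x \<in> arrs C" "trg x = src v"
    using ts that v i by (simp add: sec_cmp_def)
qed

lemma sec_cmp_sec: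
  assumes i: "i \<in> idx A" "j \<in> idx A" "k \<in> idx A" and t: "t \<in> sec j k" and s: "s \<in> sec i j"
  shows "sec_cmp C A i j k t s \<in> sec i k"
proof -
  note t' = secD[OF t i(2,3)] and s' = secD[OF s i(1,2)]
  note p = sec_cmp_props[OF i t s'(1,3)] and sg = sec_cmp_elem_mult[OF i t s'(1,3)]
  let ?e = "rst C (t \<cdot> (tau A i j \<cdot> s))"
  have c: "t \<cdot> (tau A i j \<cdot> s) \<in> arrs C" "trg (t \<cdot> (tau A i j \<cdot> s)) = ob1 A j k"
    "s \<cdot> ?e \<in> arrs C" "trg (s \<cdot> ?e) = ob1 A i j" "src (t \<cdot> (tau A i j \<cdot> s)) = src (s \<cdot> ?e)"
    using t' s' i by auto
  have "sig A i k \<cdot> sec_cmp C A i j k t s = sig A i j \<cdot> (s \<cdot> ?e)"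
    using elem_mult_props(4)[OF i c sg(2), folded sg(1)] .
  also have "\<dots> = rst C s \<cdot> ?e" using reassoc[OF s'(4), of ?e] s' t' i by simp
  also have "\<dots> = ?e" using rst_cmp_le(2)[of s "t \<cdot> tau A i j"] t' s' i by simp
  finally show ?thesis using p s' i by (simp add: psections_def)
qed

text \<open>With everything cut down to the domain \<open>e\<close> of the full composite, both
  sides are products of the same three elements, so \<open>elem_mult_assoc\<close> applies.\<close>

lemma sec_cmp_assoc:
  assumes i: "i \<in> idx A" "j \<in> idx A" "k \<in> idx A" "l \<in> idx A"
    and u: "u \<in> sec k l" and t: "t \<in> sec j k" and s: "s \<in> arrs C" "trg s = ob1 A i j"
  shows "sec_cmp C A i j l (sec_cmp C A j k l u t) s = sec_cmp C A i k l u (sec_cmp C A i j k t s)"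
proof -
  note u' = secD[OF u i(3,4)] and t' = secD[OF t i(2,3)]
  have ut: "sec_cmp C A j k l u t \<in> sec j l" by (rule sec_cmp_sec[OF i(2-4) u t])
  define z where "z = t \<cdot> (tau A i j \<cdot> s)"
  have z: "z \<in> arrs C" "src z = src s" "trg z = ob1 A j k" using t' s i by (auto simp: z_def)
  define e where "e = rst C (u \<cdot> (tau A j k \<cdot> z))"
  have e: "e \<in> arrs C" "src e = src s" "trg e = src s" "e \<in> rids C (src s)"
    using u' z i by (auto simp: e_def)
  note p1 = sec_cmp_props[OF i(1-3) t s, folded z_def]
  have 1: "sec_cmp C A j k l u t \<cdot> (tau A i j \<cdot> s) = sec_cmp C A j k l u z"
    using sec_cmp_props(6)[OF i(2-4) u t'(1,3), of "tau A i j \<cdot> s"] s t' i by (simp add: z_def)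
  have 2: "rst C (sec_cmp C A j k l u z) = e"
    using sec_cmp_props(5)[OF i(2-4) u z(1,3)] by (simp add: e_def)
  have L: "sec_cmp C A i j l (sec_cmp C A j k l u t) s = elem_mult C A i j l (sec_cmp C A j k l u z) (s \<cdot> e)"
    using sec_cmp_elem_mult(1)[OF i(1,2,4) ut s] by (simp add: 1 2)
  have L2: "sec_cmp C A j k l u z = elem_mult C A j k l (u \<cdot> (tau A j k \<cdot> z)) (z \<cdot> e)"
    using sec_cmp_elem_mult(1)[OF i(2-4) u z(1,3)] by (simp add: e_def)
  have R: "sec_cmp C A i k l u (sec_cmp C A i j k t s)
      = elem_mult C A i k l (u \<cdot> (tau A j k \<cdot> z)) (sec_cmp C A i j k t s \<cdot> e)"
    using sec_cmp_elem_mult(1)[OF i(1,3,4) u p1(1,3)] p1(4) by (simp add: e_def)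
  have ze: "rst C z \<cdot> e = e" using rst_cmp_le(2)[of z "u \<cdot> tau A j k"] u' z i by (simp add: e_def)
  have c: "z \<in> arrs C" "trg z = ob1 A j k" "s \<cdot> rst C z \<in> arrs C" "trg (s \<cdot> rst C z) = ob1 A i j"
    "src z = src (s \<cdot> rst C z)" using z s by auto
  note sg = sec_cmp_elem_mult[OF i(1-3) t s, folded z_def]
  have R2: "sec_cmp C A i j k t s \<cdot> e = elem_mult C A i j k (z \<cdot> e) (s \<cdot> e)"
    using elem_mult_props(7)[OF i(1-3) c sg(2), of e] e z s ze by (simp add: sg(1))
  have v1: "sig A k l \<cdot> (u \<cdot> (tau A j k \<cdot> z)) = tau A j k \<cdot> (z \<cdot> e)"
    using sec_cmp_elem_mult(2)[OF i(2-4) u z(1,3)] by (simp add: e_def)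
  have v2: "sig A j k \<cdot> (z \<cdot> e) = tau A i j \<cdot> (s \<cdot> e)"
    using reassoc[OF sg(2), of e] z s e ze i by simp
  have "elem_mult C A i k l (u \<cdot> (tau A j k \<cdot> z)) (elem_mult C A i j k (z \<cdot> e) (s \<cdot> e))
      = elem_mult C A i j l (elem_mult C A j k l (u \<cdot> (tau A j k \<cdot> z)) (z \<cdot> e)) (s \<cdot> e)"
    by (rule elem_mult_assoc[OF i _ _ _ _ _ _ _ _ v1 v2]) (use u' z s e i in auto)
  then show ?thesis by (simp only: L L2 R R2)
qed

text \<open>\<open>sig A i i\<close> is total, so \<open>eta A i\<close> has the same domain as its
  composite with it, which is an identity.\<close>

lemma eta_sec [simp]: "i \<in> idx A \<Longrightarrow> eta A i \<in> sec i i"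
  and eta_rst: "i \<in> idx A \<Longrightarrow> rst C (eta A i) = idn C (ob0 A i)"
proof -
  assume i: "i \<in> idx A"
  show "rst C (eta A i) = idn C (ob0 A i)"
    using total_cmp_rst[of "eta A i" "sig A i i"] sig_total[OF i i] sig_eta[OF i] i by simp
  then show "eta A i \<in> sec i i" using sig_eta[OF i] i by (simp add: psections_def)
qed

lemma eta_rid_sec: "\<lbrakk>i \<in> idx A; e \<in> rids C (ob0 A i)\<rbrakk> \<Longrightarrow> eta A i \<cdot> e \<in> sec i i"
  using psections_restrict[OF eta_sec] by simp

text \<open>By \<open>tstar_restrict\<close> the idempotent \<open>d\<close> becomes a preimage on
  arrows, and sliding it past \<open>v\<close> turns it into a preimage on the domain of
  \<open>v\<close>.\<close>

lemma sec_cmp_restrict_left: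
  assumes i: "i \<in> idx A" "j \<in> idx A" "k \<in> idx A" and t: "t \<in> sec j k"
    and v: "v \<in> arrs C" "trg v = ob1 A i j" and d: "d \<in> rids C (ob0 A j)"
  shows "sec_cmp C A i j k (t \<cdot> d) v = sec_cmp C A i j k t v \<cdot> rst C (d \<cdot> (tau A i j \<cdot> v))"
proof -
  note d' = ridsD[OF d]
  have ts: "tstar C (sig A j k) (tau A i j) t \<in> arrs C" "src (tstar C (sig A j k) (tau A i j) t) = ob1 A i j"
    "trg (tstar C (sig A j k) (tau A i j) t) = pbob C (sig A j k) (tau A i j)"
    using tstar_props(1-3)[OF tau_pb[OF i] t] i by auto
  have "rst C (d \<cdot> tau A i j) \<cdot> v = v \<cdot> rst C (d \<cdot> (tau A i j \<cdot> v))"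
    using rst_slide[of v "d \<cdot> tau A i j"] d' v i by simp
  then show ?thesis
    using tstar_restrict[OF tau_pb[OF i] t, of d] d d' ts v i by (simp add: sec_cmp_def)
qed

lemma sec_cmp_eta_left:
  assumes i: "i \<in> idx A" "j \<in> idx A" and v: "v \<in> arrs C" "trg v = ob1 A i j"
  shows "sec_cmp C A i j j (eta A j) v = v"
proof -
  have "rst C (eta A j \<cdot> (tau A i j \<cdot> v)) = rst C v"
    using total_cmp_rst[of "tau A i j \<cdot> v" "eta A j"] total_cmp_rst[of v "tau A i j"]
      eta_rst tau_total[OF i] i v by (simp add: total_def)
  then show ?thesis
    using sec_cmp_elem_mult(1)[OF i i(2) eta_sec[OF i(2)] v] elem_mult_unit_left[OF i v] v by simp
qed

lemma sec_cmp_eta_right: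
  assumes i: "i \<in> idx A" "j \<in> idx A" and s: "s \<in> sec i j"
  shows "sec_cmp C A i i j s (eta A i) = s"
proof -
  note s' = secD[OF s i]
  have "tau A i i \<cdot> eta A i = idn C (ob0 A i)" by (rule tau_eta[OF i(1)])
  then show ?thesis
    using sec_cmp_elem_mult(1)[OF i(1) i s, of "eta A i"] elem_mult_unit_right[OF i s'(1,3)] s' i by simp
qed

lemma sec_cmp_rid_left:
  assumes i: "i \<in> idx A" "j \<in> idx A" and v: "v \<in> arrs C" "trg v = ob1 A i j" and d: "d \<in> rids C (ob0 A j)"
  shows "sec_cmp C A i j j (eta A j \<cdot> d) v = v \<cdot> rst C (d \<cdot> (tau A i j \<cdot> v))"
  using sec_cmp_restrict_left[OF i i(2) eta_sec[OF i(2)] v d] sec_cmp_eta_left[OF i v] by simp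

lemma sec_cmp_rid_right:
  assumes i: "i \<in> idx A" "j \<in> idx A" and s: "s \<in> sec i j" and e: "e \<in> rids C (ob0 A i)"
  shows "sec_cmp C A i i j s (eta A i \<cdot> e) = s \<cdot> e"
  using sec_cmp_props(6)[OF i(1) i s, of "eta A i" e] sec_cmp_eta_right[OF i s] i ridsD[OF e] by simp


section \<open>Sections as arrows of a restriction category\<close>

lemma sec_arr_the_sec [simp]: "sec_arr (src x) (trg x) (the_sec A x) = x"
  by (rule arr_eqI) (auto simp: sec_arr_def the_sec_def)

lemma the_sec_sec_arr [simp]:
  assumes "s \<in> arrs C" "src s = ob0 A i" "trg s = ob1 A i j"
  shows "the_sec A (sec_arr i j s) = s"
  by (rule arr_eqI) (use assms in \<open>auto simp: sec_arr_def the_sec_def\<close>)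

lemma sec_arr_types [simp]: "src (sec_arr i j s) = i" "trg (sec_arr i j s) = j"
  by (auto simp: sec_arr_def)

lemma Phi_eqI: "\<lbrakk>src x = src y; trg x = trg y; the_sec A x = the_sec A y\<rbrakk> \<Longrightarrow> x = y"
  by (rule arr_eqI) (auto simp: the_sec_def)

lemma Phi_arrs: "x \<in> arrs (Phi_cat C A) \<longleftrightarrow>
    src x \<in> idx A \<and> trg x \<in> idx A \<and> the_sec A x \<in> sec (src x) (trg x)"
proof
  assume "x \<in> arrs (Phi_cat C A)"
  then obtain i j s where x: "x = sec_arr i j s" and i: "i \<in> idx A" "j \<in> idx A" and s: "s \<in> sec i j"
    by (auto simp: Phi_cat_def)
  show "src x \<in> idx A \<and> trg x \<in> idx A \<and> the_sec A x \<in> sec (src x) (trg x)"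
    using secD[OF s i] s i by (simp add: x)
next
  assume *: "src x \<in> idx A \<and> trg x \<in> idx A \<and> the_sec A x \<in> sec (src x) (trg x)"
  have "x = sec_arr (src x) (trg x) (the_sec A x)" by simp
  then show "x \<in> arrs (Phi_cat C A)"
    unfolding Phi_cat_def using * by (simp del: sec_arr_the_sec) blast
qed

lemma Phi_obj [simp]: "obj (Phi_cat C A) = idx A"
  by (simp add: Phi_cat_def)

lemma Phi_sec:
  assumes "x \<in> arrs (Phi_cat C A)"
  shows "src x \<in> idx A" "trg x \<in> idx A" "the_sec A x \<in> sec (src x) (trg x)"
    "the_sec A x \<in> arrs C" "src (the_sec A x) = ob0 A (src x)" "trg (the_sec A x) = ob1 A (src x) (trg x)"
    "sig A (src x) (trg x) \<cdot> the_sec A x = rst C (the_sec A x)"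
  using assms secD[of "the_sec A x" "src x" "trg x"] unfolding Phi_arrs by auto

lemma sec_arr_in_Phi: "\<lbrakk>i \<in> idx A; j \<in> idx A; s \<in> sec i j\<rbrakk> \<Longrightarrow> sec_arr i j s \<in> arrs (Phi_cat C A)"
  unfolding Phi_cat_def by auto

lemma Phi_idn:
  assumes "i \<in> idx A"
  shows "idn (Phi_cat C A) i \<in> arrs (Phi_cat C A)" "src (idn (Phi_cat C A) i) = i"
    "trg (idn (Phi_cat C A) i) = i" "the_sec A (idn (Phi_cat C A) i) = eta A i"
proof -
  have 1: "idn (Phi_cat C A) i = sec_arr i i (eta A i)" by (simp add: Phi_cat_def)
  show "idn (Phi_cat C A) i \<in> arrs (Phi_cat C A)" "src (idn (Phi_cat C A) i) = i"
    "trg (idn (Phi_cat C A) i) = i" "the_sec A (idn (Phi_cat C A) i) = eta A i"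
    using assms sec_arr_in_Phi[of i i "eta A i"] by (auto simp: 1)
qed

lemma Phi_cmp:
  assumes "x \<in> arrs (Phi_cat C A)" "y \<in> arrs (Phi_cat C A)" "trg x = src y"
  shows "y \<cdot>\<^bsub>Phi_cat C A\<^esub> x \<in> arrs (Phi_cat C A)" "src (y \<cdot>\<^bsub>Phi_cat C A\<^esub> x) = src x"
    "trg (y \<cdot>\<^bsub>Phi_cat C A\<^esub> x) = trg y"
    "the_sec A (y \<cdot>\<^bsub>Phi_cat C A\<^esub> x) = sec_cmp C A (src x) (src y) (trg y) (the_sec A y) (the_sec A x)"
proof -
  note x = Phi_sec[OF assms(1)] and y = Phi_sec[OF assms(2)]
  have i: "src x \<in> idx A" "src y \<in> idx A" "trg y \<in> idx A" using x y by auto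
  have xs: "the_sec A x \<in> sec (src x) (src y)" using x assms(3) by simp
  let ?s = "sec_cmp C A (src x) (src y) (trg y) (the_sec A y) (the_sec A x)"
  have s: "?s \<in> sec (src x) (trg y)" by (rule sec_cmp_sec[OF i y(3) xs])
  have ts: "tstar C (sig A (src y) (trg y)) (tau A (src x) (src y)) (the_sec A y) \<in> arrs C"
    "src (tstar C (sig A (src y) (trg y)) (tau A (src x) (src y)) (the_sec A y)) = ob1 A (src x) (src y)"
    "trg (tstar C (sig A (src y) (trg y)) (tau A (src x) (src y)) (the_sec A y))
      = pbob C (sig A (src y) (trg y)) (tau A (src x) (src y))"
    using tstar_props(1-3)[OF tau_pb[OF i] y(3)] i by auto
  have 1: "y \<cdot>\<^bsub>Phi_cat C A\<^esub> x = sec_arr (src x) (trg y) ?s"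
    using x(4-6) ts i assms(3) by (simp add: Phi_cat_def sec_cmp_def Let_def)
  show "y \<cdot>\<^bsub>Phi_cat C A\<^esub> x \<in> arrs (Phi_cat C A)" "src (y \<cdot>\<^bsub>Phi_cat C A\<^esub> x) = src x"
    "trg (y \<cdot>\<^bsub>Phi_cat C A\<^esub> x) = trg y"
    "the_sec A (y \<cdot>\<^bsub>Phi_cat C A\<^esub> x) = ?s"
    unfolding 1 using sec_arr_in_Phi[OF i(1,3) s] secD[OF s i(1,3)] by auto
qed

lemma Phi_rst:
  assumes "x \<in> arrs (Phi_cat C A)"
  shows "rst (Phi_cat C A) x \<in> arrs (Phi_cat C A)" "src (rst (Phi_cat C A) x) = src x"
    "trg (rst (Phi_cat C A) x) = src x"
    "the_sec A (rst (Phi_cat C A) x) = eta A (src x) \<cdot> rst C (the_sec A x)"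
proof -
  note x = Phi_sec[OF assms]
  have 1: "rst (Phi_cat C A) x = sec_arr (src x) (src x) (eta A (src x) \<cdot> rst C (the_sec A x))"
    by (simp add: Phi_cat_def)
  have s: "eta A (src x) \<cdot> rst C (the_sec A x) \<in> sec (src x) (src x)"
    using eta_rid_sec[OF x(1)] x by simp
  show "rst (Phi_cat C A) x \<in> arrs (Phi_cat C A)" "src (rst (Phi_cat C A) x) = src x"
    "trg (rst (Phi_cat C A) x) = src x"
    "the_sec A (rst (Phi_cat C A) x) = eta A (src x) \<cdot> rst C (the_sec A x)"
    unfolding 1 using sec_arr_in_Phi[OF x(1,1) s] secD[OF s x(1,1)] by auto
qed

lemma eta_rid_rst: "\<lbrakk>i \<in> idx A; e \<in> rids C (ob0 A i)\<rbrakk> \<Longrightarrow> rst C (eta A i \<cdot> e) = e"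
  using rst_cmp_rid[of "eta A i" e] eta_rst ridsD[of e "ob0 A i"] by simp

lemma tau_eta_rid: "\<lbrakk>i \<in> idx A; x \<in> arrs C; trg x = ob0 A i\<rbrakk> \<Longrightarrow> tau A i i \<cdot> (eta A i \<cdot> x) = x"
  using reassoc[OF tau_eta, of i x] by simp

text \<open>A restriction idempotent among sections is the unit cut down to an idempotent of the
  base, and as a right factor it acts by cutting down. The restriction axioms thus reduce to those
  of \<open>C\<close>.\<close>

lemma Phi_cmp_rst:
  assumes "x \<in> arrs (Phi_cat C A)" "y \<in> arrs (Phi_cat C A)" "src x = src y"
  shows "the_sec A (y \<cdot>\<^bsub>Phi_cat C A\<^esub> rst (Phi_cat C A) x) = the_sec A y \<cdot> rst C (the_sec A x)"
  using Phi_cmp(4)[OF Phi_rst(1)[OF assms(1)] assms(2)] Phi_rst(2-4)[OF assms(1)]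
    Phi_sec[OF assms(1)] Phi_sec[OF assms(2)] assms(3)
    sec_cmp_rid_right[of "src y" "trg y" "the_sec A y" "rst C (the_sec A x)"] by simp

lemma Phi_category: "category (Phi_cat C A)"
proof
  show "src f \<in> obj (Phi_cat C A)" "trg f \<in> obj (Phi_cat C A)" if "f \<in> arrs (Phi_cat C A)" for f
    using Phi_sec[OF that] by auto
  show "idn (Phi_cat C A) i \<in> hom (Phi_cat C A) i i" if "i \<in> obj (Phi_cat C A)" for i
    using Phi_idn that by simp
  show "g \<cdot>\<^bsub>Phi_cat C A\<^esub> f \<in> hom (Phi_cat C A) X Z"
    if "f \<in> hom (Phi_cat C A) X Y" "g \<in> hom (Phi_cat C A) Y Z" for f g X Y Z
    using Phi_cmp[of f g] that by simp
  show "idn (Phi_cat C A) Y \<cdot>\<^bsub>Phi_cat C A\<^esub> f = f" if f: "f \<in> hom (Phi_cat C A) X Y" for f X Y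
  proof -
    have f': "f \<in> arrs (Phi_cat C A)" "src f = X" "trg f = Y" using f by auto
    note fs = Phi_sec[OF f'(1), unfolded f'(2,3)]
    note c = Phi_cmp[OF f'(1) Phi_idn(1)[OF fs(2)]]
    show ?thesis
      by (rule Phi_eqI) (use c Phi_idn[OF fs(2)] f' fs sec_cmp_eta_left[of X Y "the_sec A f"] in auto)
  qed
  show "f \<cdot>\<^bsub>Phi_cat C A\<^esub> idn (Phi_cat C A) X = f" if f: "f \<in> hom (Phi_cat C A) X Y" for f X Y
  proof -
    have f': "f \<in> arrs (Phi_cat C A)" "src f = X" "trg f = Y" using f by auto
    note fs = Phi_sec[OF f'(1), unfolded f'(2,3)]
    note c = Phi_cmp[OF Phi_idn(1)[OF fs(1)] f'(1)]
    show ?thesis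
      by (rule Phi_eqI) (use c Phi_idn[OF fs(1)] f' fs sec_cmp_eta_right[of X Y "the_sec A f"] in auto)
  qed
  show "h \<cdot>\<^bsub>Phi_cat C A\<^esub> g \<cdot>\<^bsub>Phi_cat C A\<^esub> f = h \<cdot>\<^bsub>Phi_cat C A\<^esub> (g \<cdot>\<^bsub>Phi_cat C A\<^esub> f)"
    if "f \<in> hom (Phi_cat C A) W X" "g \<in> hom (Phi_cat C A) X Y" "h \<in> hom (Phi_cat C A) Y Z" for f g h W X Y Z
  proof -
    have f: "f \<in> arrs (Phi_cat C A)" "src f = W" "trg f = X" and g: "g \<in> arrs (Phi_cat C A)" "src g = X" "trg g = Y"
      and h: "h \<in> arrs (Phi_cat C A)" "src h = Y" "trg h = Z" using that by auto
    note fs = Phi_sec[OF f(1), unfolded f(2,3)] and gs = Phi_sec[OF g(1), unfolded g(2,3)]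
      and hs = Phi_sec[OF h(1), unfolded h(2,3)]
    note gf = Phi_cmp[OF f(1) g(1), unfolded f g, OF refl] and hg = Phi_cmp[OF g(1) h(1), unfolded g h, OF refl]
    note l = Phi_cmp[OF f(1) hg(1), unfolded hg(2-4) f, OF refl]
      and r = Phi_cmp[OF gf(1) h(1), unfolded gf(2-4) h, OF refl]
    show ?thesis
      by (rule Phi_eqI) (use l r sec_cmp_assoc[OF fs(1) gs(1) hs(1,2) hs(3) gs(3) fs(4,6)] in auto)
  qed
qed

lemma Phi_restriction: "restriction_category (Phi_cat C A)"
proof -
  interpret P: category "Phi_cat C A" by (rule Phi_category)
  let ?P = "Phi_cat C A"
  show ?thesis
  proof
    show "rst ?P f \<in> hom ?P X X" if "f \<in> hom ?P X Y" for f X Y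
      using Phi_rst[of f] that by simp
    show "f \<cdot>\<^bsub>?P\<^esub> rst ?P f = f" if f: "f \<in> arrs ?P" for f
      by (rule Phi_eqI)
        (use Phi_cmp(2,3)[OF Phi_rst(1)[OF f] f] Phi_cmp_rst[OF f f] Phi_rst[OF f] Phi_sec[OF f] in auto)
    show "rst ?P f \<cdot>\<^bsub>?P\<^esub> rst ?P g = rst ?P g \<cdot>\<^bsub>?P\<^esub> rst ?P f"
      if f: "f \<in> arrs ?P" and g: "g \<in> arrs ?P" and fg: "src f = src g" for f g
    proof -
      note f' = Phi_sec[OF f] and g' = Phi_sec[OF g] and rf = Phi_rst[OF f] and rg = Phi_rst[OF g]
      show ?thesis
      proof (rule Phi_eqI)
        show "the_sec A (rst ?P f \<cdot>\<^bsub>?P\<^esub> rst ?P g) = the_sec A (rst ?P g \<cdot>\<^bsub>?P\<^esub> rst ?P f)"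
          using Phi_cmp_rst[OF g rf(1)] Phi_cmp_rst[OF f rg(1)] rf rg fg f' g'
            rst_commute[of "the_sec A f" "the_sec A g"] by simp
      qed (use rf rg fg in auto)
    qed
    show "rst ?P (g \<cdot>\<^bsub>?P\<^esub> rst ?P f) = rst ?P g \<cdot>\<^bsub>?P\<^esub> rst ?P f"
      if f: "f \<in> arrs ?P" and g: "g \<in> arrs ?P" and fg: "src f = src g" for f g
    proof -
      note f' = Phi_sec[OF f] and g' = Phi_sec[OF g] and rf = Phi_rst[OF f] and rg = Phi_rst[OF g]
      have gf: "g \<cdot>\<^bsub>?P\<^esub> rst ?P f \<in> arrs ?P" "src (g \<cdot>\<^bsub>?P\<^esub> rst ?P f) = src g"
        "trg (g \<cdot>\<^bsub>?P\<^esub> rst ?P f) = trg g" using g rf fg by auto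
      note r = Phi_rst[OF gf(1)]
      show ?thesis
      proof (rule Phi_eqI)
        show "the_sec A (rst ?P (g \<cdot>\<^bsub>?P\<^esub> rst ?P f)) = the_sec A (rst ?P g \<cdot>\<^bsub>?P\<^esub> rst ?P f)"
          using r(4) Phi_cmp_rst[OF f g fg] Phi_cmp_rst[OF f rg(1)] gf rg rf f' g' fg
            rst_cmp_rst[of "the_sec A f" "the_sec A g"] by simp
      qed (use r gf rf rg g fg in auto)
    qed
    show "rst ?P g \<cdot>\<^bsub>?P\<^esub> f = f \<cdot>\<^bsub>?P\<^esub> rst ?P (g \<cdot>\<^bsub>?P\<^esub> f)"
      if "f \<in> hom ?P X Y" "g \<in> hom ?P Y Z" for f g X Y Z
    proof -
      have f: "f \<in> arrs ?P" "src f = X" "trg f = Y" and g: "g \<in> arrs ?P" "src g = Y" "trg g = Z"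
        using that by auto
      note f' = Phi_sec[OF f(1), unfolded f] and g' = Phi_sec[OF g(1), unfolded g] and rg = Phi_rst[OF g(1), unfolded g]
      note gf = Phi_cmp[OF f(1) g(1), unfolded f g, OF refl]
      note rgf = Phi_rst[OF gf(1)]
      let ?t = "the_sec A g" and ?s = "the_sec A f"
      have "the_sec A (rst ?P g \<cdot>\<^bsub>?P\<^esub> f) = sec_cmp C A X Y Y (eta A Y \<cdot> rst C ?t) ?s"
        using Phi_cmp(4)[OF f(1) rg(1)] rg f by simp
      also have "\<dots> = ?s \<cdot> rst C (rst C ?t \<cdot> (tau A X Y \<cdot> ?s))"
        using sec_cmp_rid_left[OF f'(1,2,4,6), of "rst C ?t"] g' by simp
      also have "\<dots> = ?s \<cdot> rst C (sec_cmp C A X Y Z ?t ?s)"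
        using sec_cmp_props(5)[OF f'(1,2) g'(2,3) f'(4,6)] f' g' by simp
      finally have 1: "the_sec A (rst ?P g \<cdot>\<^bsub>?P\<^esub> f) = ?s \<cdot> rst C (sec_cmp C A X Y Z ?t ?s)" .
      show ?thesis
      proof (rule Phi_eqI)
        show "the_sec A (rst ?P g \<cdot>\<^bsub>?P\<^esub> f) = the_sec A (f \<cdot>\<^bsub>?P\<^esub> rst ?P (g \<cdot>\<^bsub>?P\<^esub> f))"
          using 1 Phi_cmp_rst[OF gf(1) f(1)] gf f by simp
      qed (use f rg gf rgf in auto)
    qed
  qed
qed

lemma Phi_rids: "x \<in> rids (Phi_cat C A) i \<longleftrightarrow>
    (i \<in> idx A \<and> (\<exists>e \<in> rids C (ob0 A i). x = sec_arr i i (eta A i \<cdot> e)))"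
proof
  assume "x \<in> rids (Phi_cat C A) i"
  then have x: "x \<in> arrs (Phi_cat C A)" "src x = i" "trg x = i" "rst (Phi_cat C A) x = x"
    by (auto simp: in_rids)
  have "x = sec_arr i i (eta A i \<cdot> rst C (the_sec A x))"
    using x(2,4) by (simp add: Phi_cat_def)
  then show "i \<in> idx A \<and> (\<exists>e \<in> rids C (ob0 A i). x = sec_arr i i (eta A i \<cdot> e))"
    using Phi_sec[OF x(1)] x(2) by (intro conjI bexI[of _ "rst C (the_sec A x)"]) auto
next
  assume "i \<in> idx A \<and> (\<exists>e \<in> rids C (ob0 A i). x = sec_arr i i (eta A i \<cdot> e))"
  then obtain e where i: "i \<in> idx A" and e: "e \<in> rids C (ob0 A i)" and x: "x = sec_arr i i (eta A i \<cdot> e)"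
    by blast
  have "x \<in> arrs (Phi_cat C A)" unfolding x by (rule sec_arr_in_Phi[OF i i eta_rid_sec[OF i e]])
  then show "x \<in> rids (Phi_cat C A) i"
    using Phi_rst(1-3)[of x] secD[OF eta_rid_sec[OF i e] i i] i eta_rid_rst[OF i e]
    by (simp add: in_rids x Phi_cat_def)
qed

section \<open>Order and joins of sections\<close>

lemma Phi_rle:
  assumes "x \<in> hom (Phi_cat C A) i j" "y \<in> hom (Phi_cat C A) i j"
  shows "rle (Phi_cat C A) x y \<longleftrightarrow> rle C (the_sec A x) (the_sec A y)"
proof -
  interpret P: restriction_category "Phi_cat C A" by (rule Phi_restriction)
  have x: "x \<in> arrs (Phi_cat C A)" "src x = i" "trg x = j" and y: "y \<in> arrs (Phi_cat C A)" "src y = i" "trg y = j"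
    using assms by auto
  note x' = Phi_sec[OF x(1)] and y' = Phi_sec[OF y(1)]
  have c: "y \<cdot>\<^bsub>Phi_cat C A\<^esub> rst (Phi_cat C A) x \<in> hom (Phi_cat C A) i j" using x y by simp
  have "y \<cdot>\<^bsub>Phi_cat C A\<^esub> rst (Phi_cat C A) x = x \<longleftrightarrow> the_sec A y \<cdot> rst C (the_sec A x) = the_sec A x"
    using Phi_cmp_rst[OF x(1) y(1)] Phi_eqI[of "y \<cdot>\<^bsub>Phi_cat C A\<^esub> rst (Phi_cat C A) x" x] x y c by auto
  then show ?thesis using x y x' y' by (simp add: P.rle_iff rle_iff)
qed

lemma Phi_compatible:
  assumes "compatible (Phi_cat C A) x y"
  shows "compatible C (the_sec A x) (the_sec A y)"
proof -
  interpret P: restriction_category "Phi_cat C A" by (rule Phi_restriction)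
  have *: "x \<in> arrs (Phi_cat C A)" "y \<in> arrs (Phi_cat C A)" "src x = src y" "trg x = trg y"
    "x \<cdot>\<^bsub>Phi_cat C A\<^esub> rst (Phi_cat C A) y = y \<cdot>\<^bsub>Phi_cat C A\<^esub> rst (Phi_cat C A) x"
    using assms by (auto simp: P.compatible_iff)
  then show ?thesis
    using Phi_cmp_rst[OF *(1,2,3)] Phi_cmp_rst[OF *(2,1) *(3)[symmetric]] Phi_sec[OF *(1)] Phi_sec[OF *(2)]
    by (simp add: compatible_iff)
qed

text \<open>Both \<open>sig A i j \<cdot> s\<close> and the domain of \<open>s\<close> are joins of
  the domains of the members: the first by \<open>is_join_postcomp\<close>, since the members are
  sections, the second by \<open>is_join_rst\<close>.\<close>

lemma sec_join:
  assumes J: "is_join C (ob0 A i) (ob1 A i j) T s" and T: "T \<subseteq> sec i j" and i: "i \<in> idx A" "j \<in> idx A"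
  shows "s \<in> sec i j"
proof -
  note s = is_joinD(1-3)[OF J]
  have "(\<lambda>t. sig A i j \<cdot> t) ` T = rst C ` T"
    using T by (intro image_cong) (auto simp: psections_def)
  then have "sig A i j \<cdot> s = rst C s"
    using is_join_postcomp[OF J, of "sig A i j"] is_join_rst[OF J] is_join_unique i by auto
  then show ?thesis using s i by (simp add: psections_def)
qed

lemma Phi_is_joinI:
  assumes i: "i \<in> idx A" "j \<in> idx A" and S: "S \<subseteq> hom (Phi_cat C A) i j"
    and J: "is_join C (ob0 A i) (ob1 A i j) (the_sec A ` S) s"
  shows "is_join (Phi_cat C A) i j S (sec_arr i j s)" "s \<in> sec i j"
proof -
  show s: "s \<in> sec i j"
    by (rule sec_join[OF J _ i]) (use S Phi_arrs in auto)
  note s' = secD[OF s i] and x = sec_arr_in_Phi[OF i s]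
  have ts: "the_sec A (sec_arr i j s) = s" using s' by simp
  show "is_join (Phi_cat C A) i j S (sec_arr i j s)"
    unfolding is_join_def
  proof (intro conjI ballI impI)
    show "rle (Phi_cat C A) f (sec_arr i j s)" if "f \<in> S" for f
      using that S x Phi_rle[of f i j "sec_arr i j s"] is_joinD(7)[OF J, of "the_sec A f"] ts
      by (auto simp: subset_iff)
    fix h assume h: "h \<in> hom (Phi_cat C A) i j" "\<forall>f \<in> S. rle (Phi_cat C A) f h"
    have "rle C s (the_sec A h)"
    proof (rule is_join_least[OF J])
      show "the_sec A h \<in> hom C (ob0 A i) (ob1 A i j)" using h Phi_sec[of h] by auto
      show "rle C t (the_sec A h)" if "t \<in> the_sec A ` S" for t
        using that h S Phi_rle[OF _ h(1)] by blast
    qed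
    then show "rle (Phi_cat C A) (sec_arr i j s) h" using Phi_rle[of "sec_arr i j s" i j h] h x ts by simp
  qed (use S x in auto)
qed

lemma Phi_join_exists:
  assumes i: "i \<in> idx A" "j \<in> idx A" and S: "S \<subseteq> hom (Phi_cat C A) i j"
    and comp: "\<And>f g. f \<in> S \<Longrightarrow> g \<in> S \<Longrightarrow> compatible (Phi_cat C A) f g"
  obtains s where "is_join C (ob0 A i) (ob1 A i j) (the_sec A ` S) s"
proof -
  have "the_sec A ` S \<subseteq> hom C (ob0 A i) (ob1 A i j)" using S Phi_sec by (auto simp: subset_iff)
  moreover have "compatible C f g" if "f \<in> the_sec A ` S" "g \<in> the_sec A ` S" for f g
    using that comp Phi_compatible by blast
  ultimately show ?thesis using join_exists[of "ob0 A i" "ob1 A i j" "the_sec A ` S"] that i by auto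
qed

text \<open>The decoded family has a join in \<open>C\<close>, which is a join of sections by
  \<open>Phi_is_joinI\<close>; uniqueness identifies it with the given one. So joins of sections are
  the joins computed in \<open>C\<close>.\<close>

lemma Phi_is_joinD:
  assumes i: "i \<in> idx A" "j \<in> idx A" and J: "is_join (Phi_cat C A) i j S x"
  shows "is_join C (ob0 A i) (ob1 A i j) (the_sec A ` S) (the_sec A x)"
proof -
  interpret P: restriction_category "Phi_cat C A" by (rule Phi_restriction)
  have S: "S \<subseteq> hom (Phi_cat C A) i j" using P.is_join_sub[OF J] .
  have comp: "compatible (Phi_cat C A) f g" if "f \<in> S" "g \<in> S" for f g
    using P.bounded_compatible P.is_joinD(7)[OF J] that by blast
  obtain s where s: "is_join C (ob0 A i) (ob1 A i j) (the_sec A ` S) s"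
    using Phi_join_exists[OF i S comp] by blast
  note sj = Phi_is_joinI[OF i S s]
  have "x = sec_arr i j s" using P.is_join_unique[OF J sj(1)] .
  then show ?thesis using s secD[OF sj(2) i] by simp
qed

lemma Phi_join_restriction: "join_restriction_category (Phi_cat C A)"
proof -
  interpret P: restriction_category "Phi_cat C A" by (rule Phi_restriction)
  let ?P = "Phi_cat C A"
  show ?thesis
  proof
    show "\<exists>j. is_join ?P X Y S j"
      if "X \<in> obj ?P" "Y \<in> obj ?P" "S \<subseteq> hom ?P X Y" "\<And>f g. f \<in> S \<Longrightarrow> g \<in> S \<Longrightarrow> compatible ?P f g" for X Y S
      using Phi_join_exists[of X Y S] Phi_is_joinI(1)[of X Y S] that by (metis Phi_obj)
    fix S X Y j k W
    assume S: "S \<subseteq> hom ?P X Y" and "\<And>f g. f \<in> S \<Longrightarrow> g \<in> S \<Longrightarrow> compatible ?P f g"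
      and J: "is_join ?P X Y S j" and kh: "k \<in> hom ?P W X"
    note j = P.is_joinD(1-3)[OF J]
    have k: "k \<in> arrs ?P" "src k = W" "trg k = X" using kh by auto
    note k' = Phi_sec[OF k(1), unfolded k] and j' = Phi_sec[OF j(1), unfolded j]
    note JC = Phi_is_joinD[OF j'(1,2) J]
    note jk = Phi_cmp[OF k(1) j(1), unfolded j k, OF refl]
    note jks = Phi_sec[OF jk(1), unfolded jk(2,3)]
    let ?u = "tau A W X \<cdot> the_sec A k"
    have u: "?u \<in> arrs C" "src ?u = ob0 A W" "trg ?u = ob0 A X" using k' by auto
    have rk: "rst C (the_sec A (j \<cdot>\<^bsub>?P\<^esub> k)) = rst C (the_sec A j \<cdot> ?u)"
      using sec_cmp_props(5)[OF k'(1,2) j'(2,3) k'(4,6)] jk by simp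
    \<comment> \<open>Each member after \<open>k\<close> is the join after \<open>k\<close>, cut
      down to the preimage along \<open>?u\<close> of the domain of that member. Stability of joins
      of sections thereby reduces to precomposing a join in \<open>C\<close> with
      \<open>?u\<close>.\<close>
    have el: "the_sec A (f \<cdot>\<^bsub>?P\<^esub> k) = the_sec A (j \<cdot>\<^bsub>?P\<^esub> k) \<cdot> rst C (the_sec A f \<cdot> ?u)"
      "rst C (the_sec A (f \<cdot>\<^bsub>?P\<^esub> k)) = rst C (the_sec A f \<cdot> ?u)" "f \<cdot>\<^bsub>?P\<^esub> k \<in> hom ?P W Y" if fS: "f \<in> S" for f
    proof -
      have f: "f \<in> arrs ?P" "src f = X" "trg f = Y" using S fS by (auto simp: subset_iff)
      note f' = Phi_sec[OF f(1), unfolded f]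
      have fj: "the_sec A j \<cdot> rst C (the_sec A f) = the_sec A f"
        using is_joinD(8)[OF JC, of "the_sec A f"] fS by simp
      note fk = Phi_cmp[OF k(1) f(1), unfolded f k, OF refl]
      show "f \<cdot>\<^bsub>?P\<^esub> k \<in> hom ?P W Y" using fk by simp
      show "rst C (the_sec A (f \<cdot>\<^bsub>?P\<^esub> k)) = rst C (the_sec A f \<cdot> ?u)"
        using sec_cmp_props(5)[OF k'(1,2) f'(2,3) k'(4,6)] fk by simp
      show "the_sec A (f \<cdot>\<^bsub>?P\<^esub> k) = the_sec A (j \<cdot>\<^bsub>?P\<^esub> k) \<cdot> rst C (the_sec A f \<cdot> ?u)"
        using sec_cmp_restrict_left[OF k'(1,2) j'(2,3) k'(4,6), of "rst C (the_sec A f)"] fj fk jk f' u by simp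
    qed
    have "is_join C (ob0 A W) (ob1 A W Y) (the_sec A ` (\<lambda>f. f \<cdot>\<^bsub>?P\<^esub> k) ` S) (the_sec A (j \<cdot>\<^bsub>?P\<^esub> k))"
    proof (rule is_joinI)
      show "the_sec A ` (\<lambda>f. f \<cdot>\<^bsub>?P\<^esub> k) ` S \<subseteq> hom C (ob0 A W) (ob1 A W Y)"
        using el(3) Phi_sec by (auto simp: subset_iff)
      show "the_sec A (j \<cdot>\<^bsub>?P\<^esub> k) \<in> hom C (ob0 A W) (ob1 A W Y)" using jks by simp
      fix t assume "t \<in> the_sec A ` (\<lambda>f. f \<cdot>\<^bsub>?P\<^esub> k) ` S"
      then obtain f where fS: "f \<in> S" and t: "t = the_sec A (f \<cdot>\<^bsub>?P\<^esub> k)" by blast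
      have f: "f \<in> arrs ?P" "src f = X" "trg f = Y" using S fS by (auto simp: subset_iff)
      note f' = Phi_sec[OF f(1), unfolded f]
      show "rle C t (the_sec A (j \<cdot>\<^bsub>?P\<^esub> k))"
        unfolding t el(1)[OF fS] by (rule rle_restrict) (use jks f' u in auto)
    next
      have "rst C ` the_sec A ` (\<lambda>f. f \<cdot>\<^bsub>?P\<^esub> k) ` S = rst C ` (\<lambda>t. t \<cdot> ?u) ` the_sec A ` S"
        unfolding image_image by (rule image_cong) (use el in auto)
      then show "is_join C (ob0 A W) (ob0 A W) (rst C ` the_sec A ` (\<lambda>f. f \<cdot>\<^bsub>?P\<^esub> k) ` S)
          (rst C (the_sec A (j \<cdot>\<^bsub>?P\<^esub> k)))"
        using is_join_rst[OF is_join_precomp[OF JC u(1,3)]] rk u by simp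
    qed
    then have "is_join ?P W Y ((\<lambda>f. f \<cdot>\<^bsub>?P\<^esub> k) ` S) (sec_arr W Y (the_sec A (j \<cdot>\<^bsub>?P\<^esub> k)))"
      by (intro Phi_is_joinI(1)) (use k' j' el(3) in auto)
    moreover have "sec_arr W Y (the_sec A (j \<cdot>\<^bsub>?P\<^esub> k)) = j \<cdot>\<^bsub>?P\<^esub> k"
      using sec_arr_the_sec[of "j \<cdot>\<^bsub>?P\<^esub> k"] jk by simp
    ultimately show "is_join ?P W Y ((\<lambda>f. f \<cdot>\<^bsub>?P\<^esub> k) ` S) (j \<cdot>\<^bsub>?P\<^esub> k)" by simp
  qed
qed

section \<open>The projection to the base\<close>

lemma Phi_proj_far:
  "far (Phi_proj C A) x = tau A (src x) (trg x) \<cdot> the_sec A x" "fob (Phi_proj C A) = ob0 A"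
  by (auto simp: Phi_proj_def)

lemma tau_rst: "\<lbrakk>x \<in> arrs C; i \<in> idx A; j \<in> idx A; trg x = ob1 A i j\<rbrakk> \<Longrightarrow> rst C (tau A i j \<cdot> x) = rst C x"
  using total_cmp_rst[of x "tau A i j"] tau_total by simp

lemma Phi_proj_functor: "restriction_functor (Phi_cat C A) C (Phi_proj C A)"
proof -
  interpret P: restriction_category "Phi_cat C A" by (rule Phi_restriction)
  let ?P = "Phi_cat C A"
  show ?thesis
  proof
    show "fob (Phi_proj C A) X \<in> obj C" if "X \<in> obj ?P" for X using that by (simp add: Phi_proj_far)
    show "far (Phi_proj C A) f \<in> hom C (fob (Phi_proj C A) X) (fob (Phi_proj C A) Y)"
      if "f \<in> hom ?P X Y" for f X Y
      using that Phi_sec[of f] by (simp add: Phi_proj_far)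
    show "far (Phi_proj C A) (idn ?P X) = idn C (fob (Phi_proj C A) X)" if "X \<in> obj ?P" for X
      using that Phi_idn[of X] tau_eta by (simp add: Phi_proj_far)
    show "far (Phi_proj C A) (g \<cdot>\<^bsub>?P\<^esub> f) = far (Phi_proj C A) g \<cdot> far (Phi_proj C A) f"
      if fh: "f \<in> hom ?P X Y" and gh: "g \<in> hom ?P Y Z" for f g X Y Z
    proof -
      have f: "f \<in> arrs ?P" "src f = X" "trg f = Y" and g: "g \<in> arrs ?P" "src g = Y" "trg g = Z"
        using fh gh by auto
      note f' = Phi_sec[OF f(1), unfolded f] and g' = Phi_sec[OF g(1), unfolded g]
      note gf = Phi_cmp[OF f(1) g(1), unfolded f g, OF refl]
      show ?thesis
        using gf sec_cmp_props(4)[OF f'(1,2) g'(2,3) f'(4,6)] f g f' g' by (simp add: Phi_proj_far)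
    qed
    show "far (Phi_proj C A) (rst ?P f) = rst C (far (Phi_proj C A) f)" if f: "f \<in> arrs ?P" for f
      using Phi_rst[OF f] Phi_sec[OF f] tau_eta_rid tau_rst[of "the_sec A f" "src f" "trg f"]
      by (simp add: Phi_proj_far)
  qed
qed

text \<open>Idempotents among sections are units cut down to idempotents of the base, and
  \<open>tau\<close> undoes the unit, so the projection inverts this correspondence.\<close>

lemma Phi_hyperconnected: "hyperconnected (Phi_cat C A) C (Phi_proj C A)"
  unfolding hyperconnected_def
proof (intro conjI ballI)
  show "restriction_functor (Phi_cat C A) C (Phi_proj C A)" by (rule Phi_proj_functor)
  fix i assume "i \<in> obj (Phi_cat C A)"
  then have i: "i \<in> idx A" by simp
  have far: "far (Phi_proj C A) (sec_arr i i (eta A i \<cdot> e)) = e" if e: "e \<in> rids C (ob0 A i)" for e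
    using secD[OF eta_rid_sec[OF i e] i i] tau_eta_rid[OF i] ridsD[OF e] i by (simp add: Phi_proj_far)
  show "bij_betw (far (Phi_proj C A)) (rids (Phi_cat C A) i) (rids C (fob (Phi_proj C A) i))"
  proof -
    have "rids (Phi_cat C A) i = (\<lambda>e. sec_arr i i (eta A i \<cdot> e)) ` rids C (ob0 A i)"
      using i Phi_rids by blast
    then show ?thesis
      using far unfolding bij_betw_def inj_on_def Phi_proj_far(2) by (simp add: image_image)
  qed
qed

text \<open>Decoding embeds each hom-set of sections into a hom-set of \<open>C\<close>.\<close>

lemma Phi_locally_small:
  assumes "locally_small C"
  shows "locally_small (Phi_cat C A)"
  unfolding locally_small_def
proof (intro ballI)
  fix i j assume "i \<in> obj (Phi_cat C A)" "j \<in> obj (Phi_cat C A)"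
  then have i: "i \<in> idx A" "j \<in> idx A" by auto
  have "inj_on (the_sec A) (hom (Phi_cat C A) i j)"
    using Phi_eqI by (intro inj_onI) auto
  moreover have "the_sec A ` hom (Phi_cat C A) i j \<subseteq> hom C (ob0 A i) (ob1 A i j)"
    using Phi_sec by auto
  ultimately have "hom (Phi_cat C A) i j \<lesssim> hom C (ob0 A i) (ob1 A i j)"
    unfolding lepoll_def by blast
  moreover have "hom C (ob0 A i) (ob1 A i j) \<prec> (UNIV :: 'u set)"
    using assms i by (simp add: locally_small_def)
  ultimately show "hom (Phi_cat C A) i j \<prec> (UNIV :: 'u set)" by (rule lesspoll_trans1)
qed

end

section \<open>Cofunctors and functors over the base\<close>

text \<open>The typing part of the cofunctor axioms; \<open>Phi_map\<close> is already injective on such data.\<close>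

definition raw_cofun :: "('o, 'u) rcat \<Rightarrow> ('i, 'o, 'u) pcat \<Rightarrow> ('i, 'o, 'u) pcat \<Rightarrow> ('i, 'o, 'u) cofun \<Rightarrow> bool" where
  "raw_cofun C A B F \<longleftrightarrow> cfo F \<in> idx A \<rightarrow>\<^sub>E idx B \<and> cf0 F \<in> extensional (idx A) \<and>
    cf1 F \<in> extensional (idx A \<times> idx A) \<and>
    (\<forall>i \<in> idx A. cf0 F i \<in> hom C (ob0 B (cfo F i)) (ob0 A i) \<and> total C (cf0 F i)) \<and>
    (\<forall>i \<in> idx A. \<forall>j \<in> idx A.
      cf1 F (i, j) \<in> hom C (pbob C (sig A i j) (cf0 F i)) (ob1 B (cfo F i) (cfo F j)))"

text \<open>\<open>cf1\<close> on generalised elements: the arrow \<open>u\<close> acts at a point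
  \<open>z\<close> of the other category that lies over its source.\<close>

definition elem_act :: "('o, 'u) rcat \<Rightarrow> ('i, 'o, 'u) pcat \<Rightarrow> ('i, 'o, 'u) cofun \<Rightarrow> 'i \<Rightarrow> 'i
    \<Rightarrow> ('o, 'u) arr \<Rightarrow> ('o, 'u) arr \<Rightarrow> ('o, 'u) arr" where
  "elem_act C A F i j u z = cf1 F (i, j) \<cdot>\<^bsub>C\<^esub> pair C (sig A i j) (cf0 F i) u z"

text \<open>What \<Phi> does to a section, kept apart from the label encoding of
  \<open>Phi_map\<close>.\<close>

definition sec_act :: "('o, 'u) rcat \<Rightarrow> ('i, 'o, 'u) pcat \<Rightarrow> ('i, 'o, 'u) cofun \<Rightarrow> 'i \<Rightarrow> 'i
    \<Rightarrow> ('o, 'u) arr \<Rightarrow> ('o, 'u) arr" where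
  "sec_act C A F i j s = cf1 F (i, j) \<cdot>\<^bsub>C\<^esub> tstar C (sig A i j) (cf0 F i) s"

lemma Phi_map_sec_act:
  "Phi_map C A F = (restrict_func (Phi_cat C A)
       \<lparr>fob = cfo F, far = (\<lambda>f. sec_arr (cfo F (src f)) (cfo F (trg f)) (sec_act C A F (src f) (trg f) (the_sec A f)))\<rparr>,
     restrict (cf0 F) (idx A))"
  by (simp add: Phi_map_def sec_act_def tstar_def Let_def)

locale pcat_pair = plain_join_restriction_category C + A: pcat_over C A + B: pcat_over C B
  for C :: "('o, 'u) rcat" (structure) and A :: "('i, 'o, 'u) pcat" and B :: "('i, 'o, 'u) pcat"
begin

lemma raw_types:
  assumes "raw_cofun C A B F" "i \<in> idx A"
  shows "cfo F i \<in> idx B" "cf0 F i \<in> arrs C" "src (cf0 F i) = ob0 B (cfo F i)" "trg (cf0 F i) = ob0 A i"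
    "total C (cf0 F i)"
    "j \<in> idx A \<Longrightarrow> cf1 F (i, j) \<in> arrs C" "j \<in> idx A \<Longrightarrow> src (cf1 F (i, j)) = pbob C (sig A i j) (cf0 F i)"
    "j \<in> idx A \<Longrightarrow> trg (cf1 F (i, j)) = ob1 B (cfo F i) (cfo F j)"
    "j \<in> idx A \<Longrightarrow> total_pb C (sig A i j) (cf0 F i)"
  using assms A.sig_pb[of i j "cf0 F i"] unfolding raw_cofun_def by (auto simp: PiE_def Pi_def)

lemma cofunctor_raw: "partite_cofunctor C A B F \<Longrightarrow> raw_cofun C A B F"
  unfolding raw_cofun_def
  using partite_cofunctor.cfo_ext[of C A B F] partite_cofunctor.cf0_ext[of C A B F]
    partite_cofunctor.cf1_ext[of C A B F] partite_cofunctor.cf0_hom[of C A B F]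
    partite_cofunctor.cf0_total[of C A B F] partite_cofunctor.cf1_hom[of C A B F]
  by blast

lemma elem_act_props:
  assumes F: "raw_cofun C A B F" and i: "i \<in> idx A" "j \<in> idx A"
    and u: "u \<in> arrs C" "trg u = ob1 A i j" and z: "z \<in> arrs C" "trg z = ob0 B (cfo F i)" "src u = src z"
    and uz: "sig A i j \<cdot> u = cf0 F i \<cdot> z"
  shows "elem_act C A F i j u z \<in> arrs C" "src (elem_act C A F i j u z) = src z"
    "trg (elem_act C A F i j u z) = ob1 B (cfo F i) (cfo F j)"
    "\<lbrakk>x \<in> arrs C; trg x = src z\<rbrakk> \<Longrightarrow> elem_act C A F i j u z \<cdot> x = elem_act C A F i j (u \<cdot> x) (z \<cdot> x)"
proof -
  note f = raw_types[OF F i(1)]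
  note pb = total_pbD(1)[OF f(9)[OF i(2)]]
  have c: "u \<in> arrs C" "z \<in> arrs C" "src u = src z" "trg u = src (sig A i j)" "trg z = src (cf0 F i)"
    using u z i f by auto
  note pp = pair_props[OF pb c uz]
  show "elem_act C A F i j u z \<in> arrs C" "src (elem_act C A F i j u z) = src z"
    "trg (elem_act C A F i j u z) = ob1 B (cfo F i) (cfo F j)"
    using pp(1-3) f i z by (auto simp: elem_act_def)
  show "elem_act C A F i j u z \<cdot> x = elem_act C A F i j (u \<cdot> x) (z \<cdot> x)" if "x \<in> arrs C" "trg x = src z"
    using pair_cmp[OF pb c uz that(1)] that z(3) pp(1-3) f i by (simp add: elem_act_def)
qed

lemma sec_act_props:
  assumes F: "raw_cofun C A B F" and i: "i \<in> idx A" "j \<in> idx A" and s: "s \<in> A.sec i j"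
  shows "sec_act C A F i j s \<in> arrs C" "src (sec_act C A F i j s) = ob0 B (cfo F i)"
    "trg (sec_act C A F i j s) = ob1 B (cfo F i) (cfo F j)"
    "\<lbrakk>x \<in> arrs C; trg x = ob0 B (cfo F i)\<rbrakk> \<Longrightarrow>
      sec_act C A F i j s \<cdot> x = elem_act C A F i j (s \<cdot> (cf0 F i \<cdot> x)) (x \<cdot> rst C (s \<cdot> (cf0 F i \<cdot> x)))"
    "sec_act C A F i j s = elem_act C A F i j (s \<cdot> cf0 F i) (rst C (s \<cdot> cf0 F i))"
proof -
  note f = raw_types[OF F i(1)]
  note ts = tstar_props[OF f(9)[OF i(2)] s]
  show "sec_act C A F i j s \<in> arrs C" "src (sec_act C A F i j s) = ob0 B (cfo F i)"
    "trg (sec_act C A F i j s) = ob1 B (cfo F i) (cfo F j)"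
    using ts f i by (auto simp: sec_act_def)
  show "sec_act C A F i j s \<cdot> x = elem_act C A F i j (s \<cdot> (cf0 F i \<cdot> x)) (x \<cdot> rst C (s \<cdot> (cf0 F i \<cdot> x)))"
    if "x \<in> arrs C" "trg x = ob0 B (cfo F i)"
    using tstar_cmp[OF f(9)[OF i(2)] s, of x] that ts f i by (simp add: sec_act_def elem_act_def)
  show "sec_act C A F i j s = elem_act C A F i j (s \<cdot> cf0 F i) (rst C (s \<cdot> cf0 F i))"
    by (simp add: sec_act_def elem_act_def tstar_def)
qed

text \<open>For a source-etale domain the pulled back sections cover the pullback on which
  \<open>cf1\<close> lives, so the action on sections determines \<open>cf1\<close>. Stating this
  for raw data lets a candidate be compared with a cofunctor before its laws are known.\<close>

lemma Phi_map_faithful: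
  assumes se: "source_etale C A" and F: "raw_cofun C A B F" and G: "raw_cofun C A B G"
    and eq: "Phi_map C A F = Phi_map C A G"
  shows "F = G"
proof -
  have o: "restrict (cfo F) (idx A) = restrict (cfo G) (idx A)"
    and 0: "restrict (cf0 F) (idx A) = restrict (cf0 G) (idx A)"
    using eq by (auto simp: Phi_map_sec_act restrict_func_def)
  have cfo: "cfo F = cfo G"
    using o F G by (simp add: raw_cofun_def PiE_def extensional_restrict)
  have cf0: "cf0 F = cf0 G"
    using 0 F G by (simp add: raw_cofun_def extensional_restrict)
  have "cf1 F (i, j) = cf1 G (i, j)" if i: "i \<in> idx A" "j \<in> idx A" for i j
  proof -
    note f = raw_types[OF F i(1)] and g = raw_types[OF G i(1)]
    have sc: "section_cover C (sig A i j) (A.sec i j) (\<lambda>s. s)"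
      using local_homeo_section_cover se i by (simp add: source_etale_def)
    show ?thesis
    proof (rule pullback_ext[OF sc f(9)[OF i(2)]])
      show "cf1 F (i, j) \<in> hom C (pbob C (sig A i j) (cf0 F i)) (ob1 B (cfo F i) (cfo F j))"
        "cf1 G (i, j) \<in> hom C (pbob C (sig A i j) (cf0 F i)) (ob1 B (cfo F i) (cfo F j))"
        using f g i by (auto simp: cfo cf0)
      fix s assume s: "s \<in> A.sec i j"
      note x = A.sec_arr_in_Phi[OF i s] and s' = A.secD[OF s i]
      have "far (fst (Phi_map C A F)) (sec_arr i j s) = far (fst (Phi_map C A G)) (sec_arr i j s)"
        using eq by simp
      then have "sec_arr (cfo F i) (cfo F j) (sec_act C A F i j s) = sec_arr (cfo G i) (cfo G j) (sec_act C A G i j s)"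
        using x s' by (simp add: Phi_map_sec_act restrict_func_def)
      then have "lab (sec_act C A F i j s) = lab (sec_act C A G i j s)" by (simp add: sec_arr_def)
      then have "sec_act C A F i j s = sec_act C A G i j s"
        using sec_act_props(2,3)[OF F i s] sec_act_props(2,3)[OF G i s] by (intro arr_eqI) (auto simp: cfo)
      then show "cf1 F (i, j) \<cdot> tstar C (sig A i j) (cf0 F i) s = cf1 G (i, j) \<cdot> tstar C (sig A i j) (cf0 F i) s"
        by (simp add: sec_act_def cf0)
    qed
  qed
  then have "restrict (cf1 F) (idx A \<times> idx A) = restrict (cf1 G) (idx A \<times> idx A)"
    by (intro restrict_ext) auto
  then have "cf1 F = cf1 G" using F G by (simp add: raw_cofun_def extensional_restrict)
  then show ?thesis using cfo cf0 by simp
qed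

end

section \<open>Cofunctors act as functors on sections\<close>

locale cofun_over = pcat_pair C A B + partite_cofunctor C A B F
  for C :: "('o, 'u) rcat" (structure) and A :: "('i, 'o, 'u) pcat" and B :: "('i, 'o, 'u) pcat"
    and F :: "('i, 'o, 'u) cofun"
begin

lemma raw: "raw_cofun C A B F"
  by (rule cofunctor_raw) unfold_locales

lemmas F_types = raw_types[OF raw]

lemma elem_act_laws:
  assumes i: "i \<in> idx A" "j \<in> idx A"
    and u: "u \<in> arrs C" "trg u = ob1 A i j" and z: "z \<in> arrs C" "trg z = ob0 B (cfo F i)" "src u = src z"
    and uz: "sig A i j \<cdot> u = cf0 F i \<cdot> z"
  shows "sig B (cfo F i) (cfo F j) \<cdot> elem_act C A F i j u z = z"
    "cf0 F j \<cdot> (tau B (cfo F i) (cfo F j) \<cdot> elem_act C A F i j u z) = tau A i j \<cdot> u"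
    "rst C (elem_act C A F i j u z) = rst C z"
proof -
  note f = F_types[OF i(1)] and g = F_types[OF i(2)]
  note pb = total_pbD(1)[OF f(9)[OF i(2)]]
  have c: "u \<in> arrs C" "z \<in> arrs C" "src u = src z" "trg u = src (sig A i j)" "trg z = src (cf0 F i)"
    using u z i f by auto
  note pp = pair_props[OF pb c uz] and pt = pb_types[OF pb] and cp = elem_act_props[OF raw i u z uz]
  show 1: "sig B (cfo F i) (cfo F j) \<cdot> elem_act C A F i j u z = z"
    using reassoc[OF sig_cf1[OF i], of "pair C (sig A i j) (cf0 F i) u z"] pp f g i by (simp add: elem_act_def)
  show "cf0 F j \<cdot> (tau B (cfo F i) (cfo F j) \<cdot> elem_act C A F i j u z) = tau A i j \<cdot> u"
    using reassoc[OF tau_cf1[OF i], of "pair C (sig A i j) (cf0 F i) u z"] pp pt f g i by (simp add: elem_act_def)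
  show "rst C (elem_act C A F i j u z) = rst C z"
    using total_cmp_rst[of "elem_act C A F i j u z" "sig B (cfo F i) (cfo F j)"] 1 cp(1,3) f(1) g(1) B.sig_total by simp
qed

text \<open>Multiplicativity is stated for the projections of an iterated pullback. The triple
  \<open>(x, y, z)\<close> amounts to a map \<open>v\<close> into it, and both sides of the law are
  precomposed with \<open>v\<close>.\<close>

lemma elem_act_mult:
  assumes i: "i \<in> idx A" "j \<in> idx A" "k \<in> idx A"
    and x: "x \<in> arrs C" "trg x = ob1 A j k" and y: "y \<in> arrs C" "trg y = ob1 A i j" "src x = src y"
    and z: "z \<in> arrs C" "trg z = ob0 B (cfo F i)" "src y = src z"
    and xy: "sig A j k \<cdot> x = tau A i j \<cdot> y" and yz: "sig A i j \<cdot> y = cf0 F i \<cdot> z"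
  shows "elem_act C A F i k (elem_mult C A i j k x y) z
    = elem_mult C B (cfo F i) (cfo F j) (cfo F k)
        (elem_act C A F j k x (tau B (cfo F i) (cfo F j) \<cdot> elem_act C A F i j y z)) (elem_act C A F i j y z)"
proof -
  note fi = F_types[OF i(1)] and fj = F_types[OF i(2)] and fk = F_types[OF i(3)]
  define P where "P = pr1 C (sig A i j) (cf0 F i)"
  define Q where "Q = pr2 C (sig A i j) (cf0 F i)"
  define D where "D = pbob C (sig A i j) (cf0 F i)"
  note tp1 = fi(9)[OF i(2)]
  note pb1 = total_pbD(1)[OF tp1]
  have P: "P \<in> arrs C" "src P = D" "trg P = ob1 A i j" and Q: "Q \<in> arrs C" "src Q = D" "trg Q = ob0 B (cfo F i)"
    and PQ: "sig A i j \<cdot> P = cf0 F i \<cdot> Q"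
    using pb_types[OF pb1] i fi by (auto simp: P_def Q_def D_def)
  have "total C (tau A i j \<cdot> P)"
    using total_cmp[of P "tau A i j"] total_pbD(4)[OF tp1] A.tau_total[OF i(1,2)] i P by (simp add: P_def)
  then have tp2: "total_pb C (sig A j k) (tau A i j \<cdot> P)"
    by (rule A.sig_pb[OF i(2,3)]) (use P i in auto)
  note pb2 = total_pbD(1)[OF tp2]
  define a where "a = pr1 C (sig A j k) (tau A i j \<cdot> P)"
  define b where "b = pr2 C (sig A j k) (tau A i j \<cdot> P)"
  define E where "E = pbob C (sig A j k) (tau A i j \<cdot> P)"
  have a: "a \<in> arrs C" "src a = E" "trg a = ob1 A j k" and b: "b \<in> arrs C" "src b = E" "trg b = D"
    and sq: "sig A j k \<cdot> a = tau A i j \<cdot> (P \<cdot> b)"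
    using pb_types[OF pb2] i P by (auto simp: a_def b_def E_def)
  have c1: "y \<in> arrs C" "z \<in> arrs C" "src y = src z" "trg y = src (sig A i j)" "trg z = src (cf0 F i)"
    using y z i fi by auto
  define w where "w = pair C (sig A i j) (cf0 F i) y z"
  note w = pair_props[OF pb1 c1 yz, folded w_def P_def Q_def D_def]
  have c2: "x \<in> arrs C" "w \<in> arrs C" "src x = src w" "trg x = src (sig A j k)" "trg w = src (tau A i j \<cdot> P)"
    "sig A j k \<cdot> x = tau A i j \<cdot> P \<cdot> w"
    using x y w P i xy by auto
  define v where "v = pair C (sig A j k) (tau A i j \<cdot> P) x w"
  note v = pair_props[OF pb2 c2, folded v_def a_def b_def E_def]
  let ?Fi = "cfo F i" and ?Fj = "cfo F j" and ?Fk = "cfo F k"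
  define d where "d = cf1 F (i, j) \<cdot> b"
  have d: "d \<in> arrs C" "src d = E" "trg d = ob1 B ?Fi ?Fj" using fi i b by (auto simp: d_def D_def)
  have law: "elem_act C A F i k (elem_mult C A i j k a (P \<cdot> b)) (Q \<cdot> b)
      = elem_mult C B ?Fi ?Fj ?Fk (elem_act C A F j k a (tau B ?Fi ?Fj \<cdot> d)) d"
    unfolding elem_act_def elem_mult_def
    by (rule cf1_mu[OF i]) (simp_all add: a_def b_def P_def Q_def d_def)
  have Pb: "P \<cdot> b \<in> arrs C" "src (P \<cdot> b) = E" "trg (P \<cdot> b) = ob1 A i j" "P \<cdot> b \<cdot> v = y"
    and Qb: "Q \<cdot> b \<in> arrs C" "src (Q \<cdot> b) = E" "trg (Q \<cdot> b) = ob0 B ?Fi" "Q \<cdot> b \<cdot> v = z"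
    using P Q b v w by auto
  have dv: "d \<cdot> v = elem_act C A F i j y z"
    using v b fi i by (simp add: d_def D_def elem_act_def flip: w_def)
  note g = A.elem_mult_props[OF i a(1,3) Pb(1,3) _ sq]
  have PQb: "sig A i j \<cdot> (P \<cdot> b) = cf0 F i \<cdot> (Q \<cdot> b)"
    using reassoc[OF PQ, of b] P Q b i fi by simp
  have gz: "sig A i k \<cdot> elem_mult C A i j k a (P \<cdot> b) = cf0 F i \<cdot> (Q \<cdot> b)" using g(4) a Pb PQb by simp
  have "elem_act C A F i k (elem_mult C A i j k a (P \<cdot> b)) (Q \<cdot> b) \<cdot> v
      = elem_act C A F i k (elem_mult C A i j k a (P \<cdot> b) \<cdot> v) (Q \<cdot> b \<cdot> v)"
    by (rule elem_act_props(4)[OF raw i(1,3)]) (use g a Pb Qb gz v in auto)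
  also have "elem_mult C A i j k a (P \<cdot> b) \<cdot> v = elem_mult C A i j k (a \<cdot> v) (P \<cdot> b \<cdot> v)"
    by (rule g(7)) (use a Pb v in auto)
  finally have L: "elem_act C A F i k (elem_mult C A i j k a (P \<cdot> b)) (Q \<cdot> b) \<cdot> v = elem_act C A F i k (elem_mult C A i j k x y) z"
    using v Pb Qb by simp
  have td: "tau B ?Fi ?Fj \<cdot> d \<in> arrs C" "src (tau B ?Fi ?Fj \<cdot> d) = E" "trg (tau B ?Fi ?Fj \<cdot> d) = ob0 B ?Fj"
    using d fi(1) fj(1) by auto
  have aj: "sig A j k \<cdot> a = cf0 F j \<cdot> (tau B ?Fi ?Fj \<cdot> d)"
    using reassoc[OF tau_cf1[OF i(1,2), folded P_def], of b] sq fi fj i b P by (simp add: d_def D_def)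
  have c3: "src a = src (tau B ?Fi ?Fj \<cdot> d)" using a td by simp
  note cp = elem_act_props[OF raw i(2,3) a(1,3) td(1,3) c3 aj]
  note cl = elem_act_laws[OF i(2,3) a(1,3) td(1,3) c3 aj]
  have "elem_mult C B ?Fi ?Fj ?Fk (elem_act C A F j k a (tau B ?Fi ?Fj \<cdot> d)) d \<cdot> v
      = elem_mult C B ?Fi ?Fj ?Fk (elem_act C A F j k a (tau B ?Fi ?Fj \<cdot> d) \<cdot> v) (d \<cdot> v)"
    by (rule B.elem_mult_props(7)) (use fi(1) fj(1) fk(1) cp cl d td v in auto)
  also have "elem_act C A F j k a (tau B ?Fi ?Fj \<cdot> d) \<cdot> v = elem_act C A F j k (a \<cdot> v) (tau B ?Fi ?Fj \<cdot> d \<cdot> v)"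
    by (rule cp(4)) (use v td in auto)
  also have "tau B ?Fi ?Fj \<cdot> d \<cdot> v = tau B ?Fi ?Fj \<cdot> elem_act C A F i j y z"
    using d v fi(1) fj(1) by (simp add: dv)
  finally have "elem_mult C B ?Fi ?Fj ?Fk (elem_act C A F j k a (tau B ?Fi ?Fj \<cdot> d)) d \<cdot> v
      = elem_mult C B ?Fi ?Fj ?Fk (elem_act C A F j k x (tau B ?Fi ?Fj \<cdot> elem_act C A F i j y z)) (elem_act C A F i j y z)"
    using v(4) by (simp add: dv)
  then show ?thesis using L law by simp
qed

lemma sec_act_cond:
  assumes i: "i \<in> idx A" "j \<in> idx A" and s: "s \<in> A.sec i j"
  shows "sig A i j \<cdot> (s \<cdot> cf0 F i) = cf0 F i \<cdot> rst C (s \<cdot> cf0 F i)"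
    "s \<cdot> cf0 F i \<in> arrs C" "src (s \<cdot> cf0 F i) = ob0 B (cfo F i)" "trg (s \<cdot> cf0 F i) = ob1 A i j"
  using tstar_pair_cond[OF F_types(9)[OF i] s] A.secD[OF s i] F_types[OF i(1)] by auto

lemma sec_act_laws:
  assumes i: "i \<in> idx A" "j \<in> idx A" and s: "s \<in> A.sec i j"
  shows "sec_act C A F i j s \<in> B.sec (cfo F i) (cfo F j)"
    "rst C (sec_act C A F i j s) = rst C (s \<cdot> cf0 F i)"
    "cf0 F j \<cdot> (tau B (cfo F i) (cfo F j) \<cdot> sec_act C A F i j s) = tau A i j \<cdot> (s \<cdot> cf0 F i)"
proof -
  note c = sec_act_cond[OF i s] and f = F_types[OF i(1)] and g = F_types[OF i(2)]
  note sp = sec_act_props[OF raw i s]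
  have r: "rst C (s \<cdot> cf0 F i) \<in> arrs C" "trg (rst C (s \<cdot> cf0 F i)) = ob0 B (cfo F i)"
    "src (s \<cdot> cf0 F i) = src (rst C (s \<cdot> cf0 F i))" using c by auto
  note l = elem_act_laws[OF i c(2,4) r c(1), folded sp(5)]
  show 1: "rst C (sec_act C A F i j s) = rst C (s \<cdot> cf0 F i)" using l(3) c by simp
  show "sec_act C A F i j s \<in> B.sec (cfo F i) (cfo F j)"
    using l(1) 1 sp(1-3) f(1) g(1) by (simp add: psections_def)
  show "cf0 F j \<cdot> (tau B (cfo F i) (cfo F j) \<cdot> sec_act C A F i j s) = tau A i j \<cdot> (s \<cdot> cf0 F i)" by (rule l(2))
qed

text \<open>Both sides live on the domain \<open>e\<close> of the composite along
  \<open>cf0 F i\<close>. There the left side is the action on a product of elements, which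
  \<open>elem_act_mult\<close> splits, and the two factors are recognised as the images of
  \<open>t\<close> and of \<open>s\<close>.\<close>

lemma sec_act_sec_cmp:
  assumes i: "i \<in> idx A" "j \<in> idx A" "k \<in> idx A" and t: "t \<in> A.sec j k" and s: "s \<in> A.sec i j"
  shows "sec_act C A F i k (sec_cmp C A i j k t s)
    = sec_cmp C B (cfo F i) (cfo F j) (cfo F k) (sec_act C A F j k t) (sec_act C A F i j s)"
proof -
  let ?Fi = "cfo F i" and ?Fj = "cfo F j" and ?Fk = "cfo F k"
  note fi = F_types[OF i(1)] and fj = F_types[OF i(2)] and fk = F_types[OF i(3)]
  note cs = sec_act_cond[OF i(1,2) s] and s' = A.secD[OF s i(1,2)] and t' = A.secD[OF t i(2,3)]
  note sp = sec_act_props[OF raw i(1,2) s] and sl = sec_act_laws[OF i(1,2) s]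
  note tp = sec_act_props[OF raw i(2,3) t] and tl = sec_act_laws[OF i(2,3) t]
  have ts: "sec_cmp C A i j k t s \<in> A.sec i k" by (rule A.sec_cmp_sec[OF i t s])
  define x where "x = t \<cdot> (tau A i j \<cdot> (s \<cdot> cf0 F i))"
  define e where "e = rst C x"
  have x: "x \<in> arrs C" "src x = ob0 B ?Fi" "trg x = ob1 A j k" using t' s' fi i by (auto simp: x_def)
  have e: "e \<in> arrs C" "src e = ob0 B ?Fi" "trg e = ob0 B ?Fi" "rst C e = e" using x by (auto simp: e_def)
  define y where "y = s \<cdot> cf0 F i \<cdot> e"
  have y: "y \<in> arrs C" "src y = ob0 B ?Fi" "trg y = ob1 A i j" using cs e by (auto simp: y_def)
  have 1: "sec_cmp C A i j k t s \<cdot> cf0 F i = sec_cmp C A i j k t (s \<cdot> cf0 F i)"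
    using A.sec_cmp_props(6)[OF i t s'(1,3), of "cf0 F i"] fi s' by simp
  note sg = A.sec_cmp_elem_mult[OF i t cs(2,4), folded x_def e_def]
  have r: "rst C (sec_cmp C A i j k t (s \<cdot> cf0 F i)) = e"
    using A.sec_cmp_props(5)[OF i t cs(2,4)] by (simp add: x_def e_def)
  have se: "rst C (s \<cdot> cf0 F i) \<cdot> e = e"
    using rst_cmp_le(2)[of "s \<cdot> cf0 F i" "t \<cdot> tau A i j"] cs t' s' fi i by (simp add: e_def x_def)
  have xy: "sig A j k \<cdot> x = tau A i j \<cdot> y" using sg(2) by (simp add: y_def)
  have yz: "sig A i j \<cdot> y = cf0 F i \<cdot> e"
    using reassoc[OF cs(1), of e] cs e s' fi i se by (simp add: y_def)
  have L: "sec_act C A F i k (sec_cmp C A i j k t s) = elem_act C A F i k (elem_mult C A i j k x y) e"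
    using sec_act_props(5)[OF raw i(1,3) ts] sg(1) r by (simp add: 1 y_def)
  have M: "elem_act C A F i k (elem_mult C A i j k x y) e
    = elem_mult C B ?Fi ?Fj ?Fk (elem_act C A F j k x (tau B ?Fi ?Fj \<cdot> elem_act C A F i j y e)) (elem_act C A F i j y e)"
    by (rule elem_act_mult[OF i x(1,3) y(1,3) _ e(1,3) _ xy yz]) (use x y e in auto)
  have Sy: "elem_act C A F i j y e = sec_act C A F i j s \<cdot> e"
  proof -
    have "sec_act C A F i j s \<cdot> e = elem_act C A F i j (s \<cdot> (cf0 F i \<cdot> e)) (e \<cdot> rst C (s \<cdot> (cf0 F i \<cdot> e)))"
      by (rule sp(4)) (use e in auto)
    moreover have "rst C (s \<cdot> (cf0 F i \<cdot> e)) = rst C (s \<cdot> cf0 F i) \<cdot> e"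
      using rst_cmp_rid[of "s \<cdot> cf0 F i" e] e cs s' fi by (simp add: in_rids)
    ultimately show ?thesis using se e s' fi ridsD(5)[of e "ob0 B ?Fi"] by (simp add: y_def in_rids)
  qed
  let ?v = "tau B ?Fi ?Fj \<cdot> sec_act C A F i j s"
  have v: "?v \<in> arrs C" "src ?v = ob0 B ?Fi" "trg ?v = ob0 B ?Fj" using sp fi(1) fj(1) by auto
  have tx: "t \<cdot> (cf0 F j \<cdot> ?v) = x" using sl(3) by (simp add: x_def)
  have T: "sec_act C A F j k t \<cdot> ?v = elem_act C A F j k x (?v \<cdot> e)"
    using tp(4)[OF v(1,3)] tx by (simp add: e_def)
  have re: "rst C (sec_act C A F j k t \<cdot> ?v) = e"
  proof -
    have "rst C (sec_act C A F j k t \<cdot> ?v) = rst C (rst C (sec_act C A F j k t) \<cdot> ?v)"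
      using rst_rst_cmp[of ?v "sec_act C A F j k t"] tp v by simp
    also have "\<dots> = rst C (t \<cdot> cf0 F j \<cdot> ?v)"
      using rst_rst_cmp[of ?v "t \<cdot> cf0 F j"] tl(2) t' v fj by simp
    also have "t \<cdot> cf0 F j \<cdot> ?v = x" using tx t' v fj by simp
    finally show ?thesis by (simp add: e_def)
  qed
  have te: "tau B ?Fi ?Fj \<cdot> (sec_act C A F i j s \<cdot> e) = ?v \<cdot> e" using sp e fi(1) fj(1) by simp
  have "sec_cmp C B ?Fi ?Fj ?Fk (sec_act C A F j k t) (sec_act C A F i j s)
      = elem_mult C B ?Fi ?Fj ?Fk (sec_act C A F j k t \<cdot> ?v) (sec_act C A F i j s \<cdot> e)"
    using B.sec_cmp_elem_mult(1)[OF fi(1) fj(1) fk(1) tl(1) sp(1,3)] re by simp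
  then show ?thesis by (simp only: L M Sy T te)
qed

text \<open>At the identity this is preservation of units, in general preservation of restrictions;
  the unit law of the cofunctor is combined with \<open>tstar_restrict\<close>.\<close>

lemma sec_act_eta_rid:
  assumes i: "i \<in> idx A" and e: "e \<in> rids C (ob0 A i)"
  shows "sec_act C A F i i (eta A i \<cdot> e) = eta B (cfo F i) \<cdot> rst C (e \<cdot> cf0 F i)"
proof -
  note fi = F_types[OF i] and e' = ridsD[OF e]
  let ?f = "cf0 F i" and ?r = "rst C (e \<cdot> cf0 F i)"
  note tp = fi(9)[OF i] and es = A.eta_sec[OF i]
  note ts = tstar_props[OF tp es]
  have "rst C (eta A i \<cdot> ?f) = idn C (ob0 B (cfo F i))"
    using total_cmp_rst[of ?f "eta A i"] A.eta_rst[OF i] i fi by (simp add: total_def)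
  then have "cf1 F (i, i) \<cdot> tstar C (sig A i i) ?f (eta A i) = eta B (cfo F i)"
    using cf1_eta[OF i] by (simp add: tstar_def)
  moreover have "tstar C (sig A i i) ?f (eta A i \<cdot> e) = tstar C (sig A i i) ?f (eta A i) \<cdot> ?r"
    by (rule tstar_restrict[OF tp es]) (use e i in simp)
  ultimately show ?thesis
    unfolding sec_act_def using reassoc[of "cf1 F (i, i)" "tstar C (sig A i i) ?f (eta A i)" _ ?r] ts fi i e' by simp
qed

lemma Phi_map_far:
  assumes "x \<in> arrs (Phi_cat C A)"
  shows "far (fst (Phi_map C A F)) x \<in> arrs (Phi_cat C B)"
    "src (far (fst (Phi_map C A F)) x) = cfo F (src x)" "trg (far (fst (Phi_map C A F)) x) = cfo F (trg x)"
    "the_sec B (far (fst (Phi_map C A F)) x) = sec_act C A F (src x) (trg x) (the_sec A x)"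
proof -
  note x = A.Phi_sec[OF assms]
  have 1: "far (fst (Phi_map C A F)) x = sec_arr (cfo F (src x)) (cfo F (trg x)) (sec_act C A F (src x) (trg x) (the_sec A x))"
    using assms by (simp add: Phi_map_sec_act restrict_func_def)
  note s = sec_act_laws(1)[OF x(1-3)]
  show "far (fst (Phi_map C A F)) x \<in> arrs (Phi_cat C B)"
    "src (far (fst (Phi_map C A F)) x) = cfo F (src x)" "trg (far (fst (Phi_map C A F)) x) = cfo F (trg x)"
    "the_sec B (far (fst (Phi_map C A F)) x) = sec_act C A F (src x) (trg x) (the_sec A x)"
    unfolding 1 using B.sec_arr_in_Phi[OF _ _ s] F_types(1)[OF x(1)] F_types(1)[OF x(2)] sec_act_props(1-3)[OF raw x(1-3)]
    by auto
qed

lemma Phi_map_over: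
  "is_over_map C (Phi_cat C A, Phi_proj C A) (Phi_cat C B, Phi_proj C B) (Phi_map C A F)"
proof -
  interpret PA: restriction_category "Phi_cat C A" by (rule A.Phi_restriction)
  interpret PB: restriction_category "Phi_cat C B" by (rule B.Phi_restriction)
  let ?H = "fst (Phi_map C A F)"
  note far = Phi_map_far
  have ob: "fob ?H i = cfo F i" if "i \<in> idx A" for i
    using that by (simp add: Phi_map_sec_act restrict_func_def)
  have al: "snd (Phi_map C A F) = restrict (cf0 F) (idx A)" by (simp add: Phi_map_sec_act)
  have RF: "restriction_functor (Phi_cat C A) (Phi_cat C B) ?H"
  proof
    show "fob ?H X \<in> obj (Phi_cat C B)" if "X \<in> obj (Phi_cat C A)" for X
      using that ob F_types(1) by simp
    show "far ?H f \<in> hom (Phi_cat C B) (fob ?H X) (fob ?H Y)" if fh: "f \<in> hom (Phi_cat C A) X Y" for f X Y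
    proof -
      have f: "f \<in> arrs (Phi_cat C A)" "src f = X" "trg f = Y" using fh by auto
      show ?thesis using far[OF f(1)] A.Phi_sec(1,2)[OF f(1)] f ob by simp
    qed
    show "far ?H (idn (Phi_cat C A) X) = idn (Phi_cat C B) (fob ?H X)" if X: "X \<in> obj (Phi_cat C A)" for X
    proof -
      have X': "X \<in> idx A" using X by simp
      note ia = A.Phi_idn[OF X'] and ib = B.Phi_idn[OF F_types(1)[OF X']] and f = F_types[OF X']
      have "sec_act C A F X X (eta A X) = eta B (cfo F X)"
        using sec_act_eta_rid[OF X', of "idn C (ob0 A X)"] X' f by (simp add: total_def)
      then show ?thesis
        by (intro B.Phi_eqI) (use far[OF ia(1)] ia ib ob[OF X'] in auto)
    qed
    show "far ?H (g \<cdot>\<^bsub>Phi_cat C A\<^esub> f) = far ?H g \<cdot>\<^bsub>Phi_cat C B\<^esub> far ?H f"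
      if fh: "f \<in> hom (Phi_cat C A) X Y" and gh: "g \<in> hom (Phi_cat C A) Y Z" for f g X Y Z
    proof -
      have f: "f \<in> arrs (Phi_cat C A)" "src f = X" "trg f = Y" and g: "g \<in> arrs (Phi_cat C A)" "src g = Y" "trg g = Z"
        using fh gh by auto
      note f' = A.Phi_sec[OF f(1), unfolded f] and g' = A.Phi_sec[OF g(1), unfolded g]
      note gf = A.Phi_cmp[OF f(1) g(1), unfolded f g, OF refl]
      note Ff = far[OF f(1), unfolded f] and Fg = far[OF g(1), unfolded g] and Fgf = far[OF gf(1), unfolded gf(2-4)]
      note c = B.Phi_cmp[OF Ff(1) Fg(1), unfolded Ff(2-4) Fg(2-4), OF refl]
      show ?thesis
        by (rule B.Phi_eqI) (use c Fgf sec_act_sec_cmp[OF f'(1,2) g'(2,3) f'(3)] in auto)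
    qed
    show "far ?H (rst (Phi_cat C A) f) = rst (Phi_cat C B) (far ?H f)" if f: "f \<in> arrs (Phi_cat C A)" for f
    proof -
      note f' = A.Phi_sec[OF f] and r = A.Phi_rst[OF f] and Ff = far[OF f]
      note Fr = far[OF r(1), unfolded r(2-4)] and rF = B.Phi_rst[OF Ff(1), unfolded Ff(2-4)]
      note ft = F_types[OF f'(1)]
      have "rst C (rst C (the_sec A f) \<cdot> cf0 F (src f)) = rst C (the_sec A f \<cdot> cf0 F (src f))"
        using rst_rst_cmp[of "cf0 F (src f)" "the_sec A f"] f' ft by simp
      then have "sec_act C A F (src f) (src f) (eta A (src f) \<cdot> rst C (the_sec A f))
          = eta B (cfo F (src f)) \<cdot> rst C (sec_act C A F (src f) (trg f) (the_sec A f))"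
        using sec_act_eta_rid[OF f'(1), of "rst C (the_sec A f)"] sec_act_laws(2)[OF f'(1-3)] f' by simp
      then show ?thesis by (intro B.Phi_eqI) (use Fr rF in auto)
    qed
  qed
  have "is_over_map C (Phi_cat C A, Phi_proj C A) (Phi_cat C B, Phi_proj C B) (?H, snd (Phi_map C A F))"
    unfolding is_over_map.simps al
  proof (intro conjI ballI RF)
    show "fob ?H \<in> extensional (obj (Phi_cat C A))" "far ?H \<in> extensional (arrs (Phi_cat C A))"
      "restrict (cf0 F) (idx A) \<in> extensional (obj (Phi_cat C A))"
      by (auto simp: Phi_map_sec_act restrict_func_def)
    fix i assume "i \<in> obj (Phi_cat C A)"
    then have i: "i \<in> idx A" by simp
    show "restrict (cf0 F) (idx A) i \<in> hom C (fob (Phi_proj C B) (fob ?H i)) (fob (Phi_proj C A) i)"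
      "total C (restrict (cf0 F) (idx A) i)"
      using F_types[OF i] ob[OF i] i by (auto simp: A.Phi_proj_far(2) B.Phi_proj_far(2))
  next
    fix f assume f: "f \<in> arrs (Phi_cat C A)"
    note f' = A.Phi_sec[OF f] and Ff = far[OF f] and ft = F_types[OF A.Phi_sec(1)[OF f]]
    show "restrict (cf0 F) (idx A) (trg f) \<cdot> far (Phi_proj C B) (far ?H f)
        = far (Phi_proj C A) f \<cdot> restrict (cf0 F) (idx A) (src f)"
      using sec_act_laws(3)[OF f'(1-3)] f' Ff ft by (simp add: A.Phi_proj_far B.Phi_proj_far)
  qed
  then show ?thesis by simp
qed

end

section \<open>Functors over the base come from cofunctors\<close>

lemma (in pcat_over) sec_arr_eq: "\<lbrakk>src y = i; trg y = j\<rbrakk> \<Longrightarrow> sec_arr i j (the_sec A y) = y"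
  by auto

context pcat_pair
begin

text \<open>The functor prescribes the value of \<open>cf1\<close> on each pulled back section, and
  \<open>pullback_lift\<close> produces a map with these values. Its agreement condition is met
  because the functor preserves composition with restriction idempotents, so sections equal on
  \<open>c\<close> have images equal on the preimage of \<open>c\<close>.\<close>

lemma Phi_map_full:
  assumes se: "source_etale C A"
    and h: "is_over_map C (Phi_cat C A, Phi_proj C A) (Phi_cat C B, Phi_proj C B) h"
  shows "\<exists>F. partite_cofunctor C A B F \<and> Phi_map C A F = h"
proof -
  obtain H \<alpha> where hH: "h = (H, \<alpha>)" by (cases h)
  have RF: "restriction_functor (Phi_cat C A) (Phi_cat C B) H"
    and ext: "fob H \<in> extensional (idx A)" "far H \<in> extensional (arrs (Phi_cat C A))" "\<alpha> \<in> extensional (idx A)"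
    and \<alpha>: "\<And>i. i \<in> idx A \<Longrightarrow> \<alpha> i \<in> hom C (ob0 B (fob H i)) (ob0 A i) \<and> total C (\<alpha> i)"
    and nat: "\<And>f. f \<in> arrs (Phi_cat C A) \<Longrightarrow> \<alpha> (trg f) \<cdot> far (Phi_proj C B) (far H f) = far (Phi_proj C A) f \<cdot> \<alpha> (src f)"
    using h unfolding hH is_over_map.simps by (auto simp: A.Phi_proj_far(2) B.Phi_proj_far(2))
  interpret H: restriction_functor "Phi_cat C A" "Phi_cat C B" H by (rule RF)
  define hs where "hs i j s = the_sec B (far H (sec_arr i j s))" for i j and s :: "('o, 'u) arr"
  have Ho: "fob H i \<in> idx B" if "i \<in> idx A" for i using H.fob_obj[of i] that by simp
  have al: "\<alpha> i \<in> arrs C" "src (\<alpha> i) = ob0 B (fob H i)" "trg (\<alpha> i) = ob0 A i" "total C (\<alpha> i)" if "i \<in> idx A" for i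
    using \<alpha>[OF that] by auto
  have tp: "total_pb C (sig A i j) (\<alpha> i)" if "i \<in> idx A" "j \<in> idx A" for i j
    using A.sig_pb[OF that al(4)[OF that(1)] al(3)[OF that(1)]] .
  have sc: "section_cover C (sig A i j) (A.sec i j) (\<lambda>s. s)" if "i \<in> idx A" "j \<in> idx A" for i j
    using local_homeo_section_cover se that by (simp add: source_etale_def)
  have farH: "far H (sec_arr i j s) \<in> arrs (Phi_cat C B)" "src (far H (sec_arr i j s)) = fob H i"
    "trg (far H (sec_arr i j s)) = fob H j" if "i \<in> idx A" "j \<in> idx A" "s \<in> A.sec i j" for i j s
    using H.far_hom[of "sec_arr i j s" i j] A.sec_arr_in_Phi[OF that] by auto
  have hs: "hs i j s \<in> B.sec (fob H i) (fob H j)" "hs i j s \<in> arrs C" "src (hs i j s) = ob0 B (fob H i)"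
    "trg (hs i j s) = ob1 B (fob H i) (fob H j)"
    "\<alpha> j \<cdot> (tau B (fob H i) (fob H j) \<cdot> hs i j s) = tau A i j \<cdot> (s \<cdot> \<alpha> i)"
    "rst C (hs i j s) = rst C (s \<cdot> \<alpha> i)"
    if i: "i \<in> idx A" "j \<in> idx A" and s: "s \<in> A.sec i j" for i j s
  proof -
    note x = farH[OF i s] and s' = A.secD[OF s i]
    note y = B.Phi_sec[OF x(1), unfolded x]
    show t: "hs i j s \<in> B.sec (fob H i) (fob H j)" "hs i j s \<in> arrs C" "src (hs i j s) = ob0 B (fob H i)"
      "trg (hs i j s) = ob1 B (fob H i) (fob H j)"
      using y by (auto simp: hs_def)
    show n: "\<alpha> j \<cdot> (tau B (fob H i) (fob H j) \<cdot> hs i j s) = tau A i j \<cdot> (s \<cdot> \<alpha> i)"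
      using nat[OF A.sec_arr_in_Phi[OF i s]] x s' al i y by (simp add: A.Phi_proj_far B.Phi_proj_far hs_def)
    have "rst C (hs i j s) = rst C (\<alpha> j \<cdot> (tau B (fob H i) (fob H j) \<cdot> hs i j s))"
      using total_cmp_rst[of "tau B (fob H i) (fob H j) \<cdot> hs i j s" "\<alpha> j"]
        B.tau_rst[of "hs i j s" "fob H i" "fob H j"] t al[OF i(2)] Ho i by simp
    also have "\<dots> = rst C (s \<cdot> \<alpha> i)"
      unfolding n using A.tau_rst[of "s \<cdot> \<alpha> i" i j] s' al i by simp
    finally show "rst C (hs i j s) = rst C (s \<cdot> \<alpha> i)" .
  qed
  have hs_cmp: "hs i k (sec_cmp C A i j k t s) = sec_cmp C B (fob H i) (fob H j) (fob H k) (hs j k t) (hs i j s)"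
    if i: "i \<in> idx A" "j \<in> idx A" "k \<in> idx A" and t: "t \<in> A.sec j k" and s: "s \<in> A.sec i j" for i j k t s
  proof -
    note x = A.sec_arr_in_Phi[OF i(1,2) s] and y = A.sec_arr_in_Phi[OF i(2,3) t]
    note s' = A.secD[OF s i(1,2)] and t' = A.secD[OF t i(2,3)]
    note c = A.Phi_cmp[OF x y] 
    have yx: "sec_arr j k t \<cdot>\<^bsub>Phi_cat C A\<^esub> sec_arr i j s = sec_arr i k (sec_cmp C A i j k t s)"
      using A.sec_arr_the_sec[of "sec_arr j k t \<cdot>\<^bsub>Phi_cat C A\<^esub> sec_arr i j s"] c s' t' by simp
    have "far H (sec_arr i k (sec_cmp C A i j k t s)) = far H (sec_arr j k t) \<cdot>\<^bsub>Phi_cat C B\<^esub> far H (sec_arr i j s)"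
      using H.far_cmp[of "sec_arr i j s" i j "sec_arr j k t" k] x y by (simp flip: yx)
    then show ?thesis
      using B.Phi_cmp(4)[OF farH(1)[OF i(1,2) s] farH(1)[OF i(2,3) t]] farH[OF i(1,2) s] farH[OF i(2,3) t]
      by (simp add: hs_def)
  qed
  have hs_eta: "hs i i (eta A i) = eta B (fob H i)" if i: "i \<in> idx A" for i
  proof -
    have "idn (Phi_cat C A) i = sec_arr i i (eta A i)" by (simp add: Phi_cat_def)
    then show ?thesis using H.far_idn[of i] B.Phi_idn(4)[OF Ho[OF i]] i by (simp add: hs_def)
  qed
  \<comment> \<open>A restriction functor sends an idempotent to an idempotent. Which one is read
    off from the domain of its image, and naturality with totality of \<alpha> fixes that
    domain.\<close>
  have hs_rid: "hs i i (eta A i \<cdot> e) = eta B (fob H i) \<cdot> rst C (e \<cdot> \<alpha> i)"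
    if i: "i \<in> idx A" and e: "e \<in> rids C (ob0 A i)" for i e
  proof -
    let ?x = "sec_arr i i (eta A i \<cdot> e)"
    have x: "?x \<in> rids (Phi_cat C A) i" using A.Phi_rids i e by blast
    then have x': "?x \<in> arrs (Phi_cat C A)" "rst (Phi_cat C A) ?x = ?x" by (auto simp: in_rids)
    note s = A.eta_rid_sec[OF i e] and e' = ridsD[OF e]
    have "far H ?x = rst (Phi_cat C B) (far H ?x)" using H.far_rst[OF x'(1)] x'(2) by simp
    then have "hs i i (eta A i \<cdot> e) = eta B (fob H i) \<cdot> rst C (hs i i (eta A i \<cdot> e))"
      using B.Phi_rst(4)[OF farH(1)[OF i i s]] farH(2,3)[OF i i s] by (simp add: hs_def)
    also have "rst C (hs i i (eta A i \<cdot> e)) = rst C (e \<cdot> \<alpha> i)"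
      using hs(6)[OF i i s] total_cmp_rst[of "e \<cdot> \<alpha> i" "eta A i"] A.eta_rst[OF i] i e' al[OF i]
      by (simp add: total_def)
    finally show ?thesis .
  qed
  have hs_restrict: "hs i j (s \<cdot> e) = hs i j s \<cdot> rst C (e \<cdot> \<alpha> i)"
    if i: "i \<in> idx A" "j \<in> idx A" and s: "s \<in> A.sec i j" and e: "e \<in> rids C (ob0 A i)" for i j s e
  proof -
    have "hs i j (s \<cdot> e) = sec_cmp C B (fob H i) (fob H i) (fob H j) (hs i j s) (eta B (fob H i) \<cdot> rst C (e \<cdot> \<alpha> i))"
      using hs_cmp[OF i(1) i s A.eta_rid_sec[OF i(1) e]] A.sec_cmp_rid_right[OF i s e] hs_rid[OF i(1) e] by simp
    then show ?thesis
      using B.sec_cmp_rid_right[OF Ho[OF i(1)] Ho[OF i(2)] hs(1)[OF i s], of "rst C (e \<cdot> \<alpha> i)"]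
        al[OF i(1)] ridsD[OF e] by simp
  qed
  have "\<exists>k. k \<in> hom C (pbob C (sig A i j) (\<alpha> i)) (ob1 B (fob H i) (fob H j)) \<and>
      (\<forall>s \<in> A.sec i j. k \<cdot> tstar C (sig A i j) (\<alpha> i) s = hs i j s)" if i: "i \<in> idx A" "j \<in> idx A" for i j
  proof -
    have "\<exists>k \<in> hom C (pbob C (sig A i j) (\<alpha> i)) (ob1 B (fob H i) (fob H j)).
      \<forall>s \<in> A.sec i j. k \<cdot> tstar C (sig A i j) (\<alpha> i) s = hs i j s"
    proof (rule pullback_lift[OF sc[OF i] tp[OF i]])
      show "hs i j s \<in> hom C (src (\<alpha> i)) (ob1 B (fob H i) (fob H j))" if "s \<in> A.sec i j" for s
        using hs[OF i that] al[OF i(1)] by simp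
      show "hs i j s \<cdot> rst C (s \<cdot> \<alpha> i) = hs i j s" if "s \<in> A.sec i j" for s
        using hs(2,6)[OF i that] cmp_rst_self by metis
      show "ob1 B (fob H i) (fob H j) \<in> obj C" using Ho i by simp
      show "hs i j s \<cdot> rst C (c \<cdot> \<alpha> i) = hs i j t \<cdot> rst C (c \<cdot> \<alpha> i)"
        if "s \<in> A.sec i j" "t \<in> A.sec i j" "c \<in> rids C (trg (sig A i j))" "s \<cdot> c = t \<cdot> c" for s t c
        using hs_restrict[OF i that(1), of c] hs_restrict[OF i that(2), of c] that i by simp
    qed
    then show ?thesis by blast
  qed
  then obtain c where c: "\<And>i j. i \<in> idx A \<Longrightarrow> j \<in> idx A \<Longrightarrow>
      c i j \<in> hom C (pbob C (sig A i j) (\<alpha> i)) (ob1 B (fob H i) (fob H j)) \<and>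
      (\<forall>s \<in> A.sec i j. c i j \<cdot> tstar C (sig A i j) (\<alpha> i) s = hs i j s)" by metis
  define F where "F = \<lparr>cfo = fob H, cf0 = \<alpha>, cf1 = restrict (\<lambda>(i, j). c i j) (idx A \<times> idx A)\<rparr>"
  have F: "cfo F = fob H" "cf0 F = \<alpha>" "\<And>i j. i \<in> idx A \<Longrightarrow> j \<in> idx A \<Longrightarrow> cf1 F (i, j) = c i j"
    by (auto simp: F_def)
  have raw: "raw_cofun C A B F"
    using ext Ho \<alpha> c unfolding raw_cofun_def by (auto simp: F PiE_def) (simp_all add: F_def)
  have sec_act: "sec_act C A F i j s = hs i j s" if "i \<in> idx A" "j \<in> idx A" "s \<in> A.sec i j" for i j s
    using c that by (simp add: sec_act_def F)
  have Fmap: "Phi_map C A F = h"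
  proof -
    have "restrict (\<lambda>f. sec_arr (fob H (src f)) (fob H (trg f)) (sec_act C A F (src f) (trg f) (the_sec A f)))
        (arrs (Phi_cat C A)) = far H"
    proof (rule extensionalityI)
      fix f assume f: "f \<in> arrs (Phi_cat C A)"
      note f' = A.Phi_sec[OF f] and x = farH[OF A.Phi_sec(1-3)[OF f]]
      have "sec_arr (fob H (src f)) (fob H (trg f)) (hs (src f) (trg f) (the_sec A f)) = far H f"
        using B.sec_arr_eq[of "far H f"] x by (simp add: hs_def)
      then show "restrict (\<lambda>f. sec_arr (fob H (src f)) (fob H (trg f)) (sec_act C A F (src f) (trg f) (the_sec A f)))
        (arrs (Phi_cat C A)) f = far H f" using f f' sec_act by simp
    qed (use ext in auto)
    then show ?thesis
      using ext by (simp add: Phi_map_sec_act hH F restrict_func_def extensional_restrict)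
  qed
  have ct: "c i j \<in> arrs C" "src (c i j) = pbob C (sig A i j) (\<alpha> i)" "trg (c i j) = ob1 B (fob H i) (fob H j)"
    "\<And>s. s \<in> A.sec i j \<Longrightarrow> c i j \<cdot> tstar C (sig A i j) (\<alpha> i) s = hs i j s"
    if "i \<in> idx A" "j \<in> idx A" for i j
    using c[OF that] by auto
  have pt: "pr1 C (sig A i j) (\<alpha> i) \<in> arrs C" "src (pr1 C (sig A i j) (\<alpha> i)) = pbob C (sig A i j) (\<alpha> i)"
    "trg (pr1 C (sig A i j) (\<alpha> i)) = ob1 A i j"
    "pr2 C (sig A i j) (\<alpha> i) \<in> arrs C" "src (pr2 C (sig A i j) (\<alpha> i)) = pbob C (sig A i j) (\<alpha> i)"
    "trg (pr2 C (sig A i j) (\<alpha> i)) = ob0 B (fob H i)" if "i \<in> idx A" "j \<in> idx A" for i j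
    using pb_types[OF total_pbD(1)[OF tp[OF that]]] al that by auto
  \<comment> \<open>Both laws are equations between maps out of a pullback. On pulled back sections
    the first says that images are sections, the second that \<alpha> is natural.\<close>
  have sigc: "sig B (fob H i) (fob H j) \<cdot> c i j = pr2 C (sig A i j) (\<alpha> i)"
    and tauc: "\<alpha> j \<cdot> tau B (fob H i) (fob H j) \<cdot> c i j = tau A i j \<cdot> pr1 C (sig A i j) (\<alpha> i)"
    if i: "i \<in> idx A" "j \<in> idx A" for i j
  proof -
    note cij = ct[OF i] and p = pt[OF i] and Hi = Ho[OF i(1)] and Hj = Ho[OF i(2)]
    have *: "sig B (fob H i) (fob H j) \<cdot> c i j \<cdot> tstar C (sig A i j) (\<alpha> i) s
          = pr2 C (sig A i j) (\<alpha> i) \<cdot> tstar C (sig A i j) (\<alpha> i) s"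
        "\<alpha> j \<cdot> tau B (fob H i) (fob H j) \<cdot> c i j \<cdot> tstar C (sig A i j) (\<alpha> i) s
          = tau A i j \<cdot> pr1 C (sig A i j) (\<alpha> i) \<cdot> tstar C (sig A i j) (\<alpha> i) s" if s: "s \<in> A.sec i j" for s
      using cij(1-3) cij(4)[OF s] tstar_props[OF tp[OF i] s] al i Hi Hj p
        B.secD(4)[OF hs(1)[OF i s]] hs(5,6)[OF i s] by simp_all
    show "sig B (fob H i) (fob H j) \<cdot> c i j = pr2 C (sig A i j) (\<alpha> i)"
      by (rule pullback_ext[OF sc[OF i] tp[OF i], of _ "ob0 B (fob H i)"]) (use cij p Hi Hj * in auto)
    show "\<alpha> j \<cdot> tau B (fob H i) (fob H j) \<cdot> c i j = tau A i j \<cdot> pr1 C (sig A i j) (\<alpha> i)"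
      by (rule pullback_ext[OF sc[OF i] tp[OF i], of _ "ob0 A j"]) (use cij p Hi Hj al i * in auto)
  qed
  have "partite_cofunctor C A B F"
  proof (unfold_locales, unfold F(1,2))
    show "fob H \<in> idx A \<rightarrow>\<^sub>E idx B" "\<alpha> \<in> extensional (idx A)" "cf1 F \<in> extensional (idx A \<times> idx A)"
      using raw by (auto simp: raw_cofun_def F)
    show "\<alpha> i \<in> hom C (ob0 B (fob H i)) (ob0 A i)" "total C (\<alpha> i)" if "i \<in> idx A" for i using \<alpha>[OF that] by auto
    fix i j assume i: "i \<in> idx A" "j \<in> idx A"
    note f = F(3)[OF i] and cij = ct[OF i] and p = pt[OF i]
    show "cf1 F (i, j) \<in> hom C (pbob C (sig A i j) (\<alpha> i)) (ob1 B (fob H i) (fob H j))"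
      using cij by (simp add: f)
    note sct = section_cover_tstar[OF sc[OF i] tp[OF i]]
    show "total C (cf1 F (i, j))"
      unfolding f
    proof (rule section_cover_total[OF sct])
      show "c i j \<in> arrs C" "src (c i j) = src (pr2 C (sig A i j) (\<alpha> i))" using cij p by auto
      show "rst C (c i j \<cdot> tstar C (sig A i j) (\<alpha> i) s) = rst C (tstar C (sig A i j) (\<alpha> i) s)" if "s \<in> A.sec i j" for s
        using cij(4)[OF that] hs(6)[OF i that] tstar_props(6)[OF tp[OF i] that] by simp
    qed
    show "sig B (fob H i) (fob H j) \<cdot> cf1 F (i, j) = pr2 C (sig A i j) (\<alpha> i)" using sigc[OF i] by (simp add: f)
    show "\<alpha> j \<cdot> tau B (fob H i) (fob H j) \<cdot> cf1 F (i, j) = tau A i j \<cdot> pr1 C (sig A i j) (\<alpha> i)"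
      using tauc[OF i] by (simp only: f)
  next
    fix i assume i: "i \<in> idx A"
    have "rst C (eta A i \<cdot> \<alpha> i) = idn C (ob0 B (fob H i))"
      using total_cmp_rst[of "\<alpha> i" "eta A i"] A.eta_rst[OF i] i al[OF i] by (simp add: total_def)
    then have "pair C (sig A i i) (\<alpha> i) (eta A i \<cdot> \<alpha> i) (idn C (ob0 B (fob H i))) = tstar C (sig A i i) (\<alpha> i) (eta A i)"
      by (simp add: tstar_def)
    then show "cf1 F (i, i) \<cdot> pair C (sig A i i) (\<alpha> i) (eta A i \<cdot> \<alpha> i) (idn C (ob0 B (fob H i))) = eta B (fob H i)"
      using ct(4)[OF i i] hs_eta[OF i] i by (simp add: F)
  next
    fix i j k a bc b cc d
    assume i: "i \<in> idx A" "j \<in> idx A" "k \<in> idx A"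
      and a: "a = pr1 C (sig A j k) (tau A i j \<cdot> pr1 C (sig A i j) (\<alpha> i))"
      and bc: "bc = pr2 C (sig A j k) (tau A i j \<cdot> pr1 C (sig A i j) (\<alpha> i))"
      and b: "b = pr1 C (sig A i j) (\<alpha> i) \<cdot> bc" and cc: "cc = pr2 C (sig A i j) (\<alpha> i) \<cdot> bc"
      and d: "d = cf1 F (i, j) \<cdot> bc"
    let ?Hi = "fob H i" and ?Hj = "fob H j" and ?Hk = "fob H k"
    note Hi = Ho[OF i(1)] and Hj = Ho[OF i(2)] and Hk = Ho[OF i(3)]
    note ai = al[OF i(1)] and aj = al[OF i(2)]
    define P where "P = pr1 C (sig A i j) (\<alpha> i)"
    define Q where "Q = pr2 C (sig A i j) (\<alpha> i)"
    define D where "D = pbob C (sig A i j) (\<alpha> i)"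
    note tp1 = tp[OF i(1,2)]
    note pb1 = total_pbD(1)[OF tp1]
    have P: "P \<in> arrs C" "src P = D" "trg P = ob1 A i j" and Q: "Q \<in> arrs C" "src Q = D" "trg Q = ob0 B ?Hi"
      and PQ: "sig A i j \<cdot> P = \<alpha> i \<cdot> Q"
      using pb_types[OF pb1] pt[OF i(1,2)] by (auto simp: P_def Q_def D_def)
    have "total C (tau A i j \<cdot> P)"
      using total_cmp[of P "tau A i j"] total_pbD(4)[OF tp1] A.tau_total[OF i(1,2)] i P by (simp add: P_def)
    then have tp2: "total_pb C (sig A j k) (tau A i j \<cdot> P)"
      by (rule A.sig_pb[OF i(2,3)]) (use P i in auto)
    note pb2 = total_pbD(1)[OF tp2]
    define E where "E = pbob C (sig A j k) (tau A i j \<cdot> P)"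
    have a': "a \<in> arrs C" "src a = E" "trg a = ob1 A j k" and bc': "bc \<in> arrs C" "src bc = E" "trg bc = D"
      and sq: "sig A j k \<cdot> a = tau A i j \<cdot> (P \<cdot> bc)"
      using pb_types[OF pb2] i P by (auto simp: a bc E_def simp flip: P_def)
    have b': "b \<in> arrs C" "src b = E" "trg b = ob1 A i j" and cc': "cc \<in> arrs C" "src cc = E" "trg cc = ob0 B ?Hi"
      using P Q bc' by (auto simp: b cc simp flip: P_def Q_def)
    have d': "d \<in> arrs C" "src d = E" "trg d = ob1 B ?Hi ?Hj"
      using ct[OF i(1,2)] bc' i by (auto simp: d F D_def)
    have sqb: "sig A j k \<cdot> a = tau A i j \<cdot> b" using sq by (simp add: b P_def)
    have sqc: "sig A i j \<cdot> b = \<alpha> i \<cdot> cc"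
      using reassoc[OF PQ, of bc] P Q bc' ai i by (simp add: b cc flip: P_def Q_def)
    have "\<alpha> j \<cdot> tau B ?Hi ?Hj \<cdot> cf1 F (i, j) = tau A i j \<cdot> P" using tauc[OF i(1,2)] i by (simp only: F P_def)
    then have sqd: "sig A j k \<cdot> a = \<alpha> j \<cdot> (tau B ?Hi ?Hj \<cdot> d)"
      using sq reassoc[of "\<alpha> j \<cdot> tau B ?Hi ?Hj" "cf1 F (i, j)" "tau A i j \<cdot> P" bc]
        ct(1-3)[OF i(1,2)] bc' d' i P aj Hi Hj by (simp add: d F D_def)
    have td: "tau B ?Hi ?Hj \<cdot> d \<in> arrs C" "src (tau B ?Hi ?Hj \<cdot> d) = E" "trg (tau B ?Hi ?Hj \<cdot> d) = ob0 B ?Hj"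
      using d' Hi Hj by auto
    have ab: "src a = src b" "src b = src cc" "src a = src (tau B ?Hi ?Hj \<cdot> d)" using a' b' cc' td by auto
    note g = A.elem_mult_props[OF i a'(1,3) b'(1,3) ab(1) sqb]
    have gc: "sig A i k \<cdot> elem_mult C A i j k a b = cf0 F i \<cdot> cc" using g(4) sqc by (simp add: F)
    have gcc: "trg cc = ob0 B (cfo F i)" "src (elem_mult C A i j k a b) = src cc" using cc' g(2) ab by (auto simp: F)
    note cl = elem_act_props[OF raw i(1,3) g(1,3) cc'(1) gcc gc]
    have sqd': "sig A j k \<cdot> a = cf0 F j \<cdot> (tau B ?Hi ?Hj \<cdot> d)" "trg (tau B ?Hi ?Hj \<cdot> d) = ob0 B (cfo F j)"
      using sqd td by (auto simp: F)
    note cr = elem_act_props[OF raw i(2,3) a'(1,3) td(1) sqd'(2) ab(3) sqd'(1)]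
    let ?L = "elem_act C A F i k (elem_mult C A i j k a b) cc"
    let ?N = "elem_act C A F j k a (tau B ?Hi ?Hj \<cdot> d)"
    have R0: "sig B ?Hj ?Hk \<cdot> ?N = tau B ?Hi ?Hj \<cdot> d"
    proof -
      have cnd: "trg a = src (sig A j k)" "trg (tau B ?Hi ?Hj \<cdot> d) = src (\<alpha> j)"
        using a' td aj i by auto
      note pp = pair_props[OF total_pbD(1)[OF tp[OF i(2,3)]] a'(1) td(1) ab(3) cnd sqd]
      show ?thesis
        using reassoc[OF sigc[OF i(2,3)], of "pair C (sig A j k) (\<alpha> j) a (tau B ?Hi ?Hj \<cdot> d)"] pp ct(1-3)[OF i(2,3)] Hj Hk i
        by (simp add: elem_act_def F)
    qed
    have R0t: "?N \<in> arrs C" "trg ?N = ob1 B ?Hj ?Hk" "src ?N = src d" using cr td d' by (auto simp: F)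
    note gr = B.elem_mult_props[OF Hi Hj Hk R0t(1,2) d'(1,3) R0t(3) R0]
    let ?R = "elem_mult C B ?Hi ?Hj ?Hk ?N d"
    \<comment> \<open>Sections \<open>t\<close> of the outer factor reduce the equation from the
      iterated pullback to the inner one, and sections \<open>s\<close> of that reduce it to
      preservation of the composite of \<open>t\<close> and \<open>s\<close>, which is
      functoriality.\<close>
    have LR: "?L = ?R"
    proof (rule pullback_ext[OF sc[OF i(2,3)] tp2])
      show "?L \<in> hom C (pbob C (sig A j k) (tau A i j \<cdot> P)) (ob1 B ?Hi ?Hk)"
        "?R \<in> hom C (pbob C (sig A j k) (tau A i j \<cdot> P)) (ob1 B ?Hi ?Hk)"
        using cl(1-3) cc' gr(1-3) d' by (auto simp: F E_def)
      fix t assume t: "t \<in> A.sec j k"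
      note t' = A.secD[OF t i(2,3)]
      let ?w2 = "tstar C (sig A j k) (tau A i j \<cdot> P) t"
      note w2 = tstar_props[OF tp2 t]
      have w2': "?w2 \<in> arrs C" "src ?w2 = D" "trg ?w2 = E" using w2(1-3) P i by (auto simp: E_def)
      show "?L \<cdot> ?w2 = ?R \<cdot> ?w2"
      proof (rule pullback_ext[OF sc[OF i(1,2)] tp1])
        show "?L \<cdot> ?w2 \<in> hom C (pbob C (sig A i j) (\<alpha> i)) (ob1 B ?Hi ?Hk)"
          "?R \<cdot> ?w2 \<in> hom C (pbob C (sig A i j) (\<alpha> i)) (ob1 B ?Hi ?Hk)"
          using cl(1-3) cc' gr(1-3) d' w2' by (auto simp: F D_def)
        fix s assume s: "s \<in> A.sec i j"
        note s' = A.secD[OF s i(1,2)]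
        let ?w1 = "tstar C (sig A i j) (\<alpha> i) s"
        note w1 = tstar_props[OF tp1 s]
        have w1': "?w1 \<in> arrs C" "src ?w1 = ob0 B ?Hi" "trg ?w1 = D" using w1(1-3) ai by (auto simp: D_def)
        have w1P: "P \<cdot> ?w1 = s \<cdot> \<alpha> i" "Q \<cdot> ?w1 = rst C (s \<cdot> \<alpha> i)" using w1(4,5) by (auto simp: P_def Q_def)
        define T where "T = t \<cdot> (tau A i j \<cdot> (s \<cdot> \<alpha> i))"
        have T: "T \<in> arrs C" "src T = ob0 B ?Hi" "trg T = ob1 A j k" using t' s' ai i by (auto simp: T_def)
        define e where "e = rst C T"
        have e: "e \<in> arrs C" "src e = ob0 B ?Hi" "trg e = ob0 B ?Hi" "e \<in> rids C (ob0 B ?Hi)"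
          using T by (auto simp: e_def)
        have se: "rst C (s \<cdot> \<alpha> i) \<cdot> e = e"
          using rst_cmp_le(2)[of "s \<cdot> \<alpha> i" "t \<cdot> tau A i j"] s' t' ai i by (simp add: e_def T_def)
        \<comment> \<open>On \<open>W\<close> both sides become the image of the composite of the sections \<open>t\<close> and \<open>s\<close>.\<close>
        define W where "W = ?w2 \<cdot> ?w1"
        have W: "W \<in> arrs C" "src W = ob0 B ?Hi" "trg W = E" using w1' w2' by (auto simp: W_def)
        have aW: "a \<cdot> W = T"
          using reassoc[OF w2(4), of ?w1] w1P w1' w2' P t' i a' by (simp add: W_def T_def a P_def[symmetric])
        have bcW: "bc \<cdot> W = ?w1 \<cdot> e"
        proof -
          have "bc \<cdot> W = rst C (t \<cdot> (tau A i j \<cdot> P)) \<cdot> ?w1"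
            using reassoc[OF w2(5), of ?w1] w1' w2' P t' i bc' by (simp add: W_def bc P_def[symmetric])
          also have "\<dots> = ?w1 \<cdot> rst C (t \<cdot> (tau A i j \<cdot> P) \<cdot> ?w1)"
            by (rule rst_slide) (use w1' P t' i in auto)
          also have "t \<cdot> (tau A i j \<cdot> P) \<cdot> ?w1 = T" using w1P w1' P t' i by (simp add: T_def)
          finally show ?thesis by (simp add: e_def)
        qed
        have bW: "b \<cdot> W = s \<cdot> \<alpha> i \<cdot> e"
          using bcW reassoc[OF w1P(1), of e] P bc' W w1' e s' ai by (simp add: b flip: P_def)
        have ccW: "cc \<cdot> W = e"
          using bcW reassoc[OF w1P(2), of e] Q bc' W w1' e s' ai se by (simp add: cc flip: Q_def)
        have dW: "d \<cdot> W = hs i j s \<cdot> e"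
          using bcW reassoc[OF ct(4)[OF i(1,2) s], of e] ct(1-3)[OF i(1,2)] bc' W w1' e i by (simp add: d F D_def)
        have sa: "s \<cdot> \<alpha> i \<in> arrs C" "trg (s \<cdot> \<alpha> i) = ob1 A i j" "src (s \<cdot> \<alpha> i) = ob0 B ?Hi" using s' ai by auto
        note sg = A.sec_cmp_elem_mult[OF i t sa(1,2), folded T_def e_def]
        have ts: "sec_cmp C A i j k t s \<in> A.sec i k" by (rule A.sec_cmp_sec[OF i t s])
        have 1: "sec_cmp C A i j k t s \<cdot> \<alpha> i = sec_cmp C A i j k t (s \<cdot> \<alpha> i)"
          using A.sec_cmp_props(6)[OF i t s'(1,3), of "\<alpha> i"] ai s' by simp
        have r: "rst C (sec_cmp C A i j k t (s \<cdot> \<alpha> i)) = e"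
          using A.sec_cmp_props(5)[OF i t sa(1,2)] by (simp add: T_def e_def)
        have "?L \<cdot> W = elem_act C A F i k (elem_mult C A i j k a b \<cdot> W) (cc \<cdot> W)"
          by (rule cl(4)) (use W cc' in auto)
        also have "elem_mult C A i j k a b \<cdot> W = elem_mult C A i j k (a \<cdot> W) (b \<cdot> W)"
          by (rule g(7)) (use W b' in auto)
        also have "\<dots> = sec_cmp C A i j k t s \<cdot> \<alpha> i" using sg(1) 1 by (simp add: aW bW)
        also have "elem_act C A F i k (sec_cmp C A i j k t s \<cdot> \<alpha> i) (cc \<cdot> W) = sec_act C A F i k (sec_cmp C A i j k t s)"
          using sec_act_props(5)[OF raw i(1,3) ts] 1 r by (simp add: F ccW)
        also have "\<dots> = sec_cmp C B ?Hi ?Hj ?Hk (hs j k t) (hs i j s)"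
          using sec_act[OF i(1,3) ts] hs_cmp[OF i t s] by simp
        finally have L: "?L \<cdot> W = sec_cmp C B ?Hi ?Hj ?Hk (hs j k t) (hs i j s)" .
        note Hs = hs[OF i(1,2) s] and Ht = hs[OF i(2,3) t]
        let ?v = "tau B ?Hi ?Hj \<cdot> hs i j s"
        have v: "?v \<in> arrs C" "src ?v = ob0 B ?Hi" "trg ?v = ob0 B ?Hj" using Hs(2-4) Hi Hj by auto
        have tT: "t \<cdot> (\<alpha> j \<cdot> ?v) = T" using Hs(5) by (simp add: T_def)
        have dv: "tau B ?Hi ?Hj \<cdot> d \<cdot> W = ?v \<cdot> e" using d' W dW Hs(2-4) e Hi Hj by simp
        have "?N \<cdot> W = elem_act C A F j k (a \<cdot> W) (tau B ?Hi ?Hj \<cdot> d \<cdot> W)"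
          by (rule cr(4)) (use W td in auto)
        also have "\<dots> = sec_act C A F j k t \<cdot> ?v"
          using sec_act_props(4)[OF raw i(2,3) t, of ?v] v tT by (simp add: F aW dv e_def)
        also have "\<dots> = hs j k t \<cdot> ?v" using sec_act[OF i(2,3) t] by simp
        finally have R0W: "?N \<cdot> W = hs j k t \<cdot> ?v" .
        have re: "rst C (hs j k t \<cdot> ?v) = e"
        proof -
          have "rst C (hs j k t \<cdot> ?v) = rst C (rst C (hs j k t) \<cdot> ?v)"
            using rst_rst_cmp[of ?v "hs j k t"] Ht(2-4) v by simp
          also have "\<dots> = rst C (t \<cdot> \<alpha> j \<cdot> ?v)"
            using rst_rst_cmp[of ?v "t \<cdot> \<alpha> j"] Ht(6) t' v aj by simp
          also have "t \<cdot> \<alpha> j \<cdot> ?v = T" using tT t' v aj by simp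
          finally show ?thesis by (simp add: e_def)
        qed
        have "?R \<cdot> W = elem_mult C B ?Hi ?Hj ?Hk (?N \<cdot> W) (d \<cdot> W)"
          by (rule gr(7)) (use W d' in auto)
        also have "\<dots> = sec_cmp C B ?Hi ?Hj ?Hk (hs j k t) (hs i j s)"
          using B.sec_cmp_elem_mult(1)[OF Hi Hj Hk Ht(1) Hs(2,4)] re by (simp add: R0W dW)
        finally show "?L \<cdot> ?w2 \<cdot> ?w1 = ?R \<cdot> ?w2 \<cdot> ?w1"
          using L cl(1-3) gr(1-3) cc' d' w1' w2' by (simp add: W_def)
      qed
    qed
    then show "cf1 F (i, k) \<cdot> pair C (sig A i k) (\<alpha> i) (mu A i j k \<cdot> pair C (sig A j k) (tau A i j) a b) cc
        = mu B ?Hi ?Hj ?Hk \<cdot> pair C (sig B ?Hj ?Hk) (tau B ?Hi ?Hj)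
            (cf1 F (j, k) \<cdot> pair C (sig A j k) (\<alpha> j) a (tau B ?Hi ?Hj \<cdot> d)) d"
      by (simp add: elem_act_def elem_mult_def F(2))
  qed
  then show ?thesis using Fmap by blast
qed

end

section \<open>Identities and composites of cofunctors\<close>

context plain_join_restriction_category
begin

lemma id_cofun_Phi:
  assumes "pcat_over C A"
  shows "raw_cofun C A A (id_cofun C A)"
    "Phi_map C A (id_cofun C A) = id_over C (Phi_cat C A, Phi_proj C A)"
proof -
  interpret A: pcat_over C A by (rule assms)
  interpret AA: pcat_pair C A A ..
  have tp: "total_pb C (sig A i j) (idn C (ob0 A i))" if "i \<in> idx A" "j \<in> idx A" for i j
    using A.sig_pb[OF that] that by simp
  show 1: "raw_cofun C A A (id_cofun C A)"
    using pb_types[OF total_pbD(1)[OF tp]] unfolding raw_cofun_def id_cofun_def by (auto simp: PiE_def)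
  have "sec_act C A (id_cofun C A) i j s = s" if i: "i \<in> idx A" "j \<in> idx A" and s: "s \<in> A.sec i j" for i j s
    using tstar_props(4)[OF tp[OF i] s] A.secD[OF s i] i by (simp add: sec_act_def id_cofun_def)
  then have "restrict (\<lambda>f. sec_arr (cfo (id_cofun C A) (src f)) (cfo (id_cofun C A) (trg f))
      (sec_act C A (id_cofun C A) (src f) (trg f) (the_sec A f))) (arrs (Phi_cat C A))
      = restrict (\<lambda>f. f) (arrs (Phi_cat C A))"
    using A.Phi_sec by (intro restrict_ext) (simp add: id_cofun_def)
  then show "Phi_map C A (id_cofun C A) = id_over C (Phi_cat C A, Phi_proj C A)"
    by (simp add: Phi_map_sec_act restrict_func_def id_func_def A.Phi_proj_far(2)) (simp add: id_cofun_def)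
qed

text \<open>Evaluated on a pulled back section \<open>s\<close>, the projections inside the
  composite become \<open>s\<close> along the composite object map and its domain, so the definition
  collapses to the two actions in succession. The cofunctor laws are not claimed yet: they are
  deduced from this computation.\<close>

lemma comp_cofun_Phi:
  assumes F: "partite_cofunctor C A B F" and G: "partite_cofunctor C B D G"
  shows "raw_cofun C A D (comp_cofun C A B G F)"
    "Phi_map C A (comp_cofun C A B G F)
      = comp_over C (Phi_cat C A, Phi_proj C A) (Phi_map C B G) (Phi_map C A F)"
proof -
  interpret F0: partite_cofunctor C A B F by (rule F)
  interpret G0: partite_cofunctor C B D G by (rule G)
  interpret F: cofun_over C A B F ..
  interpret G: cofun_over C B D G ..
  interpret AD: pcat_pair C A D ..
  let ?K = "comp_cofun C A B G F"
  let ?h = "\<lambda>i. cf0 F i \<cdot> cf0 G (cfo F i)"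
  have K: "cfo ?K i = cfo G (cfo F i)" "cf0 ?K i = ?h i" if "i \<in> idx A" for i
    using that by (auto simp: comp_cofun_def)
  let ?x = "\<lambda>i j. pr1 C (sig A i j) (?h i)" and ?y = "\<lambda>i j. pr2 C (sig A i j) (?h i)"
  have K1: "cf1 ?K (i, j) = elem_act C B G (cfo F i) (cfo F j)
      (elem_act C A F i j (?x i j) (cf0 G (cfo F i) \<cdot> ?y i j)) (?y i j)" if "i \<in> idx A" "j \<in> idx A" for i j
    using that by (simp add: comp_cofun_def Let_def elem_act_def)
  have h: "?h i \<in> arrs C" "src (?h i) = ob0 D (cfo G (cfo F i))" "trg (?h i) = ob0 A i" "total C (?h i)"
    if "i \<in> idx A" for i
    using F.F_types[OF that] G.F_types[OF F.F_types(1)[OF that]] total_cmp[of "cf0 G (cfo F i)" "cf0 F i"] by auto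
  have tp: "total_pb C (sig A i j) (?h i)" if "i \<in> idx A" "j \<in> idx A" for i j
    using F.A.sig_pb[OF that h(4)[OF that(1)]] h(3)[OF that(1)] by simp
  \<comment> \<open>The two projections \<open>X\<close> and \<open>Y\<close> and the intermediate
    arrow \<open>U\<close> of the middle category, bundled with their typings since both claims
    start from them.\<close>
  have data: "\<exists>X Y U. X = ?x i j \<and> Y = ?y i j \<and> U = elem_act C A F i j X (cf0 G (cfo F i) \<cdot> Y) \<and>
      X \<in> arrs C \<and> src X = pbob C (sig A i j) (?h i) \<and> trg X = ob1 A i j \<and>
      Y \<in> arrs C \<and> src Y = pbob C (sig A i j) (?h i) \<and> trg Y = ob0 D (cfo G (cfo F i)) \<and>
      sig A i j \<cdot> X = cf0 F i \<cdot> (cf0 G (cfo F i) \<cdot> Y) \<and>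
      U \<in> arrs C \<and> src U = pbob C (sig A i j) (?h i) \<and> trg U = ob1 B (cfo F i) (cfo F j) \<and>
      sig B (cfo F i) (cfo F j) \<cdot> U = cf0 G (cfo F i) \<cdot> Y"
    if i: "i \<in> idx A" "j \<in> idx A" for i j
  proof -
    define X where "X = ?x i j"
    define Y where "Y = ?y i j"
    note f = F.F_types[OF i(1)] and g = G.F_types[OF F.F_types(1)[OF i(1)]]
    note pt = pb_types[OF total_pbD(1)[OF tp[OF i]], folded X_def Y_def]
    have X: "X \<in> arrs C" "src X = pbob C (sig A i j) (?h i)" "trg X = ob1 A i j"
      and Y: "Y \<in> arrs C" "src Y = pbob C (sig A i j) (?h i)" "trg Y = ob0 D (cfo G (cfo F i))"
      using pt i h by auto
    have XY: "sig A i j \<cdot> X = cf0 F i \<cdot> (cf0 G (cfo F i) \<cdot> Y)" using pt(10) Y f g by simp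
    have gY: "cf0 G (cfo F i) \<cdot> Y \<in> arrs C" "src (cf0 G (cfo F i) \<cdot> Y) = src Y"
      "trg (cf0 G (cfo F i) \<cdot> Y) = ob0 B (cfo F i)" "src X = src (cf0 G (cfo F i) \<cdot> Y)" using Y X g by auto
    note cp = F.elem_act_props[OF F.raw i X(1,3) gY(1,3,4) XY] and cl = F.elem_act_laws[OF i X(1,3) gY(1,3,4) XY]
    show ?thesis using X Y XY cp(1-3) cl(1) gY(2) unfolding X_def Y_def by simp
  qed
  show "raw_cofun C A D ?K"
    unfolding raw_cofun_def
  proof (intro conjI ballI)
    show "cfo ?K \<in> idx A \<rightarrow>\<^sub>E idx D"
      using F.F_types(1) G.F_types(1) by (auto simp: comp_cofun_def)
    show "cf0 ?K \<in> extensional (idx A)" "cf1 ?K \<in> extensional (idx A \<times> idx A)"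
      by (auto simp: comp_cofun_def)
    show "cf0 ?K i \<in> hom C (ob0 D (cfo ?K i)) (ob0 A i)" "total C (cf0 ?K i)" if "i \<in> idx A" for i
      using h[OF that] K[OF that] by auto
    fix i j assume i: "i \<in> idx A" "j \<in> idx A"
    obtain X Y U where *: "X = ?x i j" "Y = ?y i j" "U = elem_act C A F i j X (cf0 G (cfo F i) \<cdot> Y)"
      and Y: "Y \<in> arrs C" "src Y = pbob C (sig A i j) (?h i)" "trg Y = ob0 D (cfo G (cfo F i))"
      and U: "U \<in> arrs C" "src U = pbob C (sig A i j) (?h i)" "trg U = ob1 B (cfo F i) (cfo F j)"
      "sig B (cfo F i) (cfo F j) \<cdot> U = cf0 G (cfo F i) \<cdot> Y" using data[OF i] by blast
    have "src U = src Y" using U Y by simp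
    note cp = G.elem_act_props[OF G.raw F.F_types(1)[OF i(1)] F.F_types(1)[OF i(2)] U(1,3) Y(1,3) this U(4)]
    show "cf1 ?K (i, j) \<in> hom C (pbob C (sig A i j) (cf0 ?K i)) (ob1 D (cfo ?K i) (cfo ?K j))"
      using cp(1-3) K1[OF i] Y(2) * K i by simp
  qed
  have sec_act: "sec_act C A ?K i j s = sec_act C B G (cfo F i) (cfo F j) (sec_act C A F i j s)"
    if i: "i \<in> idx A" "j \<in> idx A" and s: "s \<in> F.A.sec i j" for i j s
  proof -
    obtain X Y U where *: "X = ?x i j" "Y = ?y i j" "U = elem_act C A F i j X (cf0 G (cfo F i) \<cdot> Y)"
      and X: "X \<in> arrs C" "src X = pbob C (sig A i j) (?h i)" "trg X = ob1 A i j"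
      and Y: "Y \<in> arrs C" "src Y = pbob C (sig A i j) (?h i)" "trg Y = ob0 D (cfo G (cfo F i))"
      and XY: "sig A i j \<cdot> X = cf0 F i \<cdot> (cf0 G (cfo F i) \<cdot> Y)"
      and U: "U \<in> arrs C" "src U = pbob C (sig A i j) (?h i)" "trg U = ob1 B (cfo F i) (cfo F j)"
      "sig B (cfo F i) (cfo F j) \<cdot> U = cf0 G (cfo F i) \<cdot> Y" using data[OF i] by blast
    note s' = F.A.secD[OF s i]
    note f = F.F_types[OF i(1)] and fj = F.F_types[OF i(2)]
    note g = G.F_types[OF f(1)]
    let ?g = "cf0 G (cfo F i)"
    have gY: "?g \<cdot> Y \<in> arrs C" "src (?g \<cdot> Y) = src Y"
      "trg (?g \<cdot> Y) = ob0 B (cfo F i)" "src X = src (?g \<cdot> Y)" using Y X g by auto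
    have UY: "src U = src Y" using U Y by simp
    let ?w = "tstar C (sig A i j) (?h i) s"
    note w = tstar_props[OF tp[OF i] s]
    have w': "?w \<in> arrs C" "src ?w = ob0 D (cfo G (cfo F i))" "trg ?w = pbob C (sig A i j) (?h i)"
      using w(1-3) h[OF i(1)] by auto
    have Xw: "X \<cdot> ?w = s \<cdot> ?h i" and Yw: "Y \<cdot> ?w = rst C (s \<cdot> ?h i)"
      using w(4,5) by (auto simp: *)
    note cu = F.elem_act_props[OF F.raw i X(1,3) gY(1,3,4) XY, folded *(3)]
    note cp = G.elem_act_props[OF G.raw f(1) fj(1) U(1,3) Y(1,3) UY U(4)]
    note sl = F.sec_act_laws[OF i s] and sp = F.sec_act_props[OF F.raw i s]
    have r: "rst C (sec_act C A F i j s \<cdot> ?g) = rst C (s \<cdot> ?h i)"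
    proof -
      have "rst C (sec_act C A F i j s \<cdot> ?g) = rst C (rst C (sec_act C A F i j s) \<cdot> ?g)"
        using rst_rst_cmp[of ?g "sec_act C A F i j s"] sp(1-3) g by simp
      also have "\<dots> = rst C (s \<cdot> cf0 F i \<cdot> ?g)"
        using rst_rst_cmp[of ?g "s \<cdot> cf0 F i"] sl(2) s' f g by simp
      finally show ?thesis using s' f g by simp
    qed
    have "sec_act C A ?K i j s = elem_act C B G (cfo F i) (cfo F j) U Y \<cdot> ?w"
      using K1[OF i] K[OF i(1)] by (simp add: sec_act_def *)
    also have "\<dots> = elem_act C B G (cfo F i) (cfo F j) (U \<cdot> ?w) (Y \<cdot> ?w)"
      by (rule cp(4)) (use w' Y in auto)
    also have "U \<cdot> ?w = elem_act C A F i j (X \<cdot> ?w) (?g \<cdot> Y \<cdot> ?w)"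
      by (rule cu(4)) (use w' gY Y in auto)
    also have "\<dots> = sec_act C A F i j s \<cdot> ?g"
      using sp(4)[of ?g] f g Xw Yw Y w' s' by simp
    also have "elem_act C B G (cfo F i) (cfo F j) (sec_act C A F i j s \<cdot> ?g) (Y \<cdot> ?w)
        = sec_act C B G (cfo F i) (cfo F j) (sec_act C A F i j s)"
      using G.sec_act_props(5)[OF G.raw f(1) fj(1) sl(1)] r by (simp add: Yw)
    finally show ?thesis .
  qed
  have far: "sec_arr (cfo ?K (src f)) (cfo ?K (trg f)) (sec_act C A ?K (src f) (trg f) (the_sec A f))
      = far (fst (Phi_map C B G)) (far (fst (Phi_map C A F)) f)" if f: "f \<in> arrs (Phi_cat C A)" for f
  proof -
    note f' = F.A.Phi_sec[OF f] and Ff = F.Phi_map_far[OF f]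
    note GF = G.Phi_map_far[OF Ff(1), unfolded Ff(2-4)]
    show ?thesis
      using G.B.sec_arr_eq[of "far (fst (Phi_map C B G)) (far (fst (Phi_map C A F)) f)"] GF
        sec_act[OF f'(1-3)] K f' by simp
  qed
  have ob: "fob (fst (Phi_map C B G)) (fob (fst (Phi_map C A F)) i) = cfo ?K i"
    "fob (fst (Phi_map C A F)) i = cfo F i" "snd (Phi_map C A F) i = cf0 F i"
    "snd (Phi_map C B G) (cfo F i) = cf0 G (cfo F i)" if "i \<in> idx A" for i
    using that F.F_types(1)[OF that] K(1)[OF that] by (simp_all add: Phi_map_sec_act restrict_func_def)
  have "comp_over C (Phi_cat C A, Phi_proj C A) (fst (Phi_map C B G), snd (Phi_map C B G))
      (fst (Phi_map C A F), snd (Phi_map C A F)) = Phi_map C A ?K"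
    unfolding comp_over.simps Phi_map_sec_act[of C A ?K] restrict_func_def comp_func_def
    using far ob K by (auto intro!: restrict_ext)
  then show "Phi_map C A ?K = comp_over C (Phi_cat C A, Phi_proj C A) (Phi_map C B G) (Phi_map C A F)"
    by simp
qed

end

section \<open>The glued internal category\<close>

locale hyper_over = glueing_category C + A: join_restriction_category A + P: restriction_functor A C P
  for C :: "('o, 'u) rcat" (structure) and A :: "('i, 'u) rcat" and P :: "('i, 'u, 'o, 'u) func" +
  assumes hyper: "hyperconnected A C P" and small: "locally_small A"
begin

abbreviation Sig :: "'i \<Rightarrow> 'i \<Rightarrow> ('o, 'u) arr" where "Sig i j \<equiv> Psi_sig C (A, P) i j"
abbreviation Tau :: "'i \<Rightarrow> 'i \<Rightarrow> ('o, 'u) arr" where "Tau i j \<equiv> Psi_tau C (A, P) i j"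
abbreviation Mu :: "'i \<Rightarrow> 'i \<Rightarrow> 'i \<Rightarrow> ('o, 'u) arr" where "Mu i j k \<equiv> Psi_mu C (A, P) i j k"
abbreviation Sec :: "('i, 'u) arr \<Rightarrow> ('o, 'u) arr" where "Sec f \<equiv> Psi_sec C (A, P) f"

section \<open>Idempotents under a hyperconnected functor\<close>

lemma P_types [simp]:
  assumes "f \<in> arrs A"
  shows "far P f \<in> arrs C" "src (far P f) = fob P (src f)" "trg (far P f) = fob P (trg f)"
  using P.far_hom[of f "src f" "trg f"] assms by auto

lemma P_obj [simp]: "i \<in> obj A \<Longrightarrow> fob P i \<in> obj C"
  by (rule P.fob_obj)

lemma P_cmp: "\<lbrakk>f \<in> arrs A; g \<in> arrs A; trg f = src g\<rbrakk> \<Longrightarrow> far P (g \<cdot>\<^bsub>A\<^esub> f) = far P g \<cdot> far P f"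
  using P.far_cmp[of f "src f" "trg f" g "trg g"] by simp

lemma P_rids: "e \<in> rids A i \<Longrightarrow> far P e \<in> rids C (fob P i)"
  using P.far_rst[of e] by (simp add: in_rids)

lemma P_rids_surj:
  assumes "d \<in> rids C (fob P i)" "i \<in> obj A"
  obtains e where "e \<in> rids A i" "far P e = d"
proof -
  have "far P ` rids A i = rids C (fob P i)"
    using hyper assms(2) unfolding hyperconnected_def bij_betw_def by blast
  then have "d \<in> far P ` rids A i" using assms(1) by simp
  then show ?thesis using that by blast
qed

lemma P_rids_inj:
  assumes "e \<in> rids A i" "e' \<in> rids A i" "far P e = far P e'"
  shows "e = e'"
  using hyper assms A.ridsD(6)[OF assms(1)] unfolding hyperconnected_def bij_betw_def inj_on_def by blast

lemma P_rids_le: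
  assumes "e \<in> rids A i" "e' \<in> rids A i"
  shows "e \<cdot>\<^bsub>A\<^esub> e' = e' \<longleftrightarrow> far P e \<cdot> far P e' = far P e'"
  using P_rids_inj[of "e \<cdot>\<^bsub>A\<^esub> e'" i e'] P_cmp[of e' e] assms A.rids_cmp[OF assms]
    A.ridsD[OF assms(1)] A.ridsD[OF assms(2)] by auto

text \<open>On idempotents \<open>P\<close> is a bijection preserving meets, hence an order
  isomorphism, and so preserves joins. Surjectivity gives the idempotent \<open>e'\<close> lying
  over the join \<open>k\<close> formed in \<open>C\<close>.\<close>

lemma P_join:
  assumes E: "E \<subseteq> rids A i" and J: "is_join A i i E e" and i: "i \<in> obj A"
  shows "is_join C (fob P i) (fob P i) (far P ` E) (far P e)"
proof -
  have e: "e \<in> rids A i" using A.is_join_rids[OF J E i] .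
  have PE: "far P ` E \<subseteq> rids C (fob P i)" using E P_rids by auto
  obtain k where k: "k \<in> rids C (fob P i)" and Jk: "is_join C (fob P i) (fob P i) (far P ` E) k"
    using rids_join_exists[OF PE] i by auto
  obtain e' where e': "e' \<in> rids A i" and ke: "far P e' = k" using P_rids_surj[OF k i] .
  have "rle A e e'"
  proof (rule A.is_join_least[OF J])
    show "e' \<in> hom A i i" using A.ridsD[OF e'] by simp
    fix x assume x: "x \<in> E"
    then have xi: "x \<in> rids A i" using E by blast
    have "rle C (far P x) k" using is_joinD(7)[OF Jk] x by simp
    then have "k \<cdot> far P x = far P x" using rle_rids(1)[OF P_rids[OF xi] k] by simp
    then show "rle A x e'" using P_rids_le[OF e' xi] A.rle_rids(1)[OF xi e'] by (simp add: ke)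
  qed
  then have 1: "k \<cdot> far P e = far P e" using A.rle_rids(1)[OF e e'] P_rids_le[OF e' e] by (simp add: ke)
  have "rle C k (far P e)"
  proof (rule is_join_least[OF Jk])
    show "far P e \<in> hom C (fob P i) (fob P i)" using ridsD[OF P_rids[OF e]] by simp
    fix y assume "y \<in> far P ` E"
    then obtain x where x: "x \<in> E" "y = far P x" by blast
    then have xi: "x \<in> rids A i" using E by blast
    have "e \<cdot>\<^bsub>A\<^esub> x = x" using A.is_joinD(7)[OF J x(1)] A.rle_rids(1)[OF xi e] by simp
    then show "rle C y (far P e)" using P_rids_le[OF e xi] rle_rids(1)[OF P_rids[OF xi] P_rids[OF e]] x by simp
  qed
  moreover have "rle C (far P e) k" using 1 rle_rids(1)[OF P_rids[OF e] k] by simp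
  ultimately have "k = far P e" by (rule rle_antisym)
  then show ?thesis using Jk by simp
qed

lemma agree_rids: "f \<in> hom A i j \<Longrightarrow> agree A f g \<in> rids A i"
  using A.agree_is_join(2)[of f g] by auto

text \<open>\<open>agreement\<close> joins the images of the agreeing idempotents, and by
  \<open>P_join\<close> this is the image of their join. The calculus of \<open>agree\<close>
  thereby governs the atlas.\<close>

lemma agreement_agr:
  assumes "f \<in> hom A i j"
  shows "agreement C (A, P) f g = far P (agree A f g)"
proof -
  have f: "f \<in> arrs A" "src f = i" using assms by auto
  have "agree_set A f g \<subseteq> rids A i" using f by (auto simp: agree_set_def)
  from P_join[OF this] A.agree_is_join(1)[OF f(1), of g] f
  have "is_join C (fob P i) (fob P i) (far P ` agree_set A f g) (far P (agree A f g))"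
    using A.arr_obj(1)[OF f(1)] by simp
  moreover have "far P ` agree_set A f g =
      {far P e |e. e \<in> rids A i \<and> rle A e (rst A f \<cdot>\<^bsub>A\<^esub> rst A g) \<and> f \<cdot>\<^bsub>A\<^esub> e = g \<cdot>\<^bsub>A\<^esub> e}"
    using f by (auto simp: agree_set_def)
  ultimately show ?thesis using join_eq f by (simp add: agreement_def)
qed

lemma agreement_atlas:
  assumes i: "i \<in> obj A"
  shows "local_atlas C (fob P i) (hom A i j) (agreement C (A, P))"
  unfolding local_atlas_def
proof (intro conjI ballI)
  show "fob P i \<in> obj C" using i by simp
  fix f g assume f: "f \<in> hom A i j" and g: "g \<in> hom A i j"
  show "agreement C (A, P) f g \<in> rids C (fob P i)"
    using P_rids[OF agree_rids[OF f]] agreement_agr[OF f] by simp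
  show "agreement C (A, P) f g = agreement C (A, P) g f"
    using agreement_agr[OF f] agreement_agr[OF g] A.agree_sym[OF f g] by simp
  fix h assume h: "h \<in> hom A i j"
  have a: "agree A f g \<in> rids A i" "agree A g h \<in> rids A i" "agree A f h \<in> rids A i"
    using agree_rids[OF f] agree_rids[OF g] by blast+
  have le: "agree A f h \<cdot>\<^bsub>A\<^esub> (agree A g h \<cdot>\<^bsub>A\<^esub> agree A f g) = agree A g h \<cdot>\<^bsub>A\<^esub> agree A f g"
    using A.agree_trans[OF f g h] A.rle_rids(1)[OF A.rids_cmp[OF a(2,1)] a(3)] by simp
  have c: "far P (agree A g h \<cdot>\<^bsub>A\<^esub> agree A f g) = agreement C (A, P) g h \<cdot> agreement C (A, P) f g"
    using P_cmp[of "agree A f g" "agree A g h"] A.ridsD[OF a(1)] A.ridsD[OF a(2)]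
      agreement_agr[OF f] agreement_agr[OF g] by simp
  show "rle C (agreement C (A, P) g h \<cdot> agreement C (A, P) f g) (agreement C (A, P) f h)"
    using le P_rids_le[OF a(3) A.rids_cmp[OF a(2,1)]] rle_rids(1)[OF P_rids[OF A.rids_cmp[OF a(2,1)]] P_rids[OF a(3)]]
      agreement_agr[OF f] by (simp add: c)
qed

text \<open>\<open>Psi_sec\<close> looks up the glueing belonging to the source and target of its
  argument, so on one hom-set it is the chosen family of sections. \<Psi> has no name for the
  partial isomorphisms \<open>ps\<close>, hence the existential.\<close>

lemma Psi_glue:
  assumes i: "i \<in> obj A" "j \<in> obj A"
  shows "\<exists>ps. is_glueing C (fob P i) (hom A i j) (agreement C (A, P)) (Sig i j) ps (Psi_sec C (A, P))"
proof -
  have "hom A i j \<prec> (UNIV :: 'u set)" using small i by (simp add: locally_small_def)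
  then have "\<exists>x. case x of (p, ps, ss) \<Rightarrow> is_glueing C (fob P i) (hom A i j) (agreement C (A, P)) p ps ss"
    using glueing_exists[OF glueings _ _ agreement_atlas[OF i(1)], of j i j] by auto
  from someI_ex[OF this]
  have "case Psi_glueing C (A, P) i j of (p, ps, ss) \<Rightarrow>
      is_glueing C (fob P i) (hom A i j) (agreement C (A, P)) p ps ss"
    by (simp add: Psi_glueing_def)
  then obtain ps ss where "is_glueing C (fob P i) (hom A i j) (agreement C (A, P)) (Sig i j) ps ss"
    and "\<And>f. f \<in> hom A i j \<Longrightarrow> Psi_sec C (A, P) f = ss f"
    by (auto simp: Psi_sig_def Psi_sec_def split: prod.splits)
  then show ?thesis unfolding is_glueing_def by auto
qed

lemma Sig_props:
  assumes i: "i \<in> obj A" "j \<in> obj A"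
  shows "local_homeo C (Sig i j)" "total C (Sig i j)" "Sig i j \<in> arrs C" "trg (Sig i j) = fob P i"
    "src (Sig i j) \<in> obj C" "section_cover C (Sig i j) (hom A i j) (Psi_sec C (A, P))"
proof -
  obtain ps where G: "is_glueing C (fob P i) (hom A i j) (agreement C (A, P)) (Sig i j) ps (Psi_sec C (A, P))"
    using Psi_glue[OF i] by blast
  note gl = glueing_props[OF G agreement_atlas[OF i(1)]]
  show "local_homeo C (Sig i j)" using G by (simp add: is_glueing_def)
  show 1: "total C (Sig i j)" "Sig i j \<in> arrs C" "trg (Sig i j) = fob P i"
    "section_cover C (Sig i j) (hom A i j) (Psi_sec C (A, P))"
    using gl total_arr by auto
  show "src (Sig i j) \<in> obj C" using 1 by simp
qed

section \<open>Glued sections correspond to maps\<close>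

lemma hom_obj: "f \<in> hom A i j \<Longrightarrow> i \<in> obj A" "f \<in> hom A i j \<Longrightarrow> j \<in> obj A"
  by auto

lemma Sec_props:
  assumes f: "f \<in> hom A i j"
  shows "Sec f \<in> psections C (Sig i j)" "Sec f \<in> arrs C" "src (Sec f) = fob P i" "trg (Sec f) = src (Sig i j)"
    "Sig i j \<cdot> Sec f = far P (rst A f)" "rst C (Sec f) = far P (rst A f)"
proof -
  note i = hom_obj[OF f]
  obtain ps where G: "is_glueing C (fob P i) (hom A i j) (agreement C (A, P)) (Sig i j) ps (Psi_sec C (A, P))"
    using Psi_glue[OF i] by blast
  note gl = glueing_props[OF G agreement_atlas[OF i(1)]] and sp = Sig_props[OF i]
  show s: "Sec f \<in> psections C (Sig i j)" using section_coverD(4)[OF sp(6)] f by blast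
  show r: "rst C (Sec f) = far P (rst A f)"
    using gl(4)[OF f] agreement_agr[OF f, of f] A.agree_self[of f] f by simp
  show "Sec f \<in> arrs C" "src (Sec f) = fob P i" "trg (Sec f) = src (Sig i j)" "Sig i j \<cdot> Sec f = far P (rst A f)"
    using psectionsD[OF s] sp r by auto
qed

text \<open>Glued sections agree as far as the atlas prescribes, and the atlas is the image of
  agreement in \<open>A\<close>. Injectivity of \<open>P\<close> on idempotents takes the resulting
  equations back to \<open>A\<close>.\<close>

lemma Sec_agree:
  assumes f: "f \<in> hom A i j" and g: "g \<in> hom A i j" and e: "e \<in> rids A i"
  shows "Sec f \<cdot> far P e = Sec g \<cdot> far P e \<longleftrightarrow> f \<cdot>\<^bsub>A\<^esub> e = g \<cdot>\<^bsub>A\<^esub> e"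
proof -
  note i = hom_obj[OF f]
  obtain ps where G: "is_glueing C (fob P i) (hom A i j) (agreement C (A, P)) (Sig i j) ps (Psi_sec C (A, P))"
    using Psi_glue[OF i] by blast
  note gl = glueing_props[OF G agreement_atlas[OF i(1)]]
  note sf = Sec_props[OF f] and Sig = Sec_props[OF g] and e' = A.ridsD[OF e] and Pe = P_rids[OF e]
  note Pe' = ridsD[OF Pe]
  have f': "f \<in> arrs A" "src f = i" "trg f = j" and g': "g \<in> arrs A" "src g = i" "trg g = j" using f g by auto
  have a: "agree A f g \<in> rids A i" by (rule agree_rids[OF f])
  note a' = A.ridsD[OF a] and Pa' = ridsD[OF P_rids[OF a]]
  have ag: "Sec f \<cdot> far P (agree A f g) = Sec g \<cdot> far P (agree A f g)"
    using gl(5)[OF f g] agreement_agr[OF f, of g] by simp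
  show ?thesis
  proof
    assume eq: "f \<cdot>\<^bsub>A\<^esub> e = g \<cdot>\<^bsub>A\<^esub> e"
    have 1: "agree A f g \<cdot>\<^bsub>A\<^esub> e = rst A f \<cdot>\<^bsub>A\<^esub> e" by (rule A.agree_greatest[OF f g e eq])
    have 2: "rst A f \<cdot>\<^bsub>A\<^esub> e = rst A g \<cdot>\<^bsub>A\<^esub> e"
      using A.rst_cmp_rid[of f e] A.rst_cmp_rid[of g e] f' g' e eq by simp
    have "Sec f \<cdot> far P e = Sec f \<cdot> (rst C (Sec f) \<cdot> far P e)"
      by (rule cmp_rst_self'(1)[symmetric]) (use sf Pe' in auto)
    also have "\<dots> = Sec f \<cdot> (far P (agree A f g) \<cdot> far P e)"
      using arg_cong[OF 1, of "far P"] P_cmp[of e] f' a' e' sf by simp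
    also have "\<dots> = Sec g \<cdot> (far P (agree A f g) \<cdot> far P e)"
      using reassoc[OF ag, of "far P e"] sf Sig Pe' Pa' by simp
    also have "\<dots> = Sec g \<cdot> (rst C (Sec g) \<cdot> far P e)"
      using arg_cong[OF 1, of "far P"] 2 P_cmp[of e] f' g' a' e' Sig by simp
    also have "\<dots> = Sec g \<cdot> far P e" by (rule cmp_rst_self'(1)) (use Sig Pe' in auto)
    finally show "Sec f \<cdot> far P e = Sec g \<cdot> far P e" .
  next
    assume eq: "Sec f \<cdot> far P e = Sec g \<cdot> far P e"
    have 1: "far P (agree A f g) \<cdot> far P e = far P (rst A g) \<cdot> far P e"
      using gl(6)[OF f g Pe eq] agreement_agr[OF f, of g] agreement_agr[OF g, of g] A.agree_self[of g] g' by simp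
    have "rst C (Sec f \<cdot> far P e) = rst C (Sec g \<cdot> far P e)" using eq by simp
    then have 2: "far P (rst A f) \<cdot> far P e = far P (rst A g) \<cdot> far P e"
      using rst_cmp_rid[of "Sec f" "far P e"] rst_cmp_rid[of "Sec g" "far P e"] sf Sig Pe by simp
    \<comment> \<open>Back in \<open>A\<close>: within the domain of \<open>g\<close>, all of
      \<open>e\<close> lies in the agreement of \<open>f\<close> and \<open>g\<close>. Together with
      equality of the domains on \<open>e\<close> this suffices.\<close>
    have 3: "agree A f g \<cdot>\<^bsub>A\<^esub> e = rst A g \<cdot>\<^bsub>A\<^esub> e"
      by (rule P_rids_inj[of _ i]) (use 1 P_cmp[of e] a a' g' e e' in auto)
    have 4: "rst A f \<cdot>\<^bsub>A\<^esub> e = rst A g \<cdot>\<^bsub>A\<^esub> e"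
      by (rule P_rids_inj[of _ i]) (use 2 P_cmp[of e] f' g' e e' in auto)
    have "f \<cdot>\<^bsub>A\<^esub> e = f \<cdot>\<^bsub>A\<^esub> (rst A f \<cdot>\<^bsub>A\<^esub> e)" using f' e' by simp
    also have "\<dots> = f \<cdot>\<^bsub>A\<^esub> (agree A f g \<cdot>\<^bsub>A\<^esub> e)" using 3 4 by simp
    also have "\<dots> = g \<cdot>\<^bsub>A\<^esub> (agree A f g \<cdot>\<^bsub>A\<^esub> e)"
      using A.reassoc[OF A.agree_eq[OF f g], of e] f' g' a' e' by simp
    also have "\<dots> = g \<cdot>\<^bsub>A\<^esub> (rst A g \<cdot>\<^bsub>A\<^esub> e)" using 3 by simp
    also have "\<dots> = g \<cdot>\<^bsub>A\<^esub> e" using g' e' by simp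
    finally show "f \<cdot>\<^bsub>A\<^esub> e = g \<cdot>\<^bsub>A\<^esub> e" .
  qed
qed

text \<open>The maps \<open>f \<cdot> e\<close> and \<open>f\<close> agree on \<open>e\<close>, so
  their sections agree on the image of \<open>e\<close>. The domain of the first section already
  lies there, so restricting it changes nothing.\<close>

lemma Sec_restrict:
  assumes f: "f \<in> hom A i j" and e: "e \<in> rids A i"
  shows "Sec (f \<cdot>\<^bsub>A\<^esub> e) = Sec f \<cdot> far P e"
proof -
  have f': "f \<in> arrs A" "src f = i" "trg f = j" using f by auto
  note e' = A.ridsD[OF e] and Pe = ridsD[OF P_rids[OF e]]
  have fe: "f \<cdot>\<^bsub>A\<^esub> e \<in> hom A i j" using f' e' by simp
  note sfe = Sec_props[OF fe]
  have 1: "Sec (f \<cdot>\<^bsub>A\<^esub> e) \<cdot> far P e = Sec f \<cdot> far P e" using Sec_agree[OF fe f e] f' e' by simp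
  have "rst A (f \<cdot>\<^bsub>A\<^esub> e) = rst A f \<cdot>\<^bsub>A\<^esub> e" using A.rst_cmp_rid[of f e] f' e by simp
  then have r: "rst C (Sec (f \<cdot>\<^bsub>A\<^esub> e)) = far P (rst A f) \<cdot> far P e" using sfe P_cmp[of e "rst A f"] f' e' by simp
  then have "rst C (Sec (f \<cdot>\<^bsub>A\<^esub> e)) \<cdot> far P e = rst C (Sec (f \<cdot>\<^bsub>A\<^esub> e))" using Pe f' by simp
  then have "Sec (f \<cdot>\<^bsub>A\<^esub> e) \<cdot> far P e = Sec (f \<cdot>\<^bsub>A\<^esub> e)"
    using cmp_rst_self'(1)[of "Sec (f \<cdot>\<^bsub>A\<^esub> e)" "far P e"] cmp_rst_self[of "Sec (f \<cdot>\<^bsub>A\<^esub> e)"] sfe Pe by simp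
  then show ?thesis using 1 by simp
qed

lemma Sec_inj:
  assumes f: "f \<in> hom A i j" and g: "g \<in> hom A i j" and eq: "Sec f = Sec g"
  shows "f = g"
  using Sec_agree[OF f g, of "idn A i"] eq f g A.arr_obj(1)[of f] by auto

text \<open>The candidate is the join of all \<open>f\<close> whose section lies below
  \<open>s\<close>. On a slice, \<open>s\<close> coincides with some \<open>Sec f\<close> on an
  idempotent of the base; this idempotent is the image of some \<open>e0\<close>, so the piece is
  the section of \<open>f\<close> restricted to \<open>e0\<close>. Such pieces exhaust
  \<open>s\<close>.\<close>

lemma Sec_surj:
  assumes i: "i \<in> obj A" "j \<in> obj A" and s: "s \<in> psections C (Sig i j)"
  obtains f where "f \<in> hom A i j" "Sec f = s"
proof -
  note sp = Sig_props[OF i] and s' = psectionsD[OF s]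
  define T where "T = {f \<in> hom A i j. s \<cdot> rst C (Sec f) = Sec f}"
  have T: "f \<in> hom A i j" "s \<cdot> rst C (Sec f) = Sec f" if "f \<in> T" for f using that by (auto simp: T_def)
  \<comment> \<open>Sections below \<open>s\<close> are compatible, and \<open>Sec_inj\<close>
    reflects this to \<open>A\<close>, where the join can then be formed.\<close>
  have comp: "compatible A f g" if fT: "f \<in> T" and gT: "g \<in> T" for f g
  proof -
    note f = T[OF fT] and g = T[OF gT]
    note sf = Sec_props[OF f(1)] and sgg = Sec_props[OF g(1)]
    have f': "f \<in> arrs A" "src f = i" "trg f = j" and g': "g \<in> arrs A" "src g = i" "trg g = j" using f g by auto
    have fg: "f \<cdot>\<^bsub>A\<^esub> rst A g \<in> hom A i j" "g \<cdot>\<^bsub>A\<^esub> rst A f \<in> hom A i j" using f' g' by auto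
    have "Sec (f \<cdot>\<^bsub>A\<^esub> rst A g) = s \<cdot> rst C (Sec f) \<cdot> rst C (Sec g)"
      using Sec_restrict[OF f(1), of "rst A g"] f(2) g' sgg by simp
    also have "\<dots> = s \<cdot> rst C (Sec g) \<cdot> rst C (Sec f)"
      using rst_commute[of "Sec f" "Sec g"] sf sgg s' sp f' g' by simp
    also have "\<dots> = Sec (g \<cdot>\<^bsub>A\<^esub> rst A f)"
      using Sec_restrict[OF g(1), of "rst A f"] g(2) f' sf by simp
    finally have "f \<cdot>\<^bsub>A\<^esub> rst A g = g \<cdot>\<^bsub>A\<^esub> rst A f" by (rule Sec_inj[OF fg])
    then show ?thesis using f' g' by (simp add: A.compatible_iff)
  qed
  have TT: "T \<subseteq> hom A i j" by (auto simp: T_def)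
  obtain j0 where J: "is_join A i j T j0" using A.join_exists[OF i TT comp] by blast
  have j0: "j0 \<in> hom A i j" using A.is_joinD(1-3)[OF J] by simp
  note sj = Sec_props[OF j0]
  have rJ: "is_join C (fob P i) (fob P i) (far P ` rst A ` T) (rst C (Sec j0))"
  proof -
    have "rst A ` T \<subseteq> rids A i" using TT by (intro image_subsetI A.rst_in_rids) auto
    then show ?thesis using P_join[OF _ A.is_join_rst[OF J] i(1)] sj by simp
  qed
  have piece: "Sec j0 \<cdot> rst C (Sec f) = s \<cdot> rst C (Sec f)" if fT: "f \<in> T" for f
  proof -
    have "f \<in> arrs A" "src f = i" using T[OF fT] by auto
    then show ?thesis
      using Sec_restrict[OF j0, of "rst A f"] A.is_joinD(8)[OF J fT] T[OF fT] Sec_props[OF T(1)[OF fT]] by simp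
  qed
  have "Sec j0 \<cdot> rst C (Sec j0) = s \<cdot> rst C (Sec j0)"
  proof (rule join_ext[OF rJ])
    show "far P ` rst A ` T \<subseteq> rids C (fob P i)" using TT P_rids by auto
    show "Sec j0 \<in> hom C (fob P i) (src (Sig i j))" "s \<in> hom C (fob P i) (src (Sig i j))" using sj s' sp by auto
    show "Sec j0 \<cdot> e = s \<cdot> e" if "e \<in> far P ` rst A ` T" for e
      using that piece Sec_props(6)[OF T(1)] by auto
  qed
  then have 1: "s \<cdot> rst C (Sec j0) = Sec j0" using cmp_rst_self[OF sj(2)] by simp
  have "s \<cdot> rst C s = Sec j0 \<cdot> rst C s"
  proof (rule section_cover_pieces[OF sp(6)])
    show "s \<in> arrs C" "trg s = src (Sig i j)" "s \<in> hom C (src s) (src (Sig i j))" "Sec j0 \<in> hom C (src s) (src (Sig i j))"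
      using s' sj sp by auto
    fix e f assume e: "e \<in> rids C (src (Sig i j))" and f: "f \<in> hom A i j" and fe: "Sec f \<cdot> (Sig i j \<cdot> e) = e"
    note e' = ridsD[OF e] and sf = Sec_props[OF f]
    define d where "d = rst C (e \<cdot> s)"
    have d: "d \<in> rids C (fob P i)" using s' e' sp by (simp add: d_def)
    obtain e0 where e0: "e0 \<in> rids A i" "far P e0 = d" using P_rids_surj[OF d i(1)] .
    have f': "f \<in> arrs A" "src f = i" "trg f = j" using f by auto
    have fe0: "f \<cdot>\<^bsub>A\<^esub> e0 \<in> hom A i j" using f' A.ridsD[OF e0(1)] by simp
    note sl = slice_section[OF sf(1) s sp(3) e fe]
    have sd: "s \<cdot> d = Sec (f \<cdot>\<^bsub>A\<^esub> e0)" using sl Sec_restrict[OF f e0(1)] e0(2) by (simp add: d_def)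
    have r: "rst C (Sec (f \<cdot>\<^bsub>A\<^esub> e0)) = rst C s \<cdot> d"
      using rst_cmp_rid[of s d] s' d sp by (simp flip: sd)
    have rd: "rst C s \<cdot> d = d" using rst_cmp_le(2)[of s e] s' e' by (simp add: d_def)
    have "f \<cdot>\<^bsub>A\<^esub> e0 \<in> T" using fe0 sd r rd by (simp add: T_def)
    from piece[OF this] show "s \<cdot> rst C (e \<cdot> s) = Sec j0 \<cdot> rst C (e \<cdot> s)"
      using r rd by (simp flip: d_def)
  qed
  then have "s = Sec j0 \<cdot> rst C s" using s' by simp
  then have "rle C s (Sec j0)" "rle C (Sec j0) s" using 1 s' sj sp by (auto simp: rle_iff)
  then show ?thesis using that[OF j0] rle_antisym by blast
qed

section \<open>Target and multiplication of the glued object\<close>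

lemma Sec_far_rst:
  assumes f: "f \<in> hom A i j" and g: "g \<in> hom A j k"
  shows "rst C (Sec g \<cdot> far P f) = far P (rst A (g \<cdot>\<^bsub>A\<^esub> f))"
proof -
  have f': "f \<in> arrs A" "src f = i" "trg f = j" and g': "g \<in> arrs A" "src g = j" "trg g = k" using f g by auto
  note s = Sec_props[OF g]
  have "rst C (Sec g \<cdot> far P f) = rst C (far P (rst A g) \<cdot> far P f)"
    using rst_rst_cmp[of "far P f" "Sec g"] s f' g' by simp
  also have "\<dots> = rst C (far P (rst A g \<cdot>\<^bsub>A\<^esub> f))" using P_cmp[of f "rst A g"] f' g' by simp
  also have "\<dots> = far P (rst A (rst A g \<cdot>\<^bsub>A\<^esub> f))" using P.far_rst[of "rst A g \<cdot>\<^bsub>A\<^esub> f"] f' g' by simp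
  also have "\<dots> = far P (rst A (g \<cdot>\<^bsub>A\<^esub> f))" using A.rst_rst_cmp[of f g] f' g' by simp
  finally show ?thesis .
qed

text \<open>This is \<open>section_cover_lift\<close> with its conditions read in \<open>A\<close>:
  idempotents of the base lift through \<open>P\<close>, and agreement of sections becomes agreement
  of maps. The index set is a parameter because inversion is later prescribed on partial
  isomorphisms only.\<close>

lemma Psi_map_out:
  assumes i: "i \<in> obj A" "j \<in> obj A" and I: "I \<subseteq> hom A i j"
    and sc: "section_cover C (Sig i j) I (Psi_sec C (A, P))"
    and K: "\<And>f. f \<in> I \<Longrightarrow> K f \<in> hom C (fob P i) B" "\<And>f. f \<in> I \<Longrightarrow> K f \<cdot> far P (rst A f) = K f"
    and KK: "\<And>f g e. \<lbrakk>f \<in> I; g \<in> I; e \<in> rids A i; f \<cdot>\<^bsub>A\<^esub> e = g \<cdot>\<^bsub>A\<^esub> e\<rbrakk> \<Longrightarrow> K f \<cdot> far P e = K g \<cdot> far P e"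
    and B: "B \<in> obj C"
  shows "\<exists>k \<in> hom C (src (Sig i j)) B. \<forall>f \<in> I. k \<cdot> Sec f = K f"
proof (rule section_cover_lift[OF sc])
  note sp = Sig_props[OF i]
  show "K f \<in> hom C (trg (Sig i j)) B" if "f \<in> I" for f using K(1)[OF that] sp by simp
  show "K f \<cdot> rst C (Sec f) = K f" if "f \<in> I" for f
    using K(2)[OF that] Sec_props(6)[of f i j] that I by auto
  fix f g d assume f: "f \<in> I" and g: "g \<in> I" and d: "d \<in> rids C (trg (Sig i j))" and eq: "Sec f \<cdot> d = Sec g \<cdot> d"
  obtain e where e: "e \<in> rids A i" "far P e = d" using P_rids_surj[of d i] d sp i by auto
  have "f \<cdot>\<^bsub>A\<^esub> e = g \<cdot>\<^bsub>A\<^esub> e"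
    using Sec_agree[OF subsetD[OF I f] subsetD[OF I g] e(1)] eq e(2) by simp
  then show "K f \<cdot> d = K g \<cdot> d" using KK[OF f g e(1)] e(2) by simp
qed (rule B)

lemma Psi_ext:
  assumes i: "i \<in> obj A" "j \<in> obj A" and g: "g \<in> hom C (src (Sig i j)) B" and h: "h \<in> hom C (src (Sig i j)) B"
    and gh: "\<And>f. f \<in> hom A i j \<Longrightarrow> g \<cdot> Sec f = h \<cdot> Sec f"
  shows "g = h"
  by (rule section_cover_ext[OF Sig_props(6)[OF i] g h gh])

lemma Tau_props:
  assumes i: "i \<in> obj A" "j \<in> obj A"
  shows "Tau i j \<in> arrs C" "src (Tau i j) = src (Sig i j)" "trg (Tau i j) = fob P j"
    "\<And>f. f \<in> hom A i j \<Longrightarrow> Tau i j \<cdot> Sec f = far P f" "total C (Tau i j)"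
proof -
  note sp = Sig_props[OF i]
  have "\<exists>k \<in> hom C (src (Sig i j)) (fob P j). \<forall>f \<in> hom A i j. k \<cdot> Sec f = far P f"
  proof (rule Psi_map_out[OF i subset_refl sp(6)])
    show "far P f \<in> hom C (fob P i) (fob P j)" if "f \<in> hom A i j" for f using that by simp
    show "far P f \<cdot> far P (rst A f) = far P f" if "f \<in> hom A i j" for f
      using that P_cmp[of "rst A f" f] by simp
    show "far P f \<cdot> far P e = far P g \<cdot> far P e"
      if "f \<in> hom A i j" "g \<in> hom A i j" "e \<in> rids A i" "f \<cdot>\<^bsub>A\<^esub> e = g \<cdot>\<^bsub>A\<^esub> e" for f g e
      using that P_cmp[of e f] P_cmp[of e g] A.ridsD[OF that(3)] by simp
  qed (use i in simp)
  then obtain k where k: "k \<in> hom C (src (Sig i j)) (fob P j)" "\<forall>f \<in> hom A i j. k \<cdot> Sec f = far P f" by blast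
  have "Tau i j = k"
    unfolding Psi_tau_def fst_conv snd_conv
    by (rule the_equality) (use k Psi_ext[OF i] in auto)
  then show 1: "Tau i j \<in> arrs C" "src (Tau i j) = src (Sig i j)" "trg (Tau i j) = fob P j"
    "\<And>f. f \<in> hom A i j \<Longrightarrow> Tau i j \<cdot> Sec f = far P f" using k by auto
  show "total C (Tau i j)"
  proof (rule section_cover_total[OF sp(6) 1(1,2)])
    show "rst C (Tau i j \<cdot> Sec f) = rst C (Sec f)" if "f \<in> hom A i j" for f
      using 1(4)[OF that] Sec_props(6)[OF that] P.far_rst[of f] that by simp
  qed
qed

lemma Psi_pb:
  assumes j: "j \<in> obj A" "k \<in> obj A" and f: "total C f" "trg f = fob P j"
  shows "total_pb C (Sig j k) f"
proof -
  note sp = Sig_props[OF j]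
  obtain p q where "is_pullback C (Sig j k) f p q" using pullback_exists[OF sp(1) f(1)] f(2) sp(4) by auto
  then show ?thesis using has_pbI sp(2) f(1) unfolding total_pb_def by blast
qed

lemma Tau_pb: "\<lbrakk>i \<in> obj A; j \<in> obj A; k \<in> obj A\<rbrakk> \<Longrightarrow> total_pb C (Sig j k) (Tau i j)"
  using Psi_pb Tau_props by simp

text \<open>Pulled back sections of the second factor cover the object of composable pairs, and
  their common source is in turn covered by sections of the first factor. So maps out of it are
  tested on pairs of maps of \<open>A\<close>.\<close>

lemma Mu_unique:
  assumes i: "i \<in> obj A" "j \<in> obj A" "k \<in> obj A"
    and m: "m \<in> hom C (pbob C (Sig j k) (Tau i j)) B" and n: "n \<in> hom C (pbob C (Sig j k) (Tau i j)) B"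
    and eq: "\<And>f g. \<lbrakk>f \<in> hom A i j; g \<in> hom A j k\<rbrakk>
      \<Longrightarrow> m \<cdot> (tstar C (Sig j k) (Tau i j) (Sec g) \<cdot> Sec f) = n \<cdot> (tstar C (Sig j k) (Tau i j) (Sec g) \<cdot> Sec f)"
  shows "m = n"
proof (rule pullback_ext[OF Sig_props(6)[OF i(2,3)] Tau_pb[OF i] m n])
  fix g assume g: "g \<in> hom A j k"
  note t = Tau_props[OF i(1,2)]
  note ts = tstar_props[OF Tau_pb[OF i] Sec_props(1)[OF g]]
  show "m \<cdot> tstar C (Sig j k) (Tau i j) (Sec g) = n \<cdot> tstar C (Sig j k) (Tau i j) (Sec g)"
  proof (rule Psi_ext[OF i(1,2)])
    show "m \<cdot> tstar C (Sig j k) (Tau i j) (Sec g) \<in> hom C (src (Sig i j)) B"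
      "n \<cdot> tstar C (Sig j k) (Tau i j) (Sec g) \<in> hom C (src (Sig i j)) B" using m n ts t by auto
    fix f assume f: "f \<in> hom A i j"
    show "m \<cdot> tstar C (Sig j k) (Tau i j) (Sec g) \<cdot> Sec f = n \<cdot> tstar C (Sig j k) (Tau i j) (Sec g) \<cdot> Sec f"
      using eq[OF f g] m n ts(1-3) t Sec_props(2-4)[OF f] by simp
  qed
qed

text \<open>Built in two stages. For fixed \<open>g\<close>, postcomposition with \<open>g\<close>
  defines a map \<open>m g\<close> between glued objects; the maps \<open>m g\<close> are then the
  prescribed values on pulled back sections, from which the multiplication is lifted.\<close>

lemma Mu_props:
  assumes i: "i \<in> obj A" "j \<in> obj A" "k \<in> obj A"
  shows "Mu i j k \<in> arrs C" "src (Mu i j k) = pbob C (Sig j k) (Tau i j)" "trg (Mu i j k) = src (Sig i k)"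
    "\<And>f g. \<lbrakk>f \<in> hom A i j; g \<in> hom A j k\<rbrakk>
      \<Longrightarrow> Mu i j k \<cdot> (tstar C (Sig j k) (Tau i j) (Sec g) \<cdot> Sec f) = Sec (g \<cdot>\<^bsub>A\<^esub> f)"
proof -
  note sij = Sig_props[OF i(1,2)] and sjk = Sig_props[OF i(2,3)] and sik = Sig_props[OF i(1,3)]
  note t = Tau_props[OF i(1,2)] and tp = Tau_pb[OF i]
  have "\<exists>m. m \<in> hom C (src (Sig i j)) (src (Sig i k)) \<and> (\<forall>f \<in> hom A i j. m \<cdot> Sec f = Sec (g \<cdot>\<^bsub>A\<^esub> f))"
    if g: "g \<in> hom A j k" for g
  proof -
    have g': "g \<in> arrs A" "src g = j" "trg g = k" using g by auto
    have gf: "g \<cdot>\<^bsub>A\<^esub> f \<in> hom A i k" if "f \<in> hom A i j" for f using g' that by simp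
    have "\<exists>m \<in> hom C (src (Sig i j)) (src (Sig i k)). \<forall>f \<in> hom A i j. m \<cdot> Sec f = Sec (g \<cdot>\<^bsub>A\<^esub> f)"
    proof (rule Psi_map_out[OF i(1,2) subset_refl sij(6)])
      show "Sec (g \<cdot>\<^bsub>A\<^esub> f) \<in> hom C (fob P i) (src (Sig i k))" if "f \<in> hom A i j" for f
        using Sec_props(2-4)[OF gf[OF that]] by simp
      show "Sec (g \<cdot>\<^bsub>A\<^esub> f) \<cdot> far P (rst A f) = Sec (g \<cdot>\<^bsub>A\<^esub> f)" if "f \<in> hom A i j" for f
        using Sec_restrict[OF gf[OF that], of "rst A f"] that g' by simp
      show "src (Sig i k) \<in> obj C" using sik by simp
      show "Sec (g \<cdot>\<^bsub>A\<^esub> f) \<cdot> far P e = Sec (g \<cdot>\<^bsub>A\<^esub> f') \<cdot> far P e"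
        if "f \<in> hom A i j" "f' \<in> hom A i j" "e \<in> rids A i" "f \<cdot>\<^bsub>A\<^esub> e = f' \<cdot>\<^bsub>A\<^esub> e" for f f' e
        using Sec_restrict[OF gf[OF that(1)] that(3)] Sec_restrict[OF gf[OF that(2)] that(3)] that g' A.ridsD[OF that(3)]
        by simp
    qed
    then show ?thesis by blast
  qed
  then obtain m where m: "\<And>g. g \<in> hom A j k \<Longrightarrow> m g \<in> hom C (src (Sig i j)) (src (Sig i k)) \<and>
      (\<forall>f \<in> hom A i j. m g \<cdot> Sec f = Sec (g \<cdot>\<^bsub>A\<^esub> f))" by metis
  have mt: "m g \<in> arrs C" "src (m g) = src (Sig i j)" "trg (m g) = src (Sig i k)"
    "\<And>f. f \<in> hom A i j \<Longrightarrow> m g \<cdot> Sec f = Sec (g \<cdot>\<^bsub>A\<^esub> f)" if "g \<in> hom A j k" for g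
    using m[OF that] by auto
  \<comment> \<open>Cutting \<open>m g\<close> down along the target map cuts its value at
    \<open>f\<close> down to where \<open>c\<close> is defined after \<open>far P f\<close>. Both
    conditions of the second lift are verified through this.\<close>
  have mrid: "m g \<cdot> rst C (c \<cdot> Tau i j) \<cdot> Sec f = Sec (g \<cdot>\<^bsub>A\<^esub> f) \<cdot> rst C (c \<cdot> far P f)"
    if g: "g \<in> hom A j k" and f: "f \<in> hom A i j" and c: "c \<in> arrs C" "src c = fob P j" for g f c
  proof -
    note sf = Sec_props[OF f] and mg = mt[OF g]
    have "m g \<cdot> rst C (c \<cdot> Tau i j) \<cdot> Sec f = m g \<cdot> (Sec f \<cdot> rst C (c \<cdot> Tau i j \<cdot> Sec f))"
      using rst_slide[of "Sec f" "c \<cdot> Tau i j"] c sf mg(1-3) t(1-3) by simp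
    also have "c \<cdot> Tau i j \<cdot> Sec f = c \<cdot> far P f" using t(1-3) t(4)[OF f] sf c by simp
    also have "m g \<cdot> (Sec f \<cdot> rst C (c \<cdot> far P f)) = Sec (g \<cdot>\<^bsub>A\<^esub> f) \<cdot> rst C (c \<cdot> far P f)"
      using reassoc[OF mg(4)[OF f], of "rst C (c \<cdot> far P f)"] mg(1-3) sf c f by simp
    finally show ?thesis .
  qed
  have "\<exists>k' \<in> hom C (pbob C (Sig j k) (Tau i j)) (src (Sig i k)).
      \<forall>g \<in> hom A j k. k' \<cdot> tstar C (Sig j k) (Tau i j) (Sec g) = m g"
  proof (rule pullback_lift[OF sjk(6) tp])
    show "m g \<in> hom C (src (Tau i j)) (src (Sig i k))" if "g \<in> hom A j k" for g using mt[OF that] t by simp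
    show "src (Sig i k) \<in> obj C" using sik by simp
    show "m g \<cdot> rst C (Sec g \<cdot> Tau i j) = m g" if g: "g \<in> hom A j k" for g
    proof (rule Psi_ext[OF i(1,2)])
      note sgg = Sec_props[OF g] and mg = mt[OF g]
      show "m g \<cdot> rst C (Sec g \<cdot> Tau i j) \<in> hom C (src (Sig i j)) (src (Sig i k))" "m g \<in> hom C (src (Sig i j)) (src (Sig i k))"
        using mg sgg t by auto
      fix f assume f: "f \<in> hom A i j"
      have gf: "g \<cdot>\<^bsub>A\<^esub> f \<in> hom A i k" using f g by simp
      show "m g \<cdot> rst C (Sec g \<cdot> Tau i j) \<cdot> Sec f = m g \<cdot> Sec f"
        using mrid[OF g f sgg(2,3)] Sec_far_rst[OF f g] mg(4)[OF f] Sec_props(2,6)[OF gf] cmp_rst_self[of "Sec (g \<cdot>\<^bsub>A\<^esub> f)"]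
        by simp
    qed
    fix g g' c assume g: "g \<in> hom A j k" and g': "g' \<in> hom A j k" and c: "c \<in> rids C (trg (Sig j k))"
      and eq: "Sec g \<cdot> c = Sec g' \<cdot> c"
    have c1: "c \<in> rids C (fob P j)" using c sjk by simp
    obtain e where e: "e \<in> rids A j" "far P e = c" using P_rids_surj[OF c1 i(2)] .
    note c' = ridsD[OF c1] and e' = A.ridsD[OF e(1)]
    have ge: "g \<cdot>\<^bsub>A\<^esub> e = g' \<cdot>\<^bsub>A\<^esub> e" using Sec_agree[OF g g' e(1)] eq e(2) by simp
    show "m g \<cdot> rst C (c \<cdot> Tau i j) = m g' \<cdot> rst C (c \<cdot> Tau i j)"
    proof (rule Psi_ext[OF i(1,2)])
      show "m g \<cdot> rst C (c \<cdot> Tau i j) \<in> hom C (src (Sig i j)) (src (Sig i k))"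
        "m g' \<cdot> rst C (c \<cdot> Tau i j) \<in> hom C (src (Sig i j)) (src (Sig i k))"
        using mt[OF g] mt[OF g'] t c' by auto
      fix f assume f: "f \<in> hom A i j"
      have f': "f \<in> arrs A" "src f = i" "trg f = j" using f by auto
      have r: "rst C (c \<cdot> far P f) = far P (rst A (e \<cdot>\<^bsub>A\<^esub> f))"
        using P_cmp[of f e] P.far_rst[of "e \<cdot>\<^bsub>A\<^esub> f"] e e' f' by simp
      have re: "rst A (e \<cdot>\<^bsub>A\<^esub> f) \<in> rids A i" using e' f' by simp
      \<comment> \<open>Where \<open>f\<close> lands in \<open>e\<close>, composing with
        \<open>h\<close> is the same as composing with \<open>h\<close> restricted to
        \<open>e\<close>; so the value depends only on that restriction.\<close>
      have *: "Sec (h \<cdot>\<^bsub>A\<^esub> f) \<cdot> rst C (c \<cdot> far P f) = Sec (h \<cdot>\<^bsub>A\<^esub> e \<cdot>\<^bsub>A\<^esub> f)" if h: "h \<in> hom A j k" for h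
      proof -
        have h': "h \<in> arrs A" "src h = j" "trg h = k" using h by auto
        have "h \<cdot>\<^bsub>A\<^esub> f \<cdot>\<^bsub>A\<^esub> rst A (e \<cdot>\<^bsub>A\<^esub> f) = h \<cdot>\<^bsub>A\<^esub> e \<cdot>\<^bsub>A\<^esub> f"
          using A.rid_slide[OF e(1) f'(1,3)] f' h' e' by simp
        then show ?thesis using Sec_restrict[of "h \<cdot>\<^bsub>A\<^esub> f" i k, OF _ re] h' f' r by simp
      qed
      show "m g \<cdot> rst C (c \<cdot> Tau i j) \<cdot> Sec f = m g' \<cdot> rst C (c \<cdot> Tau i j) \<cdot> Sec f"
        using mrid[OF g f c'(1,2)] mrid[OF g' f c'(1,2)] *[OF g] *[OF g'] ge by simp
    qed
  qed
  then obtain k' where k': "k' \<in> hom C (pbob C (Sig j k) (Tau i j)) (src (Sig i k))"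
    and kt: "\<forall>g \<in> hom A j k. k' \<cdot> tstar C (Sig j k) (Tau i j) (Sec g) = m g" by blast
  have kk: "k' \<cdot> tstar C (Sig j k) (Tau i j) (Sec g) \<cdot> Sec f = Sec (g \<cdot>\<^bsub>A\<^esub> f)"
    if "f \<in> hom A i j" "g \<in> hom A j k" for f g
    using kt mt(4)[OF that(2,1)] that(2) by simp
  have ty: "n \<cdot> tstar C (Sig j k) (Tau i j) (Sec g) \<cdot> Sec f = n \<cdot> (tstar C (Sig j k) (Tau i j) (Sec g) \<cdot> Sec f)"
    if "f \<in> hom A i j" "g \<in> hom A j k" "n \<in> hom C (pbob C (Sig j k) (Tau i j)) (src (Sig i k))" for f g n
    using tstar_props(1-3)[OF tp Sec_props(1)[OF that(2)]] Sec_props(2-4)[OF that(1)] that(3) t by simp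
  have "Mu i j k = k'"
    unfolding Psi_mu_def fst_conv
  proof (rule the_equality)
    show "k' \<in> hom C (pbob C (Sig j k) (Tau i j)) (src (Sig i k)) \<and> (\<forall>f \<in> hom A i j. \<forall>g \<in> hom A j k.
        k' \<cdot> tstar C (Sig j k) (Tau i j) (Sec g) \<cdot> Sec f = Sec (g \<cdot>\<^bsub>A\<^esub> f))" using k' kk by simp
    fix n assume n: "n \<in> hom C (pbob C (Sig j k) (Tau i j)) (src (Sig i k)) \<and> (\<forall>f \<in> hom A i j. \<forall>g \<in> hom A j k.
        n \<cdot> tstar C (Sig j k) (Tau i j) (Sec g) \<cdot> Sec f = Sec (g \<cdot>\<^bsub>A\<^esub> f))"
    show "n = k'"
    proof (rule Mu_unique[OF i _ k'])
      show "n \<in> hom C (pbob C (Sig j k) (Tau i j)) (src (Sig i k))" using n by blast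
      show "n \<cdot> (tstar C (Sig j k) (Tau i j) (Sec g) \<cdot> Sec f) = k' \<cdot> (tstar C (Sig j k) (Tau i j) (Sec g) \<cdot> Sec f)"
        if "f \<in> hom A i j" "g \<in> hom A j k" for f g
        using ty[OF that, of n] ty[OF that k'] n kk[OF that] that by metis
    qed
  qed
  then show "Mu i j k \<in> arrs C" "src (Mu i j k) = pbob C (Sig j k) (Tau i j)" "trg (Mu i j k) = src (Sig i k)"
    "\<And>f g. \<lbrakk>f \<in> hom A i j; g \<in> hom A j k\<rbrakk>
      \<Longrightarrow> Mu i j k \<cdot> (tstar C (Sig j k) (Tau i j) (Sec g) \<cdot> Sec f) = Sec (g \<cdot>\<^bsub>A\<^esub> f)"
    using k' kk ty[OF _ _ k'] by auto
qed

text \<open>The element of the object of composable pairs given by \<open>f\<close> and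
  \<open>g\<close>, as a pairing whose second component is cut down to the domain of the composite;
  the second claim is the condition under which this pairing exists.\<close>

lemma tstar_Sec:
  assumes f: "f \<in> hom A i j" and g: "g \<in> hom A j k"
  shows "tstar C (Sig j k) (Tau i j) (Sec g) \<cdot> Sec f
      = pair C (Sig j k) (Tau i j) (Sec g \<cdot> far P f) (Sec f \<cdot> far P (rst A (g \<cdot>\<^bsub>A\<^esub> f)))"
    "Sig j k \<cdot> (Sec g \<cdot> far P f) = Tau i j \<cdot> (Sec f \<cdot> far P (rst A (g \<cdot>\<^bsub>A\<^esub> f)))"
proof -
  have i: "i \<in> obj A" "j \<in> obj A" "k \<in> obj A" using hom_obj[OF f] hom_obj[OF g] by auto
  note t = Tau_props[OF i(1,2)] and tp = Tau_pb[OF i] and sf = Sec_props[OF f] and sgg = Sec_props[OF g]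
  have f': "f \<in> arrs A" "src f = i" "trg f = j" and g': "g \<in> arrs A" "src g = j" "trg g = k" using f g by auto
  show 1: "tstar C (Sig j k) (Tau i j) (Sec g) \<cdot> Sec f
      = pair C (Sig j k) (Tau i j) (Sec g \<cdot> far P f) (Sec f \<cdot> far P (rst A (g \<cdot>\<^bsub>A\<^esub> f)))"
    using tstar_cmp[OF tp sgg(1), of "Sec f"] t(1-3) t(4)[OF f] sf Sec_far_rst[OF f g] by simp
  have "Sig j k \<cdot> (Sec g \<cdot> far P f) = far P (rst A g) \<cdot> far P f"
    using reassoc[OF sgg(5), of "far P f"] Sig_props[OF i(2,3)] sgg f' by simp
  also have "\<dots> = far P (rst A g \<cdot>\<^bsub>A\<^esub> f)" using P_cmp[of f "rst A g"] f' g' by simp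
  also have "rst A g \<cdot>\<^bsub>A\<^esub> f = f \<cdot>\<^bsub>A\<^esub> rst A (g \<cdot>\<^bsub>A\<^esub> f)" using A.rst_slide[of f g] f' g' by simp
  also have "far P (f \<cdot>\<^bsub>A\<^esub> rst A (g \<cdot>\<^bsub>A\<^esub> f)) = far P f \<cdot> far P (rst A (g \<cdot>\<^bsub>A\<^esub> f))"
    using P_cmp[of "rst A (g \<cdot>\<^bsub>A\<^esub> f)" f] f' g' by simp
  also have "\<dots> = Tau i j \<cdot> (Sec f \<cdot> far P (rst A (g \<cdot>\<^bsub>A\<^esub> f)))"
    using reassoc[OF t(4)[OF f], of "far P (rst A (g \<cdot>\<^bsub>A\<^esub> f))"] t(1-3) sf f' g' by simp
  finally show "Sig j k \<cdot> (Sec g \<cdot> far P f) = Tau i j \<cdot> (Sec f \<cdot> far P (rst A (g \<cdot>\<^bsub>A\<^esub> f)))" .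
qed

text \<open>The defining equation of the multiplication at an arbitrary element \<open>x\<close> of
  the base. In associativity it is used with \<open>x\<close> the image of a third map.\<close>

lemma Mu_pair:
  assumes f: "f \<in> hom A i j" and g: "g \<in> hom A j k" and x: "x \<in> arrs C" "trg x = fob P i"
  shows "Mu i j k \<cdot> pair C (Sig j k) (Tau i j) (Sec g \<cdot> (far P f \<cdot> x)) (Sec f \<cdot> (far P (rst A (g \<cdot>\<^bsub>A\<^esub> f)) \<cdot> x))
    = Sec (g \<cdot>\<^bsub>A\<^esub> f) \<cdot> x"
proof -
  have i: "i \<in> obj A" "j \<in> obj A" "k \<in> obj A" using hom_obj[OF f] hom_obj[OF g] by auto
  note t = Tau_props[OF i(1,2)] and tp = Tau_pb[OF i] and sf = Sec_props[OF f] and sgg = Sec_props[OF g]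
  have f': "f \<in> arrs A" "src f = i" "trg f = j" and g': "g \<in> arrs A" "src g = j" "trg g = k" using f g by auto
  note pb = total_pbD(1)[OF tp] and m = Mu_props[OF i]
  let ?u = "Sec g \<cdot> far P f" and ?v = "Sec f \<cdot> far P (rst A (g \<cdot>\<^bsub>A\<^esub> f))"
  have c: "?u \<in> arrs C" "?v \<in> arrs C" "src ?u = src ?v" "trg ?u = src (Sig j k)" "trg ?v = src (Tau i j)"
    using sf sgg f' g' t by auto
  have xu: "trg x = src ?u" using x sgg f' by simp
  note pp = pair_props[OF pb c tstar_Sec(2)[OF f g]]
  have "Mu i j k \<cdot> pair C (Sig j k) (Tau i j) (?u \<cdot> x) (?v \<cdot> x) = Mu i j k \<cdot> pair C (Sig j k) (Tau i j) ?u ?v \<cdot> x"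
    using pair_cmp[OF pb c tstar_Sec(2)[OF f g] x(1) xu] pp(1-3) m(1-3) x xu by simp
  also have "Mu i j k \<cdot> pair C (Sig j k) (Tau i j) ?u ?v = Sec (g \<cdot>\<^bsub>A\<^esub> f)"
    using m(4)[OF f g] tstar_Sec(1)[OF f g] by simp
  finally show ?thesis using sf sgg f' g' x by simp
qed

lemma Mu_pair':
  assumes f: "f \<in> hom A i j" and g: "g \<in> hom A j k"
  shows "Mu i j k \<cdot> pair C (Sig j k) (Tau i j) (Sec g \<cdot> far P f) (Sec f \<cdot> far P (rst A (g \<cdot>\<^bsub>A\<^esub> f))) = Sec (g \<cdot>\<^bsub>A\<^esub> f)"
  using Mu_props(4)[OF _ _ _ f g] tstar_Sec(1)[OF f g] hom_obj[OF f] hom_obj[OF g] by simp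

lemma Psi_ob_simps [simp]:
  "idx (Psi_ob C (A, P)) = obj A" "ob0 (Psi_ob C (A, P)) = fob P"
  "ob1 (Psi_ob C (A, P)) i j = src (Sig i j)" "sig (Psi_ob C (A, P)) = Psi_sig C (A, P)"
  "tau (Psi_ob C (A, P)) = Psi_tau C (A, P)" "eta (Psi_ob C (A, P)) i = Sec (idn A i)"
  "mu (Psi_ob C (A, P)) = Psi_mu C (A, P)"
  by (simp_all add: Psi_ob_def)

section \<open>Laws of the glued internal category\<close>

lemma eta_props:
  assumes "i \<in> obj A"
  shows "idn A i \<in> hom A i i" "Sec (idn A i) \<in> arrs C" "src (Sec (idn A i)) = fob P i"
    "trg (Sec (idn A i)) = src (Sig i i)" "Sig i i \<cdot> Sec (idn A i) = idn C (fob P i)"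
    "Tau i i \<cdot> Sec (idn A i) = idn C (fob P i)"
proof -
  show 1: "idn A i \<in> hom A i i" using assms by simp
  show "Sec (idn A i) \<in> arrs C" "src (Sec (idn A i)) = fob P i"
    "trg (Sec (idn A i)) = src (Sig i i)" "Sig i i \<cdot> Sec (idn A i) = idn C (fob P i)"
    using Sec_props[OF 1] assms P.far_idn by auto
  show "Tau i i \<cdot> Sec (idn A i) = idn C (fob P i)"
    using Tau_props(4)[OF assms assms 1] P.far_idn[OF assms] by simp
qed

lemma Psi_unit_right:
  assumes i: "i \<in> obj A" "j \<in> obj A"
  shows "Mu i i j \<cdot> pair C (Sig i j) (Tau i i) (idn C (src (Sig i j))) (Sec (idn A i) \<cdot> Sig i j) = idn C (src (Sig i j))"
proof (rule Psi_ext[OF i])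
  note sp = Sig_props[OF i] and m = Mu_props[OF i(1,1,2)] and tp = Tau_pb[OF i(1,1,2)] and e = eta_props[OF i(1)]
    and t = Tau_props[OF i(1,1)]
  note pb = total_pbD(1)[OF tp]
  let ?u = "idn C (src (Sig i j))" and ?v = "Sec (idn A i) \<cdot> Sig i j"
  have c: "?u \<in> arrs C" "?v \<in> arrs C" "src ?u = src ?v" "trg ?u = src (Sig i j)" "trg ?v = src (Tau i i)"
    using sp e t by auto
  have uv: "Sig i j \<cdot> ?u = Tau i i \<cdot> ?v" using reassoc[OF e(6), of "Sig i j"] sp e t by simp
  note pp = pair_props[OF pb c uv]
  show "Mu i i j \<cdot> pair C (Sig i j) (Tau i i) ?u ?v \<in> hom C (src (Sig i j)) (src (Sig i j))"
    "?u \<in> hom C (src (Sig i j)) (src (Sig i j))" using pp m sp by auto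
  fix f assume f: "f \<in> hom A i j"
  note sf = Sec_props[OF f]
  have f': "f \<in> arrs A" "src f = i" "trg f = j" using f by auto
  have "Mu i i j \<cdot> pair C (Sig i j) (Tau i i) ?u ?v \<cdot> Sec f
      = Mu i i j \<cdot> pair C (Sig i j) (Tau i i) (Sec f) (Sec (idn A i) \<cdot> far P (rst A f))"
    using pair_cmp[OF pb c uv sf(2)] pp(1-3) m(1-3) sf sp e by simp
  also have "\<dots> = Sec f" using Mu_pair'[OF e(1) f] P.far_idn[OF i(1)] sf f' by simp
  finally show "Mu i i j \<cdot> pair C (Sig i j) (Tau i i) ?u ?v \<cdot> Sec f = ?u \<cdot> Sec f" using sf sp by simp
qed

lemma Psi_unit_left:
  assumes i: "i \<in> obj A" "j \<in> obj A"
  shows "Mu i j j \<cdot> pair C (Sig j j) (Tau i j) (Sec (idn A j) \<cdot> Tau i j) (idn C (src (Sig i j))) = idn C (src (Sig i j))"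
proof (rule Psi_ext[OF i])
  note sp = Sig_props[OF i] and m = Mu_props[OF i(1,2,2)] and tp = Tau_pb[OF i(1,2,2)] and e = eta_props[OF i(2)]
    and t = Tau_props[OF i] and spj = Sig_props[OF i(2,2)]
  note pb = total_pbD(1)[OF tp]
  let ?v = "idn C (src (Sig i j))" and ?u = "Sec (idn A j) \<cdot> Tau i j"
  have c: "?u \<in> arrs C" "?v \<in> arrs C" "src ?u = src ?v" "trg ?u = src (Sig j j)" "trg ?v = src (Tau i j)"
    using sp e t by auto
  have uv: "Sig j j \<cdot> ?u = Tau i j \<cdot> ?v" using reassoc[OF e(5), of "Tau i j"] sp spj e t by simp
  note pp = pair_props[OF pb c uv]
  show "Mu i j j \<cdot> pair C (Sig j j) (Tau i j) ?u ?v \<in> hom C (src (Sig i j)) (src (Sig i j))"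
    "?v \<in> hom C (src (Sig i j)) (src (Sig i j))" using pp m sp t e by auto
  fix f assume f: "f \<in> hom A i j"
  note sf = Sec_props[OF f]
  have f': "f \<in> arrs A" "src f = i" "trg f = j" using f by auto
  have s: "Sec f \<cdot> far P (rst A f) = Sec f" using cmp_rst_self[OF sf(2)] sf(6) by simp
  have "Mu i j j \<cdot> pair C (Sig j j) (Tau i j) ?u ?v \<cdot> Sec f
      = Mu i j j \<cdot> pair C (Sig j j) (Tau i j) (Sec (idn A j) \<cdot> far P f) (Sec f)"
    using pair_cmp[OF pb c uv sf(2)] pp(1-3) m(1-3) sf sp e t(1-3) t(4)[OF f] by simp
  also have "\<dots> = Sec f" using Mu_pair'[OF f e(1)] f' s by simp
  finally show "Mu i j j \<cdot> pair C (Sig j j) (Tau i j) ?u ?v \<cdot> Sec f = ?v \<cdot> Sec f" using sf sp by simp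
qed

lemma Psi_sig_mu:
  assumes i: "i \<in> obj A" "j \<in> obj A" "k \<in> obj A"
  shows "Sig i k \<cdot> Mu i j k = Sig i j \<cdot> pr2 C (Sig j k) (Tau i j)"
    "Tau i k \<cdot> Mu i j k = Tau j k \<cdot> pr1 C (Sig j k) (Tau i j)"
proof -
  note sij = Sig_props[OF i(1,2)] and sik = Sig_props[OF i(1,3)]
  note tij = Tau_props[OF i(1,2)] and tjk = Tau_props[OF i(2,3)] and tik = Tau_props[OF i(1,3)]
  note tp = Tau_pb[OF i] and m = Mu_props[OF i]
  note pt = pb_types[OF total_pbD(1)[OF tp]]
  have *: "Sig i k \<cdot> Mu i j k \<cdot> (tstar C (Sig j k) (Tau i j) (Sec g) \<cdot> Sec f)
      = Sig i j \<cdot> pr2 C (Sig j k) (Tau i j) \<cdot> (tstar C (Sig j k) (Tau i j) (Sec g) \<cdot> Sec f)"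
    "Tau i k \<cdot> Mu i j k \<cdot> (tstar C (Sig j k) (Tau i j) (Sec g) \<cdot> Sec f)
      = Tau j k \<cdot> pr1 C (Sig j k) (Tau i j) \<cdot> (tstar C (Sig j k) (Tau i j) (Sec g) \<cdot> Sec f)"
    if f: "f \<in> hom A i j" and g: "g \<in> hom A j k" for f g
  proof -
    note sf = Sec_props[OF f] and sgg = Sec_props[OF g]
    have f': "f \<in> arrs A" "src f = i" "trg f = j" and g': "g \<in> arrs A" "src g = j" "trg g = k" using f g by auto
    have gf: "g \<cdot>\<^bsub>A\<^esub> f \<in> hom A i k" using f' g' by simp
    note sgf = Sec_props[OF gf] and ts = tstar_props[OF tp sgg(1)]
    let ?r = "far P (rst A (g \<cdot>\<^bsub>A\<^esub> f))"
    have r: "?r \<in> arrs C" "src ?r = fob P i" "trg ?r = fob P i" using f' g' by auto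
    have L: "Sig i k \<cdot> Mu i j k \<cdot> (tstar C (Sig j k) (Tau i j) (Sec g) \<cdot> Sec f) = ?r"
      using m(1-3) m(4)[OF f g] ts(1-3) sf sik tij sgf by simp
    have q: "pr2 C (Sig j k) (Tau i j) \<cdot> (tstar C (Sig j k) (Tau i j) (Sec g) \<cdot> Sec f) = Sec f \<cdot> ?r"
      using pair_props(5)[OF total_pbD(1)[OF tp] _ _ _ _ _ tstar_Sec(2)[OF f g]] tstar_Sec(1)[OF f g] sf sgg f' g' tij by simp
    have p: "pr1 C (Sig j k) (Tau i j) \<cdot> (tstar C (Sig j k) (Tau i j) (Sec g) \<cdot> Sec f) = Sec g \<cdot> far P f"
      using pair_props(4)[OF total_pbD(1)[OF tp] _ _ _ _ _ tstar_Sec(2)[OF f g]] tstar_Sec(1)[OF f g] sf sgg f' g' tij by simp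
    have "far P (rst A f) \<cdot> ?r = ?r"
      using A.rst_cmp_le(2)[of f g] P_cmp[of "rst A (g \<cdot>\<^bsub>A\<^esub> f)" "rst A f"] f' g' by simp
    then have "Sig i j \<cdot> (Sec f \<cdot> ?r) = ?r" using reassoc[OF sf(5), of ?r] sf sij r by simp
    then show "Sig i k \<cdot> Mu i j k \<cdot> (tstar C (Sig j k) (Tau i j) (Sec g) \<cdot> Sec f)
      = Sig i j \<cdot> pr2 C (Sig j k) (Tau i j) \<cdot> (tstar C (Sig j k) (Tau i j) (Sec g) \<cdot> Sec f)"
      using L q pt ts(1-3) sf sij tij by simp
    have "Tau j k \<cdot> (Sec g \<cdot> far P f) = far P (g \<cdot>\<^bsub>A\<^esub> f)"
      using reassoc[OF tjk(4)[OF g], of "far P f"] tjk(1-3) sgg f' g' P_cmp[of f g] by simp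
    then show "Tau i k \<cdot> Mu i j k \<cdot> (tstar C (Sig j k) (Tau i j) (Sec g) \<cdot> Sec f)
      = Tau j k \<cdot> pr1 C (Sig j k) (Tau i j) \<cdot> (tstar C (Sig j k) (Tau i j) (Sec g) \<cdot> Sec f)"
      using m(1-3) m(4)[OF f g] ts(1-3) sf tik(1-3) tik(4)[OF gf] tjk tij p pt sgf by simp
  qed
  show "Sig i k \<cdot> Mu i j k = Sig i j \<cdot> pr2 C (Sig j k) (Tau i j)"
    by (rule Mu_unique[OF i, of _ "fob P i"]) (use *(1) m pt sij sik tij in auto)
  show "Tau i k \<cdot> Mu i j k = Tau j k \<cdot> pr1 C (Sig j k) (Tau i j)"
    by (rule Mu_unique[OF i, of _ "fob P k"]) (use *(2) m pt sij sik tij tjk tik in auto)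
qed

text \<open>Tested on sections of the last factor and then on composable pairs, both sides become
  the section of the threefold composite, and associativity in \<open>A\<close> concludes.\<close>

lemma Psi_assoc:
  assumes i: "i \<in> obj A" "j \<in> obj A" "k \<in> obj A" "l \<in> obj A"
    and a: "a = pr1 C (Sig k l) (Tau j k \<cdot> pr1 C (Sig j k) (Tau i j))"
    and bc: "bc = pr2 C (Sig k l) (Tau j k \<cdot> pr1 C (Sig j k) (Tau i j))"
    and b: "b = pr1 C (Sig j k) (Tau i j) \<cdot> bc" and c: "c = pr2 C (Sig j k) (Tau i j) \<cdot> bc"
  shows "Mu i k l \<cdot> pair C (Sig k l) (Tau i k) a (Mu i j k \<cdot> bc)
    = Mu i j l \<cdot> pair C (Sig j l) (Tau i j) (Mu j k l \<cdot> pair C (Sig k l) (Tau j k) a b) c"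
proof -
  define p where "p = pr1 C (Sig j k) (Tau i j)"
  define q where "q = pr2 C (Sig j k) (Tau i j)"
  define D where "D = pbob C (Sig j k) (Tau i j)"
  note sjk = Sig_props[OF i(2,3)] and skl = Sig_props[OF i(3,4)]
    and sjl = Sig_props[OF i(2,4)]
  note tij = Tau_props[OF i(1,2)] and tjk = Tau_props[OF i(2,3)] and tik = Tau_props[OF i(1,3)]
  note m1 = Mu_props[OF i(1-3)] and m2 = Mu_props[OF i(1,3,4)] and m3 = Mu_props[OF i(2-4)] and m4 = Mu_props[OF i(1,2,4)]
  note tp1 = Tau_pb[OF i(1-3)] and tpikl = Tau_pb[OF i(1,3,4)] and tpjkl = Tau_pb[OF i(2-4)] and tpijl = Tau_pb[OF i(1,2,4)]
  note pt1 = pb_types[OF total_pbD(1)[OF tp1], folded p_def q_def D_def]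
  have p: "p \<in> arrs C" "src p = D" "trg p = src (Sig j k)" and q: "q \<in> arrs C" "src q = D" "trg q = src (Sig i j)"
    and pq: "Sig j k \<cdot> p = Tau i j \<cdot> q"
    using pt1 tij by auto
  have "total C (Tau j k \<cdot> p)"
    using total_cmp[of p "Tau j k"] total_pbD(4)[OF tp1] tjk p by (simp add: p_def)
  then have tp2: "total_pb C (Sig k l) (Tau j k \<cdot> p)"
    by (rule Psi_pb[OF i(3,4)]) (use p tjk in auto)
  define E where "E = pbob C (Sig k l) (Tau j k \<cdot> p)"
  note pt2 = pb_types[OF total_pbD(1)[OF tp2], folded E_def]
  have a': "a \<in> arrs C" "src a = E" "trg a = src (Sig k l)" and bc': "bc \<in> arrs C" "src bc = E" "trg bc = D"
    and sq: "Sig k l \<cdot> a = Tau j k \<cdot> (p \<cdot> bc)"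
    using pt2 tjk p by (auto simp: a bc simp flip: p_def)
  have b': "b \<in> arrs C" "src b = E" "trg b = src (Sig j k)" "b = p \<cdot> bc"
    and c': "c \<in> arrs C" "src c = E" "trg c = src (Sig i j)" "c = q \<cdot> bc"
    using p q bc' by (auto simp: b c simp flip: p_def q_def)
  have sqb: "Sig k l \<cdot> a = Tau j k \<cdot> b" using sq b' by simp
  have sbc: "Sig j k \<cdot> b = Tau i j \<cdot> c" using reassoc[OF pq, of bc] p q bc' b' c' sjk tij by simp
  have mb: "Mu i j k \<cdot> bc \<in> arrs C" "src (Mu i j k \<cdot> bc) = E" "trg (Mu i j k \<cdot> bc) = src (Sig i k)"
    using m1 bc' by (auto simp: D_def)
  have c1: "a \<in> arrs C" "Mu i j k \<cdot> bc \<in> arrs C" "src a = src (Mu i j k \<cdot> bc)" "trg a = src (Sig k l)"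
    "trg (Mu i j k \<cdot> bc) = src (Tau i k)" using a' mb tik by auto
  have e1: "Sig k l \<cdot> a = Tau i k \<cdot> (Mu i j k \<cdot> bc)"
    using reassoc[OF Psi_sig_mu(2)[OF i(1-3), folded p_def], of bc] sq m1 bc' tik tjk p by (simp add: D_def)
  note pp1 = pair_props[OF total_pbD(1)[OF tpikl] c1 e1]
  have c2: "a \<in> arrs C" "b \<in> arrs C" "src a = src b" "trg a = src (Sig k l)" "trg b = src (Tau j k)"
    using a' b' tjk by auto
  note pp2 = pair_props[OF total_pbD(1)[OF tpjkl] c2 sqb]
  let ?n = "Mu j k l \<cdot> pair C (Sig k l) (Tau j k) a b"
  have n: "?n \<in> arrs C" "src ?n = E" "trg ?n = src (Sig j l)" using pp2 m3 a' by auto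
  have e3: "Sig j l \<cdot> ?n = Tau i j \<cdot> c"
    using reassoc[OF Psi_sig_mu(1)[OF i(2-4)], of "pair C (Sig k l) (Tau j k) a b"] pp2 m3 sjl sjk sbc
      pb_types[OF total_pbD(1)[OF tpjkl]] tjk by simp
  have c3: "?n \<in> arrs C" "c \<in> arrs C" "src ?n = src c" "trg ?n = src (Sig j l)" "trg c = src (Tau i j)"
    using n c' tij by auto
  note pp3 = pair_props[OF total_pbD(1)[OF tpijl] c3 e3]
  let ?L = "Mu i k l \<cdot> pair C (Sig k l) (Tau i k) a (Mu i j k \<cdot> bc)"
  let ?R = "Mu i j l \<cdot> pair C (Sig j l) (Tau i j) ?n c"
  have L: "?L \<in> arrs C" "src ?L = E" "trg ?L = src (Sig i l)" using pp1 m2 a' by auto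
  have R: "?R \<in> arrs C" "src ?R = E" "trg ?R = src (Sig i l)" using pp3 m4 n by auto
  show "?L = ?R"
  proof (rule pullback_ext[OF skl(6) tp2])
    show "?L \<in> hom C (pbob C (Sig k l) (Tau j k \<cdot> p)) (src (Sig i l))" "?R \<in> hom C (pbob C (Sig k l) (Tau j k \<cdot> p)) (src (Sig i l))"
      using L R by (auto simp: E_def)
    fix h assume h: "h \<in> hom A k l"
    note sh = Sec_props[OF h]
    let ?w2 = "tstar C (Sig k l) (Tau j k \<cdot> p) (Sec h)"
    note w2 = tstar_props[OF tp2 sh(1)]
    have w2': "?w2 \<in> arrs C" "src ?w2 = D" "trg ?w2 = E" using w2(1-3) p tjk by (auto simp: E_def)
    show "?L \<cdot> ?w2 = ?R \<cdot> ?w2"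
    proof (rule Mu_unique[OF i(1-3)])
      show "?L \<cdot> ?w2 \<in> hom C (pbob C (Sig j k) (Tau i j)) (src (Sig i l))" "?R \<cdot> ?w2 \<in> hom C (pbob C (Sig j k) (Tau i j)) (src (Sig i l))"
        using L R w2' by (auto simp: D_def)
      fix f g assume f: "f \<in> hom A i j" and g: "g \<in> hom A j k"
      note sf = Sec_props[OF f] and sgg = Sec_props[OF g]
      have f': "f \<in> arrs A" "src f = i" "trg f = j" and g': "g \<in> arrs A" "src g = j" "trg g = k"
        and h': "h \<in> arrs A" "src h = k" "trg h = l" using f g h by auto
      have gf: "g \<cdot>\<^bsub>A\<^esub> f \<in> hom A i k" and hg: "h \<cdot>\<^bsub>A\<^esub> g \<in> hom A j l" using f' g' h' by auto
      let ?w1 = "tstar C (Sig j k) (Tau i j) (Sec g) \<cdot> Sec f"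
      note ts = tstar_props[OF tp1 sgg(1)]
      have w1: "?w1 \<in> arrs C" "src ?w1 = fob P i" "trg ?w1 = D" using ts(1-3) sf tij by (auto simp: D_def)
      have w1p: "p \<cdot> ?w1 = Sec g \<cdot> far P f" "q \<cdot> ?w1 = Sec f \<cdot> far P (rst A (g \<cdot>\<^bsub>A\<^esub> f))"
        using pair_props(4,5)[OF total_pbD(1)[OF tp1] _ _ _ _ _ tstar_Sec(2)[OF f g]] tstar_Sec(1)[OF f g] sf sgg f' g' tij
        by (auto simp: p_def q_def)
      let ?T = "Sec h \<cdot> far P (g \<cdot>\<^bsub>A\<^esub> f)"
      define e where "e = far P (rst A (h \<cdot>\<^bsub>A\<^esub> (g \<cdot>\<^bsub>A\<^esub> f)))"
      have e: "e \<in> arrs C" "src e = fob P i" "trg e = fob P i" using f' g' h' by (auto simp: e_def)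
      have Pgf: "far P (g \<cdot>\<^bsub>A\<^esub> f) = far P g \<cdot> far P f" using P_cmp[of f g] f' g' by simp
      have Te: "rst C ?T = e" using Sec_far_rst[OF gf h] by (simp add: e_def)
      have T: "?T \<in> arrs C" "src ?T = fob P i" "trg ?T = src (Sig k l)" using sh f' g' by auto
      have re: "far P (rst A (g \<cdot>\<^bsub>A\<^esub> f)) \<cdot> e = e"
        using A.rst_cmp_le(2)[of "g \<cdot>\<^bsub>A\<^esub> f" h] P_cmp[of "rst A (h \<cdot>\<^bsub>A\<^esub> (g \<cdot>\<^bsub>A\<^esub> f))" "rst A (g \<cdot>\<^bsub>A\<^esub> f)"] f' g' h'
        by (simp add: e_def)
      \<comment> \<open>\<open>W\<close> is the triple of \<open>h\<close>, \<open>g\<close> and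
        \<open>f\<close> as an element of the iterated pullback. Its components are computed next;
        all of them live on the domain \<open>e\<close> of the threefold composite.\<close>
      define W where "W = ?w2 \<cdot> ?w1"
      have W: "W \<in> arrs C" "src W = fob P i" "trg W = E" using w1 w2' by (auto simp: W_def)
      have tpw: "Tau j k \<cdot> (p \<cdot> ?w1) = far P (g \<cdot>\<^bsub>A\<^esub> f)"
        using reassoc[OF tjk(4)[OF g], of "far P f"] tjk(1-3) sgg f' Pgf by (simp add: w1p)
      have aW: "a \<cdot> W = ?T"
        using reassoc[OF w2(4), of ?w1] w1 w2' p tjk a' sh tpw by (simp add: W_def a flip: p_def)
      have bcW: "bc \<cdot> W = ?w1 \<cdot> e"
      proof -
        have "bc \<cdot> W = rst C (Sec h \<cdot> (Tau j k \<cdot> p)) \<cdot> ?w1"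
          using reassoc[OF w2(5), of ?w1] w1 w2' p tjk sh bc' by (simp add: W_def bc flip: p_def)
        also have "\<dots> = ?w1 \<cdot> rst C (Sec h \<cdot> (Tau j k \<cdot> p) \<cdot> ?w1)"
          by (rule rst_slide) (use w1 p tjk sh in auto)
        also have "Sec h \<cdot> (Tau j k \<cdot> p) \<cdot> ?w1 = ?T" using tpw w1 p tjk sh by simp
        finally show ?thesis by (simp add: Te)
      qed
      have bW: "b \<cdot> W = Sec g \<cdot> (far P f \<cdot> e)"
        using bcW reassoc[OF w1p(1), of e] p bc' W w1 e sgg f' by (simp add: b'(4))
      have cW: "c \<cdot> W = Sec f \<cdot> e"
        using bcW reassoc[OF w1p(2), of e] q bc' W w1 e sf f' g' re by (simp add: c'(4))
      have mbW: "Mu i j k \<cdot> bc \<cdot> W = Sec (g \<cdot>\<^bsub>A\<^esub> f) \<cdot> e"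
        using bcW reassoc[OF m1(4)[OF f g], of e] m1(1-3) bc' W w1 e by (simp add: D_def)
      have "?L \<cdot> W = Mu i k l \<cdot> pair C (Sig k l) (Tau i k) (a \<cdot> W) (Mu i j k \<cdot> bc \<cdot> W)"
        using pair_cmp[OF total_pbD(1)[OF tpikl] c1 e1 W(1)] W a' pp1(1-3) m2(1-3) by simp
      also have "\<dots> = Sec (h \<cdot>\<^bsub>A\<^esub> (g \<cdot>\<^bsub>A\<^esub> f))"
        using Mu_pair'[OF gf h] by (simp add: aW mbW e_def)
      finally have LW: "?L \<cdot> W = Sec (h \<cdot>\<^bsub>A\<^esub> (g \<cdot>\<^bsub>A\<^esub> f))" .
      have hge: "far P (rst A (h \<cdot>\<^bsub>A\<^esub> g)) \<cdot> far P f = far P f \<cdot> e"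
        using A.rst_slide[of f "h \<cdot>\<^bsub>A\<^esub> g"] P_cmp[of f "rst A (h \<cdot>\<^bsub>A\<^esub> g)"] P_cmp[of "rst A (h \<cdot>\<^bsub>A\<^esub> (g \<cdot>\<^bsub>A\<^esub> f))" f] f' g' h'
        by (simp add: e_def)
      have "?n \<cdot> W = Mu j k l \<cdot> pair C (Sig k l) (Tau j k) (a \<cdot> W) (b \<cdot> W)"
        using pair_cmp[OF total_pbD(1)[OF tpjkl] c2 sqb W(1)] W a' pp2(1-3) m3(1-3) by simp
      also have "\<dots> = Sec (h \<cdot>\<^bsub>A\<^esub> g) \<cdot> far P f"
        using Mu_pair[OF g h, of "far P f"] f' hge by (simp add: aW bW Pgf)
      finally have nW: "?n \<cdot> W = Sec (h \<cdot>\<^bsub>A\<^esub> g) \<cdot> far P f" .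
      have "?R \<cdot> W = Mu i j l \<cdot> pair C (Sig j l) (Tau i j) (?n \<cdot> W) (c \<cdot> W)"
        using pair_cmp[OF total_pbD(1)[OF tpijl] c3 e3 W(1)] W n pp3(1-3) m4(1-3) by (simp del: cmp_assoc' add: cmp_assoc'[of W "pair C (Sig j l) (Tau i j) ?n c"])
      also have "\<dots> = Sec (h \<cdot>\<^bsub>A\<^esub> g \<cdot>\<^bsub>A\<^esub> f)"
        using Mu_pair'[OF f hg] f' g' h' by (simp add: nW cW e_def)
      finally have "?L \<cdot> W = ?R \<cdot> W" using LW f' g' h' by simp
      then show "?L \<cdot> ?w2 \<cdot> ?w1 = ?R \<cdot> ?w2 \<cdot> ?w1"
        using cmp_assoc'[OF w1(1) w2'(1) L(1)] cmp_assoc'[OF w1(1) w2'(1) R(1)] w1 w2' L R by (simp only: W_def)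
    qed
  qed
qed

lemma Psi_partite: "partite_category C (Psi_ob C (A, P))"
proof (unfold_locales, unfold Psi_ob_simps)
  fix i assume i: "i \<in> obj A"
  note e = eta_props[OF i]
  show "fob P i \<in> obj C" using i by simp
  show "Sec (idn A i) \<in> hom C (fob P i) (src (Sig i i))" "Sig i i \<cdot> Sec (idn A i) = idn C (fob P i)"
    "Tau i i \<cdot> Sec (idn A i) = idn C (fob P i)" using e by auto
  fix j assume j: "j \<in> obj A"
  note sp = Sig_props[OF i j] and t = Tau_props[OF i j]
  show "src (Sig i j) \<in> obj C" "Sig i j \<in> hom C (src (Sig i j)) (fob P i)" "total C (Sig i j)"
    "has_pullbacks_along_total C (Sig i j)" "Tau i j \<in> hom C (src (Sig i j)) (fob P j)" "total C (Tau i j)"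
    using sp t local_homeo_pullbacks by auto
  show "Mu i i j \<cdot> pair C (Sig i j) (Tau i i) (idn C (src (Sig i j))) (Sec (idn A i) \<cdot> Sig i j) = idn C (src (Sig i j))"
    by (rule Psi_unit_right[OF i j])
  show "Mu i j j \<cdot> pair C (Sig j j) (Tau i j) (Sec (idn A j) \<cdot> Tau i j) (idn C (src (Sig i j))) = idn C (src (Sig i j))"
    by (rule Psi_unit_left[OF i j])
  fix k assume k: "k \<in> obj A"
  show "Mu i j k \<in> hom C (pbob C (Sig j k) (Tau i j)) (src (Sig i k))" using Mu_props[OF i j k] by simp
  show "Sig i k \<cdot> Mu i j k = Sig i j \<cdot> pr2 C (Sig j k) (Tau i j)" "Tau i k \<cdot> Mu i j k = Tau j k \<cdot> pr1 C (Sig j k) (Tau i j)"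
    using Psi_sig_mu[OF i j k] by auto
next
  fix i j k l a bc b c
  assume "i \<in> obj A" "j \<in> obj A" "k \<in> obj A" "l \<in> obj A"
    "a = pr1 C (Sig k l) (Tau j k \<cdot> pr1 C (Sig j k) (Tau i j))"
    "bc = pr2 C (Sig k l) (Tau j k \<cdot> pr1 C (Sig j k) (Tau i j))"
    "b = pr1 C (Sig j k) (Tau i j) \<cdot> bc" "c = pr2 C (Sig j k) (Tau i j) \<cdot> bc"
  then show "Mu i k l \<cdot> pair C (Sig k l) (Tau i k) a (Mu i j k \<cdot> bc)
    = Mu i j l \<cdot> pair C (Sig j l) (Tau i j) (Mu j k l \<cdot> pair C (Sig k l) (Tau j k) a b) c"
    by (rule Psi_assoc)
qed

lemma Psi_source_etale: "source_etale C (Psi_ob C (A, P))"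
  using Sig_props(1) by (simp add: source_etale_def)

end

text \<open>Makes the results on sections of an internal category available for the glued one under
  the prefix \<open>Y\<close>.\<close>

sublocale hyper_over \<subseteq> Y: pcat_over C "Psi_ob C (A, P)"
  using Psi_partite by (simp add: pcat_over_def plain_join_restriction_category_axioms)

section \<open>Categories over the base\<close>

text \<open>Maps over the base are stored extensionally, so identities and composites have to be cut
  back to the objects and arrows of their domain.\<close>

lemma restriction_functor_restrict:
  assumes "restriction_functor A B F"
  shows "restriction_functor A B (restrict_func A F)"
proof -
  interpret F: restriction_functor A B F by (rule assms)
  show ?thesis
  proof
    show "fob (restrict_func A F) X \<in> obj B" if "X \<in> obj A" for X
      using F.fob_obj[OF that] that by (simp add: restrict_func_def)
    show "far (restrict_func A F) f \<in> hom B (fob (restrict_func A F) X) (fob (restrict_func A F) Y)"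
      if f: "f \<in> hom A X Y" for f X Y
    proof -
      have "X \<in> obj A" "Y \<in> obj A" using f by auto
      then show ?thesis using F.far_hom[OF f] f by (simp add: restrict_func_def)
    qed
    show "far (restrict_func A F) (idn A X) = idn B (fob (restrict_func A F) X)" if "X \<in> obj A" for X
      using F.far_idn[OF that] that by (simp add: restrict_func_def)
    show "far (restrict_func A F) (g \<cdot>\<^bsub>A\<^esub> f) = far (restrict_func A F) g \<cdot>\<^bsub>B\<^esub> far (restrict_func A F) f"
      if "f \<in> hom A X Y" "g \<in> hom A Y Z" for f g X Y Z
      using F.far_cmp[OF that] that by (simp add: restrict_func_def)
    show "far (restrict_func A F) (rst A f) = rst B (far (restrict_func A F) f)" if "f \<in> arrs A" for f
      using F.far_rst[OF that] that by (simp add: restrict_func_def)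
  qed
qed

lemma restriction_functor_comp:
  assumes "restriction_functor A B F" "restriction_functor B D G"
  shows "restriction_functor A D (comp_func G F)"
proof -
  interpret F: restriction_functor A B F by (rule assms)
  interpret G: restriction_functor B D G by (rule assms)
  show ?thesis
  proof
    show "fob (comp_func G F) X \<in> obj D" if "X \<in> obj A" for X
      using F.fob_obj[OF that] G.fob_obj by (simp add: comp_func_def)
    show "far (comp_func G F) f \<in> hom D (fob (comp_func G F) X) (fob (comp_func G F) Y)"
      if f: "f \<in> hom A X Y" for f X Y
      using G.far_hom[OF F.far_hom[OF f]] by (simp add: comp_func_def)
    show "far (comp_func G F) (idn A X) = idn D (fob (comp_func G F) X)" if "X \<in> obj A" for X
      using F.far_idn[OF that] G.far_idn F.fob_obj[OF that] by (simp add: comp_func_def)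
    show "far (comp_func G F) (g \<cdot>\<^bsub>A\<^esub> f) = far (comp_func G F) g \<cdot>\<^bsub>D\<^esub> far (comp_func G F) f"
      if "f \<in> hom A X Y" "g \<in> hom A Y Z" for f g X Y Z
      using F.far_cmp[OF that] G.far_cmp[OF F.far_hom[OF that(1)] F.far_hom[OF that(2)]] by (simp add: comp_func_def)
    show "far (comp_func G F) (rst A f) = rst D (far (comp_func G F) f)" if f: "f \<in> arrs A" for f
      using F.far_rst[OF f] G.far_rst[of "far F f"] F.far_hom[of f "src f" "trg f"] f by (simp add: comp_func_def)
  qed
qed

lemma restriction_functor_id: "restriction_category A \<Longrightarrow> restriction_functor A A id_func"
proof -
  assume "restriction_category A"
  then interpret restriction_category A .
  show ?thesis by unfold_locales (auto simp: id_func_def)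
qed

lemma (in plain_restriction_category) over_map_comp:
  assumes X: "is_over C (A, P)" and Y: "is_over C (B, Q)" and Z: "is_over C (D, R)"
    and f: "is_over_map C (A, P) (B, Q) f" and g: "is_over_map C (B, Q) (D, R) g"
  shows "is_over_map C (A, P) (D, R) (comp_over C (A, P) g f)"
proof -
  obtain F \<alpha> where f': "f = (F, \<alpha>)" by (cases f)
  obtain G \<beta> where g': "g = (G, \<beta>)" by (cases g)
  have F: "restriction_functor A B F" and G: "restriction_functor B D G"
    and \<alpha>: "\<And>i. i \<in> obj A \<Longrightarrow> \<alpha> i \<in> hom C (fob Q (fob F i)) (fob P i)" "\<And>i. i \<in> obj A \<Longrightarrow> total C (\<alpha> i)"
    and an: "\<And>f. f \<in> arrs A \<Longrightarrow> \<alpha> (trg f) \<cdot> far Q (far F f) = far P f \<cdot> \<alpha> (src f)"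
    and \<beta>: "\<And>i. i \<in> obj B \<Longrightarrow> \<beta> i \<in> hom C (fob R (fob G i)) (fob Q i)" "\<And>i. i \<in> obj B \<Longrightarrow> total C (\<beta> i)"
    and bn: "\<And>f. f \<in> arrs B \<Longrightarrow> \<beta> (trg f) \<cdot> far R (far G f) = far Q f \<cdot> \<beta> (src f)"
    using f g unfolding f' g' is_over_map.simps by blast+
  interpret F: restriction_functor A B F by (rule F)
  interpret G: restriction_functor B D G by (rule G)
  interpret P: restriction_functor A C P using X by (simp add: is_over_def)
  interpret Q: restriction_functor B C Q using Y by (simp add: is_over_def)
  interpret R: restriction_functor D C R using Z by (simp add: is_over_def)
  show ?thesis
    unfolding f' g' comp_over.simps is_over_map.simps
  proof (intro conjI ballI)
    show "restriction_functor A D (restrict_func A (comp_func G F))"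
      by (rule restriction_functor_restrict[OF restriction_functor_comp[OF F G]])
    show "fob (restrict_func A (comp_func G F)) \<in> extensional (obj A)"
      "far (restrict_func A (comp_func G F)) \<in> extensional (arrs A)"
      "restrict (\<lambda>i. \<alpha> i \<cdot> \<beta> (fob F i)) (obj A) \<in> extensional (obj A)"
      by (auto simp: restrict_func_def)
    fix i assume i: "i \<in> obj A"
    note Fi = F.fob_obj[OF i]
    show "restrict (\<lambda>i. \<alpha> i \<cdot> \<beta> (fob F i)) (obj A) i
        \<in> hom C (fob R (fob (restrict_func A (comp_func G F)) i)) (fob P i)"
      using \<alpha>(1)[OF i] \<beta>(1)[OF Fi] i by (simp add: restrict_func_def comp_func_def)
    show "total C (restrict (\<lambda>i. \<alpha> i \<cdot> \<beta> (fob F i)) (obj A) i)"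
      using total_cmp[OF \<beta>(2)[OF Fi] \<alpha>(2)[OF i]] \<alpha>(1)[OF i] \<beta>(1)[OF Fi] i by simp
  next
    fix x assume x: "x \<in> arrs A"
    have Fx: "far F x \<in> hom B (fob F (src x)) (fob F (trg x))" using F.far_hom[of x] x by simp
    have GFx: "far G (far F x) \<in> hom D (fob G (fob F (src x))) (fob G (fob F (trg x)))" using G.far_hom[OF Fx] .
    have o: "src x \<in> obj A" "trg x \<in> obj A" "fob F (src x) \<in> obj B" "fob F (trg x) \<in> obj B"
      using x F.fob_obj by auto
    have t: "\<alpha> (src x) \<in> hom C (fob Q (fob F (src x))) (fob P (src x))"
      "\<alpha> (trg x) \<in> hom C (fob Q (fob F (trg x))) (fob P (trg x))"
      "\<beta> (fob F (src x)) \<in> hom C (fob R (fob G (fob F (src x)))) (fob Q (fob F (src x)))"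
      "\<beta> (fob F (trg x)) \<in> hom C (fob R (fob G (fob F (trg x)))) (fob Q (fob F (trg x)))"
      "far R (far G (far F x)) \<in> hom C (fob R (fob G (fob F (src x)))) (fob R (fob G (fob F (trg x))))"
      "far Q (far F x) \<in> hom C (fob Q (fob F (src x))) (fob Q (fob F (trg x)))"
      "far P x \<in> hom C (fob P (src x)) (fob P (trg x))"
      using \<alpha>(1) \<beta>(1) o R.far_hom[OF GFx] Q.far_hom[OF Fx] P.far_hom[of x "src x" "trg x"] x by auto
    have "\<alpha> (trg x) \<cdot> \<beta> (fob F (trg x)) \<cdot> far R (far G (far F x))
        = \<alpha> (trg x) \<cdot> (far Q (far F x) \<cdot> \<beta> (fob F (src x)))"
      using bn[of "far F x"] Fx t by simp
    also have "\<dots> = far P x \<cdot> (\<alpha> (src x) \<cdot> \<beta> (fob F (src x)))"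
      using reassoc[OF an[OF x], of "\<beta> (fob F (src x))"] t by simp
    finally show "restrict (\<lambda>i. \<alpha> i \<cdot> \<beta> (fob F i)) (obj A) (trg x) \<cdot> far R (far (restrict_func A (comp_func G F)) x)
        = far P x \<cdot> restrict (\<lambda>i. \<alpha> i \<cdot> \<beta> (fob F i)) (obj A) (src x)"
      using x o by (simp add: restrict_func_def comp_func_def)
  qed
qed

lemma (in plain_restriction_category) over_map_id:
  assumes X: "is_over C (A, P)"
  shows "is_over_map C (A, P) (A, P) (id_over C (A, P))"
proof -
  interpret P: restriction_functor A C P using X by (simp add: is_over_def)
  show ?thesis
    unfolding id_over.simps is_over_map.simps
  proof (intro conjI ballI)
    show "restriction_functor A A (restrict_func A id_func)"
      by (rule restriction_functor_restrict[OF restriction_functor_id]) unfold_locales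
    show "fob (restrict_func A id_func) \<in> extensional (obj A)" "far (restrict_func A id_func) \<in> extensional (arrs A)"
      "restrict (\<lambda>i. idn C (fob P i)) (obj A) \<in> extensional (obj A)"
      by (auto simp: restrict_func_def)
    fix i assume i: "i \<in> obj A"
    show "restrict (\<lambda>i. idn C (fob P i)) (obj A) i \<in> hom C (fob P (fob (restrict_func A id_func) i)) (fob P i)"
      "total C (restrict (\<lambda>i. idn C (fob P i)) (obj A) i)"
      using P.fob_obj[OF i] i by (auto simp: restrict_func_def id_func_def)
  next
    fix x assume x: "x \<in> arrs A"
    have "far P x \<in> hom C (fob P (src x)) (fob P (trg x))" using P.far_hom[of x] x by simp
    then show "restrict (\<lambda>i. idn C (fob P i)) (obj A) (trg x) \<cdot> far P (far (restrict_func A id_func) x)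
        = far P x \<cdot> restrict (\<lambda>i. idn C (fob P i)) (obj A) (src x)"
      using x by (simp add: restrict_func_def id_func_def)
  qed
qed

lemma over_map_types:
  assumes "is_over_map C (A, P) (B, Q) (F, \<alpha>)"
  shows "fob F \<in> extensional (obj A)" "far F \<in> extensional (arrs A)" "\<alpha> \<in> extensional (obj A)"
    "\<And>i. i \<in> obj A \<Longrightarrow> fob F i \<in> obj B"
    "\<And>x. x \<in> arrs A \<Longrightarrow> far F x \<in> arrs B \<and> src (far F x) = fob F (src x) \<and> trg (far F x) = fob F (trg x)"
    "\<And>i. i \<in> obj A \<Longrightarrow> \<alpha> i \<in> arrs C \<and> src (\<alpha> i) = fob Q (fob F i) \<and> trg (\<alpha> i) = fob P i \<and> total C (\<alpha> i)"
    "\<And>x. x \<in> arrs A \<Longrightarrow> \<alpha> (trg x) \<cdot>\<^bsub>C\<^esub> far Q (far F x) = far P x \<cdot>\<^bsub>C\<^esub> \<alpha> (src x)"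
    "restriction_functor A B F"
proof -
  show *: "fob F \<in> extensional (obj A)" "far F \<in> extensional (arrs A)" "\<alpha> \<in> extensional (obj A)"
    "restriction_functor A B F"
    "\<And>x. x \<in> arrs A \<Longrightarrow> \<alpha> (trg x) \<cdot>\<^bsub>C\<^esub> far Q (far F x) = far P x \<cdot>\<^bsub>C\<^esub> \<alpha> (src x)"
    "\<And>i. i \<in> obj A \<Longrightarrow> \<alpha> i \<in> arrs C \<and> src (\<alpha> i) = fob Q (fob F i) \<and> trg (\<alpha> i) = fob P i \<and> total C (\<alpha> i)"
    using assms by auto
  interpret F: restriction_functor A B F by (rule *(4))
  show "fob F i \<in> obj B" if "i \<in> obj A" for i using F.fob_obj[OF that] .
  show "far F x \<in> arrs B \<and> src (far F x) = fob F (src x) \<and> trg (far F x) = fob F (trg x)" if "x \<in> arrs A" for x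
    using F.far_hom[of x "src x" "trg x"] that by simp
qed

lemma over_map_eqI:
  assumes "fob F \<in> extensional O1" "fob F' \<in> extensional O1" "far F \<in> extensional S" "far F' \<in> extensional S"
    "\<alpha> \<in> extensional O1" "\<alpha>' \<in> extensional O1"
    "\<And>i. i \<in> O1 \<Longrightarrow> fob F i = fob F' i" "\<And>x. x \<in> S \<Longrightarrow> far F x = far F' x" "\<And>i. i \<in> O1 \<Longrightarrow> \<alpha> i = \<alpha>' i"
  shows "((F, \<alpha>) :: ('i, 'o, 'u) over_map) = (F', \<alpha>')"
proof -
  have "fob F = fob F'" "far F = far F'" "\<alpha> = \<alpha>'"
    using extensionalityI[OF assms(1,2,7)] extensionalityI[OF assms(3,4,8)] extensionalityI[OF assms(5,6,9)] by auto
  then show ?thesis by simp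
qed

lemma (in plain_restriction_category) category_rCat_over:
  shows "category (rCat_over C :: (('i, 'o, 'u) over, ('i, 'o, 'u) over_map) cat)"
proof -
  let ?D = "rCat_over C :: (('i, 'o, 'u) over, ('i, 'o, 'u) over_map) cat"
  have arrs: "x \<in> arrs ?D \<longleftrightarrow> is_over C (src x) \<and> is_over C (trg x) \<and> is_over_map C (src x) (trg x) (lab x)" for x
    by (cases x) (auto simp: rCat_over_def)
  have cmp: "g \<cdot>\<^bsub>?D\<^esub> f = Arr (src f) (trg g) (comp_over C (src f) (lab g) (lab f))" for f g
    by (simp add: rCat_over_def)
  show ?thesis
  proof
    show "src f \<in> obj ?D" "trg f \<in> obj ?D" if "f \<in> arrs ?D" for f
      using that arrs by (auto simp: rCat_over_def)
    show "idn ?D X \<in> hom ?D X X" if "X \<in> obj ?D" for X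
    proof -
      have "is_over C X" using that by (simp add: rCat_over_def)
      then show ?thesis using over_map_id[of "fst X" "snd X"] arrs[of "idn ?D X"] by (simp add: rCat_over_def)
    qed
    show "g \<cdot>\<^bsub>?D\<^esub> f \<in> hom ?D X Z" if "f \<in> hom ?D X Y" "g \<in> hom ?D Y Z" for f g X Y Z
      using that over_map_comp[of "fst X" "snd X" "fst Y" "snd Y" "fst Z" "snd Z" "lab f" "lab g"]
      by (auto simp: arrs cmp)
    show "idn ?D Y \<cdot>\<^bsub>?D\<^esub> f = f" if fh: "f \<in> hom ?D X Y" for f X Y
    proof -
      obtain A P where X: "X = (A, P)" by (cases X)
      obtain B Q where Y: "Y = (B, Q)" by (cases Y)
      obtain F \<alpha> where f: "f = Arr (A, P) (B, Q) (F, \<alpha>)" using fh X Y by (cases f) auto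
      have m: "is_over_map C (A, P) (B, Q) (F, \<alpha>)" using fh unfolding f in_hom arrs arr.sel by blast
      note t = over_map_types[OF m]
      have "comp_over C (A, P) (id_over C (B, Q)) (F, \<alpha>) = (F, \<alpha>)"
        unfolding id_over.simps comp_over.simps
        by (rule over_map_eqI[where S = "arrs A"]) (use t in \<open>auto simp: restrict_func_def comp_func_def id_func_def\<close>)
      then show ?thesis by (simp add: f cmp Y) (simp add: rCat_over_def)
    qed
    show "f \<cdot>\<^bsub>?D\<^esub> idn ?D X = f" if fh: "f \<in> hom ?D X Y" for f X Y
    proof -
      obtain A P where X: "X = (A, P)" by (cases X)
      obtain B Q where Y: "Y = (B, Q)" by (cases Y)
      obtain F \<alpha> where f: "f = Arr (A, P) (B, Q) (F, \<alpha>)" using fh X Y by (cases f) auto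
      have m: "is_over_map C (A, P) (B, Q) (F, \<alpha>)" and o: "is_over C (A, P)" using fh unfolding f in_hom arrs arr.sel by blast+
      note t = over_map_types[OF m]
      have "comp_over C (A, P) (F, \<alpha>) (id_over C (A, P)) = (F, \<alpha>)"
        unfolding id_over.simps comp_over.simps
        by (rule over_map_eqI[where S = "arrs A"]) (use t in \<open>auto simp: restrict_func_def comp_func_def id_func_def\<close>)
      then show ?thesis by (simp add: f cmp X) (simp add: rCat_over_def)
    qed
    show "h \<cdot>\<^bsub>?D\<^esub> g \<cdot>\<^bsub>?D\<^esub> f = h \<cdot>\<^bsub>?D\<^esub> (g \<cdot>\<^bsub>?D\<^esub> f)"
      if fh: "f \<in> hom ?D W X" and gh: "g \<in> hom ?D X Y" and hh: "h \<in> hom ?D Y Z" for f g h W X Y Z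
    proof -
      obtain A P where W: "W = (A, P)" by (cases W)
      obtain B Q where X: "X = (B, Q)" by (cases X)
      obtain D R where Y: "Y = (D, R)" by (cases Y)
      obtain E S where Z: "Z = (E, S)" by (cases Z)
      obtain F \<alpha> where f: "f = Arr (A, P) (B, Q) (F, \<alpha>)" using fh W X by (cases f) auto
      obtain G \<beta> where g: "g = Arr (B, Q) (D, R) (G, \<beta>)" using gh X Y by (cases g) auto
      obtain H \<gamma> where h: "h = Arr (D, R) (E, S) (H, \<gamma>)" using hh Y Z by (cases h) auto
      have m: "is_over_map C (A, P) (B, Q) (F, \<alpha>)" "is_over_map C (B, Q) (D, R) (G, \<beta>)" "is_over_map C (D, R) (E, S) (H, \<gamma>)"
        and o: "is_over C (A, P)"
        using fh gh hh unfolding f g h in_hom arrs arr.sel by blast+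
      interpret A: restriction_functor A C P using o by (simp add: is_over_def)
      note t1 = over_map_types[OF m(1)] and t2 = over_map_types[OF m(2)] and t3 = over_map_types[OF m(3)]
      have "comp_over C (A, P) (comp_over C (B, Q) (H, \<gamma>) (G, \<beta>)) (F, \<alpha>)
          = comp_over C (A, P) (H, \<gamma>) (comp_over C (A, P) (G, \<beta>) (F, \<alpha>))"
        unfolding comp_over.simps
      proof (rule over_map_eqI[where S = "arrs A"])
        show "fob (restrict_func A (comp_func (restrict_func B (comp_func H G)) F)) i
            = fob (restrict_func A (comp_func H (restrict_func A (comp_func G F)))) i" if "i \<in> obj A" for i
          using that t1(4)[OF that] by (simp add: restrict_func_def comp_func_def)
        show "far (restrict_func A (comp_func (restrict_func B (comp_func H G)) F)) x
            = far (restrict_func A (comp_func H (restrict_func A (comp_func G F)))) x" if "x \<in> arrs A" for x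
          using that t1(5)[OF that] by (simp add: restrict_func_def comp_func_def)
        fix i assume i: "i \<in> obj A"
        note Fi = t1(4)[OF i]
        show "restrict (\<lambda>i. \<alpha> i \<cdot> restrict (\<lambda>i. \<beta> i \<cdot> \<gamma> (fob G i)) (obj B) (fob F i)) (obj A) i
            = restrict (\<lambda>i. restrict (\<lambda>i. \<alpha> i \<cdot> \<beta> (fob F i)) (obj A) i
                \<cdot> \<gamma> (fob (restrict_func A (comp_func G F)) i)) (obj A) i"
          using i Fi t1(6)[OF i] t2(6)[OF Fi] t3(6)[OF t2(4)[OF Fi]] by (simp add: restrict_func_def comp_func_def)
      qed (auto simp: restrict_func_def)
      then show ?thesis by (simp add: f g h cmp)
    qed
  qed
qed

lemma full_subcat_simps [simp]:
  "obj (full_subcat D S) = {x \<in> obj D. S x}" "arrs (full_subcat D S) = {f \<in> arrs D. S (src f) \<and> S (trg f)}"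
  "idn (full_subcat D S) = idn D" "cmp (full_subcat D S) = cmp D"
  by (simp_all add: full_subcat_def)

lemma category_full_subcat:
  assumes "category D"
  shows "category (full_subcat D S)"
proof -
  interpret D: category D by (rule assms)
  show ?thesis by unfold_locales auto
qed

section \<open>Equivalences from full and faithful functors\<close>

text \<open>Functoriality of \<open>L\<close> is no assumption: its action on arrows is only
  required to satisfy the naturality square of the unit. Full faithfulness of \<open>R\<close> and
  invertibility of the unit force the rest.\<close>

locale equivalence_data = D: category D + E: category E
  for D :: "('o, 'u) cat" and E :: "('p, 'v) cat" +
  fixes R :: "('o, 'u, 'p, 'v) func" and L :: "('p, 'v, 'o, 'u) func" and \<eta> :: "'p \<Rightarrow> ('p, 'v) arr"
  assumes R_functor: "is_functor D E R"
    and full: "\<lbrakk>X \<in> obj D; Y \<in> obj D; h \<in> hom E (fob R X) (fob R Y)\<rbrakk> \<Longrightarrow> \<exists>f \<in> hom D X Y. far R f = h"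
    and faithful: "\<lbrakk>f \<in> hom D X Y; g \<in> hom D X Y; far R f = far R g\<rbrakk> \<Longrightarrow> f = g"
    and L_obj: "Z \<in> obj E \<Longrightarrow> fob L Z \<in> obj D"
    and unit_hom: "Z \<in> obj E \<Longrightarrow> \<eta> Z \<in> hom E Z (fob R (fob L Z))"
    and unit_iso: "Z \<in> obj E \<Longrightarrow> is_iso E (\<eta> Z)"
    and L_far: "h \<in> arrs E \<Longrightarrow> far L h \<in> hom D (fob L (src h)) (fob L (trg h))"
      "h \<in> arrs E \<Longrightarrow> far R (far L h) \<cdot>\<^bsub>E\<^esub> \<eta> (src h) = \<eta> (trg h) \<cdot>\<^bsub>E\<^esub> h"
begin

text \<open>Full subcategories keep hom-sets and composition, so only the two object conditions
  matter. An inverse of a unit component stays inside because its source and target do.\<close>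

lemma equivalence_data_restrict:
  assumes S: "\<And>X. \<lbrakk>X \<in> obj D; S X\<rbrakk> \<Longrightarrow> T (fob R X)" and T: "\<And>Y. \<lbrakk>Y \<in> obj E; T Y\<rbrakk> \<Longrightarrow> S (fob L Y)"
  shows "equivalence_data (full_subcat D S) (full_subcat E T) R L \<eta>"
proof -
  interpret D': category "full_subcat D S" by (rule category_full_subcat) unfold_locales
  interpret E': category "full_subcat E T" by (rule category_full_subcat) unfold_locales
  interpret R: is_functor D E R by (rule R_functor)
  show ?thesis
  proof (intro equivalence_data.intro equivalence_data_axioms.intro)
    show "category (full_subcat D S)" "category (full_subcat E T)" by unfold_locales
    show "is_functor (full_subcat D S) (full_subcat E T) R"
      by unfold_locales (use R.fob_obj R.far_idn S R.far_hom R.far_cmp in auto)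
    show "\<exists>f \<in> hom (full_subcat D S) X Y. far R f = h"
      if X: "X \<in> obj (full_subcat D S)" and Y: "Y \<in> obj (full_subcat D S)" and h: "h \<in> hom (full_subcat E T) (fob R X) (fob R Y)" for X Y h
      using full[of X Y h] that by auto
    show "f = g" if "f \<in> hom (full_subcat D S) X Y" "g \<in> hom (full_subcat D S) X Y" "far R f = far R g" for f g X Y
      using faithful[of f X Y g] that by auto
    show "fob L Y \<in> obj (full_subcat D S)" if "Y \<in> obj (full_subcat E T)" for Y using L_obj T that by auto
    show "\<eta> Y \<in> hom (full_subcat E T) Y (fob R (fob L Y))" if "Y \<in> obj (full_subcat E T)" for Y
      using unit_hom[of Y] that S T L_obj[of Y] by auto
    show "is_iso (full_subcat E T) (\<eta> Y)" if "Y \<in> obj (full_subcat E T)" for Y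
    proof -
      have Y: "Y \<in> obj E" "T Y" using that by auto
      have TR: "T (fob R (fob L Y))" using S[OF L_obj[OF Y(1)] T[OF Y]] .
      obtain g where g: "g \<in> hom E (trg (\<eta> Y)) (src (\<eta> Y))" "g \<cdot>\<^bsub>E\<^esub> \<eta> Y = idn E (src (\<eta> Y))"
        "\<eta> Y \<cdot>\<^bsub>E\<^esub> g = idn E (trg (\<eta> Y))"
        using unit_iso[OF Y(1)] unfolding is_iso_def by blast
      show ?thesis
        unfolding is_iso_def using g unit_hom[OF Y(1)] Y(2) TR by (intro conjI bexI[of _ g]) auto
    qed
    show "far L h \<in> hom (full_subcat D S) (fob L (src h)) (fob L (trg h))" if "h \<in> arrs (full_subcat E T)" for h
      using L_far(1)[of h] that T by auto
    show "far R (far L h) \<cdot>\<^bsub>full_subcat E T\<^esub> \<eta> (src h) = \<eta> (trg h) \<cdot>\<^bsub>full_subcat E T\<^esub> h" if "h \<in> arrs (full_subcat E T)" for h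
      using L_far(2)[of h] that by auto
  qed
qed

lemma equivalence: "adjoint_equivalence D E R L \<eta>"
proof -
  interpret R: is_functor D E R by (rule R_functor)
  have Rt: "far R f \<in> arrs E" "src (far R f) = fob R (src f)" "trg (far R f) = fob R (trg f)" if "f \<in> arrs D" for f
    using R.far_hom[of f "src f" "trg f"] that by auto
  have Rc: "far R (g \<cdot>\<^bsub>D\<^esub> f) = far R g \<cdot>\<^bsub>E\<^esub> far R f" if "f \<in> arrs D" "g \<in> arrs D" "trg f = src g" for f g
    using R.far_cmp[of f "src f" "trg f" g "trg g"] that by simp
  have e: "\<eta> Y \<in> arrs E" "src (\<eta> Y) = Y" "trg (\<eta> Y) = fob R (fob L Y)" if "Y \<in> obj E" for Y
    using unit_hom[OF that] by auto
  have "\<exists>g. g \<in> hom E (fob R (fob L Y)) Y \<and> g \<cdot>\<^bsub>E\<^esub> \<eta> Y = idn E Y \<and> \<eta> Y \<cdot>\<^bsub>E\<^esub> g = idn E (fob R (fob L Y))" if "Y \<in> obj E" for Y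
    using unit_iso[OF that] e[OF that] unfolding is_iso_def by auto
  then obtain \<eta>' where inv: "\<And>Y. Y \<in> obj E \<Longrightarrow> \<eta>' Y \<in> hom E (fob R (fob L Y)) Y \<and> \<eta>' Y \<cdot>\<^bsub>E\<^esub> \<eta> Y = idn E Y
      \<and> \<eta> Y \<cdot>\<^bsub>E\<^esub> \<eta>' Y = idn E (fob R (fob L Y))" by metis
  have e': "\<eta>' Y \<in> arrs E" "src (\<eta>' Y) = fob R (fob L Y)" "trg (\<eta>' Y) = Y" "\<eta>' Y \<cdot>\<^bsub>E\<^esub> \<eta> Y = idn E Y"
    "\<eta> Y \<cdot>\<^bsub>E\<^esub> \<eta>' Y = idn E (fob R (fob L Y))" if "Y \<in> obj E" for Y
    using inv[OF that] by auto
  have L: "far L h \<in> arrs D" "src (far L h) = fob L (src h)" "trg (far L h) = fob L (trg h)" if "h \<in> arrs E" for h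
    using L_far(1)[OF that] by auto
  \<comment> \<open>The unit is invertible, hence cancellable on the right; so the naturality square
    determines \<open>R\<close> of \<open>L h\<close>.\<close>
  have epi: "x = y" if "Y \<in> obj E" "x \<in> arrs E" "y \<in> arrs E" "src x = fob R (fob L Y)" "src y = fob R (fob L Y)"
    "x \<cdot>\<^bsub>E\<^esub> \<eta> Y = y \<cdot>\<^bsub>E\<^esub> \<eta> Y" for x y Y
  proof -
    have "x \<cdot>\<^bsub>E\<^esub> \<eta> Y \<cdot>\<^bsub>E\<^esub> \<eta>' Y = y \<cdot>\<^bsub>E\<^esub> \<eta> Y \<cdot>\<^bsub>E\<^esub> \<eta>' Y" using that(6) by simp
    then show ?thesis using that(2-5) e[OF that(1)] e'[OF that(1)] by simp
  qed
  \<comment> \<open>Conjugation by the unit. Every equation about \<open>L\<close> is verified by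
    applying the faithful \<open>R\<close> and rewriting with this formula.\<close>
  have RL: "far R (far L h) = \<eta> (trg h) \<cdot>\<^bsub>E\<^esub> (h \<cdot>\<^bsub>E\<^esub> \<eta>' (src h))" if h: "h \<in> arrs E" for h
    by (rule epi[of "src h"])
      (use h L[OF h] Rt[OF L(1)[OF h]] e[of "src h"] e'[of "src h"] e[of "trg h"] L_far(2)[OF h] in auto)
  have Lf: "is_functor E D L"
  proof
    show "fob L X \<in> obj D" if "X \<in> obj E" for X using L_obj[OF that] .
    show "far L f \<in> hom D (fob L X) (fob L Y)" if "f \<in> hom E X Y" for f X Y using L[of f] that by simp
    show "far L (idn E X) = idn D (fob L X)" if X: "X \<in> obj E" for X
    proof (rule faithful)
      show "far L (idn E X) \<in> hom D (fob L X) (fob L X)" "idn D (fob L X) \<in> hom D (fob L X) (fob L X)"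
        using L[of "idn E X"] X L_obj[OF X] by auto
      show "far R (far L (idn E X)) = far R (idn D (fob L X))"
        using RL[of "idn E X"] X e[OF X] e'[OF X] R.far_idn[OF L_obj[OF X]] by simp
    qed
    show "far L (g \<cdot>\<^bsub>E\<^esub> f) = far L g \<cdot>\<^bsub>D\<^esub> far L f" if fh: "f \<in> hom E X Y" and gh: "g \<in> hom E Y Z" for f g X Y Z
    proof (rule faithful)
      have f: "f \<in> arrs E" "src f = X" "trg f = Y" and g: "g \<in> arrs E" "src g = Y" "trg g = Z" using fh gh by auto
      have gf: "g \<cdot>\<^bsub>E\<^esub> f \<in> arrs E" using f g by simp
      have o: "X \<in> obj E" "Y \<in> obj E" "Z \<in> obj E" using f g by auto
      show "far L (g \<cdot>\<^bsub>E\<^esub> f) \<in> hom D (fob L X) (fob L Z)" "far L g \<cdot>\<^bsub>D\<^esub> far L f \<in> hom D (fob L X) (fob L Z)"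
        using L[OF gf] L[OF f(1)] L[OF g(1)] f g by auto
      show "far R (far L (g \<cdot>\<^bsub>E\<^esub> f)) = far R (far L g \<cdot>\<^bsub>D\<^esub> far L f)"
        using RL[OF gf] RL[OF f(1)] RL[OF g(1)] Rc[OF L(1)[OF f(1)] L(1)[OF g(1)]] L(2,3)[OF f(1)] L(2,3)[OF g(1)]
          E.reassoc[OF e'(4)[OF o(2)], of "f \<cdot>\<^bsub>E\<^esub> \<eta>' X"] e[OF o(1)] e[OF o(2)] e[OF o(3)] e'(1-3)[OF o(1)] e'(1-3)[OF o(2)] f g o
        by simp
    qed
  qed
  have RX: "fob R X \<in> obj E" "fob L (fob R X) \<in> obj D" if "X \<in> obj D" for X using R.fob_obj[OF that] L_obj by auto
  \<comment> \<open>The counit at \<open>X\<close> is the arrow that fullness provides over the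
    inverse of the unit at \<open>R X\<close>. One triangle identity then holds by construction, the
    other after applying \<open>R\<close>.\<close>
  have "\<exists>f. f \<in> hom D (fob L (fob R X)) X \<and> far R f = \<eta>' (fob R X)" if X: "X \<in> obj D" for X
    using full[OF RX(2)[OF X] X, of "\<eta>' (fob R X)"] e'(1-3)[OF RX(1)[OF X]] by auto
  then obtain \<epsilon> where eps: "\<And>X. X \<in> obj D \<Longrightarrow> \<epsilon> X \<in> hom D (fob L (fob R X)) X \<and> far R (\<epsilon> X) = \<eta>' (fob R X)" by metis
  have ep: "\<epsilon> X \<in> arrs D" "src (\<epsilon> X) = fob L (fob R X)" "trg (\<epsilon> X) = X" "far R (\<epsilon> X) = \<eta>' (fob R X)" if "X \<in> obj D" for X
    using eps[OF that] by auto
  have epi_iso: "is_iso D (\<epsilon> X)" if X: "X \<in> obj D" for X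
  proof -
    note o = RX[OF X]
    obtain g where g: "g \<in> hom D X (fob L (fob R X))" "far R g = \<eta> (fob R X)"
      using full[OF X o(2), of "\<eta> (fob R X)"] e[OF o(1)] by auto
    have g': "g \<in> arrs D" "src g = X" "trg g = fob L (fob R X)" using g by auto
    have "g \<cdot>\<^bsub>D\<^esub> \<epsilon> X = idn D (fob L (fob R X))"
      by (rule faithful[of _ "fob L (fob R X)" "fob L (fob R X)"])
        (use Rc[OF ep(1)[OF X] g'(1)] ep[OF X] g' g(2) o R.far_idn e'[OF o(1)] in auto)
    moreover have "\<epsilon> X \<cdot>\<^bsub>D\<^esub> g = idn D X"
      by (rule faithful[of _ X X])
        (use Rc[OF g'(1) ep(1)[OF X]] ep[OF X] g' g(2) o X R.far_idn e'[OF o(1)] in auto)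
    ultimately show ?thesis using g ep[OF X] unfolding is_iso_def by auto
  qed
  have nat: "\<epsilon> (trg f) \<cdot>\<^bsub>D\<^esub> far L (far R f) = f \<cdot>\<^bsub>D\<^esub> \<epsilon> (src f)" if f: "f \<in> arrs D" for f
  proof (rule faithful)
    have o: "src f \<in> obj D" "trg f \<in> obj D" using f by auto
    note r = Rt[OF f] and ls = L[OF Rt(1)[OF f]] and es = ep[OF o(1)] and et = ep[OF o(2)]
    have oo: "fob R (src f) \<in> obj E" "fob R (trg f) \<in> obj E" using RX o by auto
    show "\<epsilon> (trg f) \<cdot>\<^bsub>D\<^esub> far L (far R f) \<in> hom D (fob L (fob R (src f))) (trg f)"
      "f \<cdot>\<^bsub>D\<^esub> \<epsilon> (src f) \<in> hom D (fob L (fob R (src f))) (trg f)" using ls es et r f by auto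
    have "far R (\<epsilon> (trg f) \<cdot>\<^bsub>D\<^esub> far L (far R f)) = \<eta>' (fob R (trg f)) \<cdot>\<^bsub>E\<^esub> (\<eta> (fob R (trg f)) \<cdot>\<^bsub>E\<^esub> (far R f \<cdot>\<^bsub>E\<^esub> \<eta>' (fob R (src f))))"
      using Rc[OF ls(1) et(1)] ls et r RL[OF r(1)] by simp
    also have "\<dots> = far R f \<cdot>\<^bsub>E\<^esub> \<eta>' (fob R (src f))"
      using E.reassoc[OF e'(4)[OF oo(2)], of "far R f \<cdot>\<^bsub>E\<^esub> \<eta>' (fob R (src f))"] e'(1-3)[OF oo(1)] e'(1-3)[OF oo(2)] e[OF oo(2)] r oo by simp
    also have "\<dots> = far R (f \<cdot>\<^bsub>D\<^esub> \<epsilon> (src f))" using Rc[OF es(1) f] es by simp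
    finally show "far R (\<epsilon> (trg f) \<cdot>\<^bsub>D\<^esub> far L (far R f)) = far R (f \<cdot>\<^bsub>D\<^esub> \<epsilon> (src f))" .
  qed
  have tri1: "\<epsilon> (fob L Y) \<cdot>\<^bsub>D\<^esub> far L (\<eta> Y) = idn D (fob L Y)" if Y: "Y \<in> obj E" for Y
  proof (rule faithful)
    note eY = e[OF Y] and LY = L_obj[OF Y]
    note l = L[OF eY(1), unfolded eY] and ee = ep[OF LY]
    have RLY: "fob R (fob L Y) \<in> obj E" by (rule RX(1)[OF LY])
    show "\<epsilon> (fob L Y) \<cdot>\<^bsub>D\<^esub> far L (\<eta> Y) \<in> hom D (fob L Y) (fob L Y)" "idn D (fob L Y) \<in> hom D (fob L Y) (fob L Y)"
      using l ee LY by auto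
    have "far R (far L (\<eta> Y)) = \<eta> (fob R (fob L Y))"
      using RL[OF eY(1)] eY e'[OF Y] e[OF RLY] by simp
    then show "far R (\<epsilon> (fob L Y) \<cdot>\<^bsub>D\<^esub> far L (\<eta> Y)) = far R (idn D (fob L Y))"
      using Rc[OF l(1) ee(1)] l ee e'[OF RLY] R.far_idn[OF LY] by simp
  qed
  have "nat_iso E E id_func (comp_func R L) \<eta>"
    unfolding nat_iso_def id_func_def comp_func_def using unit_hom unit_iso L_far(2) by simp
  moreover have "nat_iso D D (comp_func L R) id_func \<epsilon>"
    unfolding nat_iso_def id_func_def comp_func_def using eps epi_iso nat by simp
  moreover have "\<forall>X \<in> obj D. far R (\<epsilon> X) \<cdot>\<^bsub>E\<^esub> \<eta> (fob R X) = idn E (fob R X)"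
    using ep(4) e'(4) RX(1) by simp
  ultimately show ?thesis
    unfolding adjoint_equivalence_def using R_functor Lf tri1 by blast
qed

end

section \<open>The equivalence for source-etale categories\<close>

lemma obj_peCat: "A \<in> obj (peCat C) \<longleftrightarrow> partite_category C A \<and> source_etale C A"
  by (simp add: peCat_def pCat_def)

lemma arrs_pCat: "f \<in> arrs (pCat C) \<longleftrightarrow> partite_cofunctor C (src f) (trg f) (lab f)"
  by (cases f) (auto simp: pCat_def)

lemma arrs_peCat: "f \<in> arrs (peCat C) \<longleftrightarrow>
    partite_cofunctor C (src f) (trg f) (lab f) \<and> source_etale C (src f) \<and> source_etale C (trg f)"
  by (simp add: peCat_def arrs_pCat)

lemma peCat_ops:
  "idn (peCat C) = (\<lambda>A. Arr A A (id_cofun C A))"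
  "cmp (peCat C) = (\<lambda>g f. Arr (src f) (trg g) (comp_cofun C (src f) (trg f) (lab g) (lab f)))"
  by (simp_all add: peCat_def pCat_def)

lemma arrs_rCat_over: "x \<in> arrs (rCat_over C) \<longleftrightarrow>
    is_over C (src x) \<and> is_over C (trg x) \<and> is_over_map C (src x) (trg x) (lab x)"
  by (cases x) (auto simp: rCat_over_def)

lemma rCat_over_ops:
  "idn (rCat_over C) = (\<lambda>X. Arr X X (id_over C X))"
  "cmp (rCat_over C) = (\<lambda>g f. Arr (src f) (trg g) (comp_over C (src f) (lab g) (lab f)))"
  by (simp_all add: rCat_over_def)

lemma jrCat_ops [simp]: "idn (jrCat_h C) = idn (rCat_over C)" "cmp (jrCat_h C) = cmp (rCat_over C)"
  by (simp_all add: jrCat_h_def)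

lemma obj_jrCat: "(A, P) \<in> obj (jrCat_h C) \<longleftrightarrow>
    is_over C (A, P) \<and> join_restriction_category A \<and> hyperconnected A C P"
  by (simp add: jrCat_h_def rCat_over_def)

lemma arrs_jrCat: "x \<in> arrs (jrCat_h C) \<longleftrightarrow>
    x \<in> arrs (rCat_over C) \<and> src x \<in> obj (jrCat_h C) \<and> trg x \<in> obj (jrCat_h C)"
  by (auto simp: jrCat_h_def rCat_over_def)

lemma Phi_simps: "fob (Phi C) A = (Phi_cat C A, Phi_proj C A)"
  "far (Phi C) f = Arr (fob (Phi C) (src f)) (fob (Phi C) (trg f)) (Phi_map C (src f) (lab f))"
  by (simp_all add: Phi_def)

text \<open>The inverse function on arrows inherits every preservation law, because \<open>U\<close>
  is injective and satisfies it. Identity components force \<open>P\<close> and \<open>Q\<close> to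
  match under \<open>U\<close>, so the inverse can again be equipped with identities.\<close>

lemma (in plain_restriction_category) over_map_inverse:
  assumes X: "is_over C (A, P)" and Y: "is_over C (B, Q)"
    and U: "is_over_map C (A, P) (B, Q) (U, \<alpha>)"
    and ob: "obj B = obj A" "\<And>i. i \<in> obj A \<Longrightarrow> fob U i = i"
    and bij: "bij_betw (far U) (arrs A) (arrs B)" and al: "\<And>i. i \<in> obj A \<Longrightarrow> \<alpha> i = idn C (fob P i)"
  shows "\<exists>h. is_over_map C (B, Q) (A, P) h \<and> comp_over C (A, P) h (U, \<alpha>) = id_over C (A, P) \<and>
    comp_over C (B, Q) (U, \<alpha>) h = id_over C (B, Q)"
proof -
  note t = over_map_types[OF U]
  interpret U: restriction_functor A B U by (rule t(8))
  interpret P: restriction_functor A C P using X by (simp add: is_over_def)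
  interpret Q: restriction_functor B C Q using Y by (simp add: is_over_def)
  define V where "V = restrict_func B \<lparr>fob = (\<lambda>i. i), far = inv_into (arrs A) (far U)\<rparr>"
  define \<beta> where "\<beta> = restrict (\<lambda>i. idn C (fob Q i)) (obj B)"
  have QP: "fob Q i = fob P i" if "i \<in> obj A" for i
    using t(6)[OF that] ob(2)[OF that] al[OF that] P.fob_obj[OF that] by auto
  have Vo: "fob V i = i" if "i \<in> obj A" for i using that by (simp add: V_def restrict_func_def ob)
  have V: "far V y \<in> arrs A" "far U (far V y) = y" if "y \<in> arrs B" for y
  proof -
    have "y \<in> far U ` arrs A" using bij that by (simp add: bij_betw_def)
    then show "far V y \<in> arrs A" "far U (far V y) = y"
      using that f_inv_into_f[of y "far U" "arrs A"] inv_into_into[of y "far U" "arrs A"]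
      by (simp_all add: V_def restrict_func_def)
  qed
  have inj: "x = x'" if "x \<in> arrs A" "x' \<in> arrs A" "far U x = far U x'" for x x'
    using bij that unfolding bij_betw_def inj_on_def by blast
  have VU: "far V (far U x) = x" if "x \<in> arrs A" for x
  proof -
    have "far U x \<in> arrs B" using t(5)[OF that] by blast
    from inj[OF V(1)[OF this] that V(2)[OF this]] show ?thesis .
  qed
  have Vt: "src (far V y) = src y" "trg (far V y) = trg y" if y: "y \<in> arrs B" for y
    using t(5)[OF V(1)[OF y]] V(2)[OF y] ob(2)[of "src (far V y)"] ob(2)[of "trg (far V y)"] V(1)[OF y] by auto
  have VF: "restriction_functor B A V"
  proof
    show "fob V i \<in> obj A" if "i \<in> obj B" for i using that Vo ob(1) by simp
    show "far V y \<in> hom A (fob V i) (fob V j)" if "y \<in> hom B i j" for y i j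
    proof -
      have y: "y \<in> arrs B" "src y = i" "trg y = j" using that by auto
      have "src (far V y) \<in> obj A" "trg (far V y) \<in> obj A" using V(1)[OF y(1)] by simp_all
      then have "i \<in> obj A" "j \<in> obj A" using Vt[OF y(1)] y by simp_all
      then show ?thesis using V(1)[OF y(1)] Vt[OF y(1)] y Vo by simp
    qed
    show "far V (idn B i) = idn A (fob V i)" if "i \<in> obj B" for i
    proof -
      have i: "i \<in> obj A" using that ob by simp
      show ?thesis using VU[of "idn A i"] U.far_idn[OF i] ob(2)[OF i] Vo[OF i] i by simp
    qed
    show "far V (g \<cdot>\<^bsub>B\<^esub> f) = far V g \<cdot>\<^bsub>A\<^esub> far V f" if "f \<in> hom B i j" "g \<in> hom B j k" for f g i j k
    proof -
      have f: "f \<in> arrs B" "src f = i" "trg f = j" and g: "g \<in> arrs B" "src g = j" "trg g = k" using that by auto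
      have "far U (far V g \<cdot>\<^bsub>A\<^esub> far V f) = g \<cdot>\<^bsub>B\<^esub> f"
        using U.far_cmp[of "far V f" i j "far V g" k] V[OF f(1)] V[OF g(1)] Vt[OF f(1)] Vt[OF g(1)] f g by simp
      then show ?thesis
        using VU[of "far V g \<cdot>\<^bsub>A\<^esub> far V f"] V[OF f(1)] V[OF g(1)] Vt[OF f(1)] Vt[OF g(1)] f g by simp
    qed
    show "far V (rst B y) = rst A (far V y)" if y: "y \<in> arrs B" for y
      using VU[of "rst A (far V y)"] U.far_rst[OF V(1)[OF y]] V[OF y] by simp
  qed
  have over: "is_over_map C (B, Q) (A, P) (V, \<beta>)"
    unfolding is_over_map.simps
  proof (intro conjI ballI VF)
    show "fob V \<in> extensional (obj B)" "far V \<in> extensional (arrs B)" "\<beta> \<in> extensional (obj B)"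
      by (auto simp: V_def restrict_func_def \<beta>_def)
    show "\<beta> i \<in> hom C (fob P (fob V i)) (fob Q i)" "total C (\<beta> i)" if "i \<in> obj B" for i
      using that Vo[of i] QP[of i] ob(1) Q.fob_obj[OF that] by (auto simp: \<beta>_def)
    fix y assume y: "y \<in> arrs B"
    have "src y \<in> obj B" "trg y \<in> obj B" using y by simp_all
    then have o: "src y \<in> obj A" "trg y \<in> obj A" by (simp_all add: ob(1))
    note n = t(7)[OF V(1)[OF y]]
    have Qy: "far Q y \<in> hom C (fob Q (src y)) (fob Q (trg y))" using Q.far_hom[of y] y by simp
    have Py: "far P (far V y) \<in> hom C (fob P (src y)) (fob P (trg y))"
      using P.far_hom[of "far V y" "src y" "trg y"] V(1)[OF y] Vt[OF y] by simp
    have "far Q y = far P (far V y)"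
      using n V(2)[OF y] Vt[OF y] al[OF o(1)] al[OF o(2)] Qy Py QP[OF o(1)] QP[OF o(2)] by simp
    then show "\<beta> (trg y) \<cdot> far P (far V y) = far Q y \<cdot> \<beta> (src y)"
      using Qy o ob(1) by (simp add: \<beta>_def)
  qed
  have "comp_over C (A, P) (V, \<beta>) (U, \<alpha>) = id_over C (A, P)"
    unfolding comp_over.simps id_over.simps
  proof (rule over_map_eqI[where S = "arrs A"])
    fix i assume i: "i \<in> obj A"
    show "fob (restrict_func A (comp_func V U)) i = fob (restrict_func A id_func) i"
      using i ob(2) Vo by (simp add: restrict_func_def comp_func_def id_func_def)
    show "restrict (\<lambda>i. \<alpha> i \<cdot> \<beta> (fob U i)) (obj A) i = restrict (\<lambda>i. idn C (fob P i)) (obj A) i"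
      using i ob(2)[OF i] al[OF i] QP[OF i] ob(1) P.fob_obj[OF i] by (simp add: \<beta>_def)
  next
    show "far (restrict_func A (comp_func V U)) x = far (restrict_func A id_func) x" if "x \<in> arrs A" for x
      using that VU[OF that] by (simp add: restrict_func_def comp_func_def id_func_def)
  qed (auto simp: restrict_func_def)
  moreover have "comp_over C (B, Q) (U, \<alpha>) (V, \<beta>) = id_over C (B, Q)"
    unfolding comp_over.simps id_over.simps
  proof (rule over_map_eqI[where S = "arrs B"])
    fix i assume iB: "i \<in> obj B"
    then have i: "i \<in> obj A" using ob by simp
    show "fob (restrict_func B (comp_func U V)) i = fob (restrict_func B id_func) i"
      using i iB ob(2) Vo by (simp add: restrict_func_def comp_func_def id_func_def)
    show "restrict (\<lambda>i. \<beta> i \<cdot> \<alpha> (fob V i)) (obj B) i = restrict (\<lambda>i. idn C (fob Q i)) (obj B) i"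
      using i iB Vo[OF i] al[OF i] QP[OF i] P.fob_obj[OF i] by (simp add: \<beta>_def)
  next
    show "far (restrict_func B (comp_func U V)) x = far (restrict_func B id_func) x" if "x \<in> arrs B" for x
      using that V(2)[OF that] by (simp add: restrict_func_def comp_func_def id_func_def)
  qed (auto simp: restrict_func_def)
  ultimately show ?thesis using over by blast
qed

section \<open>Invertibility of the unit\<close>

context hyper_over
begin

lemma sec_cmp_Sec: "\<lbrakk>f \<in> hom A i j; g \<in> hom A j k\<rbrakk> \<Longrightarrow> sec_cmp C (Psi_ob C (A, P)) i j k (Sec g) (Sec f) = Sec (g \<cdot>\<^bsub>A\<^esub> f)"
proof -
  assume f: "f \<in> hom A i j" and g: "g \<in> hom A j k"
  show ?thesis
    using Mu_props(4)[OF hom_obj(1)[OF f] hom_obj(2)[OF f] hom_obj(2)[OF g] f g] by (simp add: sec_cmp_def)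
qed

lemma Sec_rst:
  assumes f: "f \<in> hom A i j"
  shows "Sec (rst A f) = Sec (idn A i) \<cdot> far P (rst A f)"
proof -
  have f': "f \<in> arrs A" "src f = i" "trg f = j" using f by auto
  show ?thesis using Sec_restrict[OF eta_props(1)[OF hom_obj(1)[OF f]], of "rst A f"] f' by simp
qed

text \<open>\<open>Sec_inj\<close> and \<open>Sec_surj\<close> give bijectivity on arrows, the
  defining equation of the multiplication gives functoriality, and that of the target map gives
  compatibility with the projections.\<close>

lemma unit_over_map:
  "is_over_map C (A, P) (fob (Phi C) (Psi_ob C (A, P))) (lab (unit_arr C (A, P)))"
  "\<exists>h. is_over_map C (fob (Phi C) (Psi_ob C (A, P))) (A, P) h \<and>
    comp_over C (A, P) h (lab (unit_arr C (A, P))) = id_over C (A, P) \<and>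
    comp_over C (fob (Phi C) (Psi_ob C (A, P))) (lab (unit_arr C (A, P))) h
      = id_over C (fob (Phi C) (Psi_ob C (A, P)))"
proof -
  let ?Y = "Psi_ob C (A, P)"
  interpret F: restriction_category "Phi_cat C ?Y" by (rule Y.Phi_restriction)
  define U where "U = restrict_func A \<lparr>fob = (\<lambda>i. i), far = (\<lambda>f. sec_arr (src f) (trg f) (Sec f))\<rparr>"
  define \<alpha> where "\<alpha> = restrict (\<lambda>i. idn C (fob P i)) (obj A)"
  have un: "lab (unit_arr C (A, P)) = (U, \<alpha>)" by (simp add: unit_arr_def U_def \<alpha>_def)
  have Uo: "fob U i = i" if "i \<in> obj A" for i using that by (simp add: U_def restrict_func_def)
  have U: "far U f \<in> arrs (Phi_cat C ?Y)" "src (far U f) = src f" "trg (far U f) = trg f"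
    "the_sec ?Y (far U f) = Sec f" if f: "f \<in> arrs A" for f
  proof -
    have fh: "f \<in> hom A (src f) (trg f)" using f by simp
    note s = Sec_props[OF fh]
    have 1: "far U f = sec_arr (src f) (trg f) (Sec f)" using f by (simp add: U_def restrict_func_def)
    show "far U f \<in> arrs (Phi_cat C ?Y)" "src (far U f) = src f" "trg (far U f) = trg f" "the_sec ?Y (far U f) = Sec f"
      unfolding 1 using Y.sec_arr_in_Phi[of "src f" "trg f" "Sec f"] s f by auto
  qed
  have F: "restriction_functor A (Phi_cat C ?Y) U"
  proof
    show "fob U i \<in> obj (Phi_cat C ?Y)" if "i \<in> obj A" for i using that Uo by simp
    show "far U f \<in> hom (Phi_cat C ?Y) (fob U i) (fob U j)" if fh: "f \<in> hom A i j" for f i j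
      using U[of f] fh Uo[OF hom_obj(1)[OF fh]] Uo[OF hom_obj(2)[OF fh]] by simp
    show "far U (idn A i) = idn (Phi_cat C ?Y) (fob U i)" if i: "i \<in> obj A" for i
      by (rule Y.Phi_eqI) (use U[of "idn A i"] Y.Phi_idn[of i] i Uo[OF i] in auto)
    show "far U (g \<cdot>\<^bsub>A\<^esub> f) = far U g \<cdot>\<^bsub>Phi_cat C ?Y\<^esub> far U f" if fh: "f \<in> hom A i j" and gh: "g \<in> hom A j k" for f g i j k
    proof -
      have f: "f \<in> arrs A" "src f = i" "trg f = j" and g: "g \<in> arrs A" "src g = j" "trg g = k" using fh gh by auto
      have gf: "g \<cdot>\<^bsub>A\<^esub> f \<in> arrs A" using f g by simp
      note Uf = U[OF f(1)] and Ug = U[OF g(1)]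
      have tr: "trg (far U f) = src (far U g)" using Uf Ug f g by simp
      note c = Y.Phi_cmp[OF Uf(1) Ug(1) tr]
      show ?thesis by (rule Y.Phi_eqI) (use c U[OF gf] Uf Ug f g sec_cmp_Sec[OF fh gh] in auto)
    qed
    show "far U (rst A f) = rst (Phi_cat C ?Y) (far U f)" if f: "f \<in> arrs A" for f
    proof -
      have fh: "f \<in> hom A (src f) (trg f)" using f by simp
      note Uf = U[OF f] and Ur = U[of "rst A f"]
      show ?thesis
        by (rule Y.Phi_eqI) (use Y.Phi_rst[OF Uf(1)] Uf Ur f Sec_rst[OF fh] Sec_props(6)[OF fh] in auto)
    qed
  qed
  show ov: "is_over_map C (A, P) (fob (Phi C) ?Y) (lab (unit_arr C (A, P)))"
    unfolding un Phi_simps is_over_map.simps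
  proof (intro conjI ballI F)
    show "fob U \<in> extensional (obj A)" "far U \<in> extensional (arrs A)" "\<alpha> \<in> extensional (obj A)"
      by (auto simp: U_def \<alpha>_def restrict_func_def)
    show "\<alpha> i \<in> hom C (fob (Phi_proj C ?Y) (fob U i)) (fob P i)" "total C (\<alpha> i)" if "i \<in> obj A" for i
      using that Uo[OF that] by (auto simp: \<alpha>_def Y.Phi_proj_far)
    fix f assume f: "f \<in> arrs A"
    then have fh: "f \<in> hom A (src f) (trg f)" by simp
    note i = hom_obj[OF fh]
    have "far (Phi_proj C ?Y) (far U f) = far P f"
      using U[OF f] Tau_props(4)[OF i fh] by (simp add: Y.Phi_proj_far)
    then show "\<alpha> (trg f) \<cdot> far (Phi_proj C ?Y) (far U f) = far P f \<cdot> \<alpha> (src f)" using f i by (simp add: \<alpha>_def)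
  qed
  have bij: "bij_betw (far U) (arrs A) (arrs (Phi_cat C ?Y))"
    unfolding bij_betw_def
  proof (intro conjI inj_onI set_eqI iffI)
    fix f g assume f: "f \<in> arrs A" and g: "g \<in> arrs A" and eq: "far U f = far U g"
    have st: "src f = src g" "trg f = trg g" using U(2,3)[OF f] U(2,3)[OF g] eq by auto
    have "Sec f = Sec g" using U(4)[OF f] U(4)[OF g] eq by simp
    then show "f = g" using Sec_inj[of f "src f" "trg f" g] f g st by simp
  next
    show "y \<in> arrs (Phi_cat C ?Y)" if "y \<in> far U ` arrs A" for y using that U(1) by blast
    fix y assume y: "y \<in> arrs (Phi_cat C ?Y)"
    note y' = Y.Phi_sec[OF y]
    obtain f where f: "f \<in> hom A (src y) (trg y)" "Sec f = the_sec ?Y y"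
      using Sec_surj[of "src y" "trg y" "the_sec ?Y y"] y' by auto
    have "far U f = y" by (rule Y.Phi_eqI) (use U[of f] f in auto)
    then show "y \<in> far U ` arrs A" using f by auto
  qed
  have oA: "is_over C (A, P)" using small P.restriction_functor_axioms by (simp add: is_over_def)
  have oY: "is_over C (Phi_cat C ?Y, Phi_proj C ?Y)"
    using Y.Phi_locally_small[OF loc_small] Y.Phi_proj_functor by (simp add: is_over_def)
  show "\<exists>h. is_over_map C (fob (Phi C) ?Y) (A, P) h \<and>
    comp_over C (A, P) h (lab (unit_arr C (A, P))) = id_over C (A, P) \<and>
    comp_over C (fob (Phi C) ?Y) (lab (unit_arr C (A, P))) h = id_over C (fob (Phi C) ?Y)"
    unfolding un Phi_simps
    by (rule over_map_inverse[OF oA oY ov[unfolded un Phi_simps] _ _ bij]) (use Uo in \<open>auto simp: \<alpha>_def\<close>)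
qed

end

section \<open>The functors and their equivalence data\<close>

context glueing_category
begin

lemma plain_joinC: "plain_join_restriction_category C"
  by unfold_locales

lemma pcat_overI: "partite_category C A \<Longrightarrow> pcat_over C A"
  by (simp add: pcat_over_def plain_joinC)

lemma pcat_pairI: "\<lbrakk>partite_category C A; partite_category C B\<rbrakk> \<Longrightarrow> pcat_pair C A B"
  by (simp add: pcat_pair_def pcat_overI plain_joinC)

lemma cofunctorD:
  assumes "partite_cofunctor C A B F"
  shows "partite_category C A" "partite_category C B" "cofun_over C A B F"
proof -
  show 1: "partite_category C A" "partite_category C B"
    using assms by (simp_all add: partite_cofunctor_def)
  show "cofun_over C A B F" using assms pcat_pairI[OF 1] by (simp add: cofun_over_def)
qed

lemma Phi_obj:
  assumes "partite_category C A"
  shows "fob (Phi C) A \<in> obj (jrCat_h C)" "is_over C (fob (Phi C) A)"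
proof -
  interpret A: pcat_over C A by (rule pcat_overI[OF assms])
  show "is_over C (fob (Phi C) A)"
    using A.Phi_locally_small[OF loc_small] A.Phi_proj_functor by (simp add: is_over_def Phi_simps)
  then show "fob (Phi C) A \<in> obj (jrCat_h C)"
    using A.Phi_join_restriction A.Phi_hyperconnected by (simp add: Phi_simps obj_jrCat)
qed

text \<open>Fullness yields a cofunctor with the same image as \<open>K\<close>, and faithfulness on
  raw data shows that it is \<open>K\<close>. A candidate given by a formula is therefore a
  cofunctor as soon as its image is a map over the base.\<close>

lemma cofunctor_of_over_map:
  assumes A: "partite_category C A" "source_etale C A" and B: "partite_category C B"
    and K: "raw_cofun C A B K" and o: "is_over_map C (fob (Phi C) A) (fob (Phi C) B) (Phi_map C A K)"
  shows "partite_cofunctor C A B K"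
proof -
  interpret pcat_pair C A B by (rule pcat_pairI[OF A(1) B])
  obtain F where F: "partite_cofunctor C A B F" "Phi_map C A F = Phi_map C A K"
    using Phi_map_full[OF A(2) o[unfolded Phi_simps]] by blast
  then have "F = K" using Phi_map_faithful[OF A(2) cofunctor_raw[OF F(1)] K] by simp
  then show ?thesis using F by simp
qed

lemma Phi_map_is_over_map:
  "partite_cofunctor C A B F \<Longrightarrow> is_over_map C (fob (Phi C) A) (fob (Phi C) B) (Phi_map C A F)"
  using cofun_over.Phi_map_over[OF cofunctorD(3)] by (simp add: Phi_simps)

lemma id_cofunctor:
  assumes A: "partite_category C A" "source_etale C A"
  shows "partite_cofunctor C A A (id_cofun C A)"
proof -
  note i = id_cofun_Phi[OF pcat_overI[OF A(1)]]
  show ?thesis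
    by (rule cofunctor_of_over_map[OF A A(1) i(1)])
      (use over_map_id[OF Phi_obj(2)[OF A(1), unfolded Phi_simps]] i(2) in \<open>simp add: Phi_simps\<close>)
qed

lemma comp_cofunctor:
  assumes F: "partite_cofunctor C A B F" and G: "partite_cofunctor C B D G" and A: "source_etale C A"
  shows "partite_cofunctor C A D (comp_cofun C A B G F)"
proof -
  note f = cofunctorD[OF F] and g = cofunctorD[OF G]
  note c = comp_cofun_Phi[OF F G]
  have "is_over_map C (fob (Phi C) A) (fob (Phi C) D) (Phi_map C A (comp_cofun C A B G F))"
    unfolding c(2) Phi_simps
    by (rule over_map_comp)
      (use Phi_obj(2)[OF f(1)] Phi_obj(2)[OF f(2)] Phi_obj(2)[OF g(2)] Phi_map_is_over_map[OF F] Phi_map_is_over_map[OF G]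
        in \<open>simp_all add: Phi_simps\<close>)
  then show ?thesis by (rule cofunctor_of_over_map[OF f(1) A g(2) c(1)])
qed

lemma peCat_cmp:
  assumes "f \<in> arrs (peCat C)" "g \<in> arrs (peCat C)" "trg f = src g"
  shows "g \<cdot>\<^bsub>peCat C\<^esub> f \<in> arrs (peCat C)" "src (g \<cdot>\<^bsub>peCat C\<^esub> f) = src f" "trg (g \<cdot>\<^bsub>peCat C\<^esub> f) = trg g"
    "far (Phi C) (g \<cdot>\<^bsub>peCat C\<^esub> f) = far (Phi C) g \<cdot>\<^bsub>rCat_over C\<^esub> far (Phi C) f"
proof -
  have F: "partite_cofunctor C (src f) (src g) (lab f)" and G: "partite_cofunctor C (src g) (trg g) (lab g)"
    and s: "source_etale C (src f)" "source_etale C (trg g)"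
    using assms by (auto simp: arrs_peCat)
  show "g \<cdot>\<^bsub>peCat C\<^esub> f \<in> arrs (peCat C)"
    using comp_cofunctor[OF F G s(1)] s assms(3) by (simp add: arrs_peCat peCat_ops)
  show "src (g \<cdot>\<^bsub>peCat C\<^esub> f) = src f" "trg (g \<cdot>\<^bsub>peCat C\<^esub> f) = trg g" by (simp_all add: peCat_ops)
  show "far (Phi C) (g \<cdot>\<^bsub>peCat C\<^esub> f) = far (Phi C) g \<cdot>\<^bsub>rCat_over C\<^esub> far (Phi C) f"
    using comp_cofun_Phi(2)[OF F G] assms(3) by (simp add: peCat_ops Phi_simps rCat_over_ops)
qed

lemma peCat_idn:
  assumes "A \<in> obj (peCat C)"
  shows "idn (peCat C) A \<in> arrs (peCat C)" "src (idn (peCat C) A) = A" "trg (idn (peCat C) A) = A"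
    "far (Phi C) (idn (peCat C) A) = idn (rCat_over C) (fob (Phi C) A)"
proof -
  have A: "partite_category C A" "source_etale C A" using assms by (auto simp: obj_peCat)
  show "idn (peCat C) A \<in> arrs (peCat C)" "src (idn (peCat C) A) = A" "trg (idn (peCat C) A) = A"
    using id_cofunctor[OF A] A by (auto simp: arrs_peCat peCat_ops)
  show "far (Phi C) (idn (peCat C) A) = idn (rCat_over C) (fob (Phi C) A)"
    using id_cofun_Phi(2)[OF pcat_overI[OF A(1)]] by (simp add: peCat_ops Phi_simps rCat_over_ops)
qed

lemma Phi_far:
  assumes "f \<in> arrs (peCat C)"
  shows "far (Phi C) f \<in> arrs (rCat_over C)" "src (far (Phi C) f) = fob (Phi C) (src f)"
    "trg (far (Phi C) f) = fob (Phi C) (trg f)" "far (Phi C) f \<in> arrs (jrCat_h C)"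
proof -
  have F: "partite_cofunctor C (src f) (trg f) (lab f)" using assms by (simp add: arrs_peCat)
  show 1: "src (far (Phi C) f) = fob (Phi C) (src f)" "trg (far (Phi C) f) = fob (Phi C) (trg f)"
    by (simp_all add: Phi_simps(2))
  show 2: "far (Phi C) f \<in> arrs (rCat_over C)"
    using Phi_map_is_over_map[OF F] Phi_obj(2)[OF cofunctorD(1)[OF F]] Phi_obj(2)[OF cofunctorD(2)[OF F]]
    by (simp add: arrs_rCat_over Phi_simps(2))
  show "far (Phi C) f \<in> arrs (jrCat_h C)"
    using 1 2 Phi_obj(1)[OF cofunctorD(1)[OF F]] Phi_obj(1)[OF cofunctorD(2)[OF F]] by (simp add: arrs_jrCat)
qed

lemma Phi_faithful:
  assumes "f \<in> arrs (peCat C)" "g \<in> arrs (peCat C)" "src f = src g" "trg f = trg g" "far (Phi C) f = far (Phi C) g"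
  shows "f = g"
proof -
  have F: "partite_cofunctor C (src f) (trg f) (lab f)" and G: "partite_cofunctor C (src f) (trg f) (lab g)"
    and s: "source_etale C (src f)" using assms by (auto simp: arrs_peCat)
  interpret pcat_pair C "src f" "trg f" by (rule pcat_pairI[OF cofunctorD(1,2)[OF F]])
  have "lab f = lab g"
    using Phi_map_faithful[OF s cofunctor_raw[OF F] cofunctor_raw[OF G]] assms(3,5) by (simp add: Phi_simps)
  then show ?thesis using assms(3,4) by (intro arr_eqI) auto
qed

lemma category_peCat: "category (peCat C :: (('i, 'o, 'u) pcat, ('i, 'o, 'u) cofun) cat)"
proof -
  let ?D = "peCat C :: (('i, 'o, 'u) pcat, ('i, 'o, 'u) cofun) cat"
  interpret R: category "rCat_over C :: (('i, 'o, 'u) over, ('i, 'o, 'u) over_map) cat"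
    by (rule category_rCat_over)
  have ob: "src f \<in> obj ?D" "trg f \<in> obj ?D" if "f \<in> arrs ?D" for f
    using that cofunctorD(1,2)[of "src f" "trg f" "lab f"] by (auto simp: arrs_peCat obj_peCat)
  show ?thesis
  proof
    show "src f \<in> obj ?D" "trg f \<in> obj ?D" if "f \<in> arrs ?D" for f using ob[OF that] .
    show "idn ?D A \<in> hom ?D A A" if "A \<in> obj ?D" for A using peCat_idn[OF that] by simp
    show "g \<cdot>\<^bsub>?D\<^esub> f \<in> hom ?D X Z" if "f \<in> hom ?D X Y" "g \<in> hom ?D Y Z" for f g X Y Z
      using peCat_cmp[of f g] that by simp
    show "idn ?D Y \<cdot>\<^bsub>?D\<^esub> f = f" if "f \<in> hom ?D X Y" for f X Y
    proof -
      have f: "f \<in> arrs ?D" "src f = X" "trg f = Y" using that by auto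
      have Y: "Y \<in> obj ?D" using ob[OF f(1)] f by simp
      have t: "trg f = src (idn ?D Y)" using f(3) peCat_idn(2)[OF Y] by simp
      note i = peCat_idn[OF Y] and F = Phi_far[OF f(1)]
      note c = peCat_cmp[OF f(1) i(1) t]
      show ?thesis
        by (rule Phi_faithful[OF c(1) f(1)]) (use c i f F in auto)
    qed
    show "f \<cdot>\<^bsub>?D\<^esub> idn ?D X = f" if "f \<in> hom ?D X Y" for f X Y
    proof -
      have f: "f \<in> arrs ?D" "src f = X" "trg f = Y" using that by auto
      have X: "X \<in> obj ?D" using ob[OF f(1)] f by simp
      have t: "trg (idn ?D X) = src f" using f(2) peCat_idn(3)[OF X] by simp
      note i = peCat_idn[OF X] and F = Phi_far[OF f(1)]
      note c = peCat_cmp[OF i(1) f(1) t]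
      show ?thesis
        by (rule Phi_faithful[OF c(1) f(1)]) (use c i f F in auto)
    qed
    show "h \<cdot>\<^bsub>?D\<^esub> g \<cdot>\<^bsub>?D\<^esub> f = h \<cdot>\<^bsub>?D\<^esub> (g \<cdot>\<^bsub>?D\<^esub> f)"
      if "f \<in> hom ?D W X" "g \<in> hom ?D X Y" "h \<in> hom ?D Y Z" for f g h W X Y Z
    proof -
      have f: "f \<in> arrs ?D" "src f = W" "trg f = X" and g: "g \<in> arrs ?D" "src g = X" "trg g = Y"
        and h: "h \<in> arrs ?D" "src h = Y" "trg h = Z" using that by auto
      have t: "trg f = src g" "trg g = src h" using f g h by auto
      note gf = peCat_cmp[OF f(1) g(1) t(1)] and hg = peCat_cmp[OF g(1) h(1) t(2)]
      have t2: "trg f = src (h \<cdot>\<^bsub>?D\<^esub> g)" "trg (g \<cdot>\<^bsub>?D\<^esub> f) = src h" using gf hg t by auto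
      note l = peCat_cmp[OF f(1) hg(1) t2(1)] and r = peCat_cmp[OF gf(1) h(1) t2(2)]
      note Ff = Phi_far[OF f(1)] and Fg = Phi_far[OF g(1)] and Fh = Phi_far[OF h(1)]
      show ?thesis
        by (rule Phi_faithful[OF l(1) r(1)]) (use l r gf hg f g h Ff Fg Fh in auto)
    qed
  qed
qed

lemma category_jrCat: "category (jrCat_h C :: (('i, 'o, 'u) over, ('i, 'o, 'u) over_map) cat)"
  unfolding jrCat_h_def by (rule category_full_subcat[OF category_rCat_over])

lemma Phi_full:
  assumes A: "A \<in> obj (peCat C)" and B: "B \<in> obj (peCat C)"
    and h: "h \<in> hom (jrCat_h C) (fob (Phi C) A) (fob (Phi C) B)"
  shows "\<exists>f \<in> hom (peCat C) A B. far (Phi C) f = h"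
proof -
  have A': "partite_category C A" "source_etale C A" and B': "partite_category C B" "source_etale C B"
    using A B by (auto simp: obj_peCat)
  have h': "h \<in> arrs (rCat_over C)" "src h = fob (Phi C) A" "trg h = fob (Phi C) B" using h by (auto simp: arrs_jrCat)
  interpret pcat_pair C A B by (rule pcat_pairI[OF A'(1) B'(1)])
  obtain F where F: "partite_cofunctor C A B F" "Phi_map C A F = lab h"
    using Phi_map_full[OF A'(2), of "lab h"] h' by (auto simp: arrs_rCat_over Phi_simps)
  have "far (Phi C) (Arr A B F) = h" using F(2) h' by (intro arr_eqI) (auto simp: Phi_simps)
  then show ?thesis using F A' B' by (intro bexI[of _ "Arr A B F"]) (auto simp: arrs_peCat)
qed

lemma hyper_overI:
  assumes "(A, P) \<in> obj (jrCat_h C)"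
  shows "hyper_over C A P"
  using assms glueing_category_axioms
  by (simp add: obj_jrCat is_over_def hyper_over_def hyper_over_axioms_def)

lemma Psi_obj:
  assumes "X \<in> obj (jrCat_h C)"
  shows "fob (Psi C) X \<in> obj (peCat C)"
proof -
  obtain A P where X: "X = (A, P)" by (cases X)
  interpret hyper_over C A P by (rule hyper_overI) (use assms X in simp)
  show ?thesis using Psi_partite Psi_source_etale by (simp add: X Psi_def obj_peCat)
qed

lemma unit_props:
  assumes X: "X \<in> obj (jrCat_h C)"
  shows "unit_arr C X \<in> hom (jrCat_h C) X (fob (Phi C) (fob (Psi C) X))" "is_iso (jrCat_h C) (unit_arr C X)"
proof -
  obtain A P where XA: "X = (A, P)" by (cases X)
  interpret hyper_over C A P by (rule hyper_overI) (use assms XA in simp)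
  let ?Y = "fob (Phi C) (Psi_ob C X)"
  have Y: "?Y \<in> obj (jrCat_h C)" "is_over C ?Y" using Phi_obj[OF Psi_partite] by (auto simp: XA)
  have o: "is_over C X" using X by (auto simp: XA obj_jrCat)
  have st: "src (unit_arr C X) = X" "trg (unit_arr C X) = ?Y" by (simp_all add: unit_arr_def)
  have u: "unit_arr C X \<in> arrs (jrCat_h C)"
    using X Y o unit_over_map(1) st by (simp add: arrs_jrCat arrs_rCat_over XA)
  then show "unit_arr C X \<in> hom (jrCat_h C) X (fob (Phi C) (fob (Psi C) X))"
    using st by (simp add: Psi_def)
  obtain h where h: "is_over_map C ?Y X h" "comp_over C X h (lab (unit_arr C X)) = id_over C X"
    "comp_over C ?Y (lab (unit_arr C X)) h = id_over C ?Y"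
    using unit_over_map(2) XA by blast
  show "is_iso (jrCat_h C) (unit_arr C X)"
    unfolding is_iso_def
    by (intro conjI u bexI[of _ "Arr ?Y X h"])
      (use h st X Y o in \<open>auto simp: arrs_jrCat arrs_rCat_over rCat_over_ops\<close>)
qed

text \<open>The arrow part of \<Psi> is a definite description. Existence: fullness lifts the
  conjugate of \<open>h\<close> by the units. Uniqueness: the unit at the source cancels on the
  right, and \<Phi> is faithful.\<close>

lemma Psi_far:
  assumes h: "h \<in> arrs (jrCat_h C)"
  shows "far (Psi C) h \<in> hom (peCat C) (fob (Psi C) (src h)) (fob (Psi C) (trg h))"
    "far (Phi C) (far (Psi C) h) \<cdot>\<^bsub>jrCat_h C\<^esub> unit_arr C (src h) = unit_arr C (trg h) \<cdot>\<^bsub>jrCat_h C\<^esub> h"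
proof -
  interpret E: category "jrCat_h C" by (rule category_jrCat)
  have o: "src h \<in> obj (jrCat_h C)" "trg h \<in> obj (jrCat_h C)" using h by simp_all
  let ?X = "src h" and ?Y = "trg h"
  let ?LX = "fob (Psi C) ?X" and ?LY = "fob (Psi C) ?Y"
  note uX = unit_props[OF o(1)] and uY = unit_props[OF o(2)]
  note LX = Psi_obj[OF o(1)] and LY = Psi_obj[OF o(2)]
  have eX: "unit_arr C ?X \<in> arrs (jrCat_h C)" "src (unit_arr C ?X) = ?X" "trg (unit_arr C ?X) = fob (Phi C) ?LX"
    and eY: "unit_arr C ?Y \<in> arrs (jrCat_h C)" "src (unit_arr C ?Y) = ?Y" "trg (unit_arr C ?Y) = fob (Phi C) ?LY"
    using uX(1) uY(1) by auto
  obtain v where v: "v \<in> arrs (jrCat_h C)" "src v = fob (Phi C) ?LX" "trg v = ?X"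
    "v \<cdot>\<^bsub>jrCat_h C\<^esub> unit_arr C ?X = idn (jrCat_h C) ?X" "unit_arr C ?X \<cdot>\<^bsub>jrCat_h C\<^esub> v = idn (jrCat_h C) (fob (Phi C) ?LX)"
    using uX(2) eX unfolding is_iso_def by auto
  let ?k = "unit_arr C ?Y \<cdot>\<^bsub>jrCat_h C\<^esub> (h \<cdot>\<^bsub>jrCat_h C\<^esub> v)"
  have k: "?k \<in> hom (jrCat_h C) (fob (Phi C) ?LX) (fob (Phi C) ?LY)"
    using eY v h by (simp del: jrCat_ops)
  obtain G where G: "G \<in> hom (peCat C) ?LX ?LY" "far (Phi C) G = ?k"
    using Phi_full[OF LX LY k] by blast
  have GG: "far (Phi C) G \<cdot>\<^bsub>jrCat_h C\<^esub> unit_arr C ?X = unit_arr C ?Y \<cdot>\<^bsub>jrCat_h C\<^esub> h"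
    unfolding G(2) using eX eY v h by (simp del: jrCat_ops)
  have Ps: "fob (Psi C) = Psi_ob C" by (simp add: Psi_def)
  have "(THE G. G \<in> hom (pCat C) (Psi_ob C ?X) (Psi_ob C ?Y) \<and>
      far (Phi C) G \<cdot>\<^bsub>rCat_over C\<^esub> unit_arr C ?X = unit_arr C ?Y \<cdot>\<^bsub>rCat_over C\<^esub> h) = G"
  proof (rule the_equality)
    show "G \<in> hom (pCat C) (Psi_ob C ?X) (Psi_ob C ?Y) \<and>
      far (Phi C) G \<cdot>\<^bsub>rCat_over C\<^esub> unit_arr C ?X = unit_arr C ?Y \<cdot>\<^bsub>rCat_over C\<^esub> h"
      using G(1) GG by (auto simp: arrs_peCat arrs_pCat Ps)
    fix G' assume G': "G' \<in> hom (pCat C) (Psi_ob C ?X) (Psi_ob C ?Y) \<and>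
      far (Phi C) G' \<cdot>\<^bsub>rCat_over C\<^esub> unit_arr C ?X = unit_arr C ?Y \<cdot>\<^bsub>rCat_over C\<^esub> h"
    \<comment> \<open>The description ranges over arrows of \<open>pCat\<close>; between glued
      objects, which are source-etale, these are arrows of \<open>peCat\<close>.\<close>
    have g: "G' \<in> arrs (peCat C)" "src G' = ?LX" "trg G' = ?LY"
      using G' LX LY by (auto simp: arrs_peCat arrs_pCat obj_peCat Ps)
    have g0: "G \<in> arrs (peCat C)" "src G = ?LX" "trg G = ?LY" using G(1) by auto
    note F = Phi_far[OF g(1)] and F0 = Phi_far[OF g0(1)]
    have eq: "far (Phi C) G' \<cdot>\<^bsub>jrCat_h C\<^esub> unit_arr C ?X = far (Phi C) G \<cdot>\<^bsub>jrCat_h C\<^esub> unit_arr C ?X"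
      using G' GG by simp
    have "far (Phi C) G' \<cdot>\<^bsub>jrCat_h C\<^esub> unit_arr C ?X \<cdot>\<^bsub>jrCat_h C\<^esub> v = far (Phi C) G \<cdot>\<^bsub>jrCat_h C\<^esub> unit_arr C ?X \<cdot>\<^bsub>jrCat_h C\<^esub> v"
      using eq by simp
    then have "far (Phi C) G' = far (Phi C) G"
      using F F0 g g0 eX v by (simp del: jrCat_ops)
    then show "G' = G" using Phi_faithful[OF g(1) g0(1)] g g0 by simp
  qed
  then have "far (Psi C) h = G" by (simp add: Psi_def)
  then show "far (Psi C) h \<in> hom (peCat C) ?LX ?LY"
    "far (Phi C) (far (Psi C) h) \<cdot>\<^bsub>jrCat_h C\<^esub> unit_arr C (src h) = unit_arr C (trg h) \<cdot>\<^bsub>jrCat_h C\<^esub> h"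
    using G(1) GG by auto
qed

lemma Phi_Psi_equivalence_data:
  "equivalence_data (peCat C :: (('i, 'o, 'u) pcat, ('i, 'o, 'u) cofun) cat) (jrCat_h C) (Phi C) (Psi C) (unit_arr C)"
proof (intro equivalence_data.intro equivalence_data_axioms.intro)
  let ?D = "peCat C :: (('i, 'o, 'u) pcat, ('i, 'o, 'u) cofun) cat"
  show "category ?D" by (rule category_peCat)
  show "category (jrCat_h C)" by (rule category_jrCat)
  show "is_functor ?D (jrCat_h C) (Phi C)"
  proof (intro is_functor.intro is_functor_axioms.intro)
    show "category ?D" by (rule category_peCat)
    show "category (jrCat_h C)" by (rule category_jrCat)
    show "fob (Phi C) X \<in> obj (jrCat_h C)" if "X \<in> obj ?D" for X
      using Phi_obj(1)[of X] that by (simp add: obj_peCat)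
    show "far (Phi C) f \<in> hom (jrCat_h C) (fob (Phi C) X) (fob (Phi C) Y)" if "f \<in> hom ?D X Y" for f X Y
      using Phi_far[of f] that by simp
    show "far (Phi C) (idn ?D X) = idn (jrCat_h C) (fob (Phi C) X)" if "X \<in> obj ?D" for X
      using peCat_idn(4)[OF that] by simp
    show "far (Phi C) (g \<cdot>\<^bsub>?D\<^esub> f) = far (Phi C) g \<cdot>\<^bsub>jrCat_h C\<^esub> far (Phi C) f"
      if "f \<in> hom ?D X Y" "g \<in> hom ?D Y Z" for f g X Y Z
      using peCat_cmp(4)[of f g] that by simp
  qed
  show "\<exists>f \<in> hom ?D X Y. far (Phi C) f = h"
    if "X \<in> obj ?D" "Y \<in> obj ?D" "h \<in> hom (jrCat_h C) (fob (Phi C) X) (fob (Phi C) Y)" for X Y h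
    by (rule Phi_full[OF that])
  show "f = g" if "f \<in> hom ?D X Y" "g \<in> hom ?D X Y" "far (Phi C) f = far (Phi C) g" for f g X Y
    using Phi_faithful[of f g] that by simp
  show "fob (Psi C) Z \<in> obj ?D" if "Z \<in> obj (jrCat_h C)" for Z by (rule Psi_obj[OF that])
  show "unit_arr C Z \<in> hom (jrCat_h C) Z (fob (Phi C) (fob (Psi C) Z))" "is_iso (jrCat_h C) (unit_arr C Z)"
    if "Z \<in> obj (jrCat_h C)" for Z using unit_props[OF that] .
  show "far (Psi C) h \<in> hom ?D (fob (Psi C) (src h)) (fob (Psi C) (trg h))"
    "far (Phi C) (far (Psi C) h) \<cdot>\<^bsub>jrCat_h C\<^esub> unit_arr C (src h) = unit_arr C (trg h) \<cdot>\<^bsub>jrCat_h C\<^esub> h"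
    if "h \<in> arrs (jrCat_h C)" for h using Psi_far[OF that] .
qed

end

section \<open>Etale groupoids\<close>

text \<open>Converse to \<open>partial_inverse_section\<close>: inside one of its own slices a
  section becomes a partial isomorphism, inverse to \<open>q\<close> on that slice.\<close>

lemma (in restriction_category) slice_inverse:
  assumes s: "s \<in> psections C q" and q: "total C q" and e: "e \<in> rids C (src q)" and se: "s \<cdot> (q \<cdot> e) = e"
  shows "partial_inverse C (e \<cdot> s) (q \<cdot> e)"
proof -
  note s' = psectionsD[OF s] and e' = ridsD[OF e] and q' = total_arr[OF q]
  note sl = slice_section[OF s s q'(1) e se]
  have "q \<cdot> (e \<cdot> s) = rst C s \<cdot> rst C (e \<cdot> s)"
    using arg_cong[OF sl(2), of "\<lambda>x. q \<cdot> x"] reassoc[OF s'(4), of "rst C (e \<cdot> s)"] s' e' q' by simp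
  also have "\<dots> = rst C (e \<cdot> s)" using rst_cmp_le(2)[of s e] s' e' by simp
  finally have 1: "q \<cdot> (e \<cdot> s) = rst C (e \<cdot> s)" .
  have "rst C (q \<cdot> e) = e" using total_cmp_rst[of e q] q e' by simp
  moreover have "q \<cdot> e \<cdot> (e \<cdot> s) = q \<cdot> (e \<cdot> s)" using reassoc[OF e'(5), of s] s' e' q' by simp
  ultimately show ?thesis using 1 se s' e' q' by (simp add: partial_inverse_def)
qed

section \<open>Sections of an etale groupoid form an etale category\<close>

context pcat_over
begin

text \<open>Two slices are needed for each piece. The slice \<open>e1\<close> of the source map
  makes the section invertible onto its image. The slice \<open>e2\<close> is one of the source map
  for the opposite pair; it serves the target map, which is that source map after inversion. Where
  the section lies in \<open>e1\<close> and its inverse in \<open>e2\<close>, the target of the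
  section is a composite of partial isomorphisms of \<open>C\<close>.\<close>

lemma Phi_etale:
  assumes se: "source_etale C A" and gpd: "partite_groupoid C A"
  shows "etale_category (Phi_cat C A)"
  unfolding etale_category_def
proof (intro conjI ballI Phi_join_restriction)
  fix x assume x: "x \<in> arrs (Phi_cat C A)"
  obtain \<iota> where \<iota>: "\<And>i j. i \<in> idx A \<Longrightarrow> j \<in> idx A \<Longrightarrow>
      \<iota> i j \<in> hom C (ob1 A i j) (ob1 A j i) \<and> total C (\<iota> i j) \<and> \<iota> i j \<cdot> \<iota> j i = idn C (ob1 A j i) \<and>
      sig A j i \<cdot> \<iota> i j = tau A i j \<and>
      mu A i j i \<cdot> pair C (sig A j i) (tau A i j) (\<iota> i j) (idn C (ob1 A i j)) = eta A i \<cdot> sig A i j"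
    using gpd unfolding partite_groupoid_def by blast
  have io: "\<iota> i j \<in> arrs C" "src (\<iota> i j) = ob1 A i j" "trg (\<iota> i j) = ob1 A j i" "total C (\<iota> i j)"
    "\<iota> i j \<cdot> \<iota> j i = idn C (ob1 A j i)" "sig A j i \<cdot> \<iota> i j = tau A i j" if "i \<in> idx A" "j \<in> idx A" for i j
    using \<iota>[OF that] by auto
  \<comment> \<open>The inverse law, specialised from the universal arrow to an arbitrary element
    \<open>y\<close>.\<close>
  have gi: "elem_mult C A i j i (\<iota> i j \<cdot> y) y = eta A i \<cdot> (sig A i j \<cdot> y)"
    if i: "i \<in> idx A" "j \<in> idx A" and y: "y \<in> arrs C" "trg y = ob1 A i j" for i j y
  proof -
    have sq: "sig A j i \<cdot> \<iota> i j = tau A i j \<cdot> idn C (ob1 A i j)" using io[OF i] i by simp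
    have "elem_mult C A i j i (\<iota> i j) (idn C (ob1 A i j)) \<cdot> y = elem_mult C A i j i (\<iota> i j \<cdot> y) (idn C (ob1 A i j) \<cdot> y)"
      by (rule elem_mult_props(7)[OF i i(1) _ _ _ _ _ sq]) (use io[OF i] i y in auto)
    moreover have "elem_mult C A i j i (\<iota> i j) (idn C (ob1 A i j)) = eta A i \<cdot> sig A i j"
      using \<iota>[OF i] by (simp add: elem_mult_def)
    ultimately show ?thesis using i y by simp
  qed
  define i where "i = src x"
  define j where "j = trg x"
  define s where "s = the_sec A x"
  note xs = Phi_sec[OF x, folded i_def j_def s_def]
  have ij: "i \<in> idx A" "j \<in> idx A" using xs by auto
  have sc: "section_cover C (sig A i j) (sec i j) (\<lambda>s. s)" "section_cover C (sig A j i) (sec j i) (\<lambda>s. s)"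
    using local_homeo_section_cover se ij by (auto simp: source_etale_def)
  note i1 = io[OF ij] and i2 = io[OF ij(2,1)]
  \<comment> \<open>The source law for the opposite pair, composed with \<open>\<iota> i j\<close>;
    the two inversions cancel.\<close>
  have ti: "tau A j i \<cdot> \<iota> i j = sig A i j"
    using reassoc[OF i2(6), of "\<iota> i j"] i1 i2 ij by simp
  define Dset where "Dset = {d \<in> rids C (ob0 A i). rle C d (rst C s) \<and> partial_iso (Phi_cat C A) (sec_arr i j (s \<cdot> d))}"
  have is_t: "\<iota> i j \<cdot> s \<in> arrs C" "src (\<iota> i j \<cdot> s) = ob0 A i" "trg (\<iota> i j \<cdot> s) = ob1 A j i" "rst C (\<iota> i j \<cdot> s) = rst C s"
    using i1 xs total_cmp_rst[of s "\<iota> i j"] by auto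
  have piece: "rst C (e1 \<cdot> s) \<cdot> rst C (e2 \<cdot> (\<iota> i j \<cdot> s)) \<in> Dset"
    if e1: "e1 \<in> rids C (ob1 A i j)" and r1: "r1 \<in> sec i j" "r1 \<cdot> (sig A i j \<cdot> e1) = e1"
      and e2: "e2 \<in> rids C (ob1 A j i)" and r2: "r2 \<in> sec j i" "r2 \<cdot> (sig A j i \<cdot> e2) = e2" for e1 r1 e2 r2
  proof -
    note e1' = ridsD[OF e1] and e2' = ridsD[OF e2] and r1' = secD[OF r1(1) ij]
    define a where "a = rst C (e1 \<cdot> s)"
    define b where "b = rst C (e2 \<cdot> (\<iota> i j \<cdot> s))"
    have a: "a \<in> rids C (ob0 A i)" using xs e1' by (simp add: a_def)
    have b: "b \<in> rids C (ob0 A i)" using is_t(1-3) e2' unfolding b_def by (intro rst_in_rids) simp_all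
    note a' = ridsD[OF a] and b' = ridsD[OF b]
    define d where "d = a \<cdot> b"
    have d: "d \<in> rids C (ob0 A i)" using a b by (simp add: d_def)
    note d' = ridsD[OF d]
    have ad: "a \<cdot> d = d" using reassoc[OF a'(5), of b] a' b' by (simp add: d_def)
    have bd: "b \<cdot> d = d" using reassoc[OF b'(5), of a] a' b' rids_comm[OF a b] by (simp add: d_def)
    have ra: "rst C s \<cdot> a = a" using rst_cmp_le(2)[of s e1] xs e1' by (simp add: a_def)
    have rd: "rst C s \<cdot> d = d" using reassoc[OF ra, of b] xs a' b' by (simp add: d_def)
    define s1 where "s1 = s \<cdot> d"
    have s1s: "s1 \<in> sec i j" using psections_restrict[OF xs(3), of d] d ij by (simp add: s1_def)
    note s1 = secD[OF s1s ij]
    have rs1: "rst C s1 = d" using rst_cmp_rid[of s d] xs d rd by (simp add: s1_def)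
    have es: "e1 \<cdot> s = s \<cdot> a" using rid_slide[OF e1, of s] xs by (simp add: a_def)
    have es1: "e1 \<cdot> s1 = s1" using reassoc[OF es, of d] ad xs e1' a' d' by (simp add: s1_def)
    have eis: "e2 \<cdot> (\<iota> i j \<cdot> s) = (\<iota> i j \<cdot> s) \<cdot> b" using rid_slide[OF e2, of "\<iota> i j \<cdot> s"] is_t by (simp add: b_def)
    have "e2 \<cdot> ((\<iota> i j \<cdot> s) \<cdot> d) = (\<iota> i j \<cdot> s) \<cdot> (b \<cdot> d)"
      using reassoc[OF eis, of d] is_t e2' b' d' xs i1 by simp
    then have eis1: "e2 \<cdot> (\<iota> i j \<cdot> s1) = \<iota> i j \<cdot> s1" using bd xs i1 d' by (simp add: s1_def)
    have "e1 \<cdot> s1 = r1 \<cdot> (sig A i j \<cdot> (e1 \<cdot> s1))" using reassoc[OF r1(2), of s1] r1' e1' s1 ij by simp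
    then have "s1 = r1 \<cdot> d" using es1 s1(4) rs1 by simp
    then have s1e: "s1 = e1 \<cdot> r1 \<cdot> d" using es1 r1' e1' d' by simp
    define v where "v = tau A i j \<cdot> s1"
    have v: "v \<in> arrs C" "src v = ob0 A i" "trg v = ob0 A j" using s1 ij by (auto simp: v_def)
    have rv: "rst C v = d" using tau_rst[of s1 i j] s1 ij rs1 by (simp add: v_def)
    have vi: "v = sig A j i \<cdot> (\<iota> i j \<cdot> s1)" using reassoc[OF i1(6), of s1] i1 s1 ij by (simp add: v_def)
    \<comment> \<open>Now \<open>v\<close> is a composite of partial isomorphisms:
      \<open>e1 \<cdot> r1\<close> and \<open>sig A j i \<cdot> e2\<close> by
      \<open>slice_inverse\<close>, the idempotent \<open>d\<close>, and the invertible
      \<open>\<iota> i j\<close>.\<close>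
    then have ve: "v = sig A j i \<cdot> e2 \<cdot> (\<iota> i j \<cdot> (e1 \<cdot> r1 \<cdot> d))"
      using eis1 s1e i1 s1 e2' ij by simp
    have io_inv: "partial_inverse C (\<iota> i j) (\<iota> j i)"
      using i1 i2 total_arr(2)[OF i1(4)] total_arr(2)[OF i2(4)] by (simp add: partial_inverse_def)
    have "partial_inverse C (e1 \<cdot> r1 \<cdot> d) (d \<cdot> (sig A i j \<cdot> e1))"
      by (rule partial_inverse_cmp[OF partial_inverse_rid[OF d] slice_inverse[OF r1(1) sig_total[OF ij] _ r1(2)]])
        (use e1 r1' e1' d' ij in auto)
    then have "partial_inverse C (\<iota> i j \<cdot> (e1 \<cdot> r1 \<cdot> d)) (d \<cdot> (sig A i j \<cdot> e1) \<cdot> \<iota> j i)"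
      by (rule partial_inverse_cmp[OF _ io_inv]) (use i1 r1' e1' d' in auto)
    moreover have "partial_inverse C (sig A j i \<cdot> e2) (e2 \<cdot> r2)"
      by (rule partial_inverse_sym[OF slice_inverse[OF r2(1) sig_total[OF ij(2,1)] _ r2(2)]]) (use e2 ij in simp)
    ultimately have "partial_inverse C (sig A j i \<cdot> e2 \<cdot> (\<iota> i j \<cdot> (e1 \<cdot> r1 \<cdot> d)))
        ((d \<cdot> (sig A i j \<cdot> e1)) \<cdot> \<iota> j i \<cdot> (e2 \<cdot> r2))"
      by (rule partial_inverse_cmp) (use i1 r1' e1' e2' d' ij in auto)
    then obtain w where w0: "partial_inverse C v w" using ve by blast
    have w: "w \<in> arrs C" "src w = ob0 A j" "trg w = ob0 A i" "w \<cdot> v = d" "v \<cdot> w = rst C w"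
      using w0 v rv by (auto simp: partial_inverse_def)
    have dw: "d \<cdot> w = w" using reassoc[OF w(4), of w] w v by simp
    \<comment> \<open>the partial inverse of \<open>s1\<close> in the category of sections\<close>
    define t1 where "t1 = \<iota> i j \<cdot> (s1 \<cdot> w)"
    have sw: "s1 \<cdot> w \<in> arrs C" "src (s1 \<cdot> w) = ob0 A j" "trg (s1 \<cdot> w) = ob1 A i j" using s1 w by auto
    have tsw: "tau A i j \<cdot> (s1 \<cdot> w) = rst C w" using w(5) s1 w ij by (simp add: v_def)
    have rsw: "rst C (s1 \<cdot> w) = rst C w" using tau_rst[OF sw(1) ij sw(3)] tsw w by simp
    have t1: "t1 \<in> arrs C" "src t1 = ob0 A j" "trg t1 = ob1 A j i" using sw i1 by (auto simp: t1_def)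
    have rt1: "rst C t1 = rst C w" using total_cmp_rst[OF sw(1) i1(4)] sw i1 rsw by (simp add: t1_def)
    have st1: "sig A j i \<cdot> t1 = rst C w"
      using reassoc[OF i1(6), of "s1 \<cdot> w"] i1 sw tsw ij by (simp add: t1_def)
    have t1s: "t1 \<in> sec j i" using t1 rt1 st1 ij by (simp add: psections_def)
    have s1d: "s1 \<cdot> d = s1" using cmp_rst_self[OF s1(1)] rs1 by simp
    have tv: "t1 \<cdot> v = \<iota> i j \<cdot> s1" using w(4) s1d i1 s1 w v by (simp add: t1_def)
    have "rst C (\<iota> i j \<cdot> s1) = d" using total_cmp_rst[of s1 "\<iota> i j"] i1 s1 rs1 by simp
    then have c1: "sec_cmp C A i j i t1 s1 = eta A i \<cdot> rst C s1"
      using sec_cmp_elem_mult(1)[OF ij ij(1) t1s s1(1,3)] tv s1d gi[OF ij s1(1,3)] s1(4) by (simp flip: v_def)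
    have "sig A i j \<cdot> (s1 \<cdot> w) = w" using reassoc[OF s1(4), of w] s1 w dw rs1 ij by simp
    then have tt1: "tau A j i \<cdot> t1 = w"
      using reassoc[OF ti, of "s1 \<cdot> w"] i1 sw ij by (simp add: t1_def)
    have it1: "\<iota> j i \<cdot> t1 = s1 \<cdot> w"
      using reassoc[OF i2(5), of "s1 \<cdot> w"] i1 i2 sw by (simp add: t1_def)
    have t1w: "t1 \<cdot> rst C w = t1" using cmp_rst_self[OF t1(1)] rt1 by simp
    have c2: "sec_cmp C A j i j s1 t1 = eta A j \<cdot> rst C t1"
      using sec_cmp_elem_mult(1)[OF ij(2,1,2) s1s t1(1,3)] tt1 rsw t1w gi[OF ij(2,1) t1(1,3)] it1 st1 rt1 by simp
    let ?X = "sec_arr i j s1" and ?T = "sec_arr j i t1"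
    note X = sec_arr_in_Phi[OF ij s1s] and T = sec_arr_in_Phi[OF ij(2,1) t1s]
    have ts: "the_sec A ?X = s1" "the_sec A ?T = t1" using s1 t1 by auto
    have tr: "trg ?X = src ?T" "trg ?T = src ?X" by auto
    note TX = Phi_cmp[OF X T tr(1)] and XT = Phi_cmp[OF T X tr(2)]
    have "?T \<cdot>\<^bsub>Phi_cat C A\<^esub> ?X = rst (Phi_cat C A) ?X"
      by (rule Phi_eqI) (use TX Phi_rst[OF X] ts c1 in auto)
    moreover have "?X \<cdot>\<^bsub>Phi_cat C A\<^esub> ?T = rst (Phi_cat C A) ?T"
      by (rule Phi_eqI) (use XT Phi_rst[OF T] ts c2 in auto)
    ultimately have "partial_inverse (Phi_cat C A) ?X ?T" using X T by (simp add: partial_inverse_def)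
    then have "partial_iso (Phi_cat C A) (sec_arr i j (s \<cdot> d))" unfolding partial_iso_def s1_def by blast
    moreover have "rle C d (rst C s)" using rle_rids(1)[OF d, of "rst C s"] rd xs by simp
    ultimately show ?thesis using d by (simp add: Dset_def d_def a_def b_def)
  qed
  have Dr: "Dset \<subseteq> rids C (ob0 A i)" by (auto simp: Dset_def)
  obtain k where k: "k \<in> rids C (ob0 A i)" and Jk: "is_join C (ob0 A i) (ob0 A i) Dset k"
    using rids_join_exists[OF Dr] ij by auto
  note k' = ridsD[OF k]
  have kd: "k \<cdot> d = d" if "d \<in> Dset" for d
    using is_joinD(7)[OF Jk that] rle_rids(1)[OF _ k, of d] Dr that by blast
  \<comment> \<open>The good idempotents exhaust the domain of \<open>s\<close>: it is cut by the
    slices that \<open>s\<close> meets and then by those that its inverse meets, and every resulting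
    part belongs to \<open>Dset\<close> by \<open>piece\<close>.\<close>
  have "idn C (ob0 A i) \<cdot> rst C s = k \<cdot> rst C s"
  proof (rule section_cover_pieces[OF sc(1)])
    show "s \<in> arrs C" "trg s = src (sig A i j)" "idn C (ob0 A i) \<in> hom C (src s) (ob0 A i)" "k \<in> hom C (src s) (ob0 A i)"
      using xs k' ij by auto
    fix e1 r1 assume e1: "e1 \<in> rids C (src (sig A i j))" and r1: "r1 \<in> sec i j" "r1 \<cdot> (sig A i j \<cdot> e1) = e1"
    have e1o: "e1 \<in> rids C (ob1 A i j)" using e1 ij by simp
    note e1' = ridsD[OF e1o]
    define a where "a = rst C (e1 \<cdot> s)"
    have a: "a \<in> arrs C" "src a = ob0 A i" "trg a = ob0 A i" using xs e1' by (auto simp: a_def)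
    have "a \<cdot> rst C (\<iota> i j \<cdot> s) = (k \<cdot> a) \<cdot> rst C (\<iota> i j \<cdot> s)"
    proof (rule section_cover_pieces[OF sc(2) is_t(1)])
      show "trg (\<iota> i j \<cdot> s) = src (sig A j i)" "a \<in> hom C (src (\<iota> i j \<cdot> s)) (ob0 A i)" "k \<cdot> a \<in> hom C (src (\<iota> i j \<cdot> s)) (ob0 A i)"
        using is_t a k' ij by auto
      fix e2 r2 assume e2: "e2 \<in> rids C (src (sig A j i))" and r2: "r2 \<in> sec j i" "r2 \<cdot> (sig A j i \<cdot> e2) = e2"
      have e2o: "e2 \<in> rids C (ob1 A j i)" using e2 ij by simp
      note e2' = ridsD[OF e2o]
      have b: "rst C (e2 \<cdot> (\<iota> i j \<cdot> s)) \<in> arrs C" "src (rst C (e2 \<cdot> (\<iota> i j \<cdot> s))) = ob0 A i"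
        "trg (rst C (e2 \<cdot> (\<iota> i j \<cdot> s))) = ob0 A i"
        using rst_types[of "e2 \<cdot> (\<iota> i j \<cdot> s)"] is_t(1-3) e2' by simp_all
      show "a \<cdot> rst C (e2 \<cdot> (\<iota> i j \<cdot> s)) = (k \<cdot> a) \<cdot> rst C (e2 \<cdot> (\<iota> i j \<cdot> s))"
        using kd[OF piece[OF e1o r1 e2o r2]] a b k' by (simp add: a_def)
    qed
    moreover have "a \<cdot> rst C s = a" using rst_cmp_le(1)[of s e1] xs e1' by (simp add: a_def)
    ultimately show "idn C (ob0 A i) \<cdot> rst C (e1 \<cdot> s) = k \<cdot> rst C (e1 \<cdot> s)"
      using is_t(4) a k' xs by (simp flip: a_def)
  qed
  then have ks: "k \<cdot> rst C s = rst C s" using xs by simp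
  have rs: "rst C s \<in> rids C (ob0 A i)" using xs by simp
  have "rle C k (rst C s)"
    by (rule is_join_least[OF Jk]) (use xs in \<open>auto simp: Dset_def\<close>)
  then have "k = rst C s" using ks rle_rids(2)[OF k rs] by simp
  then have "is_join C (ob0 A i) (ob1 A i j) ((\<lambda>d. s \<cdot> d) ` Dset) s"
    using is_join_postcomp[OF Jk, of s] xs by simp
  moreover have "the_sec A ` (\<lambda>d. sec_arr i j (s \<cdot> d)) ` Dset = (\<lambda>d. s \<cdot> d) ` Dset"
    unfolding image_image
    by (rule image_cong[OF refl]) (use xs ij Dr in \<open>auto simp: subset_iff in_rids\<close>)
  moreover have "(\<lambda>d. sec_arr i j (s \<cdot> d)) ` Dset \<subseteq> hom (Phi_cat C A) i j"
    using sec_arr_in_Phi[OF ij psections_restrict[OF xs(3)]] Dr ij by auto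
  ultimately have "is_join (Phi_cat C A) i j ((\<lambda>d. sec_arr i j (s \<cdot> d)) ` Dset) (sec_arr i j s)"
    by (intro Phi_is_joinI(1)[OF ij]) simp_all
  then have "is_join (Phi_cat C A) (src x) (trg x) ((\<lambda>d. sec_arr i j (s \<cdot> d)) ` Dset) x"
    by (simp add: i_def j_def s_def)
  then show "etale_map (Phi_cat C A) x"
    unfolding etale_map_def
    by (intro exI[of _ "(\<lambda>d. sec_arr i j (s \<cdot> d)) ` Dset"]) (auto simp: Dset_def)
qed

end

section \<open>An etale category glues to a groupoid\<close>

context hyper_over
begin

text \<open>Let \<open>k\<close> be the join of the slices belonging to partial isomorphisms. It
  fixes their sections, hence the section of every \<open>f\<close>, because \<open>f\<close> is a
  join of partial isomorphisms whose sections are restrictions of \<open>Sec f\<close>. Since all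
  sections together cover, \<open>k\<close> is the identity.\<close>

lemma partial_iso_section_cover:
  assumes et: "etale_category A" and i: "i \<in> obj A" "j \<in> obj A"
  shows "section_cover C (Sig i j) {f \<in> hom A i j. partial_iso A f} (Psi_sec C (A, P))"
proof -
  note sp = Sig_props[OF i]
  obtain ps where G: "is_glueing C (fob P i) (hom A i j) (agreement C (A, P)) (Sig i j) ps (Psi_sec C (A, P))"
    using Psi_glue[OF i] by blast
  let ?I = "{f \<in> hom A i j. partial_iso A f}"
  define E where "E = {e \<in> rids C (src (Sig i j)). \<exists>f \<in> ?I. Sec f \<cdot> (Sig i j \<cdot> e) = e}"
  have ER: "E \<subseteq> rids C (src (Sig i j))" by (auto simp: E_def)
  obtain k where k: "k \<in> rids C (src (Sig i j))" and Jk: "is_join C (src (Sig i j)) (src (Sig i j)) E k"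
    using rids_join_exists[OF ER sp(5)] by blast
  note k' = ridsD[OF k]
  have kf: "k \<cdot> Sec f = Sec f" if f: "f \<in> ?I" for f
  proof -
    have fh: "f \<in> hom A i j" using f by simp
    note s = Sec_props[OF fh]
    have inv: "partial_inverse C (ps f) (Sec f)" and J: "is_join C (src (Sig i j)) (fob P i) (ps ` hom A i j) (Sig i j)"
      using G fh unfolding is_glueing_def by blast+
    have le: "rle C (ps f) (Sig i j)" using is_joinD(7)[OF J] fh by blast
    have p: "ps f \<in> arrs C" "src (ps f) = src (Sig i j)" "trg (ps f) = fob P i" using le sp by (auto simp: rle_iff)
    have e: "rst C (ps f) \<in> rids C (src (Sig i j))" using p by simp
    have eE: "rst C (ps f) \<in> E" using e partial_inverse_section(2)[OF inv le] f unfolding E_def by blast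
    have "Sec f \<cdot> ps f = rst C (ps f)" "ps f \<cdot> Sec f = rst C (Sec f)" using inv by (auto simp: partial_inverse_def)
    then have es: "rst C (ps f) \<cdot> Sec f = Sec f" using reassoc[of "Sec f" "ps f" "rst C (ps f)" "Sec f"] cmp_rst_self[OF s(2)] p s by simp
    have ke: "k \<cdot> rst C (ps f) = rst C (ps f)" using is_joinD(7)[OF Jk eE] rle_rids(1)[OF e k] by simp
    then show ?thesis using reassoc[OF ke, of "Sec f"] es p s k' by simp
  qed
  have "idn C (src (Sig i j)) = k"
  proof (rule Psi_ext[OF i])
    show "idn C (src (Sig i j)) \<in> hom C (src (Sig i j)) (src (Sig i j))" "k \<in> hom C (src (Sig i j)) (src (Sig i j))"
      using sp k' by auto
    fix f assume f: "f \<in> hom A i j"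
    note s = Sec_props[OF f]
    have f': "f \<in> arrs A" "src f = i" "trg f = j" using f by auto
    have "etale_map A f" using et f' by (simp add: etale_category_def)
    then obtain S where S: "\<forall>g \<in> S. partial_iso A g" and J: "is_join A i j S f"
      unfolding etale_map_def f'(2,3) by blast
    have Sh: "g \<in> hom A i j" if "g \<in> S" for g using A.is_join_sub[OF J] that by blast
    have sr: "rst A ` S \<subseteq> rids A i" using Sh by (intro image_subsetI A.rst_in_rids) auto
    note JP = P_join[OF sr A.is_join_rst[OF J] i(1)]
    have "k \<cdot> Sec f \<cdot> far P (rst A f) = Sec f \<cdot> far P (rst A f)"
    proof (rule join_ext[OF JP])
      show "far P ` rst A ` S \<subseteq> rids C (fob P i)" using sr P_rids by blast
      show "k \<cdot> Sec f \<in> hom C (fob P i) (src (Sig i j))" "Sec f \<in> hom C (fob P i) (src (Sig i j))" using k' s by auto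
      fix e assume "e \<in> far P ` rst A ` S"
      then obtain g where g: "g \<in> S" "e = far P (rst A g)" by blast
      have rg: "rst A g \<in> rids A i" using sr g by blast
      have "Sec f \<cdot> e = Sec g" using Sec_restrict[OF f rg] A.is_joinD(8)[OF J g(1)] g(2) by simp
      moreover have "k \<cdot> Sec g = Sec g" using kf[of g] Sh[OF g(1)] S g(1) by simp
      ultimately show "k \<cdot> Sec f \<cdot> e = Sec f \<cdot> e" using k' s ridsD[OF P_rids[OF rg]] g(2) by simp
    qed
    moreover have "Sec f \<cdot> far P (rst A f) = Sec f" using cmp_rst_self[OF s(2)] s(6) by simp
    ultimately show "idn C (src (Sig i j)) \<cdot> Sec f = k \<cdot> Sec f" using k' s sp f' by simp
  qed
  then have "is_join C (src (Sig i j)) (src (Sig i j)) E (idn C (src (Sig i j)))" using Jk by simp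
  then show ?thesis using sp(2) Sec_props(1) unfolding section_cover_def E_def by auto
qed

lemma Psi_groupoid:
  assumes et: "etale_category A"
  shows "partite_groupoid C (Psi_ob C (A, P))"
proof -
  define I where "I i j = {f \<in> hom A i j. partial_iso A f}" for i j
  define st where "st f = (SOME g. partial_inverse A f g)" for f
  have st: "partial_inverse A f (st f)" if "f \<in> I i j" for f i j
    using that someI_ex[of "partial_inverse A f"] by (auto simp: I_def st_def partial_iso_def)
  have stI: "st f \<in> I j i" "st f \<in> hom A j i" "st f \<cdot>\<^bsub>A\<^esub> f = rst A f" "f \<cdot>\<^bsub>A\<^esub> st f = rst A (st f)" if f: "f \<in> I i j" for f i j
  proof -
    have fh: "f \<in> arrs A" "src f = i" "trg f = j" using f by (auto simp: I_def)
    show 1: "st f \<in> hom A j i" "st f \<cdot>\<^bsub>A\<^esub> f = rst A f" "f \<cdot>\<^bsub>A\<^esub> st f = rst A (st f)"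
      using st[OF f] fh by (auto simp: partial_inverse_def)
    show "st f \<in> I j i" using 1 A.partial_inverse_sym[OF st[OF f]] by (auto simp: I_def partial_iso_def)
  qed
  have stst: "st (st f) = f" if f: "f \<in> I i j" for f i j
    using A.partial_inverse_unique[OF st[OF stI(1)[OF f]] A.partial_inverse_sym[OF st[OF f]]] .
  have Ih: "f \<in> hom A i j" if "f \<in> I i j" for f i j using that by (simp add: I_def)
  have sc: "section_cover C (Sig i j) (I i j) (Psi_sec C (A, P))" if "i \<in> obj A" "j \<in> obj A" for i j
    unfolding I_def by (rule partial_iso_section_cover[OF et that])
  have "\<exists>k. k \<in> hom C (src (Sig i j)) (src (Sig j i)) \<and> (\<forall>f \<in> I i j. k \<cdot> Sec f = Sec (st f) \<cdot> far P f)"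
    if i: "i \<in> obj A" "j \<in> obj A" for i j
  proof -
    have "\<exists>k \<in> hom C (src (Sig i j)) (src (Sig j i)). \<forall>f \<in> I i j. k \<cdot> Sec f = Sec (st f) \<cdot> far P f"
    proof (rule Psi_map_out[OF i _ sc[OF i]])
      show "I i j \<subseteq> hom A i j" using Ih by blast
      show "src (Sig j i) \<in> obj C" using Sig_props[OF i(2,1)] by simp
      fix f assume f: "f \<in> I i j"
      note s = Sec_props[OF stI(2)[OF f]]
      have f': "f \<in> arrs A" "src f = i" "trg f = j" using Ih[OF f] by auto
      show "Sec (st f) \<cdot> far P f \<in> hom C (fob P i) (src (Sig j i))" using s f' by simp
      show "Sec (st f) \<cdot> far P f \<cdot> far P (rst A f) = Sec (st f) \<cdot> far P f"
        using s f' P_cmp[of "rst A f" f] by simp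
      \<comment> \<open>On \<open>e\<close>, the prescribed value is the section of \<open>e\<close>
        after \<open>st f\<close>, taken along the image of \<open>f\<close> restricted to
        \<open>e\<close>. As \<open>e\<close> after \<open>st f\<close> is the unique partial
        inverse of that restriction, the value depends on the restriction alone, which is the
        condition for the lift.\<close>
      have ex: "Sec (st f) \<cdot> far P f \<cdot> far P e = Sec (e \<cdot>\<^bsub>A\<^esub> st f) \<cdot> far P (f \<cdot>\<^bsub>A\<^esub> e) \<and>
          partial_inverse A (f \<cdot>\<^bsub>A\<^esub> e) (e \<cdot>\<^bsub>A\<^esub> st f)" if f: "f \<in> I i j" and e: "e \<in> rids A i" for f e
      proof
        note s = Sec_props[OF stI(2)[OF f]] and e' = A.ridsD[OF e] and stf = stI[OF f]
        have f': "f \<in> arrs A" "src f = i" "trg f = j" using Ih[OF f] by auto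
        have g': "st f \<in> arrs A" "src (st f) = j" "trg (st f) = i" using stf(2) by auto
        show "partial_inverse A (f \<cdot>\<^bsub>A\<^esub> e) (e \<cdot>\<^bsub>A\<^esub> st f)"
          by (rule A.partial_inverse_cmp[OF A.partial_inverse_rid[OF e] st[OF f]]) (use e' f' in simp)
        define r where "r = rst A (e \<cdot>\<^bsub>A\<^esub> st f)"
        have r: "r \<in> rids A j" using e' g' by (simp add: r_def)
        note r' = A.ridsD[OF r]
        have est: "e \<cdot>\<^bsub>A\<^esub> st f = st f \<cdot>\<^bsub>A\<^esub> r" using A.rid_slide[OF e, of "st f"] g' by (simp add: r_def)
        have fe: "f \<cdot>\<^bsub>A\<^esub> e \<in> arrs A" "src (f \<cdot>\<^bsub>A\<^esub> e) = i" "trg (f \<cdot>\<^bsub>A\<^esub> e) = j" using f' e' by auto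
        have "e \<cdot>\<^bsub>A\<^esub> st f \<cdot>\<^bsub>A\<^esub> (f \<cdot>\<^bsub>A\<^esub> e) = e \<cdot>\<^bsub>A\<^esub> (rst A f \<cdot>\<^bsub>A\<^esub> e)"
          using A.reassoc[OF stf(3), of e] f' g' e' by simp
        also have "\<dots> = rst A f \<cdot>\<^bsub>A\<^esub> e"
          using A.rids_comm[OF e, of "rst A f"] A.reassoc[OF e'(5), of "rst A f"] f' e' by simp
        also have "\<dots> = rst A (f \<cdot>\<^bsub>A\<^esub> e)" using A.rst_cmp_rid[of f e] f' e by simp
        finally have "rst A (e \<cdot>\<^bsub>A\<^esub> st f \<cdot>\<^bsub>A\<^esub> (f \<cdot>\<^bsub>A\<^esub> e)) = rst A (f \<cdot>\<^bsub>A\<^esub> e)" using fe by simp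
        then have rfe: "r \<cdot>\<^bsub>A\<^esub> (f \<cdot>\<^bsub>A\<^esub> e) = f \<cdot>\<^bsub>A\<^esub> e"
          using A.rst_slide[of "f \<cdot>\<^bsub>A\<^esub> e" "e \<cdot>\<^bsub>A\<^esub> st f"] A.cmp_rst_self[OF fe(1)] fe g' e' unfolding r_def by simp
        have "Sec (e \<cdot>\<^bsub>A\<^esub> st f) \<cdot> far P (f \<cdot>\<^bsub>A\<^esub> e) = Sec (st f) \<cdot> (far P r \<cdot> far P (f \<cdot>\<^bsub>A\<^esub> e))"
          using Sec_restrict[OF stf(2) r] s r' fe unfolding est by simp
        also have "far P r \<cdot> far P (f \<cdot>\<^bsub>A\<^esub> e) = far P (f \<cdot>\<^bsub>A\<^esub> e)"
          using P_cmp[of "f \<cdot>\<^bsub>A\<^esub> e" r] fe r' rfe by simp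
        also have "Sec (st f) \<cdot> far P (f \<cdot>\<^bsub>A\<^esub> e) = Sec (st f) \<cdot> far P f \<cdot> far P e"
          using P_cmp[of e f] f' e' s by simp
        finally show "Sec (st f) \<cdot> far P f \<cdot> far P e = Sec (e \<cdot>\<^bsub>A\<^esub> st f) \<cdot> far P (f \<cdot>\<^bsub>A\<^esub> e)" by simp
      qed
      fix g e assume g: "g \<in> I i j" and e: "e \<in> rids A i" and eq: "f \<cdot>\<^bsub>A\<^esub> e = g \<cdot>\<^bsub>A\<^esub> e"
      have "e \<cdot>\<^bsub>A\<^esub> st f = e \<cdot>\<^bsub>A\<^esub> st g"
        using A.partial_inverse_unique[of "f \<cdot>\<^bsub>A\<^esub> e"] ex[OF f e] ex[OF g e] eq by simp
      then show "Sec (st f) \<cdot> far P f \<cdot> far P e = Sec (st g) \<cdot> far P g \<cdot> far P e"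
        using ex[OF f e] ex[OF g e] eq by simp
    qed
    then show ?thesis by blast
  qed
  then obtain \<iota> where \<iota>: "\<And>i j. i \<in> obj A \<Longrightarrow> j \<in> obj A \<Longrightarrow>
      \<iota> i j \<in> hom C (src (Sig i j)) (src (Sig j i)) \<and> (\<forall>f \<in> I i j. \<iota> i j \<cdot> Sec f = Sec (st f) \<cdot> far P f)"
    by metis
  have io: "\<iota> i j \<in> arrs C" "src (\<iota> i j) = src (Sig i j)" "trg (\<iota> i j) = src (Sig j i)"
    "\<And>f. f \<in> I i j \<Longrightarrow> \<iota> i j \<cdot> Sec f = Sec (st f) \<cdot> far P f" if "i \<in> obj A" "j \<in> obj A" for i j
    using \<iota>[OF that] by auto
  have "\<iota> i j \<in> hom C (src (Sig i j)) (src (Sig j i)) \<and> total C (\<iota> i j) \<and> \<iota> i j \<cdot> \<iota> j i = idn C (src (Sig j i)) \<and>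
      Sig j i \<cdot> \<iota> i j = Tau i j \<and>
      Mu i j i \<cdot> pair C (Sig j i) (Tau i j) (\<iota> i j) (idn C (src (Sig i j))) = Sec (idn A i) \<cdot> Sig i j"
    if i: "i \<in> obj A" "j \<in> obj A" for i j
  proof (intro conjI)
    note sij = Sig_props[OF i] and sji = Sig_props[OF i(2,1)] and t = Tau_props[OF i]
    note i1 = io[OF i] and i2 = io[OF i(2,1)]
    show "\<iota> i j \<in> hom C (src (Sig i j)) (src (Sig j i))" using i1 by simp
    show "total C (\<iota> i j)"
    proof (rule section_cover_total[OF sc[OF i] i1(1,2)])
      show "rst C (\<iota> i j \<cdot> Sec f) = rst C (Sec f)" if f: "f \<in> I i j" for f
        using i1(4)[OF f] Sec_far_rst[OF Ih[OF f] stI(2)[OF f]] stI(3)[OF f] Sec_props(6)[OF Ih[OF f]] Ih[OF f] by simp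
    qed
    show "\<iota> i j \<cdot> \<iota> j i = idn C (src (Sig j i))"
    proof (rule section_cover_ext[OF sc[OF i(2,1)]])
      show "\<iota> i j \<cdot> \<iota> j i \<in> hom C (src (Sig j i)) (src (Sig j i))" "idn C (src (Sig j i)) \<in> hom C (src (Sig j i)) (src (Sig j i))"
        using i1 i2 sji by auto
      fix f assume f: "f \<in> I j i"
      note s = Sec_props[OF Ih[OF f]] and stf = stI[OF f]
      note s2 = Sec_props[OF stf(2)]
      have f': "f \<in> arrs A" "src f = j" "trg f = i" and g': "st f \<in> arrs A" "src (st f) = i" "trg (st f) = j"
        using Ih[OF f] stf(2) by auto
      \<comment> \<open>Since \<open>st (st f)\<close> is \<open>f\<close>, inverting twice returns
        \<open>Sec f\<close> along the image of \<open>st f\<close> after \<open>f\<close>, and this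
        image is the domain of \<open>Sec f\<close>.\<close>
      have "\<iota> i j \<cdot> \<iota> j i \<cdot> Sec f = \<iota> i j \<cdot> (Sec (st f) \<cdot> far P f)" using i1(1-3) i2(1-3) i2(4)[OF f] s by simp
      also have "\<dots> = Sec f \<cdot> (far P (st f) \<cdot> far P f)"
        using reassoc[OF i1(4)[OF stf(1)], of "far P f"] stst[OF f] i1(1-3) s s2 f' g' by simp
      also have "far P (st f) \<cdot> far P f = rst C (Sec f)" using P_cmp[of f "st f"] stf(3) s f' g' by simp
      finally show "\<iota> i j \<cdot> \<iota> j i \<cdot> Sec f = idn C (src (Sig j i)) \<cdot> Sec f" using cmp_rst_self[OF s(2)] s sji by simp
    qed
    show "Sig j i \<cdot> \<iota> i j = Tau i j"
    proof (rule section_cover_ext[OF sc[OF i]])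
      show "Sig j i \<cdot> \<iota> i j \<in> hom C (src (Sig i j)) (fob P j)" "Tau i j \<in> hom C (src (Sig i j)) (fob P j)"
        using i1 sji t by auto
      fix f assume f: "f \<in> I i j"
      note s = Sec_props[OF Ih[OF f]] and stf = stI[OF f]
      note s2 = Sec_props[OF stf(2)]
      have f': "f \<in> arrs A" "src f = i" "trg f = j" and g': "st f \<in> arrs A" "src (st f) = j" "trg (st f) = i"
        using Ih[OF f] stf(2) by auto
      have "rst A (st f) \<cdot>\<^bsub>A\<^esub> f = f"
        using A.rst_slide[of f "st f"] stf(3) f' g' by simp
      then have "far P (rst A (st f)) \<cdot> far P f = far P f" using P_cmp[of f "rst A (st f)"] f' g' by simp
      then show "Sig j i \<cdot> \<iota> i j \<cdot> Sec f = Tau i j \<cdot> Sec f"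
        using i1(1-3) i1(4)[OF f] s s2 sji f' reassoc[OF s2(5), of "far P f"] t(4)[OF Ih[OF f]] by simp
    qed
    then have sq: "Sig j i \<cdot> \<iota> i j = Tau i j \<cdot> idn C (src (Sig i j))" using t sij by simp
    note e = eta_props[OF i(1)] and tp = Tau_pb[OF i i(1)] and m = Mu_props[OF i i(1)]
    note pb = total_pbD(1)[OF tp]
    have c: "\<iota> i j \<in> arrs C" "idn C (src (Sig i j)) \<in> arrs C" "src (\<iota> i j) = src (idn C (src (Sig i j)))"
      "trg (\<iota> i j) = src (Sig j i)" "trg (idn C (src (Sig i j))) = src (Tau i j)"
      using i1 sij t by auto
    note pp = pair_props[OF pb c sq]
    show "Mu i j i \<cdot> pair C (Sig j i) (Tau i j) (\<iota> i j) (idn C (src (Sig i j))) = Sec (idn A i) \<cdot> Sig i j"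
    proof (rule section_cover_ext[OF sc[OF i]])
      show "Mu i j i \<cdot> pair C (Sig j i) (Tau i j) (\<iota> i j) (idn C (src (Sig i j))) \<in> hom C (src (Sig i j)) (src (Sig i i))"
        "Sec (idn A i) \<cdot> Sig i j \<in> hom C (src (Sig i j)) (src (Sig i i))"
        using pp m i1 e sij by auto
      fix f assume f: "f \<in> I i j"
      note s = Sec_props[OF Ih[OF f]] and stf = stI[OF f]
      have f': "f \<in> arrs A" "src f = i" "trg f = j" and g': "st f \<in> arrs A" "src (st f) = j" "trg (st f) = i"
        using Ih[OF f] stf(2) by auto
      have fr: "Sec f \<cdot> far P (rst A f) = Sec f" using cmp_rst_self[OF s(2)] s(6) by simp
      have "Mu i j i \<cdot> pair C (Sig j i) (Tau i j) (\<iota> i j) (idn C (src (Sig i j))) \<cdot> Sec f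
          = Mu i j i \<cdot> pair C (Sig j i) (Tau i j) (Sec (st f) \<cdot> far P f) (Sec f)"
        using pair_cmp[OF pb c sq s(2)] pp(1-3) m(1-3) s i1(1-3) i1(4)[OF f] sij by simp
      \<comment> \<open>The glued multiplication of the sections of \<open>st f\<close> and
        \<open>f\<close> is the section of their composite, which is the restriction of
        \<open>f\<close>.\<close>
      also have "\<dots> = Sec (rst A f)" using Mu_pair'[OF Ih[OF f] stf(2)] stf(3) f' fr by simp
      also have "\<dots> = Sec (idn A i) \<cdot> far P (rst A f)" by (rule Sec_rst[OF Ih[OF f]])
      finally show "Mu i j i \<cdot> pair C (Sig j i) (Tau i j) (\<iota> i j) (idn C (src (Sig i j))) \<cdot> Sec f = Sec (idn A i) \<cdot> Sig i j \<cdot> Sec f"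
        using s e sij by simp
    qed
  qed
  then show ?thesis
    unfolding partite_groupoid_def Psi_ob_simps by (intro conjI Psi_partite exI[of _ \<iota>]) blast
qed

end

lemma peGpd_full: "peGpd C = full_subcat (peCat C) (partite_groupoid C)"
  by (auto simp: peGpd_def peCat_def full_subcat_def)

text \<open>Being a join restriction category is part of being an etale one, so the two conditions
  nest.\<close>

lemma ejCat_full: "ejCat_h C = full_subcat (jrCat_h C) (\<lambda>X. etale_category (fst X))"
  by (auto simp: ejCat_h_def jrCat_h_def full_subcat_def etale_category_def split: prod.splits)

theorem theorem6p3:
  fixes C :: "('o, 'u) rcat"
  assumes "join_restriction_category C"
    and "locally_small C"
    and "has_local_glueings C"
  shows "adjoint_equivalence
           (peCat C :: (('i, 'o, 'u) pcat, ('i, 'o, 'u) cofun) cat) (jrCat_h C)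
           (Phi C) (Psi C) (unit_arr C) \<and>
         adjoint_equivalence
           (peGpd C :: (('i, 'o, 'u) pcat, ('i, 'o, 'u) cofun) cat) (ejCat_h C)
           (Phi C) (Psi C) (unit_arr C)"
proof -
  interpret join_restriction_category C by (rule assms)
  interpret glueing_category C
    by unfold_locales (rule assms)+
  let ?D = "peCat C :: (('i, 'o, 'u) pcat, ('i, 'o, 'u) cofun) cat"
  interpret eq: equivalence_data ?D "jrCat_h C" "Phi C" "Psi C" "unit_arr C"
    by (rule Phi_Psi_equivalence_data)
  \<comment> \<open>The groupoid condition and the etale condition concern objects only, so the
    equivalence restricts once each functor is known to respect them.\<close>
  have "equivalence_data (full_subcat ?D (partite_groupoid C)) (full_subcat (jrCat_h C) (\<lambda>X. etale_category (fst X)))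
      (Phi C) (Psi C) (unit_arr C)"
  proof (rule eq.equivalence_data_restrict)
    fix A :: "('i, 'o, 'u) pcat"
    assume "A \<in> obj ?D" "partite_groupoid C A"
    then show "etale_category (fst (fob (Phi C) A))"
      using pcat_over.Phi_etale[OF pcat_overI] by (auto simp: obj_peCat Phi_simps)
  next
    fix X :: "('i, 'o, 'u) over"
    assume X: "X \<in> obj (jrCat_h C)" "etale_category (fst X)"
    obtain A P where XA: "X = (A, P)" by (cases X)
    interpret hyper_over C A P by (rule hyper_overI) (use X XA in simp)
    show "partite_groupoid C (fob (Psi C) X)" using Psi_groupoid X by (simp add: XA Psi_def)
  qed
  then show ?thesis
    using eq.equivalence equivalence_data.equivalence by (auto simp: peGpd_full ejCat_full)
qed

end
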